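(* Let $n \geq 1$ and let $f \in \mathbb{Z}[X_1, \dots, X_n]$ be a polynomial that is irreducible over $\mathbb{Q}$, of total degree $d$, and of degree at least $2$ in $X_1$. Then for all $B \geq 1$, \[ N_{\mathrm{rat}}(f, B) \ll_{d, n} B^{2n-3} (\log\|f\| + \log B)^5 . \]
   Context: The height of a rational number $t = x/y$ written in lowest terms (coprime integers $x,y$) is $H(t) = \max(|x|,|y|)$. For a nonzero polynomial $f$ with integer coefficients, $\|f\|$ denotes the maximum of $2$ and the absolute values of its coefficients. For $f \in \mathbb{Z}[X_1,\dots,X_n]$, $N_{\mathrm{rat}}(f,B)$ is the number of $(x_1,\dots,x_n) \in \mathbb{Q}^n$ with $f(x_1,\dots,x_n)=0$ and $H(x_i) \le B$ for all $i$. The notation $U \ll_\rho V$ means $|U| \le cV$ for a positive constant $c$ depending only on the parameters $\rho$. *)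

theory Defs
  imports "HOL-Analysis.Analysis" "HOL-Library.Poly_Mapping" "HOL-Computational_Algebra.Factorial_Ring"
begin

text \<open>Multivariate polynomials are represented as finitely supported maps from
  monomials (exponent vectors \<open>nat \<Rightarrow>\<^sub>0 nat\<close>) to coefficients; the library's convolution
  product makes \<open>(nat \<Rightarrow>\<^sub>0 nat) \<Rightarrow>\<^sub>0 'a\<close> the polynomial ring over \<open>'a\<close> in the variables
  X_0, X_1, ... . The paper's variable X_(i+1) is our index i.\<close>

type_synonym 'a mpoly = "(nat \<Rightarrow>\<^sub>0 nat) \<Rightarrow>\<^sub>0 'a"

definition vars_in :: "nat \<Rightarrow> 'a::zero mpoly \<Rightarrow> bool" where
  "vars_in n f \<longleftrightarrow> (\<forall>m\<in>Poly_Mapping.keys f. Poly_Mapping.keys m \<subseteq> {..<n})"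

definition total_deg :: "'a::zero mpoly \<Rightarrow> nat" where
  "total_deg f = Max (insert 0 ((\<lambda>m. sum (Poly_Mapping.lookup m) (Poly_Mapping.keys m)) ` Poly_Mapping.keys f))"

definition deg_in :: "nat \<Rightarrow> 'a::zero mpoly \<Rightarrow> nat" where
  "deg_in i f = Max (insert 0 ((\<lambda>m. Poly_Mapping.lookup m i) ` Poly_Mapping.keys f))"

definition coeff_norm :: "int mpoly \<Rightarrow> int" where
  "coeff_norm f = max 2 (Max (insert 0 ((\<lambda>m. \<bar>Poly_Mapping.lookup f m\<bar>) ` Poly_Mapping.keys f)))"

definition mpoly_eval :: "int mpoly \<Rightarrow> (nat \<Rightarrow> 'a::comm_ring_1) \<Rightarrow> 'a" where
  "mpoly_eval f x = (\<Sum>m\<in>Poly_Mapping.keys f. of_int (Poly_Mapping.lookup f m) * (\<Prod>i\<in>Poly_Mapping.keys m. x i ^ Poly_Mapping.lookup m i))"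

definition rat_height :: "rat \<Rightarrow> int" where
  "rat_height t = (case quotient_of t of (a, b) \<Rightarrow> max \<bar>a\<bar> \<bar>b\<bar>)"

definition N_rat :: "nat \<Rightarrow> int mpoly \<Rightarrow> real \<Rightarrow> nat" where
  "N_rat n f B = card {x :: nat \<Rightarrow> rat. (\<forall>i\<ge>n. x i = 0) \<and>
      (\<forall>i<n. real_of_int (rat_height (x i)) \<le> B) \<and> mpoly_eval f x = 0}"

end

theory Submission
  imports Defs "HOL-Number_Theory.Cong" "HOL-Computational_Algebra.Computational_Algebra"
    "HOL-Computational_Algebra.Field_as_Ring" "HOL-Real_Asymp.Real_Asymp"
begin

text \<open>
  Let \<open>l\<close> be the leading coefficient of \<open>f\<close> in the distinguished variable \<open>X\<close> and put \<open>z = l X\<close>,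
  so that \<open>z\<close> is a root of a monic polynomial over the ring of integer polynomials in the remaining
  variables \<open>y\<close>. One has to count the \<open>y\<close> for which this polynomial has a rational root, and
  separately the \<open>y\<close> for which \<open>f\<close> vanishes identically in \<open>X\<close>.

  For a single parameter \<open>y\<close>, replace the polynomial by the derivative of which a given point
  \<open>(z, y)\<close> is a simple zero. Among \<open>O(log)\<close> primes \<open>p\<close> of size about \<open>B\<close> one keeps the zero
  simple modulo \<open>p\<close>. The points in one residue class modulo \<open>p\<close> lie on one \<open>p\<close>-adic branch, so by
  the pigeonhole principle there is a form \<open>A0(y) + z A1(y)\<close> of degree \<open>O(log)\<close> whose values at these points
  are divisible by a power of \<open>p\<close> exceeding their size, hence vanish. So \<open>z = - A0(y) / A1(y)\<close>; either \<open>y\<close> is a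
  root of the resulting nonzero univariate polynomial, or \<open>- A0 / A1\<close> is a polynomial root of the family, a section.

  With more parameters, fix the last one, \<open>t\<close>. If the family over \<open>t\<close> has no section, use induction.
  The \<open>t\<close> for which it has one are few, by interpolating sections from a grid.

  The \<open>y\<close> with \<open>f\<close> vanishing identically in \<open>X\<close> form a set of codimension 2: \<open>f\<close> is prime by unique factorization,
  so any variable can be eliminated between \<open>f\<close> and \<open>l\<close>.
\<close>

text \<open>There are O(B^(2m)) parameters, m = n - 1, and one factor B has to be saved. It comes
  from congruences: a prime of size B, up to logarithms, leaves only O(p) residue classes of points,
  each with few parameters. The obstacle is slicing. Fixing a parameter can destroy irreducibility
  and create multiple roots everywhere, so neither irreducibility nor squarefreeness can be carried
  through the induction. What survives is the absence of a polynomial root, and multiplicity is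
  treated point by point, without a discriminant. This is where the monic form pays: in one
  parameter a rational section is a polynomial of degree at most \<open>D\<close>, polynomials of
  bounded degree are determined by finitely many values, and a root over u / v has denominator at
  most v^D. Slices with and without a section contribute a sum, not a product, so the exponent of
  the logarithm is the same in every dimension. Codimension 2 for the parameters with
  \<open>f\<close> identically zero in \<open>X\<close> is forced by the count: over each of them
  all O(B^2) values of \<open>X\<close> are zeros, and codimension 1 would only give B^(2m).\<close>

subsection \<open>Many primes below a given bound\<close>

text \<open>Leibniz' harmonic triangle: \<open>1 / ((k+1) (n choose k+1)) = 1 / (k (n-1 choose k)) - 1 / (k (n choose k))\<close>.\<close>
lemma Lcm_div_Leibniz_Ints:
  assumes "1 \<le> k" "k \<le> n"
  shows "real (Lcm {1..n}) / real (k * (n choose k)) \<in> \<int>"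
  using assms
proof (induction k arbitrary: n rule: nat_induct_at_least)
  case base
  then have "n dvd Lcm {1..n}" by (intro dvd_Lcm) auto
  then obtain q where "Lcm {1..n} = n * q" by blast
  with base show ?case by auto
next
  case (Suc k)
  then obtain m where n: "n = Suc m" "k \<le> m" by (cases n) auto
  have "Lcm {1..m} dvd Lcm {1..n}"
    by (intro Lcm_subset) (auto simp: n)
  then obtain q where q: "Lcm {1..n} = Lcm {1..m} * q" by blast
  have "real (Lcm {1..m}) / real (k * (m choose k)) * real q \<in> \<int>"
    using Suc.IH[of m] n by (intro Ints_mult) auto
  moreover have "real (Lcm {1..n}) / real (k * (n choose k)) \<in> \<int>"
    using Suc.IH[of n] n by auto
  ultimately have "real (Lcm {1..m}) / real (k * (m choose k)) * real q
      - real (Lcm {1..n}) / real (k * (n choose k)) \<in> \<int>"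
    by (rule Ints_diff)
  also have "real (Lcm {1..m}) / real (k * (m choose k)) * real q
      = real (Lcm {1..n}) / real (k * (m choose k))"
    unfolding q of_nat_mult by simp
  also have "real (Lcm {1..n}) / real (k * (m choose k)) - real (Lcm {1..n}) / real (k * (n choose k))
     = real (Lcm {1..n}) * (1 / real (k * (m choose k)) - 1 / real (k * (n choose k)))"
    by (simp add: algebra_simps)
  also have "1 / real (k * (m choose k)) - 1 / real (k * (n choose k)) = 1 / real (Suc k * (n choose Suc k))"
  proof -
    define b where "b = real (m choose k)"
    have b0: "b > 0" using n by (simp add: b_def)
    have e1: "Suc k * (n choose Suc k) = n * (m choose k)"
      using Suc_times_binomial_eq[of m k] n by (simp add: mult.commute)
    have "k * (n choose k) + k * (n choose Suc k) + (n choose Suc k) = k * (n choose k) + n * (m choose k)"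
      using e1 by simp
    have "(n - k) * (n choose k) = n * (m choose k)"
      using binomial_absorb_comp[of n k] n by simp
    then have "(real n - real k) * real (n choose k) = real n * b"
      using n by (metis b_def le_Suc_eq of_nat_diff of_nat_mult)
    moreover have nk: "real n - real k > 0" using n by simp
    ultimately have e2: "real (n choose k) = real n * b / (real n - real k)"
      by (simp add: field_simps)
    have e3: "real (Suc k * (n choose Suc k)) = real n * b" unfolding e1 by (simp add: b_def)
    have e4: "real (k * (n choose k)) = real k * (real n * b / (real n - real k))" 
      using e2 by simp
    have e5: "real (k * (m choose k)) = real k * b" by (simp add: b_def)
    have "real k > 0" "real n > 0" using Suc n by auto
    then show ?thesis unfolding e3 e4 e5 using b0 nk by (simp add: field_simps)
  qed
  finally show ?case by simp
qed

text \<open>By the previous lemma \<open>Lcm {1..n}\<close> is a multiple of each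
  \<open>k * (n choose k)\<close>. These \<open>n\<close> numbers have the sum
  \<open>n * 2 ^ (n - 1)\<close>, so one of them is at least the average.\<close>

lemma Lcm_upto_lower_bound:
  assumes "n \<ge> 1"
  shows "2 ^ (n - 1) \<le> Lcm {1..n::nat}"
proof -
  have "\<exists>k\<in>{1..n}. k * (n choose k) \<ge> 2 ^ (n - 1)"
  proof (rule ccontr)
    assume "\<not> ?thesis"
    then have *: "k * (n choose k) < 2 ^ (n - 1)" if "k \<in> {1..n}" for k using that by force
    have "(\<Sum>k\<in>{1..n}. k * (n choose k)) < (\<Sum>k\<in>{1..n}. 2 ^ (n - 1))"
      using assms by (intro sum_strict_mono *) auto
    moreover have "(\<Sum>k\<in>{1..n}. k * (n choose k)) = (\<Sum>k\<le>n. k * (n choose k))"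
      by (intro sum.mono_neutral_left) auto
    ultimately show False using choose_linear_sum[of n] by simp
  qed
  then obtain k where k: "1 \<le> k" "k \<le> n" "k * (n choose k) \<ge> 2 ^ (n - 1)" by auto
  from Lcm_div_Leibniz_Ints[OF k(1,2)] obtain q :: int
    where q: "real (Lcm {1..n}) / real (k * (n choose k)) = of_int q" by (auto elim: Ints_cases)
  have "Lcm {1..n} \<noteq> 0" by (simp add: Lcm_0_iff)
  moreover have pos: "real (k * (n choose k)) > 0" using k by auto
  ultimately have "of_int q > (0::real)" using q by (metis divide_pos_pos of_nat_0_less_iff gr0I)
  then have "of_int q \<ge> (1::real)" by simp
  then have "real (Lcm {1..n}) \<ge> real (k * (n choose k))"
    using q pos by (simp add: le_divide_eq_1 flip: q)
  then show ?thesis using k(3) by linarith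
qed

lemma prime_power_Lcm_upto:
  assumes "prime p" "n \<ge> 1"
  shows "p ^ multiplicity p (Lcm {1..n::nat}) \<le> n"
  using assms(2)
proof (induction n rule: nat_induct_at_least)
  case base
  then show ?case by simp
next
  case (Suc n)
  have "Lcm {1..Suc n} = lcm (Suc n) (Lcm {1..n})"
    by (simp add: atLeastAtMostSuc_conv)
  moreover have "Lcm {1..n} \<noteq> 0" by (simp add: Lcm_0_iff)
  ultimately have "multiplicity p (Lcm {1..Suc n}) = max (multiplicity p (Suc n)) (multiplicity p (Lcm {1..n}))"
    using multiplicity_lcm[of "Suc n" "Lcm {1..n}" p] assms(1) by simp
  moreover have "p ^ multiplicity p (Suc n) \<le> Suc n"
    by (intro dvd_imp_le multiplicity_dvd) auto
  ultimately show ?case using Suc.IH by (auto simp: max_def)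
qed

text \<open>Chebyshev's lower bound: the \<open>Lcm\<close> is a product of prime powers, one for
  each prime up to \<open>n\<close> and each at most \<open>n\<close>.\<close>

lemma primes_upto_lower_bound:
  assumes "n \<ge> 1"
  shows "2 ^ (n - 1) \<le> n ^ card {p::nat. prime p \<and> p \<le> n}"
proof -
  let ?L = "Lcm {1..n}"
  have L0: "?L \<noteq> 0" by (simp add: Lcm_0_iff)
  have sub: "prime_factors ?L \<subseteq> {p. prime p \<and> p \<le> n}"
  proof
    fix p assume p: "p \<in> prime_factors ?L"
    then have pp: "prime p" by auto
    have "multiplicity p ?L > 0" using p prime_factors_multiplicity by blast
    then have "p ^ 1 \<le> p ^ multiplicity p ?L" using pp by (intro power_increasing) (auto dest: prime_gt_0_nat)
    with prime_power_Lcm_upto[OF pp assms] pp show "p \<in> {p. prime p \<and> p \<le> n}" by auto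
  qed
  have fin: "finite {p::nat. prime p \<and> p \<le> n}" by (rule finite_subset[of _ "{..n}"]) auto
  have "?L = (\<Prod>p\<in>prime_factors ?L. p ^ multiplicity p ?L)"
    using prime_factorization_nat[of ?L] L0 by blast
  also have "\<dots> \<le> (\<Prod>p\<in>prime_factors ?L. n)"
    using assms prime_power_Lcm_upto[OF _ assms] by (intro prod_mono) auto
  also have "\<dots> = n ^ card (prime_factors ?L)" by simp
  also have "\<dots> \<le> n ^ card {p::nat. prime p \<and> p \<le> n}"
    using assms sub fin by (intro power_increasing card_mono) auto
  finally show ?thesis using Lcm_upto_lower_bound[OF assms] by linarith
qed

text \<open>Chebyshev's bound at N = c B \<Lambda>^2 gives a multiple of B \<Lambda> of primes,
  since log N is O(\<Lambda>). One factor \<Lambda> of N pays for log N, the other for the number of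
  primes wanted. The upper bound on \<open>card P\<close> is there because the final count sums over
  \<open>P\<close>.\<close>

lemma exists_many_primes:
  fixes K :: real
  assumes "K \<ge> 0"
  shows "\<exists>c\<ge>1. \<forall>B\<ge>1. \<forall>\<Lambda>\<ge>1. ln B \<le> \<Lambda> \<longrightarrow>
    (\<exists>P::nat set. finite P \<and> real (card P) \<ge> K * \<Lambda> \<and> real (card P) \<le> K * \<Lambda> + 1
        \<and> (\<forall>p\<in>P. prime p \<and> 4 * B \<le> real p \<and> real p \<le> c * B * \<Lambda>\<^sup>2))"
proof -
  \<comment> \<open>The 6 covers what is discarded: at most \<open>4 * B + 1\<close> primes lie
    below \<open>4 * B\<close>, and \<open>B >= 1\<close>.\<close>
  have "eventually (\<lambda>c::real. c * ln 2 / (2 * (ln c + 3)) \<ge> K + 6) at_top" by real_asymp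
  moreover have "eventually (\<lambda>c::real. c \<ge> 4) at_top" by (rule eventually_ge_at_top)
  ultimately have "eventually (\<lambda>c::real. c * ln 2 / (2 * (ln c + 3)) \<ge> K + 6 \<and> c \<ge> 4) at_top" 
    by eventually_elim auto
  then obtain c :: real where c: "c * ln 2 / (2 * (ln c + 3)) \<ge> K + 6" "c \<ge> 4"
    unfolding eventually_at_top_linorder by blast
  have "\<exists>P::nat set. finite P \<and> real (card P) \<ge> K * \<Lambda> \<and> real (card P) \<le> K * \<Lambda> + 1
        \<and> (\<forall>p\<in>P. prime p \<and> 4 * B \<le> real p \<and> real p \<le> c * B * \<Lambda>\<^sup>2)"
    if B: "B \<ge> 1" and L: "\<Lambda> \<ge> 1" "ln B \<le> \<Lambda>" for B \<Lambda> :: real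
  proof -
    define R where "R = c * B * \<Lambda>\<^sup>2"
    define n where "n = nat \<lfloor>R\<rfloor>"
    have BL: "B * \<Lambda>\<^sup>2 \<ge> 1 * 1" using B L by (intro mult_mono) auto
    have "c * (B * \<Lambda>\<^sup>2) \<ge> 4 * 1" using c BL by (intro mult_mono) auto
    then have R4: "R \<ge> 4" by (simp add: R_def)
    have n: "real n \<le> R" "real n \<ge> R - 1" unfolding n_def using R4 by linarith+
    have n1: "n \<ge> 1" "real n \<ge> 3" using n R4 by linarith+
    let ?A = "{p::nat. prime p \<and> p \<le> n}"
    have finA: "finite ?A" by (rule finite_subset[of _ "{..n}"]) auto
    have "(2::real) ^ (n - 1) \<le> real n ^ card ?A"
      using primes_upto_lower_bound[OF n1(1)] by (metis of_nat_le_iff of_nat_numeral of_nat_power)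
    then have "ln ((2::real) ^ (n - 1)) \<le> ln (real n ^ card ?A)"
      using n1 by (subst ln_le_cancel_iff) auto
    then have 1: "real (n - 1) * ln 2 \<le> real (card ?A) * ln (real n)"
      using n1 by (simp add: ln_realpow)
    have "ln (real n) \<le> ln R" using n n1 R4 by (subst ln_le_cancel_iff) auto
    also have "ln R = ln c + ln B + 2 * ln \<Lambda>"
      using c B L unfolding R_def by (simp add: ln_mult ln_realpow)
    also have "ln \<Lambda> \<le> \<Lambda>" using ln_le_minus_one[of \<Lambda>] L by linarith
    finally have "ln (real n) \<le> ln c + 3 * \<Lambda>" using L by linarith
    also have "ln c \<le> ln c * \<Lambda>" using c L by (simp add: mult_le_cancel_left1)
    finally have 2: "ln (real n) \<le> (ln c + 3) * \<Lambda>" by (simp add: algebra_simps)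
    have lc: "ln c + 3 > 0" using c by (simp add: add_nonneg_pos)
    have "R / 2 * ln 2 \<le> real (n - 1) * ln 2"
      using n R4 n1 by (intro mult_right_mono) (auto simp: of_nat_diff)
    also note 1
    also have "real (card ?A) * ln (real n) \<le> real (card ?A) * ((ln c + 3) * \<Lambda>)"
      using 2 by (intro mult_left_mono) auto
    finally have "c * ln 2 / (2 * (ln c + 3)) * (B * \<Lambda>) \<le> real (card ?A)"
    proof -
      assume "R / 2 * ln 2 \<le> real (card ?A) * ((ln c + 3) * \<Lambda>)"
      then have "\<Lambda> * (c * ln 2 * (B * \<Lambda>)) \<le> \<Lambda> * (2 * (ln c + 3) * real (card ?A))"
        by (simp add: R_def power2_eq_square algebra_simps)
      then have "c * ln 2 * (B * \<Lambda>) \<le> 2 * (ln c + 3) * real (card ?A)"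
        using L by (subst (asm) mult_le_cancel_left_pos) auto
      then show ?thesis using lc by (simp add: pos_divide_le_eq mult.commute)
    qed
    moreover have "(K + 6) * (B * \<Lambda>) \<le> c * ln 2 / (2 * (ln c + 3)) * (B * \<Lambda>)"
      using c(1) B L by (intro mult_right_mono) auto
    ultimately have 3: "(K + 6) * (B * \<Lambda>) \<le> real (card ?A)" by linarith
    have 4: "B * \<Lambda> \<ge> B" "B * \<Lambda> \<ge> \<Lambda>" using B L by (auto simp: mult_le_cancel_left1 mult_le_cancel_right1)
    have 5: "K * (B * \<Lambda>) \<ge> K * \<Lambda>" using 4 assms by (intro mult_left_mono) auto
    let ?P = "{p\<in>?A. 4 * B \<le> real p}"
    have "4 * B \<le> real x" if "\<not> x \<le> nat \<lfloor>4 * B\<rfloor>" for x using that by linarith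
    then have "?A \<subseteq> ?P \<union> {..nat \<lfloor>4 * B\<rfloor>}" by auto
    then have "card ?A \<le> card (?P \<union> {..nat \<lfloor>4 * B\<rfloor>})" 
      using finA by (intro card_mono) auto
    also have "\<dots> \<le> card ?P + card {..nat \<lfloor>4 * B\<rfloor>}" by (rule card_Un_le)
    finally have 6: "real (card ?A) \<le> real (card ?P) + (real (nat \<lfloor>4 * B\<rfloor>) + 1)" by simp
    have "real (nat \<lfloor>4 * B\<rfloor>) \<le> 4 * B" using B by linarith
    have "K * (B * \<Lambda>) + 6 * (B * \<Lambda>) \<le> real (card ?A)" using 3 by (simp only: distrib_right)
    moreover have "x \<ge> k + 1" if "y + 6 * b \<le> r" "b \<ge> B" "k \<le> y" "r \<le> x + (t + 1)" "t \<le> 4 * B" for k x y b r t :: real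
      using that B by linarith
    ultimately have "real (card ?P) \<ge> K * \<Lambda> + 1" using 4(1) 5 6 \<open>real (nat \<lfloor>4 * B\<rfloor>) \<le> 4 * B\<close> by blast
    then have "K * \<Lambda> \<le> real (card ?P)" by simp
    then have "nat \<lceil>K * \<Lambda>\<rceil> \<le> card ?P" by (rule nat_ceiling_le_eq[THEN iffD2])
    then obtain P where P: "P \<subseteq> ?P" "card P = nat \<lceil>K * \<Lambda>\<rceil>" "finite P"
      by (rule obtain_subset_with_card_n)
    have "K * \<Lambda> \<ge> 0" using assms L by simp
    moreover have "real (nat \<lceil>x\<rceil>) \<le> x + 1" if "x \<ge> 0" for x :: real using that by linarith
    ultimately have "real (card P) \<ge> K * \<Lambda>" "real (card P) \<le> K * \<Lambda> + 1"
      unfolding P(2) by (auto simp: real_nat_ceiling_ge)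
    moreover have "\<forall>p\<in>P. prime p \<and> 4 * B \<le> real p \<and> real p \<le> R"
      using P(1) n by force
    ultimately show ?thesis using P(3) by (auto simp: R_def)
  qed
  then show ?thesis using c(2) by (intro exI[of _ c]) auto
qed

subsection \<open>The localization of the rationals at a prime\<close>

text \<open>The ideal generated by \<open>p ^ k\<close> in the ring of rationals with denominator
  prime to \<open>p\<close>. Membership plays the part of congruence modulo \<open>p ^ k\<close>, so
  that p-adic arguments never leave the rationals.\<close>

definition loc_ideal :: "int \<Rightarrow> nat \<Rightarrow> rat set" where
  "loc_ideal p k = {x. \<exists>a b. \<not> p dvd b \<and> x = of_int (p ^ k * a) / of_int b}"

lemma plocI: "\<not> p dvd b \<Longrightarrow> of_int (p ^ k * a) / of_int b \<in> loc_ideal p k"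
  unfolding loc_ideal_def by blast

lemma plocE:
  assumes "x \<in> loc_ideal p k"
  obtains a b where "\<not> p dvd b" "x = of_int (p ^ k * a) / of_int b" "b \<noteq> 0"
  using assms unfolding loc_ideal_def by auto

lemma loc_ideal_add:
  assumes "prime p" "x \<in> loc_ideal p k" "y \<in> loc_ideal p k"
  shows "x + y \<in> loc_ideal p k"
proof -
  obtain a b where 1: "\<not> p dvd b" "x = of_int (p ^ k * a) / of_int b" "b \<noteq> 0" using assms(2) by (rule plocE)
  obtain c d where 2: "\<not> p dvd d" "y = of_int (p ^ k * c) / of_int d" "d \<noteq> 0" using assms(3) by (rule plocE)
  have "x + y = of_int (p ^ k * (a * d + c * b)) / of_int (b * d)"
    using 1 2 by (simp add: field_simps)
  then show ?thesis using 1 2 assms(1) by (metis plocI prime_dvd_mult_iff)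
qed

lemma loc_ideal_mult:
  assumes "prime p" "x \<in> loc_ideal p k" "y \<in> loc_ideal p l"
  shows "x * y \<in> loc_ideal p (k + l)"
proof -
  obtain a b where 1: "\<not> p dvd b" "x = of_int (p ^ k * a) / of_int b" "b \<noteq> 0" using assms(2) by (rule plocE)
  obtain c d where 2: "\<not> p dvd d" "y = of_int (p ^ l * c) / of_int d" "d \<noteq> 0" using assms(3) by (rule plocE)
  have "x * y = of_int (p ^ (k + l) * (a * c)) / of_int (b * d)"
    using 1 2 by (simp add: field_simps power_add)
  then show ?thesis using 1 2 assms(1) by (metis plocI prime_dvd_mult_iff)
qed

lemma loc_ideal_mult0: "prime p \<Longrightarrow> x \<in> loc_ideal p 0 \<Longrightarrow> y \<in> loc_ideal p k \<Longrightarrow> x * y \<in> loc_ideal p k"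
  using loc_ideal_mult[of p x 0 y k] by simp

lemma loc_ideal_of_int_iff:
  assumes "prime p"
  shows "of_int n \<in> loc_ideal p k \<longleftrightarrow> p ^ k dvd n"
proof
  assume "of_int n \<in> loc_ideal p k"
  then obtain a b where 1: "\<not> p dvd b" "(of_int n :: rat) = of_int (p ^ k * a) / of_int b" "b \<noteq> 0" by (rule plocE)
  then have "(of_int (n * b) :: rat) = of_int (p ^ k * a)" by (simp add: field_simps)
  then have "n * b = p ^ k * a" using of_int_eq_iff by blast
  moreover have "coprime (p ^ k) b" using assms 1(1) by (simp add: prime_imp_coprime)
  ultimately show "p ^ k dvd n" by (metis coprime_dvd_mult_left_iff dvd_triv_left)
next
  assume "p ^ k dvd n"
  then obtain a where "n = p ^ k * a" by blast
  moreover have "\<not> p dvd 1" using assms not_prime_unit by blast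
  ultimately show "of_int n \<in> loc_ideal p k" using plocI[of p 1 k a] by simp
qed

lemma loc_ideal_of_int0 [simp]: "prime p \<Longrightarrow> of_int n \<in> loc_ideal p 0"
  by (simp add: loc_ideal_of_int_iff)

lemma loc_ideal_zero [simp]: "prime p \<Longrightarrow> 0 \<in> loc_ideal p k"
  using loc_ideal_of_int_iff[of p 0 k] by simp

lemma loc_ideal_one [simp]: "prime p \<Longrightarrow> 1 \<in> loc_ideal p 0"
  using loc_ideal_of_int0[of p 1] by simp

lemma loc_ideal_uminus: "prime p \<Longrightarrow> x \<in> loc_ideal p k \<Longrightarrow> - x \<in> loc_ideal p k"
  using loc_ideal_mult0[of p "of_int (-1)" x k, OF _ loc_ideal_of_int0] by simp

lemma loc_ideal_diff: "prime p \<Longrightarrow> x \<in> loc_ideal p k \<Longrightarrow> y \<in> loc_ideal p k \<Longrightarrow> x - y \<in> loc_ideal p k"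
  using loc_ideal_add[of p x k "- y"] loc_ideal_uminus[of p y k] by simp

lemma loc_ideal_sum: "prime p \<Longrightarrow> (\<And>i. i \<in> A \<Longrightarrow> f i \<in> loc_ideal p k) \<Longrightarrow> sum f A \<in> loc_ideal p k"
  by (induction A rule: infinite_finite_induct) (auto intro: loc_ideal_add)

lemma loc_ideal_antimono:
  assumes "prime p" "l \<le> k" "x \<in> loc_ideal p k" shows "x \<in> loc_ideal p l"
proof -
  obtain a b where 1: "\<not> p dvd b" "x = of_int (p ^ k * a) / of_int b" "b \<noteq> 0" using assms(3) by (rule plocE)
  have "p ^ k = p ^ l * p ^ (k - l)" using assms(2) by (simp flip: power_add)
  then have "x = of_int (p ^ l * (p ^ (k - l) * a)) / of_int b" using 1 by simp
  then show ?thesis using 1 plocI by blast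
qed

lemma loc_ideal_power: "prime p \<Longrightarrow> x \<in> loc_ideal p k \<Longrightarrow> x ^ n \<in> loc_ideal p (k * n)"
  by (induction n) (auto intro: loc_ideal_mult)

lemma loc_ideal_power0: "prime p \<Longrightarrow> x \<in> loc_ideal p 0 \<Longrightarrow> x ^ n \<in> loc_ideal p 0"
  using loc_ideal_power[of p x 0 n] by simp

lemma loc_ideal_quotient: "prime p \<Longrightarrow> \<not> p dvd b \<Longrightarrow> of_int a / of_int b \<in> loc_ideal p 0"
  using plocI[of p b 0 a] by simp

text \<open>The residue field of the localization has \<open>p\<close> elements: multiply the
  numerator by an inverse of the denominator modulo \<open>p\<close>.\<close>

lemma loc_ideal_residue:
  assumes "prime p" "x \<in> loc_ideal p 0"
  obtains r :: int where "r \<in> {0..<p}" "x - of_int r \<in> loc_ideal p 1"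
proof -
  obtain a b where 1: "\<not> p dvd b" "x = of_int (p ^ 0 * a) / of_int b" "b \<noteq> 0" using assms(2) by (rule plocE)
  have "coprime b p" using prime_imp_coprime[OF assms(1) 1(1)] by (simp add: coprime_commute)
  then obtain c where c: "[b * c = 1] (mod p)" using cong_solve_coprime_int by blast
  define r where "r = (a * c) mod p"
  have "[b * r = b * (a * c)] (mod p)" unfolding r_def by (simp add: cong_def mod_mult_right_eq)
  also have "[b * (a * c) = a] (mod p)" using cong_mult[OF c cong_refl[of a]] by (simp add: mult.commute mult.left_commute)
  finally have "p dvd a - b * r" by (simp add: cong_iff_dvd_diff dvd_diff_commute)
  then obtain q where q: "a - b * r = p * q" by blast
  have "x - of_int r = of_int (a - b * r) / of_int b" using 1 by (simp add: field_simps)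
  also have "\<dots> = of_int (p ^ 1 * q) / of_int b" using q by simp
  finally have "x - of_int r \<in> loc_ideal p 1" using 1(1) plocI by metis
  moreover have "r \<in> {0..<p}" using assms(1) prime_gt_0_int unfolding r_def by simp
  ultimately show ?thesis using that by blast
qed

subsection \<open>Bivariate integer polynomials\<close>

text \<open>A bivariate polynomial is a coefficient array cut off at \<open>a\<close> and
  \<open>D\<close>. The value ring is left open, since the same array is evaluated at rational
  points, at integer residues, at an integer polynomial (the branch) and at a rational polynomial (a
  section).\<close>

definition biv_eval :: "nat \<Rightarrow> nat \<Rightarrow> (nat \<Rightarrow> nat \<Rightarrow> int) \<Rightarrow> 'b::comm_ring_1 \<Rightarrow> 'b \<Rightarrow> 'b" where
  "biv_eval a D g z y = (\<Sum>i\<le>a. \<Sum>j\<le>D. of_int (g i j) * z ^ i * y ^ j)"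

definition deriv_coeffs :: "(nat \<Rightarrow> nat \<Rightarrow> int) \<Rightarrow> nat \<Rightarrow> nat \<Rightarrow> int" where
  "deriv_coeffs g i j = int (Suc i) * g (Suc i) j"

lemma loc_ideal_prod_diff:
  assumes "prime p" "x \<in> loc_ideal p 0" "x' \<in> loc_ideal p 0" "y \<in> loc_ideal p 0" "y' \<in> loc_ideal p 0"
    "x - x' \<in> loc_ideal p k" "y - y' \<in> loc_ideal p k"
  shows "x * y - x' * y' \<in> loc_ideal p k"
proof -
  have "x * y - x' * y' = y * (x - x') + x' * (y - y')" by (simp add: algebra_simps)
  then show ?thesis using assms by (auto intro!: loc_ideal_add loc_ideal_mult0)
qed

lemma loc_ideal_power_diff:
  assumes "prime p" "x \<in> loc_ideal p 0" "x' \<in> loc_ideal p 0" "x - x' \<in> loc_ideal p k"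
  shows "x ^ n - x' ^ n \<in> loc_ideal p k"
proof (induction n)
  case (Suc n)
  then show ?case using assms by (auto intro!: loc_ideal_prod_diff loc_ideal_power0)
qed (use assms in simp)

lemma loc_ideal_bev_diff:
  assumes "prime p" "z \<in> loc_ideal p 0" "y \<in> loc_ideal p 0" "z' \<in> loc_ideal p 0" "y' \<in> loc_ideal p 0"
    "z - z' \<in> loc_ideal p k" "y - y' \<in> loc_ideal p k"
  shows "biv_eval a D g z y - biv_eval a D g z' y' \<in> loc_ideal p k"
proof -
  have "biv_eval a D g z y - biv_eval a D g z' y'
      = (\<Sum>i\<le>a. \<Sum>j\<le>D. of_int (g i j) * (z ^ i * y ^ j - z' ^ i * y' ^ j))"
    unfolding biv_eval_def by (simp add: sum_subtractf algebra_simps)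
  also have "\<dots> \<in> loc_ideal p k"
    using assms by (intro loc_ideal_sum loc_ideal_mult0 loc_ideal_prod_diff loc_ideal_power_diff loc_ideal_power0) auto
  finally show ?thesis .
qed

lemma biv_eval_of_int: "biv_eval a D g (of_int z) (of_int y) = of_int (biv_eval a D g z y)"
  unfolding biv_eval_def by simp

text \<open>Taylor's formula to second order; the recursion for the remainder shows it to be
  p-integral without any division by 2.\<close>

lemma power_Taylor2:
  assumes "prime p" "z \<in> loc_ideal p 0" "z' \<in> loc_ideal p 0"
  shows "\<exists>s\<in>loc_ideal p 0. z' ^ i - z ^ i = (z' - z) * (of_nat i * z ^ (i - 1) + (z' - z) * s)"
proof (induction i)
  case 0
  then show ?case using assms by (intro bexI[of _ 0]) auto
next
  case (Suc i)
  then obtain s where s: "s \<in> loc_ideal p 0" "z' ^ i - z ^ i = (z' - z) * (of_nat i * z ^ (i - 1) + (z' - z) * s)" by blast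
  define t where "t = of_nat i * z ^ (i - 1) + z' * s"
  have "of_int (int i) * z ^ (i - 1) \<in> loc_ideal p 0" using assms by (intro loc_ideal_mult0 loc_ideal_power0 loc_ideal_of_int0)
  then have "of_nat i * z ^ (i - 1) \<in> loc_ideal p 0" by simp
  moreover have "z' * s \<in> loc_ideal p 0" using assms s(1) by (intro loc_ideal_mult0)
  ultimately have "t \<in> loc_ideal p 0" using assms(1) unfolding t_def by (intro loc_ideal_add)
  moreover have "z' ^ Suc i - z ^ Suc i = (z' - z) * (of_nat (Suc i) * z ^ (Suc i - 1) + (z' - z) * t)"
  proof -
    have "z' ^ Suc i - z ^ Suc i = z' * (z' ^ i - z ^ i) + (z' - z) * z ^ i" by (simp add: algebra_simps)
    also have "\<dots> = (z' - z) * (z' * (of_nat i * z ^ (i - 1) + (z' - z) * s) + z ^ i)"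
      unfolding s(2) by (simp add: algebra_simps)
    also have "z' * (of_nat i * z ^ (i - 1) + (z' - z) * s) = of_nat i * (z * z ^ (i - 1)) + (z' - z) * t"
      unfolding t_def by (simp add: algebra_simps)
    also have "of_nat i * (z * z ^ (i - 1)) = of_nat i * z ^ i" by (cases i) auto
    finally show ?thesis by (simp add: algebra_simps)
  qed
  ultimately show ?case by blast
qed

text \<open>Row \<open>a\<close> of \<open>deriv_coeffs g\<close> reads row \<open>Suc a\<close> of
  \<open>g\<close>, beyond the cut-off; with that row zero the array is the derivative in
  \<open>z\<close>.\<close>

lemma biv_eval_dz:
  fixes z y :: "'b::comm_ring_1"
  assumes "\<And>j. g (Suc a) j = 0"
  shows "biv_eval a D (deriv_coeffs g) z y = (\<Sum>i\<le>a. \<Sum>j\<le>D. of_int (g i j) * (of_nat i * z ^ (i - 1)) * y ^ j)"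
proof -
  define h where "h = (\<lambda>i. \<Sum>j\<le>D. of_int (g i j) * (of_nat i * z ^ (i - 1)) * y ^ j)"
  have "(\<Sum>i\<le>Suc a. h i) = h 0 + (\<Sum>i\<le>a. h (Suc i))" by (rule sum.atMost_Suc_shift)
  moreover have "(\<Sum>i\<le>Suc a. h i) = (\<Sum>i\<le>a. h i)" by (simp add: h_def assms)
  moreover have "h 0 = 0" by (simp add: h_def)
  moreover have "(\<Sum>i\<le>a. h (Suc i)) = biv_eval a D (deriv_coeffs g) z y"
    unfolding h_def biv_eval_def deriv_coeffs_def by (intro sum.cong refl) (simp add: algebra_simps)
  ultimately show ?thesis by (simp add: h_def)
qed

lemma biv_eval_Taylor2:
  assumes "prime p" "z \<in> loc_ideal p 0" "z' \<in> loc_ideal p 0" "y \<in> loc_ideal p 0" "\<And>j. g (Suc a) j = 0"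
  shows "\<exists>s\<in>loc_ideal p 0. biv_eval a D g z' y - biv_eval a D g z y = (z' - z) * (biv_eval a D (deriv_coeffs g) z y + (z' - z) * s)"
proof -
  obtain s where s: "\<And>i. s i \<in> loc_ideal p 0"
     "\<And>i. z' ^ i - z ^ i = (z' - z) * (of_nat i * z ^ (i - 1) + (z' - z) * s i)"
    using power_Taylor2[OF assms(1-3)] by metis
  define S where "S = (\<Sum>i\<le>a. \<Sum>j\<le>D. of_int (g i j) * s i * y ^ j)"
  have "S \<in> loc_ideal p 0" unfolding S_def using assms s by (intro loc_ideal_sum loc_ideal_mult0 loc_ideal_power0) auto
  moreover have "biv_eval a D g z' y - biv_eval a D g z y = (\<Sum>i\<le>a. \<Sum>j\<le>D. of_int (g i j) * (z' ^ i - z ^ i) * y ^ j)"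
    unfolding biv_eval_def by (simp add: sum_subtractf algebra_simps)
  then have "biv_eval a D g z' y - biv_eval a D g z y = (z' - z) * (biv_eval a D (deriv_coeffs g) z y + (z' - z) * S)"
    unfolding s(2) biv_eval_dz[of g a, OF assms(5)] S_def sum_distrib_left sum.distrib[symmetric]
    by (simp add: algebra_simps)
  ultimately show ?thesis by blast
qed

subsection \<open>Evaluation of integer polynomials at rationals\<close>

definition int_poly_eval :: "int poly \<Rightarrow> rat \<Rightarrow> rat" where
  "int_poly_eval q y = poly (map_poly of_int q) y"

lemma int_poly_eval_0 [simp]: "int_poly_eval 0 y = 0" by (simp add: int_poly_eval_def)

lemma int_poly_eval_pCons [simp]: "int_poly_eval (pCons c q) y = of_int c + y * int_poly_eval q y"
  by (simp add: int_poly_eval_def map_poly_pCons)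

lemma int_poly_eval_add [simp]: "int_poly_eval (p + q) y = int_poly_eval p y + int_poly_eval q y"
proof -
  have "map_poly of_int (p + q) = map_poly of_int p + (map_poly of_int q :: rat poly)"
    by (intro poly_eqI) (simp add: coeff_map_poly)
  then show ?thesis by (simp add: int_poly_eval_def)
qed

lemma int_poly_eval_smult [simp]: "int_poly_eval (smult c q) y = of_int c * int_poly_eval q y"
  by (induction q) (simp_all add: algebra_simps)

lemma int_poly_eval_uminus [simp]: "int_poly_eval (- q) y = - int_poly_eval q y"
  using int_poly_eval_smult[of "-1" q y] by simp

lemma int_poly_eval_diff [simp]: "int_poly_eval (p - q) y = int_poly_eval p y - int_poly_eval q y"
  using int_poly_eval_add[of p "- q" y] by simp

lemma int_poly_eval_mult [simp]: "int_poly_eval (p * q) y = int_poly_eval p y * int_poly_eval q y"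
  by (induction p) (simp_all add: algebra_simps)

lemma int_poly_eval_one [simp]: "int_poly_eval 1 y = 1" by (simp add: int_poly_eval_def)

lemma int_poly_eval_power [simp]: "int_poly_eval (p ^ n) y = int_poly_eval p y ^ n"
  by (induction n) simp_all

lemma int_poly_eval_sum: "int_poly_eval (sum f A) y = (\<Sum>i\<in>A. int_poly_eval (f i) y)"
  by (induction A rule: infinite_finite_induct) simp_all

lemma int_poly_eval_of_int [simp]: "int_poly_eval (of_int c) y = of_int c"
  by (simp add: of_int_poly)

lemma int_poly_eval_pcompose: "int_poly_eval (pcompose p q) y = int_poly_eval p (int_poly_eval q y)"
  by (induction p) (simp_all add: pcompose_pCons)

lemma int_poly_eval_bev: "int_poly_eval (biv_eval a D g q r) y = biv_eval a D g (int_poly_eval q y) (int_poly_eval r y)"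
  unfolding biv_eval_def by (simp add: int_poly_eval_sum)

lemma int_poly_eval_altdef:
  assumes "degree q \<le> n"
  shows "int_poly_eval q y = (\<Sum>i\<le>n. of_int (coeff q i) * y ^ i)"
proof -
  have "degree (map_poly of_int q :: rat poly) \<le> n" using assms by (intro degree_le) (simp add: coeff_map_poly coeff_eq_0)
  then have "int_poly_eval q y = (\<Sum>i\<le>n. coeff (map_poly of_int q) i * y ^ i)"
    unfolding int_poly_eval_def poly_altdef by (intro sum.mono_neutral_left) (auto simp: coeff_eq_0)
  then show ?thesis by (simp add: coeff_map_poly)
qed

lemma loc_ideal_ipe: "prime p \<Longrightarrow> y \<in> loc_ideal p 0 \<Longrightarrow> int_poly_eval q y \<in> loc_ideal p 0"
  by (induction q) (auto intro!: loc_ideal_add loc_ideal_mult0)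

text \<open>In the expansion around \<open>y0\<close> the l-th term gets \<open>p ^ l\<close> from
  the power of \<open>y - y0\<close> and the missing \<open>p ^ (N - l)\<close> from its
  coefficient.\<close>

lemma loc_ideal_ipe_shift:
  assumes p: "prime p" and y: "y - of_int y0 \<in> loc_ideal p 1"
    and dvd: "\<And>l. l < N \<Longrightarrow> p ^ (N - l) dvd coeff (pcompose q [:y0, 1:]) l"
  shows "int_poly_eval q y \<in> loc_ideal p N"
proof -
  define c where "c = pcompose q [:y0, 1:]"
  have "int_poly_eval q y = int_poly_eval c (y - of_int y0)" by (simp add: c_def int_poly_eval_pcompose)
  also have "\<dots> = (\<Sum>l\<le>degree c. of_int (coeff c l) * (y - of_int y0) ^ l)"
    by (rule int_poly_eval_altdef) simp
  also have "\<dots> \<in> loc_ideal p N"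
  proof (rule loc_ideal_sum[OF p])
    fix l
    have 1: "(y - of_int y0) ^ l \<in> loc_ideal p l" using loc_ideal_power[OF p y, of l] by simp
    have 2: "of_int (coeff c l) \<in> loc_ideal p (N - l)"
      using dvd[of l] p by (cases "l < N") (auto simp: loc_ideal_of_int_iff c_def)
    have "of_int (coeff c l) * (y - of_int y0) ^ l \<in> loc_ideal p ((N - l) + l)" by (rule loc_ideal_mult[OF p 2 1])
    then show "of_int (coeff c l) * (y - of_int y0) ^ l \<in> loc_ideal p N" by (rule loc_ideal_antimono[OF p, rotated]) simp
  qed
  finally show ?thesis .
qed

subsection \<open>The local branch through a simple point\<close>

text \<open>Newton's iteration with frozen slope: \<open>w\<close> will be an inverse modulo
  \<open>p\<close> of the derivative at (\<open>z0\<close>, \<open>y0\<close>), used in every step.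
  This gains one power of \<open>p\<close> per step and needs no division, so the approximations are
  integer polynomials in \<open>y\<close>, valid on the whole residue class.\<close>

primrec branch :: "nat \<Rightarrow> nat \<Rightarrow> (nat \<Rightarrow> nat \<Rightarrow> int) \<Rightarrow> int \<Rightarrow> int \<Rightarrow> nat \<Rightarrow> int poly" where
  "branch a D g w z0 0 = [:z0:]"
| "branch a D g w z0 (Suc k) = branch a D g w z0 k - smult w (biv_eval a D g (branch a D g w z0 k) [:0, 1:])"

text \<open>One step multiplies the error \<open>z - f\<close> by \<open>1 - w * d\<close> plus a
  multiple of the error itself. Both are divisible by \<open>p\<close>, as the derivative
  \<open>d\<close> at the point is congruent to the one at (\<open>z0\<close>,
  \<open>y0\<close>).\<close>

lemma branch_approx:
  assumes p: "prime p" and yz: "y \<in> loc_ideal p 0" "z \<in> loc_ideal p 0"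
    and near: "y - of_int y0 \<in> loc_ideal p 1" "z - of_int z0 \<in> loc_ideal p 1"
    and g0: "\<And>j. g (Suc a) j = 0"
    and w: "[w * biv_eval a D (deriv_coeffs g) z0 y0 = 1] (mod p)"
    and root: "biv_eval a D g z y = 0"
  shows "z - int_poly_eval (branch a D g w z0 k) y \<in> loc_ideal p (Suc k)"
proof (induction k)
  case 0
  then show ?case using near by simp
next
  case (Suc k)
  define f where "f = int_poly_eval (branch a D g w z0 k) y"
  have f: "f \<in> loc_ideal p 0" unfolding f_def by (rule loc_ideal_ipe[OF p yz(1)])
  have zf: "z - f \<in> loc_ideal p (Suc k)" using Suc by (simp add: f_def)
  obtain s where s: "s \<in> loc_ideal p 0" "biv_eval a D g f y - biv_eval a D g z y = (f - z) * (biv_eval a D (deriv_coeffs g) z y + (f - z) * s)"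
    using biv_eval_Taylor2[OF p yz(2) f yz(1), of g a D] g0 by blast
  define d where "d = biv_eval a D (deriv_coeffs g) z y"
  have "d - biv_eval a D (deriv_coeffs g) (of_int z0) (of_int y0) \<in> loc_ideal p 1"
    unfolding d_def using p yz near by (intro loc_ideal_bev_diff) auto
  then have 1: "of_int w * (d - of_int (biv_eval a D (deriv_coeffs g) z0 y0)) \<in> loc_ideal p 1"
    using p by (simp add: biv_eval_of_int loc_ideal_mult0)
  have "p ^ 1 dvd 1 - w * biv_eval a D (deriv_coeffs g) z0 y0" using w by (simp add: cong_iff_dvd_diff dvd_diff_commute)
  then have 2: "of_int (1 - w * biv_eval a D (deriv_coeffs g) z0 y0) \<in> loc_ideal p 1" using p loc_ideal_of_int_iff by blast
  have "1 - of_int w * d = of_int (1 - w * biv_eval a D (deriv_coeffs g) z0 y0) - of_int w * (d - of_int (biv_eval a D (deriv_coeffs g) z0 y0))"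
    by (simp add: algebra_simps)
  then have 3: "1 - of_int w * d \<in> loc_ideal p 1" using loc_ideal_diff[OF p 2 1] by argo
  have 4: "of_int w * s * (z - f) \<in> loc_ideal p 1"
    using p s(1) zf by (intro loc_ideal_mult0 loc_ideal_antimono[OF p _ zf]) auto
  have "z - int_poly_eval (branch a D g w z0 (Suc k)) y = z - f + of_int w * biv_eval a D g f y"
    by (simp add: int_poly_eval_bev f_def)
  also have "biv_eval a D g f y = (f - z) * (d + (f - z) * s)" using s(2) root by (simp add: d_def)
  also have "z - f + of_int w * \<dots> = (z - f) * ((1 - of_int w * d) + of_int w * s * (z - f))"
    by (simp add: algebra_simps)
  also have "\<dots> \<in> loc_ideal p (Suc k + 1)" using loc_ideal_mult[OF p zf loc_ideal_add[OF p 3 4]] .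
  finally show ?case by simp
qed

subsection \<open>An auxiliary linear form\<close>

text \<open>The moduli multiply to \<open>p ^ (s * (s + 1) / 2)\<close>, at most
  \<open>p ^ (s * (E + 2))\<close> since \<open>s + 1 <= 2 * (E + 2)\<close>, whereas there are
  \<open>(p ^ (E + 2) + 1) ^ s\<close> vectors with entries between 0 and
  \<open>p ^ (E + 2)\<close>. Two of them agree in all residues; \<open>b\<close> is their
  difference.\<close>

lemma pigeonhole_congruences:
  fixes M :: "nat \<Rightarrow> nat \<Rightarrow> int" and p :: int
  assumes p: "p \<ge> 1" and s: "s = 2 * (E + 1)"
  shows "\<exists>b. (\<exists>k<s. b k \<noteq> 0) \<and> (\<forall>k<s. \<bar>b k\<bar> \<le> p ^ (E + 2)) \<and>
     (\<forall>l<s. p ^ (s - l) dvd (\<Sum>k<s. b k * M k l))"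
proof -
  let ?A = "{..<s} \<rightarrow>\<^sub>E {0..p ^ (E + 2)}"
  let ?f = "\<lambda>b. \<lambda>l\<in>{..<s}. (\<Sum>k<s. b k * M k l) mod p ^ (s - l)"
  let ?C = "PiE {..<s} (\<lambda>l. {0..<p ^ (s - l)})"
  have sub: "?f ` ?A \<subseteq> ?C" using p by (auto simp: PiE_def Pi_def)
  have fin: "finite ?C" by (intro finite_PiE) auto
  have prodsum: "(\<Prod>l<s. nat p ^ (s - l)) = nat p ^ (\<Sum>l<s. s - l)" by (simp add: power_sum)
  have "(\<Sum>l<s. s - l) = (\<Sum>l<s. Suc l)"
    by (rule sum.reindex_bij_witness[of _ "\<lambda>l. s - Suc l" "\<lambda>l. s - Suc l"]) auto
  also have "\<dots> \<le> s * (E + 2)"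
  proof -
    have "2 * (\<Sum>l<n. Suc l) = n * (n + 1)" for n by (induction n) auto
    from this[of s] have "2 * (\<Sum>l<s. Suc l) = s * (s + 1)" .
    also have "s + 1 \<le> 2 * (E + 2)" using s by simp
    then have "s * (s + 1) \<le> s * (2 * (E + 2))" by (rule mult_le_mono2)
    finally show ?thesis by (simp only: mult.left_commute[of s 2])
  qed
  finally have le: "(\<Sum>l<s. s - l) \<le> s * (E + 2)" .
  have "card ?C = (\<Prod>l<s. nat p ^ (s - l))"
    using p by (simp add: card_PiE nat_power_eq)
  also have "\<dots> \<le> nat p ^ (s * (E + 2))"
    unfolding prodsum using le p by (intro power_increasing) auto
  also have "\<dots> = (nat p ^ (E + 2)) ^ s" by (metis power_mult mult.commute)
  also have "\<dots> < (nat p ^ (E + 2) + 1) ^ s" using s by (intro power_strict_mono) auto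
  also have "\<dots> = card ?A"
  proof -
    define q where "q = p ^ (E + 2)"
    have "q \<ge> 0" "nat q = nat p ^ (E + 2)" using p unfolding q_def by (simp_all only: nat_power_eq) simp_all
    then show ?thesis unfolding q_def[symmetric] by (simp add: card_PiE nat_add_distrib)
  qed
  finally have "card (?f ` ?A) < card ?A" using card_mono[OF fin sub] by linarith
  then have "\<not> inj_on ?f ?A" by (rule pigeonhole)
  then obtain b1 b2 where b: "b1 \<in> ?A" "b2 \<in> ?A" "b1 \<noteq> b2" "?f b1 = ?f b2" unfolding inj_on_def by blast
  define b where "b = (\<lambda>k. b1 k - b2 k)"
  have "\<exists>k<s. b k \<noteq> 0"
  proof (rule ccontr)
    assume "\<not> ?thesis"
    then have "b1 = b2" using b(1,2) by (intro PiE_ext[of b1 "{..<s}" _ b2]) (auto simp: b_def)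
    then show False using b(3) by simp
  qed
  moreover have "\<bar>b k\<bar> \<le> p ^ (E + 2)" if "k < s" for k
  proof -
    have "b1 k \<in> {0..p ^ (E + 2)}" "b2 k \<in> {0..p ^ (E + 2)}"
      using PiE_mem[OF b(1), of k] PiE_mem[OF b(2), of k] that by simp_all
    then show ?thesis unfolding b_def atLeastAtMost_iff by linarith
  qed
  moreover have "p ^ (s - l) dvd (\<Sum>k<s. b k * M k l)" if l: "l < s" for l
  proof -
    have "(\<Sum>k<s. b1 k * M k l) mod p ^ (s - l) = (\<Sum>k<s. b2 k * M k l) mod p ^ (s - l)"
      using fun_cong[OF b(4), of l] l by simp
    then show ?thesis by (simp add: b_def mod_eq_dvd_iff sum_subtractf left_diff_distrib)
  qed
  ultimately show ?thesis by blast
qed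

text \<open>Let \<open>z = f(y)\<close> be the branch through the class. The coefficients of \<open>A0 + f A1\<close> around \<open>y0\<close> are linear in the coefficients of \<open>A0, A1\<close>; making the \<open>l\<close>-th one divisible by \<open>p ^ (s - l)\<close> for all \<open>l < s\<close> makes \<open>A0(y) + z A1(y)\<close> divisible by \<open>p ^ s\<close> on the whole class, which its size only allows if it vanishes.\<close>
lemma class_auxiliary_form:
  fixes p y0 z0 :: int and B K :: real
  assumes p: "prime p" and g0: "\<And>j. g (Suc a) j = 0"
    and simple: "\<not> p dvd biv_eval a D (deriv_coeffs g) z0 y0"
    and size: "real (E + 1) * B ^ E * (B ^ D + K) < real_of_int p ^ E" and B: "B \<ge> 0" "K \<ge> 0"
  shows "\<exists>A0 A1 :: int poly. (A0 \<noteq> 0 \<or> A1 \<noteq> 0) \<and> degree A0 \<le> E \<and> degree A1 \<le> E \<and>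
    (\<forall>u v w y z. \<not> p dvd v \<and> \<bar>real_of_int u\<bar> \<le> B \<and> \<bar>real_of_int v\<bar> \<le> B \<and> \<bar>real_of_int w\<bar> \<le> K \<and>
       y = of_int u / of_int v \<and> z = of_int w / of_int v ^ D \<and>
       y - of_int y0 \<in> loc_ideal p 1 \<and> z - of_int z0 \<in> loc_ideal p 1 \<and> biv_eval a D g z y = 0
       \<longrightarrow> int_poly_eval A0 y + z * int_poly_eval A1 y = 0)"
proof -
  define s where "s = 2 * (E + 1)"
  have "coprime (biv_eval a D (deriv_coeffs g) z0 y0) p" using prime_imp_coprime[OF p simple] by (simp add: coprime_commute)
  then obtain w0 where "[biv_eval a D (deriv_coeffs g) z0 y0 * w0 = 1] (mod p)" using cong_solve_coprime_int by blast
  then have w0: "[w0 * biv_eval a D (deriv_coeffs g) z0 y0 = 1] (mod p)" by (simp add: mult.commute)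
  define f where "f = branch a D g w0 z0 s"
  \<comment> \<open>The \<open>s = 2 * (E + 1)\<close> unknowns are the coefficients of
    \<open>A0\<close>, belonging to y^k, followed by those of \<open>A1\<close>, belonging to f
    y^k.\<close>
  define e where "e = (\<lambda>k. if k \<le> E then monom 1 k else f * monom 1 (k - (E + 1)))"
  have p1: "p \<ge> 1" using prime_gt_0_int[OF p] by simp
  obtain b where b: "\<exists>k<s. b k \<noteq> 0" "\<And>k. k < s \<Longrightarrow> \<bar>b k\<bar> \<le> p ^ (E + 2)"
     "\<And>l. l < s \<Longrightarrow> p ^ (s - l) dvd (\<Sum>k<s. b k * coeff (pcompose (e k) [:y0, 1:]) l)"
    using pigeonhole_congruences[OF p1 s_def, of "\<lambda>k l. coeff (pcompose (e k) [:y0, 1:]) l"] by blast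
  define A0 where "A0 = (\<Sum>k\<le>E. monom (b k) k)"
  define A1 where "A1 = (\<Sum>k\<le>E. monom (b (k + (E + 1))) k)"
  have c0: "coeff A0 k = (if k \<le> E then b k else 0)" for k
    by (auto simp: A0_def coeff_sum)
  have c1: "coeff A1 k = (if k \<le> E then b (k + (E + 1)) else 0)" for k
    by (auto simp: A1_def coeff_sum)
  have deg: "degree A0 \<le> E" "degree A1 \<le> E" by (auto intro!: degree_le simp: c0 c1)
  have split: "(\<Sum>k<s. h k) = (\<Sum>k\<le>E. h k) + (\<Sum>k\<le>E. h (k + (E + 1)))" for h :: "nat \<Rightarrow> int poly"
  proof -
    have "{..<s} = {..E} \<union> {E + 1..<s}" by (auto simp: s_def)
    then have "(\<Sum>k<s. h k) = sum h ({..E} \<union> {E + 1..<s})" by (rule arg_cong)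
    also have "\<dots> = sum h {..E} + sum h {E + 1..<s}" by (rule sum.union_disjoint) auto
    also have "sum h {E + 1..<s} = (\<Sum>k\<le>E. h (k + (E + 1)))"
      by (rule sum.reindex_bij_witness[of _ "\<lambda>k. k + (E + 1)" "\<lambda>k. k - (E + 1)"]) (auto simp: s_def)
    finally show ?thesis .
  qed
  have Psi: "(\<Sum>k<s. smult (b k) (e k)) = A0 + f * A1"
  proof -
    have "(\<Sum>k\<le>E. smult (b k) (e k)) = A0"
      unfolding A0_def by (intro sum.cong) (auto simp: e_def smult_monom)
    moreover have "smult (b (k + (E + 1))) (e (k + (E + 1))) = f * monom (b (k + (E + 1))) k" for k
    proof -
      have "f * monom (b (k + (E + 1))) k = f * smult (b (k + (E + 1))) (monom 1 k)" by (simp add: smult_monom)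
      then show ?thesis by (simp add: e_def)
    qed
    ultimately show ?thesis unfolding split A1_def sum_distrib_left by simp
  qed
  have pc: "pcompose (\<Sum>k<s. smult (b k) (e k)) [:y0, 1:] = (\<Sum>k<s. smult (b k) (pcompose (e k) [:y0, 1:]))"
    by (simp add: pcompose_sum pcompose_smult)
  have dvd: "p ^ (s - l) dvd coeff (pcompose (A0 + f * A1) [:y0, 1:]) l" if "l < s" for l
    using b(3)[OF that] unfolding Psi[symmetric] pc by (simp add: coeff_sum)
  have "A0 \<noteq> 0 \<or> A1 \<noteq> 0"
  proof -
    obtain k where k: "k < s" "b k \<noteq> 0" using b(1) by blast
    show ?thesis
    proof (cases "k \<le> E")
      case True
      then show ?thesis using k c0[of k] by auto
    next
      case False
      then have "k - (E + 1) \<le> E" "k - (E + 1) + (E + 1) = k" using k by (auto simp: s_def)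
      then have "coeff A1 (k - (E + 1)) = b k" using c1[of "k - (E + 1)"] by (simp only: if_True)
      with k have "coeff A1 (k - (E + 1)) \<noteq> 0" by simp
      then show ?thesis by auto
    qed
  qed
  moreover have "int_poly_eval A0 y + z * int_poly_eval A1 y = 0"
    if v: "\<not> p dvd v" and bd: "\<bar>real_of_int u\<bar> \<le> B" "\<bar>real_of_int v\<bar> \<le> B" "\<bar>real_of_int w\<bar> \<le> K"
      and y: "y = of_int u / of_int v" and z: "z = of_int w / of_int v ^ D"
      and near: "y - of_int y0 \<in> loc_ideal p 1" "z - of_int z0 \<in> loc_ideal p 1" and root: "biv_eval a D g z y = 0"
    for u v w :: int and y z :: rat
  proof -
    have v0: "v \<noteq> 0" using v by auto
    have vD: "\<not> p dvd v ^ D" using v prime_dvd_power[OF p] by blast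
    have y0: "y \<in> loc_ideal p 0" unfolding y by (rule loc_ideal_quotient[OF p v])
    have z0': "z \<in> loc_ideal p 0" unfolding z using loc_ideal_quotient[OF p vD, of w] by simp
    have 1: "int_poly_eval (A0 + f * A1) y \<in> loc_ideal p s" by (rule loc_ideal_ipe_shift[OF p near(1) dvd])
    \<comment> \<open>Replacing the approximate branch \<open>f\<close> by the actual root costs
      only a multiple of \<open>p ^ s\<close>.\<close>
    have "z - int_poly_eval f y \<in> loc_ideal p (Suc s)" unfolding f_def
      by (rule branch_approx[OF p y0 z0' near _ w0 root]) (rule g0)
    then have "z - int_poly_eval f y \<in> loc_ideal p s" by (rule loc_ideal_antimono[OF p, rotated]) simp
    with loc_ideal_ipe[OF p y0] have "int_poly_eval A1 y * (z - int_poly_eval f y) \<in> loc_ideal p s" by (rule loc_ideal_mult0[OF p])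
    from loc_ideal_add[OF p 1 this] have 2: "int_poly_eval A0 y + z * int_poly_eval A1 y \<in> loc_ideal p s"
      by (simp add: algebra_simps)
    \<comment> \<open>\<open>v ^ E\<close> clears the denominators of \<open>A0\<close> and
      \<open>A1\<close> at u / v, and \<open>v ^ D\<close> that of \<open>z\<close>. The resulting
      integer is divisible by \<open>p ^ s\<close> and will be seen to be smaller.\<close>
    define J where "J = (\<Sum>k\<le>E. b k * u ^ k * v ^ (E - k)) * v ^ D + w * (\<Sum>k\<le>E. b (k + (E + 1)) * u ^ k * v ^ (E - k))"
    have yk: "of_int v ^ E * y ^ k = of_int (u ^ k * v ^ (E - k))" if "k \<le> E" for k
    proof -
      have "(of_int v :: rat) ^ E = of_int v ^ k * of_int v ^ (E - k)" using that by (simp flip: power_add)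
      then show ?thesis using v0 by (simp add: y power_divide field_simps)
    qed
    have e0: "of_int v ^ E * int_poly_eval A0 y = of_int (\<Sum>k\<le>E. b k * u ^ k * v ^ (E - k))"
      unfolding int_poly_eval_altdef[OF deg(1)] sum_distrib_left
      unfolding of_int_sum
    proof (intro sum.cong refl)
      fix k assume "k \<in> {..E}"
      then have "of_int v ^ E * y ^ k = of_int (u ^ k * v ^ (E - k))" by (intro yk) simp
      then show "of_int v ^ E * (of_int (coeff A0 k) * y ^ k) = of_int (b k * u ^ k * v ^ (E - k))"
        using \<open>k \<in> {..E}\<close> by (simp add: c0 mult.left_commute)
    qed
    have e1: "of_int v ^ E * int_poly_eval A1 y = of_int (\<Sum>k\<le>E. b (k + (E + 1)) * u ^ k * v ^ (E - k))"
      unfolding int_poly_eval_altdef[OF deg(2)] sum_distrib_left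
      unfolding of_int_sum
    proof (intro sum.cong refl)
      fix k assume "k \<in> {..E}"
      then have "of_int v ^ E * y ^ k = of_int (u ^ k * v ^ (E - k))" by (intro yk) simp
      then show "of_int v ^ E * (of_int (coeff A1 k) * y ^ k) = of_int (b (k + (E + 1)) * u ^ k * v ^ (E - k))"
        using \<open>k \<in> {..E}\<close> by (simp add: c1 mult.left_commute)
    qed
    have J: "of_int J = of_int (v ^ (E + D)) * (int_poly_eval A0 y + z * int_poly_eval A1 y)"
    proof -
      have "of_int (v ^ (E + D)) * (int_poly_eval A0 y + z * int_poly_eval A1 y)
         = (of_int v ^ E * int_poly_eval A0 y) * of_int v ^ D + (z * of_int v ^ D) * (of_int v ^ E * int_poly_eval A1 y)"
        by (simp add: power_add algebra_simps)
      also have "z * of_int v ^ D = of_int w" using v0 by (simp add: z)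
      finally show ?thesis unfolding e0 e1 by (simp add: J_def)
    qed
    have "of_int J \<in> loc_ideal p s" unfolding J using 2 by (intro loc_ideal_mult0[OF p] loc_ideal_of_int0[OF p])
    then have "p ^ s dvd J" using p loc_ideal_of_int_iff by blast
    moreover have "\<bar>J\<bar> < p ^ s"
    proof -
      have S: "\<bar>real_of_int (\<Sum>k\<le>E. c k * u ^ k * v ^ (E - k))\<bar> \<le> real (E + 1) * (real_of_int p ^ (E + 2) * B ^ E)"
        if c: "\<And>k. k \<le> E \<Longrightarrow> \<bar>c k\<bar> \<le> p ^ (E + 2)" for c
      proof -
        have "\<bar>real_of_int (\<Sum>k\<le>E. c k * u ^ k * v ^ (E - k))\<bar> \<le> (\<Sum>k\<le>E. \<bar>real_of_int (c k * u ^ k * v ^ (E - k))\<bar>)"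
          unfolding of_int_sum by (rule sum_abs)
        also have "\<dots> \<le> (\<Sum>k\<le>E. real_of_int p ^ (E + 2) * B ^ E)"
        proof (intro sum_mono)
          fix k assume k: "k \<in> {..E}"
          have "\<bar>c k\<bar> \<le> p ^ (E + 2)" using c[of k] k by simp
          then have "real_of_int \<bar>c k\<bar> \<le> real_of_int (p ^ (E + 2))" by (rule of_int_le_iff[THEN iffD2])
          then have "\<bar>real_of_int (c k)\<bar> \<le> real_of_int p ^ (E + 2)" by (simp only: of_int_abs of_int_power)
          moreover have "\<bar>real_of_int u\<bar> ^ k \<le> B ^ k" "\<bar>real_of_int v\<bar> ^ (E - k) \<le> B ^ (E - k)"
            using bd by (auto intro!: power_mono)
          ultimately have "\<bar>real_of_int (c k)\<bar> * (\<bar>real_of_int u\<bar> ^ k * \<bar>real_of_int v\<bar> ^ (E - k))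
               \<le> real_of_int p ^ (E + 2) * (B ^ k * B ^ (E - k))"
            using B p1 by (intro mult_mono) auto
          also have "B ^ k * B ^ (E - k) = B ^ E" using k by (simp flip: power_add)
          finally show "\<bar>real_of_int (c k * u ^ k * v ^ (E - k))\<bar> \<le> real_of_int p ^ (E + 2) * B ^ E"
            by (simp add: abs_mult power_abs mult.assoc)
        qed
        also have "\<dots> = real (E + 1) * (real_of_int p ^ (E + 2) * B ^ E)" by simp
        finally show ?thesis .
      qed
      let ?S0 = "\<Sum>k\<le>E. b k * u ^ k * v ^ (E - k)" and ?S1 = "\<Sum>k\<le>E. b (k + (E + 1)) * u ^ k * v ^ (E - k)"
      let ?X = "real (E + 1) * (real_of_int p ^ (E + 2) * B ^ E)"
      have S0: "\<bar>real_of_int ?S0\<bar> \<le> ?X" by (rule S) (use b(2) in \<open>auto simp: s_def\<close>)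
      have S1: "\<bar>real_of_int ?S1\<bar> \<le> ?X" by (rule S) (use b(2) in \<open>auto simp: s_def\<close>)
      have X0: "?X \<ge> 0" using B p1 by simp
      have "\<bar>real_of_int J\<bar> \<le> \<bar>real_of_int ?S0\<bar> * \<bar>real_of_int v\<bar> ^ D + \<bar>real_of_int w\<bar> * \<bar>real_of_int ?S1\<bar>"
        unfolding J_def of_int_add of_int_mult of_int_power
        by (rule order_trans[OF abs_triangle_ineq]) (simp add: abs_mult power_abs)
      also have "\<dots> \<le> ?X * B ^ D + K * ?X"
        using S0 S1 bd X0 B by (intro add_mono mult_mono power_mono) auto
      also have "\<dots> = (real (E + 1) * B ^ E * (B ^ D + K)) * real_of_int p ^ (E + 2)"
        by (simp add: algebra_simps)
      \<comment> \<open>The unknowns are as large as \<open>p ^ (E + 2)\<close>, so everything else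
        must stay below \<open>p ^ E\<close>: this is the hypothesis \<open>size\<close>, and
        \<open>s = E + (E + 2)\<close>.\<close>
      also have "\<dots> < real_of_int p ^ E * real_of_int p ^ (E + 2)"
        using size p1 by (intro mult_strict_right_mono) auto
      also have "\<dots> = real_of_int (p ^ s)" by (simp only: power_add[symmetric] of_int_power) (simp add: s_def mult_2)
      finally show ?thesis by linarith
    qed
    moreover have "\<bar>p ^ s\<bar> = p ^ s" using p1 by simp
    ultimately have "J = 0" using dvd_imp_le_int[of J "p ^ s"] by linarith
    then show ?thesis using J v0 by simp
  qed
  ultimately show ?thesis using deg by blast
qed

subsection \<open>Sections and simple points\<close>

text \<open>The rational root theorem in homogeneous form: after division by the gcd,
  \<open>B\<close> divides a power of an element coprime to it. Over the integers it shows that a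
  scaled root is an integer, over the rational polynomials that a rational section is a
  polynomial.\<close>

lemma homogeneous_monic_dvd:
  fixes A B :: "'a :: ring_gcd"
  assumes "(\<Sum>i\<le>a. c i * A ^ i * B ^ (a - i)) = 0" "c a = 1"
  shows "B dvd A"
proof (cases "B = 0")
  case True
  have "(\<Sum>i<a. c i * A ^ i * B ^ (a - i)) = 0" by (intro sum.neutral) (auto simp: True)
  then have "A ^ a = 0" using assms by (simp add: lessThan_Suc_atMost[symmetric])
  then show ?thesis by (simp add: True)
next
  case False
  define g where "g = gcd A B"
  have g: "g \<noteq> 0" using False by (simp add: g_def)
  then obtain A' B' where AB: "A = A' * g" "B = B' * g" "coprime A' B'"
    unfolding g_def using gcd_coprime_exists[of A B] by blast
  have "c i * A ^ i * B ^ (a - i) = c i * A' ^ i * B' ^ (a - i) * g ^ a" if "i \<le> a" for i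
  proof -
    have "g ^ a = g ^ i * g ^ (a - i)" using that by (simp flip: power_add)
    then show ?thesis by (simp add: AB power_mult_distrib algebra_simps)
  qed
  then have "(\<Sum>i\<le>a. c i * A' ^ i * B' ^ (a - i)) * g ^ a = 0"
    using assms(1) by (simp add: sum_distrib_right)
  then have "(\<Sum>i\<le>a. c i * A' ^ i * B' ^ (a - i)) = 0" using g by simp
  then have "(\<Sum>i<a. c i * A' ^ i * B' ^ (a - i)) + A' ^ a = 0"
    using assms(2) by (simp add: lessThan_Suc_atMost[symmetric])
  moreover have "B' dvd (\<Sum>i<a. c i * A' ^ i * B' ^ (a - i))"
    by (intro dvd_sum dvd_mult dvd_power) auto
  ultimately have "B' dvd A' ^ a" by (metis dvd_0_right dvd_add_right_iff)
  moreover have "coprime B' (A' ^ a)" using AB(3) by (simp add: coprime_commute)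
  ultimately have "is_unit B'" using coprime_absorb_left by blast
  then have "B' dvd A'" by (rule unit_imp_dvd)
  then show ?thesis unfolding AB(1,2) by (rule mult_dvd_mono) simp
qed

lemma biv_eval_monic:
  assumes "\<And>j. g a j = (if j = 0 then 1 else 0)"
  shows "biv_eval a D g z y = z ^ a + (\<Sum>i<a. \<Sum>j\<le>D. of_int (g i j) * z ^ i * y ^ j)"
proof -
  have "(\<Sum>j\<le>D. of_int (g a j) * z ^ a * y ^ j) = (\<Sum>j\<le>D. if j = 0 then z ^ a else 0)"
    by (intro sum.cong) (auto simp: assms)
  also have "\<dots> = z ^ a" by simp
  finally show ?thesis unfolding biv_eval_def by (simp add: lessThan_Suc_atMost[symmetric])
qed

text \<open>If the degree exceeded \<open>D\<close>, the term \<open>\<sigma> ^ a\<close> would have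
  larger degree than all the others.\<close>

lemma degree_root_le:
  fixes \<sigma> :: "rat poly"
  assumes monic: "\<And>j. g a j = (if j = 0 then 1 else 0)" and root: "biv_eval a D g \<sigma> [:0, 1:] = 0"
  shows "degree \<sigma> \<le> D"
proof (rule ccontr)
  assume "\<not> ?thesis"
  then have D: "degree \<sigma> > D" by simp
  define S where "S = (\<Sum>i<a. \<Sum>j\<le>D. of_int (g i j) * \<sigma> ^ i * [:0, 1:] ^ j :: rat poly)"
  have S: "\<sigma> ^ a = - S" using root unfolding biv_eval_monic[of g a, OF monic] S_def by (simp add: eq_neg_iff_add_eq_0)
  have a: "a > 0"
  proof (rule ccontr)
    assume "\<not> a > 0" then show False using S by (simp add: S_def)
  qed
  have "degree S \<le> (a - 1) * degree \<sigma> + D" unfolding S_def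
  proof (intro degree_sum_le finite_lessThan finite_atMost)
    fix i j assume i: "i \<in> {..<a}" and j: "j \<in> {..D}"
    have "degree (of_int (g i j) * \<sigma> ^ i * [:0, 1:] ^ j) \<le> degree (of_int (g i j) * \<sigma> ^ i) + degree ([:0, 1:] ^ j :: rat poly)"
      by (rule degree_mult_le)
    also have "\<dots> \<le> (degree (of_int (g i j) :: rat poly) + degree (\<sigma> ^ i)) + degree ([:0, 1:] ^ j :: rat poly)"
      by (intro add_right_mono degree_mult_le)
    also have "\<dots> \<le> i * degree \<sigma> + j"
      using degree_power_le[of \<sigma> i] degree_power_le[of "[:0, 1:] :: rat poly" j] by (simp add: mult.commute)
    also have "\<dots> \<le> (a - 1) * degree \<sigma> + D"
      using i j by (intro add_mono mult_right_mono) auto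
    finally show "degree (of_int (g i j) * \<sigma> ^ i * [:0, 1:] ^ j) \<le> (a - 1) * degree \<sigma> + D" .
  qed
  moreover have "degree S = a * degree \<sigma>" 
  proof -
    have "\<sigma> \<noteq> 0" using D by auto
    then show ?thesis using arg_cong[OF S, of degree] by (simp add: degree_power_eq)
  qed
  moreover have "a * degree \<sigma> = (a - 1) * degree \<sigma> + degree \<sigma>" using a by (cases a) auto
  ultimately show False using D by linarith
qed

text \<open>With P, Q for \<open>A0\<close>, \<open>A1\<close>, the points satisfy z = - P / Q off
  the roots of Q. Substituting this into the family and clearing denominators gives a polynomial R
  in y. If R is nonzero, only roots of R and Q remain. If R = 0, then - P / Q is a root of a monic
  polynomial, hence a section, and \<open>T\<close> excludes the points on it; only roots of Q
  remain.\<close>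

lemma linear_form_points:
  fixes A0 A1 :: "int poly" and D :: nat
  assumes monic: "\<And>j. g a j = (if j = 0 then 1 else 0)"
    and A: "A0 \<noteq> 0 \<or> A1 \<noteq> 0" "degree A0 \<le> E" "degree A1 \<le> E"
  defines "T \<equiv> {y. \<exists>z. biv_eval a D g z y = 0 \<and> int_poly_eval A0 y + z * int_poly_eval A1 y = 0 \<and>
     (\<forall>\<sigma>. degree \<sigma> \<le> D \<and> biv_eval a D g \<sigma> [:0, 1:] = 0 \<longrightarrow> poly \<sigma> y \<noteq> z)}"
  shows "finite T \<and> card T \<le> E + a * E + D"
proof -
  define P :: "rat poly" where "P = map_poly of_int A0"
  define Q :: "rat poly" where "Q = map_poly of_int A1"
  have eP: "int_poly_eval A0 y = poly P y" and eQ: "int_poly_eval A1 y = poly Q y" for y by (simp_all add: int_poly_eval_def P_def Q_def)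
  have nz: "P \<noteq> 0 \<or> Q \<noteq> 0" using A(1) by (auto simp: P_def Q_def map_poly_eq_0_iff)
  have deg: "degree P \<le> E" "degree Q \<le> E"
    using A(2,3) by (auto intro!: degree_le simp: P_def Q_def coeff_map_poly coeff_eq_0)
  have roots: "finite {y. poly S y = 0} \<and> card {y. poly S y = 0} \<le> degree S" if "S \<noteq> 0" for S :: "rat poly"
    using poly_roots_finite[OF that] card_poly_roots_bound[OF that] by simp
  have le: "finite T \<and> card T \<le> n" if "T \<subseteq> U" "finite U" "card U \<le> n" for U n
    using that finite_subset card_mono le_trans by metis
  show ?thesis
  proof (cases "Q = 0")
    case True
    then have P: "P \<noteq> 0" using nz by simp
    have "T \<subseteq> {y. poly P y = 0}" by (auto simp: T_def eP eQ True)
    from le[OF this, of "degree P"] roots[OF P] deg show ?thesis by force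
  next
    case Q: False
    define X :: "rat poly" where "X = [:0, 1:]"
    define R where "R = (\<Sum>i\<le>a. (\<Sum>j\<le>D. of_int (g i j) * X ^ j) * (- P) ^ i * Q ^ (a - i))"
    have key: "(\<Sum>i\<le>a. (\<Sum>j\<le>D. of_int (g i j) * y ^ j) * p ^ i * q ^ (a - i)) = q ^ a * biv_eval a D g z y"
      if "p = q * z" for p q z y :: "'b :: comm_ring_1"
    proof -
      have "q ^ a * (\<Sum>j\<le>D. of_int (g i j) * z ^ i * y ^ j) = (\<Sum>j\<le>D. of_int (g i j) * y ^ j) * p ^ i * q ^ (a - i)"
        if "i \<le> a" for i
      proof -
        have "q ^ a = q ^ i * q ^ (a - i)" using that by (simp flip: power_add)
        then show ?thesis using \<open>p = q * z\<close>
          by (simp add: sum_distrib_left sum_distrib_right power_mult_distrib algebra_simps)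
      qed
      then show ?thesis unfolding biv_eval_def by (simp add: sum_distrib_left)
    qed
    have Ry: "poly R y = poly Q y ^ a * biv_eval a D g z y" if "poly P y + z * poly Q y = 0" for y z
    proof -
      have "poly R y = (\<Sum>i\<le>a. (\<Sum>j\<le>D. of_int (g i j) * y ^ j) * (- poly P y) ^ i * poly Q y ^ (a - i))"
        unfolding R_def X_def by (simp add: poly_sum of_int_poly)
      also have "\<dots> = poly Q y ^ a * biv_eval a D g z y"
        by (rule key) (use that in \<open>simp add: algebra_simps eq_neg_iff_add_eq_0 add.commute\<close>)
      finally show ?thesis .
    qed
    show ?thesis
    proof (cases "R = 0")
      case False
      have "T \<subseteq> {y. poly Q y = 0} \<union> {y. poly R y = 0}"
        using Ry by (auto simp: T_def eP eQ)
      moreover have "degree R \<le> a * E + D" unfolding R_def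
      proof (intro degree_sum_le finite_atMost)
        fix i assume i: "i \<in> {..a}"
        have "degree (\<Sum>j\<le>D. of_int (g i j) * X ^ j) \<le> D"
        proof (intro degree_sum_le finite_atMost)
          fix j assume "j \<in> {..D}"
          then show "degree (of_int (g i j) * X ^ j) \<le> D"
            using degree_mult_le[of "of_int (g i j)" "X ^ j"] degree_power_le[of X j] by (simp add: X_def)
        qed
        moreover have "degree ((- P) ^ i) \<le> E * i" using degree_power_le[of "- P" i] deg
          by (metis degree_minus le_trans mult_le_mono1)
        moreover have "degree (Q ^ (a - i)) \<le> E * (a - i)" using degree_power_le[of Q "a - i"] deg
          by (metis le_trans mult_le_mono1)
        ultimately have "degree (\<Sum>j\<le>D. of_int (g i j) * X ^ j) + degree ((- P) ^ i) + degree (Q ^ (a - i)) \<le> D + E * i + E * (a - i)"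
          by (intro add_mono)
        also have "E * i + E * (a - i) = E * a" using i by (simp flip: distrib_left)
        then have "D + E * i + E * (a - i) = a * E + D" by (simp add: mult.commute)
        finally show "degree ((\<Sum>j\<le>D. of_int (g i j) * X ^ j) * (- P) ^ i * Q ^ (a - i)) \<le> a * E + D"
          by (meson add_right_mono degree_mult_le le_trans)
      qed
      then have "card ({y. poly Q y = 0} \<union> {y. poly R y = 0}) \<le> E + (a * E + D)"
        using roots[OF False] roots[OF Q] deg card_Un_le[of "{y. poly Q y = 0}" "{y. poly R y = 0}"] by linarith
      moreover have "finite ({y. poly Q y = 0} \<union> {y. poly R y = 0})" using roots[OF False] roots[OF Q] by simp
      ultimately show ?thesis using le by (metis add.assoc)
    next
      case True
      have "Q dvd - P"
      proof (rule homogeneous_monic_dvd)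
        show "(\<Sum>i\<le>a. (\<Sum>j\<le>D. of_int (g i j) * X ^ j) * (- P) ^ i * Q ^ (a - i)) = 0" using True by (simp add: R_def)
        have "(\<Sum>j\<le>D. of_int (g a j) * X ^ j) = (\<Sum>j\<le>D. if j = 0 then 1 else 0)"
          by (intro sum.cong) (auto simp: monic)
        then show "(\<Sum>j\<le>D. of_int (g a j) * X ^ j) = 1" by simp
      qed
      then obtain \<sigma> where \<sigma>: "- P = Q * \<sigma>" by blast
      have "Q ^ a * biv_eval a D g \<sigma> X = 0" using key[OF \<sigma>, of X] True by (simp add: R_def)
      then have root: "biv_eval a D g \<sigma> [:0, 1:] = 0" using Q by (simp add: X_def)
      have "T \<subseteq> {y. poly Q y = 0}"
      proof
        fix y assume "y \<in> T"
        then obtain z where z: "poly P y + z * poly Q y = 0" "poly \<sigma> y \<noteq> z"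
          using root degree_root_le[of g a, OF monic root] by (auto simp: T_def eP eQ)
        have s: "poly Q y * poly \<sigma> y = - poly P y" using \<sigma> by (metis poly_minus poly_mult)
        have "poly Q y * (z - poly \<sigma> y) = poly P y + z * poly Q y"
          unfolding right_diff_distrib s by simp
        then have "poly Q y * (z - poly \<sigma> y) = 0" using z(1) by simp
        then show "y \<in> {y. poly Q y = 0}" using z(2) by simp
      qed
      from le[OF this, of "degree Q"] roots[OF Q] deg show ?thesis by force
    qed
  qed
qed

section \<open>Residue classes of simple zeros modulo a prime\<close>

lemma roots_mod_prime_aux:
  fixes p :: int
  assumes "prime p" "\<not> p dvd c m"
  shows "card {z\<in>{0..<p}. p dvd (\<Sum>i\<le>m. c i * z ^ i)} \<le> m"
  using assms(2)
proof (induction m arbitrary: c)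
  case 0
  then show ?case by simp
next
  case (Suc m)
  let ?S = "{z\<in>{0..<p}. p dvd (\<Sum>i\<le>Suc m. c i * z ^ i)}"
  show ?case
  proof (cases "?S = {}")
    case False
    then obtain r where r: "r \<in> {0..<p}" "p dvd (\<Sum>i\<le>Suc m. c i * r ^ i)" by auto
    define d where "d = (\<lambda>j. \<Sum>i=Suc j..Suc m. c i * r ^ (i - j - 1))"
    have eq: "(\<Sum>i\<le>Suc m. c i * z ^ i) - (\<Sum>i\<le>Suc m. c i * r ^ i) = (z - r) * (\<Sum>j\<le>m. d j * z ^ j)" for z
      unfolding d_def lessThan_Suc_atMost[symmetric]
      using polyfun_diff[of "Suc m" c z r] by (simp add: lessThan_Suc_atMost)
    have "\<not> p dvd d m" using Suc.prems by (simp add: d_def)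
    then have IH: "card {z\<in>{0..<p}. p dvd (\<Sum>i\<le>m. d i * z ^ i)} \<le> m" by (rule Suc.IH)
    have "?S \<subseteq> insert r {z\<in>{0..<p}. p dvd (\<Sum>i\<le>m. d i * z ^ i)}"
    proof
      fix z assume z: "z \<in> ?S"
      then have "p dvd (z - r) * (\<Sum>j\<le>m. d j * z ^ j)" using r eq[of z] by (metis (mono_tags) dvd_diff mem_Collect_eq)
      then have "p dvd z - r \<or> p dvd (\<Sum>j\<le>m. d j * z ^ j)" using assms(1) prime_dvd_mult_iff by blast
      moreover have "z = r" if "p dvd z - r"
      proof (rule ccontr)
        assume "z \<noteq> r"
        then have "\<bar>p\<bar> \<le> \<bar>z - r\<bar>" using dvd_imp_le_int[of "z - r" p] that by simp
        then show False using r(1) z by auto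
      qed
      ultimately show "z \<in> insert r {z\<in>{0..<p}. p dvd (\<Sum>i\<le>m. d i * z ^ i)}" using z by auto
    qed
    moreover have fin: "finite {z\<in>{0..<p}. p dvd (\<Sum>i\<le>m. d i * z ^ i)}"
      by (rule finite_subset[of _ "{0..<p}"]) auto
    ultimately have "card ?S \<le> card (insert r {z\<in>{0..<p}. p dvd (\<Sum>i\<le>m. d i * z ^ i)})"
      by (intro card_mono) simp_all
    also have "\<dots> \<le> Suc (card {z\<in>{0..<p}. p dvd (\<Sum>i\<le>m. d i * z ^ i)})" using fin by (simp add: card_insert_if)
    finally show ?thesis using IH by simp
  next
    case True
    then show ?thesis by (simp only: card.empty)
  qed
qed

text \<open>Leading coefficients may vanish modulo \<open>p\<close>; the sum is cut down to the
  largest index \<open>m\<close> that survives.\<close>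

lemma roots_mod_prime:
  fixes p :: int
  assumes "prime p" "i \<le> a" "\<not> p dvd c i"
  shows "card {z\<in>{0..<p}. p dvd (\<Sum>i\<le>a. c i * z ^ i)} \<le> a"
proof -
  define m where "m = Max {i. i \<le> a \<and> \<not> p dvd c i}"
  have fin: "finite {i. i \<le> a \<and> \<not> p dvd c i}" by simp
  then have m: "m \<le> a" "\<not> p dvd c m" using Max_in[OF fin] assms unfolding m_def by blast+
  have big: "p dvd c j" if "m < j" "j \<le> a" for j
  proof (rule ccontr)
    assume "\<not> p dvd c j"
    then have "j \<in> {i. i \<le> a \<and> \<not> p dvd c i}" using that by blast
    then have "j \<le> m" unfolding m_def by (rule Max_ge[OF fin])
    then show False using that by simp
  qed
  have "p dvd (\<Sum>i\<le>a. c i * z ^ i) \<longleftrightarrow> p dvd (\<Sum>i\<le>m. c i * z ^ i)" for z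
  proof -
    have "{..a} = {..m} \<union> {m<..a}" using m by auto
    then have "(\<Sum>i\<le>a. c i * z ^ i) = (\<Sum>i\<in>{..m} \<union> {m<..a}. c i * z ^ i)" by (rule arg_cong)
    also have "\<dots> = (\<Sum>i\<le>m. c i * z ^ i) + (\<Sum>i\<in>{m<..a}. c i * z ^ i)" by (rule sum.union_disjoint) auto
    finally have "(\<Sum>i\<le>a. c i * z ^ i) = (\<Sum>i\<le>m. c i * z ^ i) + (\<Sum>i\<in>{m<..a}. c i * z ^ i)" .
    moreover have "p dvd (\<Sum>i\<in>{m<..a}. c i * z ^ i)" using big by (intro dvd_sum dvd_mult2) auto
    ultimately show ?thesis by (simp add: dvd_add_left_iff)
  qed
  then show ?thesis using roots_mod_prime_aux[of p c m, OF assms(1) m(2)] m(1) by simp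
qed

text \<open>The parameter residue comes first and the root residue second, opposite to the argument
  order of \<open>biv_eval\<close>.\<close>

definition simple_classes :: "nat \<Rightarrow> nat \<Rightarrow> (nat \<Rightarrow> nat \<Rightarrow> int) \<Rightarrow> int \<Rightarrow> (int \<times> int) set" where
  "simple_classes a D g p = (SIGMA y0:{0..<p}. {z0\<in>{0..<p}. p dvd biv_eval a D g z0 y0 \<and> \<not> p dvd biv_eval a D (deriv_coeffs g) z0 y0})"

text \<open>Over \<open>y0\<close> a simple zero exists only if the polynomial is nonzero modulo
  \<open>p\<close>, as otherwise its derivative vanishes too; and then there are at most
  \<open>a\<close> zeros.\<close>

lemma card_simple_classes:
  fixes p :: int
  assumes "prime p" "\<And>j. g (Suc a) j = 0"
  shows "finite (simple_classes a D g p) \<and> card (simple_classes a D g p) \<le> nat p * a"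
proof
  show "finite (simple_classes a D g p)" unfolding simple_classes_def
    by (rule finite_subset[of _ "{0..<p} \<times> {0..<p}"]) auto
  have "card {z0\<in>{0..<p}. p dvd biv_eval a D g z0 y0 \<and> \<not> p dvd biv_eval a D (deriv_coeffs g) z0 y0} \<le> a" (is "card ?F \<le> a") for y0
  proof (cases "?F = {}")
    case False
    then obtain z where z: "\<not> p dvd biv_eval a D (deriv_coeffs g) z y0" by auto
    define c where "c = (\<lambda>i. \<Sum>j\<le>D. g i j * y0 ^ j)"
    have e: "biv_eval a D g x y0 = (\<Sum>i\<le>a. c i * x ^ i)" for x
      unfolding biv_eval_def c_def by (simp add: sum_distrib_left sum_distrib_right algebra_simps)
    have dze: "biv_eval a D (deriv_coeffs g) z y0 = (\<Sum>i\<le>a. c i * (of_nat i * z ^ (i - 1)))"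
      unfolding biv_eval_dz[of g a, OF assms(2)] c_def by (simp add: sum_distrib_left sum_distrib_right algebra_simps)
    have "\<exists>i\<le>a. \<not> p dvd c i"
    proof (rule ccontr)
      assume "\<not> ?thesis"
      then have "p dvd biv_eval a D (deriv_coeffs g) z y0" unfolding dze by (intro dvd_sum dvd_mult2) auto
      then show False using z by simp
    qed
    then obtain i where "i \<le> a" "\<not> p dvd c i" by blast
    from roots_mod_prime[of p _ a c, OF assms(1) this] have "card {x\<in>{0..<p}. p dvd biv_eval a D g x y0} \<le> a" by (simp add: e)
    moreover have "finite {x\<in>{0..<p}. p dvd biv_eval a D g x y0}" by (rule finite_subset[of _ "{0..<p}"]) auto
    then have "card ?F \<le> card {x\<in>{0..<p}. p dvd biv_eval a D g x y0}" by (intro card_mono) auto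
    ultimately show ?thesis by linarith
  next
    case True
    then show ?thesis by (simp only: card.empty)
  qed
  note F = this
  have "card (simple_classes a D g p)
      = (\<Sum>y0\<in>{0..<p}. card {z0\<in>{0..<p}. p dvd biv_eval a D g z0 y0 \<and> \<not> p dvd biv_eval a D (deriv_coeffs g) z0 y0})"
    unfolding simple_classes_def
    by (rule card_SigmaI) (auto intro: finite_subset[of _ "{0..<p}"])
  also have "\<dots> \<le> (\<Sum>y0\<in>{0..<p}. a)" by (intro sum_mono F)
  finally show "card (simple_classes a D g p) \<le> nat p * a" by simp
qed

text \<open>Used contrapositively: a nonzero integer below \<open>2 ^ card P\<close> escapes some
  prime of \<open>P\<close>. This is why a number of primes logarithmic in the heights
  suffices.\<close>

lemma prime_set_dvd_bound:
  assumes "finite P" "J \<noteq> 0" "\<And>p. p \<in> P \<Longrightarrow> prime p \<and> int p dvd J"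
  shows "2 ^ card P \<le> \<bar>J\<bar>"
proof -
  have "int (\<Prod>P) dvd J \<and> 2 ^ card P \<le> \<Prod>P" using assms(1,3)
  proof (induction P rule: finite_induct)
    case empty
    then show ?case by simp
  next
    case (insert p P)
    have "coprime p (\<Prod>P)"
      by (rule prod_coprime_right) (use insert primes_coprime in \<open>metis insertCI\<close>)
    then have "coprime (int p) (int (\<Prod>P))" by (rule coprime_int_iff[THEN iffD2])
    with insert have "int p * int (\<Prod>P) dvd J" by (intro divides_mult) auto
    moreover have "2 \<le> p" using insert.prems[of p] prime_ge_2_nat by simp
    ultimately show ?case using insert by (auto intro: mult_le_mono)
  qed
  then have 1: "int (\<Prod>P) dvd J" "2 ^ card P \<le> \<Prod>P" by auto
  from 1(2) have "int (2 ^ card P) \<le> int (\<Prod>P)" by (rule of_nat_le_iff[THEN iffD2])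
  also have "\<dots> \<le> \<bar>J\<bar>" using dvd_imp_le_int[OF assms(2) 1(1)] by simp
  finally show ?thesis by simp
qed

lemma funpow_dz_bound:
  assumes "\<And>i j. \<bar>real_of_int (g i j)\<bar> \<le> H" "\<And>i j. i > a \<Longrightarrow> g i j = 0" "H \<ge> 0"
  shows "\<bar>real_of_int ((deriv_coeffs ^^ k) g i j)\<bar> \<le> real a ^ k * H \<and> (i > a \<longrightarrow> (deriv_coeffs ^^ k) g i j = 0)"
proof (induction k arbitrary: i j)
  case 0
  then show ?case using assms by simp
next
  case (Suc k)
  show ?case
  proof (cases "Suc i \<le> a")
    case True
    have "\<bar>real_of_int ((deriv_coeffs ^^ Suc k) g i j)\<bar> = real (Suc i) * \<bar>real_of_int ((deriv_coeffs ^^ k) g (Suc i) j)\<bar>"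
      by (simp add: deriv_coeffs_def abs_mult)
    also have "\<dots> \<le> real a * (real a ^ k * H)" using Suc[of "Suc i" j] True by (intro mult_mono) auto
    finally show ?thesis using True by (simp add: mult.assoc)
  next
    case False
    then show ?thesis using Suc[of "Suc i" j] assms(3) by (simp add: deriv_coeffs_def)
  qed
qed

text \<open>Each derivative multiplies the leading row by the current degree. For
  \<open>k = a\<close> and monic \<open>g\<close> only a nonzero constant is left.\<close>

lemma funpow_dz_top:
  assumes "\<And>i j. i > a \<Longrightarrow> g i j = 0" "k \<le> a"
  shows "\<exists>m>0. (\<forall>j. (deriv_coeffs ^^ k) g (a - k) j = m * g a j) \<and> (\<forall>i>a - k. \<forall>j. (deriv_coeffs ^^ k) g i j = 0)"
  using assms(2)
proof (induction k)
  case 0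
  then show ?case using assms by (intro exI[of _ 1]) auto
next
  case (Suc k)
  then obtain m where m: "m > 0" "\<And>j. (deriv_coeffs ^^ k) g (a - k) j = m * g a j" "\<And>i j. i > a - k \<Longrightarrow> (deriv_coeffs ^^ k) g i j = 0" by auto
  have s: "Suc (a - Suc k) = a - k" using Suc.prems by simp
  have "(deriv_coeffs ^^ Suc k) g (a - Suc k) j = (int (a - k) * m) * g a j" for j
    using m(2)[of j] by (simp add: deriv_coeffs_def s)
  moreover have "(deriv_coeffs ^^ Suc k) g i j = 0" if "i > a - Suc k" for i j
    using m(3)[of "Suc i" j] that by (simp add: deriv_coeffs_def)
  moreover have "int (a - k) * m > 0" using m(1) Suc.prems by simp
  ultimately show ?case by blast
qed

text \<open>The a-th derivative is a nonzero constant. The first derivative that does not vanish at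
  the point is therefore preceded by one of which the point is a simple zero, however multiple the
  root \<open>z\<close> is.\<close>

lemma exists_simple_derivative:
  fixes z y :: rat
  assumes monic: "\<And>j. g a j = (if j = 0 then 1 else 0)" and zero: "\<And>i j. i > a \<Longrightarrow> g i j = 0"
    and root: "biv_eval a D g z y = 0"
  shows "\<exists>k<a. biv_eval a D ((deriv_coeffs ^^ k) g) z y = 0 \<and> biv_eval a D ((deriv_coeffs ^^ Suc k) g) z y \<noteq> 0"
proof -
  obtain m where m: "m > 0" "\<And>j. (deriv_coeffs ^^ a) g 0 j = m * g a j" "\<And>i j. i > 0 \<Longrightarrow> (deriv_coeffs ^^ a) g i j = 0"
    using funpow_dz_top[of a g a, OF zero] by auto
  have "biv_eval a D ((deriv_coeffs ^^ a) g) z y = (\<Sum>i\<le>a. if i = 0 then (\<Sum>j\<le>D. if j = 0 then of_int m else 0) else 0)"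
    unfolding biv_eval_def by (intro sum.cong refl) (auto simp: m(2,3) monic simp del: sum.delta sum.delta' intro!: sum.cong)
  also have "\<dots> = (\<Sum>j\<le>D. if j = 0 then of_int m else 0)" by simp
  finally have "biv_eval a D ((deriv_coeffs ^^ a) g) z y = of_int m" by simp
  then have ex: "biv_eval a D ((deriv_coeffs ^^ a) g) z y \<noteq> 0" using m by simp
  define n where "n = (LEAST k. biv_eval a D ((deriv_coeffs ^^ k) g) z y \<noteq> 0)"
  have n: "biv_eval a D ((deriv_coeffs ^^ n) g) z y \<noteq> 0" "n \<le> a" unfolding n_def
    by (rule LeastI[where P = "\<lambda>k. biv_eval a D ((deriv_coeffs ^^ k) g) z y \<noteq> 0", OF ex],
        rule Least_le[where P = "\<lambda>k. biv_eval a D ((deriv_coeffs ^^ k) g) z y \<noteq> 0", OF ex])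
  then have "n \<noteq> 0" using root by (cases n) auto
  then obtain k where k: "n = Suc k" by (cases n) auto
  then have "k < (LEAST k. biv_eval a D ((deriv_coeffs ^^ k) g) z y \<noteq> 0)" by (simp add: n_def)
  then have "\<not> biv_eval a D ((deriv_coeffs ^^ k) g) z y \<noteq> 0" by (rule not_less_Least)
  then show ?thesis using k n by (intro exI[of _ k]) auto
qed

text \<open>Up to the common denominator \<open>v ^ (D + D * a)\<close>, the power
  \<open>u ^ j\<close> lacks \<open>D - j\<close> factors \<open>v\<close>, and \<open>w ^ i\<close>
  lacks \<open>D * (a - i)\<close> of them.\<close>

lemma biv_eval_clear_denominators:
  assumes "v \<noteq> 0" "y = of_int u / of_int v" "z = of_int w / of_int v ^ D"
  shows "(of_int (\<Sum>i\<le>a. \<Sum>j\<le>D. g i j * w ^ i * u ^ j * v ^ ((D - j) + D * (a - i))) :: rat)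
     = of_int v ^ (D + D * a) * biv_eval a D g z y"
proof -
  have "(of_int (g i j * w ^ i * u ^ j * v ^ ((D - j) + D * (a - i))) :: rat)
      = of_int v ^ (D + D * a) * (of_int (g i j) * z ^ i * y ^ j)" if "i \<le> a" "j \<le> D" for i j
  proof -
    have "D + D * a = (D - j) + D * (a - i) + D * i + j" using that by (simp flip: distrib_left)
    then have V: "(of_int v :: rat) ^ (D + D * a) = of_int v ^ ((D - j) + D * (a - i)) * (of_int v ^ D) ^ i * of_int v ^ j"
      by (simp only: power_add power_mult)
    have W: "(of_int v ^ D) ^ i * z ^ i = of_int w ^ i" using assms by (simp flip: power_mult_distrib)
    have U: "of_int v ^ j * y ^ j = of_int u ^ j" using assms by (simp flip: power_mult_distrib)
    show ?thesis unfolding V of_int_mult of_int_power W[symmetric] U[symmetric] by (simp only: mult_ac)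
  qed
  then show ?thesis unfolding biv_eval_def sum_distrib_left of_int_sum by (intro sum.cong refl) auto
qed

lemma biv_eval_clear_denominators_bound:
  fixes B K H :: real
  assumes "\<And>i j. \<bar>real_of_int (g i j)\<bar> \<le> H" "\<bar>real_of_int u\<bar> \<le> B" "\<bar>real_of_int v\<bar> \<le> B" "\<bar>real_of_int w\<bar> \<le> K"
    "B \<ge> 1" "K \<ge> 1" "H \<ge> 0"
  shows "\<bar>real_of_int (\<Sum>i\<le>a. \<Sum>j\<le>D. g i j * w ^ i * u ^ j * v ^ ((D - j) + D * (a - i)))\<bar>
     \<le> real (a + 1) * real (D + 1) * H * K ^ a * B ^ (D + D * a)"
proof -
  have *: "\<bar>real_of_int (g i j * w ^ i * u ^ j * v ^ ((D - j) + D * (a - i)))\<bar> \<le> H * K ^ a * B ^ (D + D * a)"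
    if "i \<le> a" "j \<le> D" for i j
  proof -
    have "\<bar>real_of_int w\<bar> ^ i \<le> K ^ i" using assms by (intro power_mono) auto
    also have "K ^ i \<le> K ^ a" using assms that by (intro power_increasing) auto
    finally have w: "\<bar>real_of_int w\<bar> ^ i \<le> K ^ a" .
    have "\<bar>real_of_int u\<bar> ^ j * \<bar>real_of_int v\<bar> ^ ((D - j) + D * (a - i)) \<le> B ^ j * B ^ ((D - j) + D * (a - i))"
      using assms by (intro mult_mono power_mono) auto
    also have "\<dots> = B ^ (j + ((D - j) + D * (a - i)))" by (simp only: power_add)
    also have "\<dots> \<le> B ^ (D + D * a)" using assms that by (intro power_increasing) auto
    finally have uv: "\<bar>real_of_int u\<bar> ^ j * \<bar>real_of_int v\<bar> ^ ((D - j) + D * (a - i)) \<le> B ^ (D + D * a)" .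
    have "\<bar>real_of_int (g i j)\<bar> * \<bar>real_of_int w\<bar> ^ i * (\<bar>real_of_int u\<bar> ^ j * \<bar>real_of_int v\<bar> ^ ((D - j) + D * (a - i)))
       \<le> H * K ^ a * B ^ (D + D * a)"
      using assms w uv by (intro mult_mono) auto
    then show ?thesis by (simp add: abs_mult power_abs mult.assoc)
  qed
  have "\<bar>real_of_int (\<Sum>i\<le>a. \<Sum>j\<le>D. g i j * w ^ i * u ^ j * v ^ ((D - j) + D * (a - i)))\<bar>
     \<le> (\<Sum>i\<le>a. \<Sum>j\<le>D. \<bar>real_of_int (g i j * w ^ i * u ^ j * v ^ ((D - j) + D * (a - i)))\<bar>)"
    unfolding of_int_sum by (intro order_trans[OF sum_abs] sum_mono order_trans[OF sum_abs]) auto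
  also have "\<dots> \<le> (\<Sum>i\<le>a. \<Sum>j\<le>D. H * K ^ a * B ^ (D + D * a))" by (intro sum_mono *) auto
  also have "\<dots> = real (a + 1) * real (D + 1) * H * K ^ a * B ^ (D + D * a)" by simp
  finally show ?thesis .
qed

section \<open>The count for one parameter\<close>

lemma rat_height_quotient:
  assumes "real_of_int (rat_height y) \<le> B"
  obtains u v where "v > 0" "\<bar>real_of_int u\<bar> \<le> B" "\<bar>real_of_int v\<bar> \<le> B" "y = of_int u / of_int v"
proof -
  obtain u v where uv: "quotient_of y = (u, v)" by (cases "quotient_of y")
  then have "v > 0" "y = of_int u / of_int v" using quotient_of_denom_pos quotient_of_div by blast+
  moreover have "\<bar>real_of_int u\<bar> \<le> B" "\<bar>real_of_int v\<bar> \<le> B" using assms by (simp_all add: rat_height_def uv)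
  ultimately show ?thesis using that by blast
qed

text \<open>With \<open>y = u / v\<close> the number \<open>z * v ^ D\<close> is a root of a monic
  polynomial over the integers, hence an integer \<open>w\<close>; Cauchy's bound by the sum of the
  absolute values of the lower coefficients gives its size.\<close>

lemma root_point_data:
  fixes y z :: rat and B H :: real
  assumes monic: "\<And>j. g a j = (if j = 0 then 1 else 0)" and gH: "\<And>i j. \<bar>real_of_int (g i j)\<bar> \<le> H"
    and HB: "H \<ge> 1" "B \<ge> 1" and a: "a \<ge> 1" and root: "biv_eval a D g z y = 0" and ht: "real_of_int (rat_height y) \<le> B"
  shows "\<exists>u v w. v > 0 \<and> \<bar>real_of_int u\<bar> \<le> B \<and> \<bar>real_of_int v\<bar> \<le> B \<and>
     \<bar>real_of_int w\<bar> \<le> real a * (real D + 1) * H * B ^ (D * a) \<and> y = of_int u / of_int v \<and> z = of_int w / of_int v ^ D"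
proof -
  obtain u v where uv: "v > 0" "\<bar>real_of_int u\<bar> \<le> B" "\<bar>real_of_int v\<bar> \<le> B" "y = of_int u / of_int v"
    using rat_height_quotient[OF ht] by blast
  \<comment> \<open>The coefficients of the monic equation for \<open>z * v ^ D\<close>, obtained on
    multiplying by \<open>v ^ (D * a)\<close>. The exponent \<open>D * (a - i) - j\<close> is a true
    difference because \<open>i < a\<close> and \<open>j <= D\<close>.\<close>
  define e where "e = (\<lambda>i. if i = a then 1 else (\<Sum>j\<le>D. g i j * u ^ j * v ^ (D * (a - i) - j)))"
  define W where "W = z * of_int v ^ D"
  have v0: "v \<noteq> 0" using uv by simp
  have sumW: "(\<Sum>i\<le>a. of_int (e i) * W ^ i) = 0"
  proof -
    have "of_int (e i) * W ^ i = of_int v ^ (D * a) * (\<Sum>j\<le>D. of_int (g i j) * z ^ i * y ^ j)" if i: "i < a" for i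
    proof -
      have "of_int (g i j * u ^ j * v ^ (D * (a - i) - j)) * W ^ i = of_int v ^ (D * a) * (of_int (g i j) * z ^ i * y ^ j)"
        if j: "j \<le> D" for j
      proof -
        have "D * 1 \<le> D * (a - i)" using i by (intro mult_le_mono2) auto
        moreover have "D * a = D * (a - i) + D * i" using i by (simp flip: distrib_left)
        ultimately have "D * a = (D * (a - i) - j) + D * i + j" using j by linarith
        then have "(of_int v :: rat) ^ (D * a) = of_int v ^ (D * (a - i) - j) * (of_int v ^ D) ^ i * of_int v ^ j"
          by (simp only: power_add power_mult)
        moreover have "of_int v ^ j * y ^ j = of_int u ^ j" using uv(4) v0 by (simp flip: power_mult_distrib)
        ultimately show ?thesis by (simp add: W_def power_mult_distrib algebra_simps)
      qed
      then have "(\<Sum>j\<le>D. of_int (g i j * u ^ j * v ^ (D * (a - i) - j)) * W ^ i)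
          = (\<Sum>j\<le>D. of_int v ^ (D * a) * (of_int (g i j) * z ^ i * y ^ j))" by (intro sum.cong refl) auto
      then show ?thesis using i unfolding e_def by (simp add: sum_distrib_left sum_distrib_right)
    qed
    moreover have "of_int (e a) * W ^ a = of_int v ^ (D * a) * z ^ a"
      by (simp add: e_def W_def power_mult_distrib power_mult)
    ultimately have "(\<Sum>i\<le>a. of_int (e i) * W ^ i) = of_int v ^ (D * a) * biv_eval a D g z y"
      unfolding biv_eval_monic[of g a, OF monic] lessThan_Suc_atMost[symmetric]
      by (simp add: algebra_simps sum_distrib_left)
    then show ?thesis using root by simp
  qed
  obtain r s where rs: "quotient_of W = (r, s)" by (cases "quotient_of W")
  then have s0: "s > 0" and W: "W = of_int r / of_int s" using quotient_of_denom_pos quotient_of_div by blast+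
  have "(of_int (\<Sum>i\<le>a. e i * r ^ i * s ^ (a - i)) :: rat) = of_int s ^ a * (\<Sum>i\<le>a. of_int (e i) * W ^ i)"
  proof -
    have "of_int (e i * r ^ i * s ^ (a - i)) = of_int s ^ a * (of_int (e i) * W ^ i)" if "i \<le> a" for i
    proof -
      have "(of_int s :: rat) ^ a = of_int s ^ i * of_int s ^ (a - i)" using that by (simp flip: power_add)
      moreover have "of_int s ^ i * W ^ i = of_int r ^ i" using W s0 by (simp flip: power_mult_distrib)
      ultimately show ?thesis by (simp add: algebra_simps)
    qed
    then show ?thesis unfolding of_int_sum sum_distrib_left by (intro sum.cong refl) simp
  qed
  then have "(\<Sum>i\<le>a. e i * r ^ i * s ^ (a - i)) = 0" using sumW by (simp only: mult_zero_right of_int_eq_0_iff)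
  then have "s dvd r" by (rule homogeneous_monic_dvd) (simp add: e_def)
  then obtain w where w: "r = s * w" by blast
  then have Ww: "W = of_int w" using W s0 by simp
  define S where "S = (\<Sum>i<a. real_of_int \<bar>e i\<bar>)"
  have e_bound: "real_of_int \<bar>e i\<bar> \<le> (real D + 1) * H * B ^ (D * a)" if i: "i < a" for i
  proof -
    have "real_of_int \<bar>e i\<bar> \<le> (\<Sum>j\<le>D. \<bar>real_of_int (g i j * u ^ j * v ^ (D * (a - i) - j))\<bar>)"
      using i by (simp add: e_def sum_abs del: of_int_mult of_int_power)
    also have "\<dots> \<le> (\<Sum>j\<le>D. H * B ^ (D * a))"
    proof (intro sum_mono)
      fix j assume "j \<in> {..D}"
      then have j: "j \<le> D" by simp
      have "D * 1 \<le> D * (a - i)" using i by (intro mult_le_mono2) auto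
      then have "j + (D * (a - i) - j) = D * (a - i)" using j by linarith
      then have le: "j + (D * (a - i) - j) \<le> D * a" by simp
      have "\<bar>real_of_int u\<bar> ^ j * \<bar>real_of_int v\<bar> ^ (D * (a - i) - j) \<le> B ^ j * B ^ (D * (a - i) - j)"
        using uv HB by (intro mult_mono power_mono) auto
      also have "\<dots> = B ^ (j + (D * (a - i) - j))" by (simp only: power_add)
      also have "\<dots> \<le> B ^ (D * a)" using HB le by (intro power_increasing) auto
      finally have "\<bar>real_of_int (g i j)\<bar> * (\<bar>real_of_int u\<bar> ^ j * \<bar>real_of_int v\<bar> ^ (D * (a - i) - j)) \<le> H * B ^ (D * a)"
        using gH[of i j] HB by (intro mult_mono) auto
      then show "\<bar>real_of_int (g i j * u ^ j * v ^ (D * (a - i) - j))\<bar> \<le> H * B ^ (D * a)"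
        by (simp add: abs_mult power_abs mult.assoc)
    qed
    also have "\<dots> = (real D + 1) * H * B ^ (D * a)" by simp
    finally show ?thesis .
  qed
  have "S \<le> (\<Sum>i<a. (real D + 1) * H * B ^ (D * a))" unfolding S_def by (intro sum_mono e_bound) auto
  then have S: "S \<le> real a * (real D + 1) * H * B ^ (D * a)" by (simp add: mult.assoc)
  have K1: "1 \<le> real a * (real D + 1) * H * B ^ (D * a)"
  proof -
    have "1 * 1 * 1 * 1 \<le> real a * (real D + 1) * H * B ^ (D * a)"
      using a HB by (intro mult_mono one_le_power) auto
    then show ?thesis by simp
  qed
  have "\<bar>real_of_int w\<bar> \<le> real a * (real D + 1) * H * B ^ (D * a)"
  proof (cases "w = 0")
    case True
    then show ?thesis using K1 by simp
  next
    case False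
    then have w1: "\<bar>real_of_int w\<bar> \<ge> 1" by linarith
    have "of_int (\<Sum>i\<le>a. e i * w ^ i) = (0 :: rat)" using sumW by (simp add: Ww)
    then have "(\<Sum>i\<le>a. e i * w ^ i) = 0" by (simp only: of_int_eq_0_iff)
    then have "(\<Sum>i<a. e i * w ^ i) + w ^ a = 0" by (simp add: lessThan_Suc_atMost[symmetric] e_def)
    then have "\<bar>w\<bar> ^ a = \<bar>\<Sum>i<a. e i * w ^ i\<bar>" by (simp add: power_abs[symmetric] eq_neg_iff_add_eq_0 abs_eq_iff add.commute)
    also have "\<dots> \<le> (\<Sum>i<a. \<bar>e i * w ^ i\<bar>)" by (rule sum_abs)
    also have "\<dots> \<le> (\<Sum>i<a. \<bar>e i\<bar> * \<bar>w\<bar> ^ (a - 1))"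
      using False by (intro sum_mono) (auto simp: abs_mult power_abs intro!: mult_left_mono power_increasing)
    also have "\<dots> = (\<Sum>i<a. \<bar>e i\<bar>) * \<bar>w\<bar> ^ (a - 1)" by (simp add: sum_distrib_right)
    also have "\<bar>w\<bar> ^ a = \<bar>w\<bar> * \<bar>w\<bar> ^ (a - 1)" using a by (cases a) auto
    finally have "\<bar>w\<bar> \<le> (\<Sum>i<a. \<bar>e i\<bar>)" using False by simp
    then have "real_of_int \<bar>w\<bar> \<le> real_of_int (\<Sum>i<a. \<bar>e i\<bar>)" by (rule of_int_le_iff[THEN iffD2])
    then have "\<bar>real_of_int w\<bar> \<le> S" by (simp add: S_def)
    with S show ?thesis by linarith
  qed
  moreover have "z = of_int w / of_int v ^ D" using Ww v0 by (simp add: W_def field_simps)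
  ultimately show ?thesis using uv by blast
qed

text \<open>The auxiliary form comes from the k-th derivative, of which the points are simple zeros;
  the alternative between few points and a section is applied to \<open>g\<close>, of which they are
  zeros as well.\<close>

lemma simple_class_points:
  fixes p y0 z0 :: int and B K :: real and a D E k :: nat and g :: "nat \<Rightarrow> nat \<Rightarrow> int"
  assumes monic: "\<And>j. g a j = (if j = 0 then 1 else 0)" and zero: "\<And>i j. i > a \<Longrightarrow> g i j = 0"
    and p: "prime p" and cls: "(y0, z0) \<in> simple_classes a D ((deriv_coeffs ^^ k) g) p"
    and size: "real (E + 1) * B ^ E * (B ^ D + K) < real_of_int p ^ E" and B: "B \<ge> 0" "K \<ge> 0"
  defines "T \<equiv> {y. \<exists>u v w z. \<not> p dvd v \<and> \<bar>real_of_int u\<bar> \<le> B \<and> \<bar>real_of_int v\<bar> \<le> B \<and> \<bar>real_of_int w\<bar> \<le> K \<and>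
       y = of_int u / of_int v \<and> z = of_int w / of_int v ^ D \<and>
       y - of_int y0 \<in> loc_ideal p 1 \<and> z - of_int z0 \<in> loc_ideal p 1 \<and> biv_eval a D ((deriv_coeffs ^^ k) g) z y = 0 \<and> biv_eval a D g z y = 0 \<and>
       (\<forall>\<sigma>. degree \<sigma> \<le> D \<and> biv_eval a D g \<sigma> [:0, 1:] = 0 \<longrightarrow> poly \<sigma> y \<noteq> z)}"
  shows "finite T \<and> card T \<le> E + a * E + D"
proof -
  have g0: "(deriv_coeffs ^^ k) g (Suc a) j = 0" for j
  proof -
    have "(deriv_coeffs ^^ k) g i j = 0" if "i > a" for i using that
      by (induction k arbitrary: i) (auto simp: zero deriv_coeffs_def)
    then show ?thesis by simp
  qed
  have simple: "\<not> p dvd biv_eval a D (deriv_coeffs ((deriv_coeffs ^^ k) g)) z0 y0" using cls by (auto simp: simple_classes_def)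
  obtain A0 A1 :: "int poly" where A: "A0 \<noteq> 0 \<or> A1 \<noteq> 0" "degree A0 \<le> E" "degree A1 \<le> E"
    and van: "\<And>u v w y z. \<not> p dvd v \<and> \<bar>real_of_int u\<bar> \<le> B \<and> \<bar>real_of_int v\<bar> \<le> B \<and> \<bar>real_of_int w\<bar> \<le> K \<and>
       y = of_int u / of_int v \<and> z = of_int w / of_int v ^ D \<and>
       y - of_int y0 \<in> loc_ideal p 1 \<and> z - of_int z0 \<in> loc_ideal p 1 \<and> biv_eval a D ((deriv_coeffs ^^ k) g) z y = 0
       \<Longrightarrow> int_poly_eval A0 y + z * int_poly_eval A1 y = 0"
    using class_auxiliary_form[of p "(deriv_coeffs ^^ k) g" a D z0 y0 E B K, OF p g0 simple size B] by blast
  let ?T = "{y. \<exists>z. biv_eval a D g z y = 0 \<and> int_poly_eval A0 y + z * int_poly_eval A1 y = 0 \<and>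
     (\<forall>\<sigma>. degree \<sigma> \<le> D \<and> biv_eval a D g \<sigma> [:0, 1:] = 0 \<longrightarrow> poly \<sigma> y \<noteq> z)}"
  have T: "finite ?T \<and> card ?T \<le> E + a * E + D"
    by (rule linear_form_points[of g a, OF monic A])
  have sub: "T \<subseteq> ?T"
  proof
    fix y assume "y \<in> T"
    then obtain u v w z where h: "\<not> p dvd v" "\<bar>real_of_int u\<bar> \<le> B" "\<bar>real_of_int v\<bar> \<le> B" "\<bar>real_of_int w\<bar> \<le> K"
       "y = of_int u / of_int v" "z = of_int w / of_int v ^ D"
       "y - of_int y0 \<in> loc_ideal p 1" "z - of_int z0 \<in> loc_ideal p 1" "biv_eval a D ((deriv_coeffs ^^ k) g) z y = 0" "biv_eval a D g z y = 0"
       "\<forall>\<sigma>. degree \<sigma> \<le> D \<and> biv_eval a D g \<sigma> [:0, 1:] = 0 \<longrightarrow> poly \<sigma> y \<noteq> z"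
      unfolding T_def by blast
    have "int_poly_eval A0 y + z * int_poly_eval A1 y = 0" by (rule van[of v u w]) (use h(1-9) in blast)
    with h(10,11) show "y \<in> ?T" by blast
  qed
  show ?thesis using T finite_subset[OF sub] card_mono[OF _ sub] by linarith
qed

text \<open>The points are distributed over \<open>a\<close> derivatives, O(\<Lambda>) primes, at
  most \<open>a * p\<close> classes with p = O(B \<Lambda>^2), and each class holds O(\<Lambda>) of
  them.\<close>

theorem count_nonsection_roots:
  fixes a D :: nat
  assumes a: "a \<ge> 1"
  shows "\<exists>C>0. \<forall>g H B. H \<ge> 3 \<and> B \<ge> 1 \<and> (\<forall>j. g a j = (if j = 0 then 1 else 0)) \<and> (\<forall>i>a. \<forall>j. g i j = 0) \<and>
     (\<forall>i j. \<bar>real_of_int (g i j)\<bar> \<le> H) \<longrightarrow>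
     real (card {y. real_of_int (rat_height y) \<le> B \<and> (\<exists>z. biv_eval a D g z y = 0 \<and>
       (\<forall>\<sigma>. degree \<sigma> \<le> D \<and> biv_eval a D g \<sigma> [:0, 1:] = 0 \<longrightarrow> poly \<sigma> y \<noteq> z))}) \<le> C * B * (ln H + ln B) ^ 5"
proof -
  \<comment> \<open>\<open>b1\<close> is the constant in the bound for the numerator
    \<open>w\<close>, and \<open>b2\<close> the one in the bound for the integer \<open>J\<close>
    attached to a derivative. Below, \<open>c1 * \<Lambda>\<close> and \<open>c2 * \<Lambda>\<close>
    dominate the logarithms of \<open>2 * K\<close> and of \<open>J\<close>.\<close>
  define b1 where "b1 = real a * (real D + 1)"
  define b2 where "b2 = real (a + 1) * real (D + 1) * real a ^ a * b1 ^ a"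
  have b1: "b1 \<ge> 1" using a mult_mono[of 1 "real a" 1 "real D + 1"] by (simp add: b1_def)
  have b2: "b2 \<ge> 1"
  proof -
    have "1 * 1 * 1 * 1 \<le> b2" unfolding b2_def using a b1 by (intro mult_mono one_le_power) auto
    then show ?thesis by simp
  qed
  define c1 where "c1 = ln (2 * b1) + 1 + real (D * a)"
  define c2 where "c2 = ln b2 + 1 + real a + real (D * a * a + D + D * a)"
  have c1: "c1 \<ge> 1" and c2: "c2 \<ge> 1" using b1 b2 by (simp_all add: c1_def c2_def)
  obtain c where c: "c \<ge> 1" and primes: "\<And>B \<Lambda>. B \<ge> 1 \<Longrightarrow> \<Lambda> \<ge> 1 \<Longrightarrow> ln B \<le> \<Lambda> \<Longrightarrow>
    (\<exists>P::nat set. finite P \<and> real (card P) \<ge> 2 * c2 * \<Lambda> \<and> real (card P) \<le> 2 * c2 * \<Lambda> + 1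
        \<and> (\<forall>p\<in>P. prime p \<and> 4 * B \<le> real p \<and> real p \<le> c * B * \<Lambda>\<^sup>2))"
    using exists_many_primes[of "2 * c2"] c2 by auto
  define C where "C = real a * (2 * c2 + 1) * (c * real a * ((2 * c1 + 1) * (1 + real a) + real D))"
  have "C > 0" unfolding C_def using a c c1 c2 by (intro mult_pos_pos add_pos_nonneg) auto
  moreover have "real (card {y. real_of_int (rat_height y) \<le> B \<and> (\<exists>z. biv_eval a D g z y = 0 \<and>
       (\<forall>\<sigma>. degree \<sigma> \<le> D \<and> biv_eval a D g \<sigma> [:0, 1:] = 0 \<longrightarrow> poly \<sigma> y \<noteq> z))}) \<le> C * B * (ln H + ln B) ^ 5"
    (is "real (card ?Y) \<le> _")
    if H: "H \<ge> 3" and B: "B \<ge> 1" and monic: "\<And>j. g a j = (if j = 0 then 1 else 0)"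
      and zero: "\<And>i j. i > a \<Longrightarrow> g i j = 0" and gH: "\<And>i j. \<bar>real_of_int (g i j)\<bar> \<le> H"
    for g :: "nat \<Rightarrow> nat \<Rightarrow> int" and H B :: real
  proof -
    define \<Lambda> where "\<Lambda> = ln H + ln B"
    have lnH: "ln H \<ge> 1" using H exp_le by (subst ln_ge_iff) auto
    have lnB: "ln B \<ge> 0" using B by simp
    have L: "\<Lambda> \<ge> 1" "ln B \<le> \<Lambda>" using lnH lnB by (auto simp: \<Lambda>_def)
    have ln_le: "ln (x * H ^ r * B ^ s) \<le> (ln x + real r + real s) * \<Lambda>" if "x \<ge> 1" for x r s
    proof -
      have "ln (x * H ^ r * B ^ s) = ln x + real r * ln H + real s * ln B"
        using that H B by (simp add: ln_mult ln_realpow)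
      also have "\<dots> \<le> ln x * \<Lambda> + real r * \<Lambda> + real s * \<Lambda>"
        using that L lnH lnB by (intro add_mono mult_left_mono) (auto simp: mult_le_cancel_left1 \<Lambda>_def)
      finally show ?thesis by (simp add: algebra_simps)
    qed
    define K where "K = b1 * H * B ^ (D * a)"
    have K: "K \<ge> 1" "B ^ D \<le> K"
    proof -
      have "1 * 1 * B ^ D \<le> K" unfolding K_def using b1 H B a by (intro mult_mono power_increasing) auto
      then show "B ^ D \<le> K" by simp
      moreover have "B ^ D \<ge> 1" using B by (intro one_le_power)
      ultimately show "K \<ge> 1" by linarith
    qed
    \<comment> \<open>The factor 2 compensates for \<open>ln 2 >= 2 / 3\<close>: as 4 / 3 exceeds 1,
      \<open>2 * K < 2 ^ E\<close> follows.\<close>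
    define E where "E = nat \<lceil>2 * c1 * \<Lambda>\<rceil>"
    have E: "real E \<ge> 2 * c1 * \<Lambda>" unfolding E_def by (rule real_nat_ceiling_ge)
    have cL: "c1 * \<Lambda> \<ge> 1" using mult_mono[of 1 c1 1 \<Lambda>] c1 L by simp
    have "real (nat \<lceil>x\<rceil>) \<le> x + 1" if "x \<ge> 0" for x :: real using that by linarith
    from this[of "2 * c1 * \<Lambda>"] cL have E': "real E \<le> 2 * c1 * \<Lambda> + 1" unfolding E_def by simp
    have two: "2 * K < 2 ^ E"
    proof -
      have "ln (2 * K) \<le> c1 * \<Lambda>" using ln_le[of "2 * b1" 1 "D * a"] b1 by (simp add: K_def c1_def mult.assoc)
      also have "(2 * c1 * \<Lambda>) * (2 / 3) = 4 / 3 * (c1 * \<Lambda>)" by simp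
      then have "c1 * \<Lambda> < (2 * c1 * \<Lambda>) * (2 / 3)" using cL by linarith
      also have "\<dots> \<le> real E * ln 2" using E ln2_ge_two_thirds cL by (intro mult_mono) auto
      also have "\<dots> = ln (2 ^ E)" by (simp add: ln_realpow)
      finally show ?thesis using K by (subst (asm) ln_less_cancel_iff) auto
    qed
    \<comment> \<open>The 4 in \<open>4 * B\<close> is spent as 2 times 2: one \<open>2 ^ E\<close>
      absorbs \<open>E + 1\<close>, the other absorbs \<open>2 * K\<close>.\<close>
    have size: "real (E + 1) * B ^ E * (B ^ D + K) < real_of_int p ^ E" if p: "4 * B \<le> real_of_int p" for p
    proof -
      have "E < 2 ^ E" by (rule less_exp)
      then have "E + 1 \<le> 2 ^ E" by linarith
      then have "real (E + 1) \<le> real (2 ^ E)" by (rule of_nat_mono)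
      then have "real (E + 1) * (B ^ D + K) \<le> 2 ^ E * (2 * K)" using K B by (intro mult_mono) auto
      also have "\<dots> < 2 ^ E * 2 ^ E" using two by simp
      finally have "real (E + 1) * (B ^ D + K) * B ^ E < 2 ^ E * 2 ^ E * B ^ E"
        using B by (intro mult_strict_right_mono) auto
      also have "\<dots> = (4 * B) ^ E" by (simp only: power_mult_distrib[symmetric]) simp
      also have "\<dots> \<le> real_of_int p ^ E" using p B by (intro power_mono) auto
      finally show ?thesis by (simp add: mult_ac)
    qed
    obtain P :: "nat set" where P: "finite P" "real (card P) \<ge> 2 * c2 * \<Lambda>" "real (card P) \<le> 2 * c2 * \<Lambda> + 1"
        "\<And>p. p \<in> P \<Longrightarrow> prime p" "\<And>p. p \<in> P \<Longrightarrow> 4 * B \<le> real p" "\<And>p. p \<in> P \<Longrightarrow> real p \<le> c * B * \<Lambda>\<^sup>2"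
      using primes[OF B L] by blast
    define T where "T = (\<lambda>k (p::nat) (y0, z0). {y. \<exists>u v w z. \<not> int p dvd v \<and> \<bar>real_of_int u\<bar> \<le> B \<and> \<bar>real_of_int v\<bar> \<le> B \<and> \<bar>real_of_int w\<bar> \<le> K \<and>
       y = of_int u / of_int v \<and> z = of_int w / of_int v ^ D \<and>
       y - of_int y0 \<in> loc_ideal (int p) 1 \<and> z - of_int z0 \<in> loc_ideal (int p) 1 \<and> biv_eval a D ((deriv_coeffs ^^ k) g) z y = 0 \<and> biv_eval a D g z y = 0 \<and>
       (\<forall>\<sigma>. degree \<sigma> \<le> D \<and> biv_eval a D g \<sigma> [:0, 1:] = 0 \<longrightarrow> poly \<sigma> y \<noteq> z)})"
    have T: "finite (T k p x) \<and> card (T k p x) \<le> E + a * E + D"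
      if "p \<in> P" "x \<in> simple_classes a D ((deriv_coeffs ^^ k) g) (int p)" for k p x
    proof -
      obtain y0 z0 where x: "x = (y0, z0)" by (cases x)
      have pp: "prime (int p)" "4 * B \<le> real_of_int (int p)" using P that by auto
      show ?thesis unfolding T_def x prod.case
        by (rule simple_class_points[of g a "int p" y0 z0 D k E B K, OF monic zero pp(1) _ size[OF pp(2)]])
          (use B K that x in auto)
    qed
    define U where "U = (\<lambda>k p. \<Union>x\<in>simple_classes a D ((deriv_coeffs ^^ k) g) (int p). T k p x)"
    have dz0: "(deriv_coeffs ^^ k) g i j = 0" if "i > a" for k i j using that
      by (induction k arbitrary: i) (auto simp: zero deriv_coeffs_def)
    have U: "finite (U k p) \<and> real (card (U k p)) \<le> c * B * \<Lambda>\<^sup>2 * real a * real (E + a * E + D)" if p: "p \<in> P" for k p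
    proof -
      let ?S = "simple_classes a D ((deriv_coeffs ^^ k) g) (int p)"
      have S: "finite ?S" "card ?S \<le> p * a"
        using card_simple_classes[of "int p" "(deriv_coeffs ^^ k) g" a D] P(4)[OF p] dz0[of "Suc a" k] by auto
      have "card (U k p) \<le> (\<Sum>x\<in>?S. card (T k p x))" unfolding U_def by (rule card_UN_le[OF S(1)])
      also have "\<dots> \<le> (\<Sum>x\<in>?S. E + a * E + D)" using T[OF p] by (intro sum_mono) blast
      also have "\<dots> \<le> p * a * (E + a * E + D)" using S(2) by simp
      finally have "real (card (U k p)) \<le> real p * real a * real (E + a * E + D)"
        by (metis of_nat_le_iff of_nat_mult)
      also have "\<dots> \<le> c * B * \<Lambda>\<^sup>2 * real a * real (E + a * E + D)"
        using P(6)[OF p] by (intro mult_right_mono) auto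
      finally show ?thesis using S(1) T[OF p] by (auto simp: U_def)
    qed
    have sub: "?Y \<subseteq> (\<Union>k\<in>{..<a}. \<Union>p\<in>P. U k p)"
    proof
      fix y assume "y \<in> ?Y"
      then obtain z where ht: "real_of_int (rat_height y) \<le> B" and root: "biv_eval a D g z y = 0"
        and ns: "\<forall>\<sigma>. degree \<sigma> \<le> D \<and> biv_eval a D g \<sigma> [:0, 1:] = 0 \<longrightarrow> poly \<sigma> y \<noteq> z" by blast
      obtain u v w where uvw: "v > 0" "\<bar>real_of_int u\<bar> \<le> B" "\<bar>real_of_int v\<bar> \<le> B" "\<bar>real_of_int w\<bar> \<le> K"
          "y = of_int u / of_int v" "z = of_int w / of_int v ^ D"
        using root_point_data[of g a H B D z y, OF monic gH _ B a root ht] H unfolding K_def b1_def by auto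
      obtain k where k: "k < a" "biv_eval a D ((deriv_coeffs ^^ k) g) z y = 0" "biv_eval a D ((deriv_coeffs ^^ Suc k) g) z y \<noteq> 0"
        using exists_simple_derivative[of g a D z y, OF monic zero root] by blast
      \<comment> \<open>\<open>G\<close> is the derivative that has to stay nonzero modulo the prime
        to be chosen, and \<open>J\<close> its value at the point with denominators cleared.\<close>
      define G where "G = (deriv_coeffs ^^ Suc k) g"
      define J where "J = (\<Sum>i\<le>a. \<Sum>j\<le>D. G i j * w ^ i * u ^ j * v ^ ((D - j) + D * (a - i)))"
      have J: "of_int J = of_int v ^ (D + D * a) * biv_eval a D G z y"
        unfolding J_def by (rule biv_eval_clear_denominators) (use uvw in auto)
      then have "of_int J \<noteq> (0 :: rat)" using k(3) uvw(1) by (simp add: G_def)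
      then have J0: "J \<noteq> 0" by simp
      have Gb: "\<bar>real_of_int (G i j)\<bar> \<le> real a ^ a * H" for i j
      proof -
        have "\<bar>real_of_int (G i j)\<bar> \<le> real a ^ Suc k * H"
          unfolding G_def using funpow_dz_bound[of g H a "Suc k" i j, OF gH zero] H by simp
        also have "\<dots> \<le> real a ^ a * H" using a k(1) H by (intro mult_right_mono power_increasing) auto
        finally show ?thesis .
      qed
      \<comment> \<open>If all of \<open>P\<close> divided \<open>J\<close>, then |J| would be at
        least 2^(2 c2 \<Lambda>), which exceeds the upper bound e^(c2 \<Lambda>).\<close>
      have "\<exists>p\<in>P. \<not> int p dvd J"
      proof (rule ccontr)
        assume "\<not> ?thesis"
        then have "2 ^ card P \<le> \<bar>J\<bar>" using P(1,4) J0 by (intro prime_set_dvd_bound) auto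
        then have "real_of_int (2 ^ card P) \<le> real_of_int \<bar>J\<bar>" by (rule of_int_le_iff[THEN iffD2])
        then have "2 ^ card P \<le> \<bar>real_of_int J\<bar>" by simp
        also have "\<dots> \<le> real (a + 1) * real (D + 1) * (real a ^ a * H) * K ^ a * B ^ (D + D * a)"
          unfolding J_def using Gb uvw B K H by (intro biv_eval_clear_denominators_bound) auto
        also have "\<dots> = b2 * H ^ Suc a * B ^ (D * a * a + D + D * a)"
          unfolding b2_def K_def by (simp add: power_mult_distrib power_add power_mult algebra_simps)
        finally have "ln (2 ^ card P) \<le> ln (b2 * H ^ Suc a * B ^ (D * a * a + D + D * a))"
          by (subst ln_le_cancel_iff) (use b2 H B in auto)
        also have "\<dots> \<le> (ln b2 + real (Suc a) + real (D * a * a + D + D * a)) * \<Lambda>" by (rule ln_le[OF b2])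
        also have "\<dots> = c2 * \<Lambda>" by (simp add: c2_def algebra_simps)
        finally have "real (card P) * ln 2 \<le> c2 * \<Lambda>" by (simp add: ln_realpow)
        moreover have "(2 * c2 * \<Lambda>) * (2 / 3) \<le> real (card P) * ln 2"
          using P(2) ln2_ge_two_thirds c2 L by (intro mult_mono) auto
        moreover have "c2 * \<Lambda> > 0" using c2 L by simp
        ultimately show False by linarith
      qed
      then obtain p where p: "p \<in> P" "\<not> int p dvd J" by blast
      have pp: "prime (int p)" using P(4)[OF p(1)] by simp
      \<comment> \<open>The prime exceeds the denominator, so the point can be reduced modulo
        it.\<close>
      have "real_of_int v < real p" using uvw(1,3) P(5)[OF p(1)] B by linarith
      then have pv: "\<not> int p dvd v" using uvw(1) zdvd_not_zless[of v "int p"] by linarith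
      then have pvD: "\<not> int p dvd v ^ D" using prime_dvd_power[OF pp] by blast
      have y0: "y \<in> loc_ideal (int p) 0" unfolding uvw(5) by (rule loc_ideal_quotient[OF pp pv])
      have z0: "z \<in> loc_ideal (int p) 0" unfolding uvw(6) using loc_ideal_quotient[OF pp pvD, of w] by simp
      obtain r where r: "r \<in> {0..<int p}" "y - of_int r \<in> loc_ideal (int p) 1" using loc_ideal_residue[OF pp y0] by blast
      obtain t where t: "t \<in> {0..<int p}" "z - of_int t \<in> loc_ideal (int p) 1" using loc_ideal_residue[OF pp z0] by blast
      have diff: "biv_eval a D f z y - of_int (biv_eval a D f t r) \<in> loc_ideal (int p) 1" for f
        using loc_ideal_bev_diff[OF pp z0 y0 loc_ideal_of_int0[OF pp, of t] loc_ideal_of_int0[OF pp, of r] t(2) r(2)] by (simp add: biv_eval_of_int)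
      have "of_int (biv_eval a D ((deriv_coeffs ^^ k) g) t r) \<in> loc_ideal (int p) 1"
        using loc_ideal_uminus[OF pp diff[of "(deriv_coeffs ^^ k) g"]] k(2) by simp
      then have 1: "int p dvd biv_eval a D ((deriv_coeffs ^^ k) g) t r" using loc_ideal_of_int_iff[OF pp] by (metis power_one_right)
      have 2: "\<not> int p dvd biv_eval a D (deriv_coeffs ((deriv_coeffs ^^ k) g)) t r"
      proof
        assume "int p dvd biv_eval a D (deriv_coeffs ((deriv_coeffs ^^ k) g)) t r"
        then have "of_int (biv_eval a D G t r) \<in> loc_ideal (int p) 1" using loc_ideal_of_int_iff[OF pp, of _ 1] by (simp add: G_def)
        from loc_ideal_add[OF pp diff[of G] this] have "biv_eval a D G z y \<in> loc_ideal (int p) 1" by simp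
        then have "of_int (v ^ (D + D * a)) * biv_eval a D G z y \<in> loc_ideal (int p) 1"
          by (rule loc_ideal_mult0[OF pp loc_ideal_of_int0[OF pp]])
        then have "of_int J \<in> loc_ideal (int p) 1" unfolding J by simp
        then show False using loc_ideal_of_int_iff[OF pp, of J 1] p(2) by simp
      qed
      have cls: "(r, t) \<in> simple_classes a D ((deriv_coeffs ^^ k) g) (int p)"
        using r(1) t(1) 1 2 by (simp add: simple_classes_def)
      have "y \<in> T k p (r, t)" unfolding T_def prod.case mem_Collect_eq
        by (intro exI[of _ u] exI[of _ v] exI[of _ w] exI[of _ z] conjI) (fact pv uvw r(2) t(2) k(2) root ns)+
      then show "y \<in> (\<Union>k\<in>{..<a}. \<Union>p\<in>P. U k p)" unfolding U_def using k(1) p(1) cls by blast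
    qed
    have fin: "finite (\<Union>k\<in>{..<a}. \<Union>p\<in>P. U k p)" using P(1) U by auto
    define M where "M = c * B * \<Lambda>\<^sup>2 * real a * real (E + a * E + D)"
    have M0: "M \<ge> 0" using c B by (simp add: M_def)
    have "real (card ?Y) \<le> real (card (\<Union>k\<in>{..<a}. \<Union>p\<in>P. U k p))" using card_mono[OF fin sub] by simp
    also have "\<dots> \<le> real (\<Sum>k<a. card (\<Union>p\<in>P. U k p))" by (intro of_nat_mono card_UN_le) simp
    also have "\<dots> \<le> real (\<Sum>k<a. \<Sum>p\<in>P. card (U k p))" by (intro of_nat_mono sum_mono card_UN_le P(1))
    also have "\<dots> = (\<Sum>k<a. \<Sum>p\<in>P. real (card (U k p)))" by simp
    also have "\<dots> \<le> (\<Sum>k<a. \<Sum>p\<in>P. M)" using U by (intro sum_mono) (auto simp: M_def)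
    also have "\<dots> = real a * (real (card P) * M)" by simp
    also have "\<dots> \<le> real a * ((2 * c2 + 1) * \<Lambda> * (c * B * \<Lambda>\<^sup>2 * real a * (((2 * c1 + 1) * (1 + real a) + real D) * \<Lambda>)))"
    proof (intro mult_left_mono mult_mono M0)
      show "real (card P) \<le> (2 * c2 + 1) * \<Lambda>" using P(3) L by (simp add: algebra_simps)
      have "real E * (1 + real a) + real D * 1 \<le> ((2 * c1 + 1) * \<Lambda>) * (1 + real a) + real D * \<Lambda>"
        using E' L by (intro add_mono mult_right_mono mult_left_mono) (auto simp: algebra_simps)
      then have "real (E + a * E + D) \<le> ((2 * c1 + 1) * (1 + real a) + real D) * \<Lambda>" by (simp add: algebra_simps)
      then show "M \<le> c * B * \<Lambda>\<^sup>2 * real a * (((2 * c1 + 1) * (1 + real a) + real D) * \<Lambda>)"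
        unfolding M_def using c B by (intro mult_left_mono) auto
    qed (use c2 L in auto)
    also have "\<dots> = C * B * \<Lambda> ^ 4" by (simp add: C_def algebra_simps power2_eq_square power4_eq_xxxx)
    also have "\<dots> \<le> C * B * \<Lambda> ^ 5" using \<open>C > 0\<close> B L by (intro mult_left_mono power_increasing) auto
    finally show ?thesis by (simp add: \<Lambda>_def)
  qed
  ultimately show ?thesis by blast
qed

subsection \<open>Polynomial functions and boxes of rational points\<close>

text \<open>\<open>S\<close> is the set of admissible coefficients, \<open>m\<close> the number of variables, and \<open>D\<close> bounds the degree in each variable separately.\<close>
primrec mpolyfun :: "rat set \<Rightarrow> nat \<Rightarrow> nat \<Rightarrow> ((nat \<Rightarrow> rat) \<Rightarrow> rat) \<Rightarrow> bool" where
  "mpolyfun S D 0 F \<longleftrightarrow> (\<exists>c\<in>S. F = (\<lambda>_. c))"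
| "mpolyfun S D (Suc m) F \<longleftrightarrow> (\<exists>G. (\<forall>j\<le>D. mpolyfun S D m (G j)) \<and> F = (\<lambda>y. \<Sum>j\<le>D. G j y * y m ^ j))"

text \<open>Integers are taken inside the rationals, so that one predicate \<open>mpolyfun\<close>
  covers integral coefficients of bounded size and, with \<open>S = UNIV\<close>, arbitrary rational
  ones.\<close>

definition bdd_ints :: "real \<Rightarrow> rat set" where
  "bdd_ints H = {of_int k | k. \<bar>real_of_int k\<bar> \<le> H}"

lemma mpolyfun_map:
  assumes "mpolyfun S D m F" "\<And>s. s \<in> S \<Longrightarrow> k * s \<in> S'"
  shows "mpolyfun S' D m (\<lambda>y. k * F y)"
  using assms(1)
proof (induction m arbitrary: F)
  case 0
  then show ?case using assms(2) by auto
next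
  case (Suc m)
  then obtain G where G: "\<forall>j\<le>D. mpolyfun S D m (G j)" "F = (\<lambda>y. \<Sum>j\<le>D. G j y * y m ^ j)" by auto
  have "\<forall>j\<le>D. mpolyfun S' D m (\<lambda>y. k * G j y)" using Suc.IH G(1) by blast
  moreover have "(\<lambda>y. k * F y) = (\<lambda>y. \<Sum>j\<le>D. (k * G j y) * y m ^ j)"
    by (simp add: G(2) sum_distrib_left mult.assoc)
  ultimately show ?case unfolding mpolyfun.simps by (intro exI[of _ "\<lambda>j y. k * G j y"]) simp
qed

lemma mpolyfun_add:
  assumes "mpolyfun S D m F" "mpolyfun S' D m F'" "\<And>s s'. s \<in> S \<Longrightarrow> s' \<in> S' \<Longrightarrow> s + s' \<in> S''"
  shows "mpolyfun S'' D m (\<lambda>y. F y + F' y)"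
  using assms(1,2)
proof (induction m arbitrary: F F')
  case 0
  then show ?case using assms(3) by auto
next
  case (Suc m)
  then obtain G where G: "\<forall>j\<le>D. mpolyfun S D m (G j)" "F = (\<lambda>y. \<Sum>j\<le>D. G j y * y m ^ j)" by auto
  from Suc obtain G' where G': "\<forall>j\<le>D. mpolyfun S' D m (G' j)" "F' = (\<lambda>y. \<Sum>j\<le>D. G' j y * y m ^ j)" by auto
  have "\<forall>j\<le>D. mpolyfun S'' D m (\<lambda>y. G j y + G' j y)" using Suc.IH G(1) G'(1) by blast
  moreover have "(\<lambda>y. F y + F' y) = (\<lambda>y. \<Sum>j\<le>D. (G j y + G' j y) * y m ^ j)"
    by (simp add: G(2) G'(2) sum.distrib algebra_simps)
  ultimately show ?case unfolding mpolyfun.simps by (intro exI[of _ "\<lambda>j y. G j y + G' j y"]) simp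
qed

lemma mpolyfun_const0: "0 \<in> S \<Longrightarrow> mpolyfun S D m (\<lambda>_. 0)"
proof (induction m)
  case (Suc m)
  then show ?case unfolding mpolyfun.simps by (intro exI[of _ "\<lambda>_ _. 0"]) auto
qed auto

lemma mpolyfun_subset: "mpolyfun S D m F \<Longrightarrow> S \<subseteq> S' \<Longrightarrow> mpolyfun S' D m F"
  using mpolyfun_map[of S D m F 1 S'] by auto

lemma mpolyfun_cong: "mpolyfun S D m F \<Longrightarrow> (\<And>i. i < m \<Longrightarrow> y i = y' i) \<Longrightarrow> F y = F y'"
proof (induction m arbitrary: F)
  case (Suc m)
  then obtain G where G: "\<forall>j\<le>D. mpolyfun S D m (G j)" "F = (\<lambda>y. \<Sum>j\<le>D. G j y * y m ^ j)" by auto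
  have "G j y = G j y'" if "j \<le> D" for j using Suc G(1) that by auto
  then show ?case using Suc.prems(2)[of m] by (simp add: G(2))
qed auto

lemma mpolyfun_sum_UNIV:
  "finite J \<Longrightarrow> (\<And>j. j \<in> J \<Longrightarrow> mpolyfun UNIV D m (G j)) \<Longrightarrow> mpolyfun UNIV D m (\<lambda>y. \<Sum>j\<in>J. k j * G j y)"
proof (induction J rule: finite_induct)
  case empty
  then show ?case by (simp add: mpolyfun_const0)
next
  case (insert x J)
  have "mpolyfun UNIV D m (\<lambda>y. k x * G x y + (\<Sum>j\<in>J. k j * G j y))"
    by (rule mpolyfun_add[where S = UNIV and S' = UNIV]) (use insert in \<open>auto intro: mpolyfun_map[where S = UNIV]\<close>)
  then show ?case using insert by simp
qed

lemma bdd_ints_add: "s \<in> bdd_ints H \<Longrightarrow> s' \<in> bdd_ints H' \<Longrightarrow> s + s' \<in> bdd_ints (H + H')"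
proof -
  assume "s \<in> bdd_ints H" "s' \<in> bdd_ints H'"
  then obtain k k' where "s = of_int k" "\<bar>real_of_int k\<bar> \<le> H" "s' = of_int k'" "\<bar>real_of_int k'\<bar> \<le> H'"
    by (auto simp: bdd_ints_def)
  moreover from this have "\<bar>real_of_int (k + k')\<bar> \<le> H + H'"
    unfolding of_int_add by (intro order_trans[OF abs_triangle_ineq] add_mono)
  ultimately show ?thesis unfolding bdd_ints_def by (intro CollectI exI[of _ "k + k'"]) simp
qed

lemma bdd_ints_mult: "s \<in> bdd_ints H \<Longrightarrow> \<bar>real_of_int k\<bar> \<le> K \<Longrightarrow> of_int k * s \<in> bdd_ints (K * H)"
proof -
  assume "s \<in> bdd_ints H" and K: "\<bar>real_of_int k\<bar> \<le> K"
  then obtain l where "s = of_int l" "\<bar>real_of_int l\<bar> \<le> H" by (auto simp: bdd_ints_def)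
  with K show ?thesis unfolding bdd_ints_def
    by (intro CollectI exI[of _ "k * l"]) (auto simp: abs_mult intro!: mult_mono)
qed

lemma bdd_ints_mono: "H \<le> H' \<Longrightarrow> bdd_ints H \<subseteq> bdd_ints H'"
  by (auto simp: bdd_ints_def)

lemma zero_in_bdd_ints: "H \<ge> 0 \<Longrightarrow> 0 \<in> bdd_ints H"
  unfolding bdd_ints_def by (intro CollectI exI[of _ 0]) auto

lemma mpolyfun_sum_bdd:
  assumes "finite J" "\<And>j. j \<in> J \<Longrightarrow> mpolyfun (bdd_ints H) D m (G j)" "\<And>j. j \<in> J \<Longrightarrow> \<bar>real_of_int (k j)\<bar> \<le> K" "H \<ge> 0" "K \<ge> 0"
  shows "mpolyfun (bdd_ints (real (card J) * (K * H))) D m (\<lambda>y. \<Sum>j\<in>J. of_int (k j) * G j y)"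
  using assms(1-3)
proof (induction J rule: finite_induct)
  case empty
  then show ?case by (simp add: mpolyfun_const0 zero_in_bdd_ints)
next
  case (insert x J)
  have "mpolyfun (bdd_ints (real (card (insert x J)) * (K * H))) D m (\<lambda>y. of_int (k x) * G x y + (\<Sum>j\<in>J. of_int (k j) * G j y))"
  proof (rule mpolyfun_add)
    show "mpolyfun (bdd_ints (K * H)) D m (\<lambda>y. of_int (k x) * G x y)"
      by (rule mpolyfun_map[where S = "bdd_ints H"]) (use insert in \<open>auto intro: bdd_ints_mult\<close>)
    show "mpolyfun (bdd_ints (real (card J) * (K * H))) D m (\<lambda>y. \<Sum>j\<in>J. of_int (k j) * G j y)"
      by (rule insert.IH) (use insert in auto)
    show "s + s' \<in> bdd_ints (real (card (insert x J)) * (K * H))"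
      if "s \<in> bdd_ints (K * H)" "s' \<in> bdd_ints (real (card J) * (K * H))" for s s'
      using bdd_ints_add[OF that] insert by (simp add: algebra_simps)
  qed
  then show ?case using insert by simp
qed

lemma mpolyfun_int_value:
  assumes "mpolyfun (bdd_ints H) D m F" "\<And>i. i < m \<Longrightarrow> y i = of_int (x i) \<and> \<bar>real_of_int (x i)\<bar> \<le> M" "M \<ge> 1" "H \<ge> 0"
  shows "F y \<in> bdd_ints (((real D + 1) * M ^ D) ^ m * H)"
  using assms(1,2)
proof (induction m arbitrary: F)
  case 0
  then show ?case by auto
next
  case (Suc m)
  then obtain G where G: "\<forall>j\<le>D. mpolyfun (bdd_ints H) D m (G j)" "F = (\<lambda>y. \<Sum>j\<le>D. G j y * y m ^ j)" by auto
  let ?Q = "((real D + 1) * M ^ D) ^ m * H"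
  have "of_int (x m ^ j) * G j y \<in> bdd_ints (M ^ D * ?Q)" if j: "j \<le> D" for j
  proof (rule bdd_ints_mult)
    show "G j y \<in> bdd_ints ?Q" using Suc G(1) j by auto
    have "\<bar>real_of_int (x m)\<bar> ^ j \<le> M ^ j" using Suc.prems(2)[of m] by (intro power_mono) auto
    also have "\<dots> \<le> M ^ D" using assms(3) j by (intro power_increasing) auto
    finally show "\<bar>real_of_int (x m ^ j)\<bar> \<le> M ^ D" by (simp add: power_abs)
  qed
  then have *: "G j y * y m ^ j \<in> bdd_ints (M ^ D * ?Q)" if "j \<le> D" for j
    using that Suc.prems(2)[of m] by (simp add: mult.commute)
  have "(\<Sum>j\<in>J. G j y * y m ^ j) \<in> bdd_ints (real (card J) * (M ^ D * ?Q))" if "J \<subseteq> {..D}" for J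
    using finite_subset[OF that finite_atMost] that
  proof (induction J rule: finite_induct)
    case empty
    then show ?case by (simp add: zero_in_bdd_ints)
  next
    case (insert j J)
    then have "G j y * y m ^ j + (\<Sum>j\<in>J. G j y * y m ^ j) \<in> bdd_ints (M ^ D * ?Q + real (card J) * (M ^ D * ?Q))"
      by (intro bdd_ints_add *) auto
    moreover have "M ^ D * ?Q + real (card J) * (M ^ D * ?Q) = real (card (insert j J)) * (M ^ D * ?Q)"
      using insert.hyps by (simp add: algebra_simps)
    ultimately show ?case using insert.hyps by simp
  qed
  from this[of "{..D}"] show ?case unfolding G(2) by (simp add: algebra_simps)
qed

section \<open>Interpolation on an integer grid\<close>

primrec grid :: "nat \<Rightarrow> nat \<Rightarrow> (nat \<Rightarrow> int) set" where
  "grid D 0 = {\<lambda>_. 0}"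
| "grid D (Suc m) = (\<lambda>(g, k). g(m := int k)) ` (grid D m \<times> {..D})"

lemma finite_grid: "finite (grid D m)"
  by (induction m) auto

lemma grid_range: "g \<in> grid D m \<Longrightarrow> (\<forall>i. \<bar>g i\<bar> \<le> int D) \<and> (\<forall>i\<ge>m. g i = 0)"
  by (induction m arbitrary: g) auto

lemma sum_grid_Suc: "(\<Sum>g\<in>grid D (Suc m). f g) = (\<Sum>g\<in>grid D m. \<Sum>k\<le>D. f (g(m := int k)))"
proof -
  have "inj_on (\<lambda>(g, k). g(m := int k)) (grid D m \<times> {..D})"
  proof (intro inj_onI)
    fix x x' assume h: "x \<in> grid D m \<times> {..D}" "x' \<in> grid D m \<times> {..D}"
      "(\<lambda>(g, k). g(m := int k)) x = (\<lambda>(g, k). g(m := int k)) x'"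
    obtain g k g' k' where x: "x = (g, k)" "x' = (g', k')" by (cases x, cases x')
    have e: "g(m := int k) = g'(m := int k')" using h x by simp
    have "g i = g' i" for i
    proof (cases "i = m")
      case True
      then show ?thesis using grid_range[of g D m] grid_range[of g' D m] h x by simp
    qed (use fun_cong[OF e, of i] in simp)
    moreover have "k = k'" using fun_cong[OF e, of m] by simp
    ultimately show "x = x'" using x by auto
  qed
  then have "(\<Sum>g\<in>grid D (Suc m). f g) = (\<Sum>(g, k)\<in>grid D m \<times> {..D}. f (g(m := int k)))"
    by (simp add: sum.reindex case_prod_unfold)
  then show ?thesis by (simp add: sum.cartesian_product)
qed

lemma Lagrange_basis:
  "\<exists>l :: nat \<Rightarrow> rat poly. (\<forall>k\<le>D. degree (l k) \<le> D) \<and>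
     (\<forall>p t. degree p \<le> D \<longrightarrow> poly p t = (\<Sum>k\<le>D. poly p (of_nat k) * poly (l k) t))"
proof -
  define l :: "nat \<Rightarrow> rat poly" where
    "l k = (\<Prod>j\<in>{..D} - {k}. smult (1 / (of_nat k - of_nat j)) [:- of_nat j, 1:])" for k
  have deg: "degree (l k) \<le> D" if "k \<le> D" for k
  proof -
    let ?f = "\<lambda>j. smult (1 / (of_nat k - of_nat j :: rat)) [:- of_nat j, 1:]"
    have "degree (l k) \<le> sum (degree \<circ> ?f) ({..D} - {k})" unfolding l_def by (rule degree_prod_sum_le) simp
    also have "\<dots> \<le> (\<Sum>j\<in>{..D} - {k}. 1)"
      unfolding o_def by (intro sum_mono order_trans[OF degree_smult_le]) simp
    also have "\<dots> = D" using that by simp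
    finally show ?thesis .
  qed
  have val: "poly (l k) (of_nat i) = (if i = k then 1 else 0)" if "i \<le> D" "k \<le> D" for i k
  proof (cases "i = k")
    case True
    have one: "poly (smult (1 / (of_nat k - of_nat j)) [:- of_nat j, 1:]) (of_nat k) = (1 :: rat)" if "j \<noteq> k" for j
    proof -
      have "poly [:- of_nat j, 1:] (of_nat k) = (of_nat k - of_nat j :: rat)" by simp
      then show ?thesis unfolding poly_smult using that by simp
    qed
    have "poly (l k) (of_nat k) = (\<Prod>j\<in>{..D} - {k}. 1)" unfolding l_def poly_prod
      by (intro prod.cong refl one) auto
    then show ?thesis using True by simp
  next
    case False
    then show ?thesis unfolding l_def poly_prod using that by (auto intro!: prod_zero)
  qed
  have "poly p t = (\<Sum>k\<le>D. poly p (of_nat k) * poly (l k) t)" if p: "degree p \<le> D" for p t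
  proof -
    define q where "q = p - (\<Sum>k\<le>D. smult (poly p (of_nat k)) (l k))"
    have "degree q \<le> D" unfolding q_def
      using p deg by (intro degree_diff_le degree_sum_le) (auto intro: order_trans[OF degree_smult_le])
    moreover have "poly q (of_nat i) = 0" if "i \<le> D" for i
    proof -
      have "(\<Sum>k\<le>D. poly p (of_nat k) * poly (l k) (of_nat i)) = (\<Sum>k\<le>D. if i = k then poly p (of_nat k) else 0)"
        using val that by (intro sum.cong) auto
      then show ?thesis using that by (simp add: q_def poly_sum)
    qed
    then have "(of_nat :: nat \<Rightarrow> rat) ` {..D} \<subseteq> {x. poly q x = 0}" by auto
    ultimately have "q = 0"
    proof -
      assume dq: "degree q \<le> D" and sub: "(of_nat :: nat \<Rightarrow> rat) ` {..D} \<subseteq> {x. poly q x = 0}"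
      show "q = 0"
      proof (rule ccontr)
        assume q: "q \<noteq> 0"
        have "card ((of_nat :: nat \<Rightarrow> rat) ` {..D}) \<le> card {x. poly q x = 0}"
          by (rule card_mono[OF poly_roots_finite[OF q] sub])
        also have "\<dots> \<le> D" using card_poly_roots_bound[OF q] dq by simp
        finally show False by (simp add: card_image inj_on_def)
      qed
    qed
    then have "poly q t = 0" by simp
    then show ?thesis by (simp add: q_def poly_sum)
  qed
  with deg show ?thesis by blast
qed

lemma poly_le_sum: "degree p \<le> D \<Longrightarrow> poly p t = (\<Sum>j\<le>D. coeff p j * t ^ j)" for p :: "'a::comm_ring_1 poly"
  unfolding poly_altdef by (intro sum.mono_neutral_left) (auto simp: coeff_eq_0)

lemma mpolyfun_times_poly:
  assumes "mpolyfun UNIV D m F" "degree p \<le> D"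
  shows "mpolyfun UNIV D (Suc m) (\<lambda>y. F y * poly p (y m))"
proof -
  have "mpolyfun UNIV D m (\<lambda>y. coeff p j * F y)" for j by (rule mpolyfun_map[OF assms(1)]) simp
  moreover have "F y * poly p (y m) = (\<Sum>j\<le>D. (coeff p j * F y) * y m ^ j)" for y
    unfolding poly_le_sum[OF assms(2)] by (simp add: sum_distrib_left algebra_simps)
  ultimately show ?thesis unfolding mpolyfun.simps by (intro exI[of _ "\<lambda>j y. coeff p j * F y"]) auto
qed

text \<open>Tensor product of one-variable Lagrange bases. The order of quantifiers matters:
  \<open>Lg\<close> does not depend on the function, so a section over \<open>t\<close> is rebuilt
  from its grid values by a formula uniform in \<open>t\<close>.\<close>

lemma grid_interpolation:
  "\<exists>Lg. (\<forall>g\<in>grid D m. mpolyfun UNIV D m (Lg g)) \<and>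
     (\<forall>F. mpolyfun UNIV D m F \<longrightarrow> (\<forall>y. F y = (\<Sum>g\<in>grid D m. F (\<lambda>i. of_int (g i)) * Lg g y)))"
proof (induction m)
  case 0
  show ?case by (intro exI[of _ "\<lambda>_ _. 1"]) auto
next
  case (Suc m)
  then obtain Lg where L: "\<And>g. g \<in> grid D m \<Longrightarrow> mpolyfun UNIV D m (Lg g)"
    "\<And>F y. mpolyfun UNIV D m F \<Longrightarrow> F y = (\<Sum>g\<in>grid D m. F (\<lambda>i. of_int (g i)) * Lg g y)" by blast
  obtain l :: "nat \<Rightarrow> rat poly" where l: "\<And>k. k \<le> D \<Longrightarrow> degree (l k) \<le> D"
    "\<And>p t. degree p \<le> D \<Longrightarrow> poly p t = (\<Sum>k\<le>D. poly p (of_nat k) * poly (l k) t)"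
    using Lagrange_basis[of D] by blast
  \<comment> \<open>A point of the larger grid is split into its first coordinates, recovered by
    resetting coordinate \<open>m\<close> to 0, and its last one.\<close>
  define M where "M = (\<lambda>(g :: nat \<Rightarrow> int) y. Lg (g(m := 0)) y * poly (l (nat (g m))) (y m))"
  have upd: "g(m := 0) = g" if "g \<in> grid D m" for g using grid_range[OF that] by auto
  have "mpolyfun UNIV D (Suc m) (M g)" if "g \<in> grid D (Suc m)" for g
  proof -
    obtain g' k where g: "g' \<in> grid D m" "k \<le> D" "g = g'(m := int k)" using \<open>g \<in> grid D (Suc m)\<close> by auto
    have "M g = (\<lambda>y. Lg g' y * poly (l k) (y m))" unfolding M_def g(3) using upd[OF g(1)] by simp
    then show ?thesis using mpolyfun_times_poly[OF L(1)[OF g(1)] l(1)[OF g(2)]] by simp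
  qed
  moreover have "F y = (\<Sum>g\<in>grid D (Suc m). F (\<lambda>i. of_int (g i)) * M g y)" if F: "mpolyfun UNIV D (Suc m) F" for F y
  proof -
    obtain G where G: "\<forall>j\<le>D. mpolyfun UNIV D m (G j)" "F = (\<lambda>y. \<Sum>j\<le>D. G j y * y m ^ j)" using F by auto
    define F' where "F' = (\<lambda>k y. \<Sum>j\<le>D. of_nat k ^ j * G j y)"
    have F': "mpolyfun UNIV D m (F' k)" for k unfolding F'_def using G(1) by (intro mpolyfun_sum_UNIV) auto
    define p where "p = (\<Sum>j\<le>D. monom (G j y) j)"
    have dp: "degree p \<le> D" unfolding p_def by (intro degree_sum_le) (auto intro: order_trans[OF degree_monom_le])
    have pt: "poly p t = (\<Sum>j\<le>D. G j y * t ^ j)" for t by (simp add: p_def poly_sum poly_monom)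
    have "F y = poly p (y m)" by (simp add: G(2) pt)
    also have "\<dots> = (\<Sum>k\<le>D. F' k y * poly (l k) (y m))"
      unfolding l(2)[OF dp, of "y m"] by (simp add: pt F'_def mult.commute)
    also have "\<dots> = (\<Sum>k\<le>D. \<Sum>g\<in>grid D m. F' k (\<lambda>i. of_int (g i)) * Lg g y * poly (l k) (y m))"
      by (subst L(2)[OF F']) (simp add: sum_distrib_right)
    also have "\<dots> = (\<Sum>g\<in>grid D m. \<Sum>k\<le>D. F' k (\<lambda>i. of_int (g i)) * Lg g y * poly (l k) (y m))" by (rule sum.swap)
    also have "\<dots> = (\<Sum>g\<in>grid D m. \<Sum>k\<le>D. F (\<lambda>i. of_int ((g(m := int k)) i)) * M (g(m := int k)) y)"
    proof (intro sum.cong refl)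
      fix g k assume g: "g \<in> grid D m"
      have "G j (\<lambda>i. of_int ((g(m := int k)) i)) = G j (\<lambda>i. of_int (g i))" if "j \<le> D" for j
        using G(1) that by (intro mpolyfun_cong[of UNIV D m "G j"]) auto
      then have "F (\<lambda>i. of_int ((g(m := int k)) i)) = F' k (\<lambda>i. of_int (g i))"
        by (simp add: G(2) F'_def mult.commute)
      then show "F' k (\<lambda>i. of_int (g i)) * Lg g y * poly (l k) (y m) = F (\<lambda>i. of_int ((g(m := int k)) i)) * M (g(m := int k)) y"
        using upd[OF g] by (simp add: M_def)
    qed
    finally show ?thesis by (simp only: sum_grid_Suc)
  qed
  ultimately show ?case by blast
qed

section \<open>Boxes of rationals of bounded height\<close>

definition ratball :: "real \<Rightarrow> rat set" where
  "ratball B = {t. real_of_int (rat_height t) \<le> B}"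

text \<open>Coordinates from \<open>m\<close> on are pinned to 0, which makes the box finite and
  matches the encoding of points in \<open>N_rat\<close>.\<close>

definition ratbox :: "nat \<Rightarrow> real \<Rightarrow> (nat \<Rightarrow> rat) set" where
  "ratbox m B = {y. (\<forall>i\<ge>m. y i = 0) \<and> (\<forall>i<m. y i \<in> ratball B)}"

lemma ratball_card:
  assumes "B \<ge> 1"
  shows "finite (ratball B) \<and> real (card (ratball B)) \<le> 3 * B\<^sup>2"
proof -
  let ?I = "{- \<lfloor>B\<rfloor>..\<lfloor>B\<rfloor>} \<times> {1..\<lfloor>B\<rfloor>}"
  have sub: "ratball B \<subseteq> (\<lambda>(u, v). of_int u / of_int v) ` ?I"
  proof
    fix t assume "t \<in> ratball B"
    then have "real_of_int (rat_height t) \<le> B" by (simp add: ratball_def)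
    then obtain u v where "v > 0" "\<bar>real_of_int u\<bar> \<le> B" "\<bar>real_of_int v\<bar> \<le> B" "t = of_int u / of_int v"
      using rat_height_quotient by blast
    then show "t \<in> (\<lambda>(u, v). of_int u / of_int v) ` ?I"
      by (intro image_eqI[of _ _ "(u, v)"]) (auto simp: le_floor_iff floor_le_iff abs_le_iff minus_le_iff)
  qed
  have "card (ratball B) \<le> card ?I" by (rule surj_card_le[OF _ sub]) auto
  also have "\<dots> = nat (2 * \<lfloor>B\<rfloor> + 1) * nat \<lfloor>B\<rfloor>" by (simp add: card_cartesian_product)
  finally have "real (card (ratball B)) \<le> real (nat (2 * \<lfloor>B\<rfloor> + 1)) * real (nat \<lfloor>B\<rfloor>)" by (metis of_nat_le_iff of_nat_mult)
  also have "\<dots> \<le> (3 * B) * B"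
  proof (intro mult_mono)
    have "real (nat (2 * \<lfloor>B\<rfloor> + 1)) = 2 * real_of_int \<lfloor>B\<rfloor> + 1" using assms by simp
    then show "real (nat (2 * \<lfloor>B\<rfloor> + 1)) \<le> 3 * B" using assms of_int_floor_le[of B] by linarith
    show "real (nat \<lfloor>B\<rfloor>) \<le> B" using assms by simp
  qed (use assms in auto)
  finally show ?thesis using finite_subset[OF sub] by (auto simp: power2_eq_square)
qed

lemma ratbox_Suc: "ratbox (Suc m) B = (\<lambda>(y, t). y(m := t)) ` (ratbox m B \<times> ratball B)"
proof (intro equalityI subsetI)
  fix y assume y: "y \<in> ratbox (Suc m) B"
  have "y(m := 0) \<in> ratbox m B" "y m \<in> ratball B" using y by (auto simp: ratbox_def)
  then show "y \<in> (\<lambda>(y, t). y(m := t)) ` (ratbox m B \<times> ratball B)"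
    by (intro image_eqI[of _ _ "(y(m := 0), y m)"]) auto
next
  fix y assume "y \<in> (\<lambda>(y, t). y(m := t)) ` (ratbox m B \<times> ratball B)"
  then show "y \<in> ratbox (Suc m) B" by (auto simp: ratbox_def less_Suc_eq)
qed

lemma ratbox_card:
  assumes "B \<ge> 1"
  shows "finite (ratbox m B) \<and> real (card (ratbox m B)) \<le> (3 * B\<^sup>2) ^ m"
proof (induction m)
  case 0
  have "ratbox 0 B = {\<lambda>_. 0}" by (auto simp: ratbox_def)
  then show ?case by simp
next
  case (Suc m)
  have fin: "finite (ratbox m B \<times> ratball B)" using Suc ratball_card[OF assms] by auto
  have "card (ratbox (Suc m) B) \<le> card (ratbox m B \<times> ratball B)" unfolding ratbox_Suc by (rule card_image_le[OF fin])
  then have "real (card (ratbox (Suc m) B)) \<le> real (card (ratbox m B)) * real (card (ratball B))"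
    by (simp add: card_cartesian_product flip: of_nat_mult)
  also have "\<dots> \<le> (3 * B\<^sup>2) ^ m * (3 * B\<^sup>2)" using Suc ratball_card[OF assms] by (intro mult_mono) auto
  finally show ?case using fin by (simp add: ratbox_Suc mult.commute)
qed

lemma ratbox_slice_card:
  assumes "B \<ge> 1"
  shows "card {y\<in>ratbox (Suc m) B. Q y} \<le> (\<Sum>t\<in>ratball B. card {y\<in>ratbox m B. Q (y(m := t))})"
proof -
  have fin: "finite (ratbox m B)" "finite (ratball B)" using ratbox_card ratball_card assms by auto
  have "{y\<in>ratbox (Suc m) B. Q y} \<subseteq> (\<Union>t\<in>ratball B. (\<lambda>y. y(m := t)) ` {y\<in>ratbox m B. Q (y(m := t))})"
    unfolding ratbox_Suc by auto
  then have "card {y\<in>ratbox (Suc m) B. Q y} \<le> card (\<Union>t\<in>ratball B. (\<lambda>y. y(m := t)) ` {y\<in>ratbox m B. Q (y(m := t))})"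
    using fin by (intro card_mono) auto
  also have "\<dots> \<le> (\<Sum>t\<in>ratball B. card ((\<lambda>y. y(m := t)) ` {y\<in>ratbox m B. Q (y(m := t))}))"
    by (rule card_UN_le[OF fin(2)])
  also have "\<dots> \<le> (\<Sum>t\<in>ratball B. card {y\<in>ratbox m B. Q (y(m := t))})"
    using fin by (intro sum_mono card_image_le) auto
  finally show ?thesis .
qed

section \<open>Monic families and their slices\<close>

definition monic_eval :: "nat \<Rightarrow> (nat \<Rightarrow> (nat \<Rightarrow> rat) \<Rightarrow> rat) \<Rightarrow> (nat \<Rightarrow> rat) \<Rightarrow> rat \<Rightarrow> rat" where
  "monic_eval a c y z = z ^ a + (\<Sum>i<a. c i y * z ^ i)"

text \<open>For \<open>t = u / v\<close> the slice has denominators. Scaling \<open>z\<close> by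
  \<open>v ^ D\<close> multiplies the i-th coefficient by \<open>v ^ (D * (a - i))\<close>, which
  clears them because \<open>i < a\<close> leaves at least one factor \<open>v ^ D\<close>. The
  logarithm of the height grows by O(log B) only, and scaling back by a nonzero constant preserves
  the absence of a section.\<close>

lemma mpolyfun_slice_integral:
  assumes c: "\<And>i. i < a \<Longrightarrow> mpolyfun (bdd_ints H) D (Suc m) (c i)" and t: "t \<in> ratball B"
    and B: "B \<ge> 1" and H: "H \<ge> 0"
    and nr: "\<not> (\<exists>R. mpolyfun UNIV D m R \<and> (\<forall>y. monic_eval a c (y(m := t)) (R y) = 0))"
  shows "\<exists>c'. (\<forall>i<a. mpolyfun (bdd_ints ((real D + 1) * H * B ^ (D * a))) D m (c' i)) \<and>
     \<not> (\<exists>R. mpolyfun UNIV D m R \<and> (\<forall>y. monic_eval a c' y (R y) = 0)) \<and>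
     (\<forall>y. (\<exists>z. monic_eval a c (y(m := t)) z = 0) \<longrightarrow> (\<exists>z. monic_eval a c' y z = 0))"
proof -
  have "real_of_int (rat_height t) \<le> B" using t by (simp add: ratball_def)
  then obtain u v where uv: "v > 0" "\<bar>real_of_int u\<bar> \<le> B" "\<bar>real_of_int v\<bar> \<le> B" "t = of_int u / of_int v"
    using rat_height_quotient by blast
  have "\<forall>i. \<exists>G. i < a \<longrightarrow> (\<forall>j\<le>D. mpolyfun (bdd_ints H) D m (G j)) \<and> c i = (\<lambda>y. \<Sum>j\<le>D. G j y * y m ^ j)"
    using c by (auto simp: Bex_def)
  then obtain G where G: "\<And>i j. i < a \<Longrightarrow> j \<le> D \<Longrightarrow> mpolyfun (bdd_ints H) D m (G i j)"
    "\<And>i. i < a \<Longrightarrow> c i = (\<lambda>y. \<Sum>j\<le>D. G i j y * y m ^ j)" by metis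
  define k where "k = (\<lambda>i j. u ^ j * v ^ (D - j) * v ^ (D * (a - i - 1)))"
  define c' where "c' = (\<lambda>i y. \<Sum>j\<le>D. of_int (k i j) * G i j y)"
  have kb: "\<bar>real_of_int (k i j)\<bar> \<le> B ^ (D * a)" if "i < a" "j \<le> D" for i j
  proof -
    have "\<bar>real_of_int (k i j)\<bar> = \<bar>real_of_int u\<bar> ^ j * \<bar>real_of_int v\<bar> ^ (D - j) * \<bar>real_of_int v\<bar> ^ (D * (a - i - 1))"
      by (simp add: k_def abs_mult power_abs)
    also have "\<dots> \<le> B ^ j * B ^ (D - j) * B ^ (D * (a - i - 1))"
      using uv B by (intro mult_mono power_mono) auto
    also have "\<dots> = B ^ (j + (D - j) + D * (a - i - 1))" by (simp only: power_add)
    also have "\<dots> \<le> B ^ (D * a)"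
    proof (rule power_increasing)
      have "j + (D - j) + D * (a - i - 1) = D * (1 + (a - i - 1))" using that by simp
      also have "\<dots> \<le> D * a" using that by (intro mult_le_mono2) simp
      finally show "j + (D - j) + D * (a - i - 1) \<le> D * a" .
    qed (use B in simp)
    finally show ?thesis .
  qed
  have pf': "mpolyfun (bdd_ints ((real D + 1) * H * B ^ (D * a))) D m (c' i)" if i: "i < a" for i
  proof -
    have "mpolyfun (bdd_ints (real (card {..D}) * (B ^ (D * a) * H))) D m (c' i)"
      unfolding c'_def by (rule mpolyfun_sum_bdd) (use i kb G H B in auto)
    then show ?thesis by (simp add: algebra_simps)
  qed
  have c'_eq: "c' i y = of_int v ^ (D * (a - i)) * c i (y(m := t))" if i: "i < a" for i y
  proof -
    have "of_int (k i j) * G i j y = of_int v ^ (D * (a - i)) * (G i j (y(m := t)) * t ^ j)" if j: "j \<le> D" for j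
    proof -
      have "a - i = Suc (a - i - 1)" using i by simp
      then have "D * (a - i) = D * Suc (a - i - 1)" by (rule arg_cong)
      then have "D * (a - i) = j + (D - j) + D * (a - i - 1)" using j by simp
      then have "(of_int v :: rat) ^ (D * (a - i)) = of_int v ^ j * of_int v ^ (D - j) * of_int v ^ (D * (a - i - 1))"
        by (simp only: power_add)
      moreover have "of_int v ^ j * t ^ j = of_int u ^ j" using uv by (simp flip: power_mult_distrib)
      moreover have "G i j (y(m := t)) = G i j y" by (rule mpolyfun_cong[OF G(1)[OF i j]]) simp
      ultimately show ?thesis by (simp add: k_def algebra_simps)
    qed
    then show ?thesis unfolding c'_def using G(2)[OF i] by (simp add: sum_distrib_left)
  qed
  have mev': "monic_eval a c' y (of_int v ^ D * z) = of_int v ^ (D * a) * monic_eval a c (y(m := t)) z" for y z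
  proof -
    have "c' i y * (of_int v ^ D * z) ^ i = of_int v ^ (D * a) * (c i (y(m := t)) * z ^ i)" if i: "i < a" for i
    proof -
      have "D * a = D * (a - i) + D * i" using i by (simp flip: distrib_left)
      then have "(of_int v :: rat) ^ (D * a) = of_int v ^ (D * (a - i)) * (of_int v ^ D) ^ i" by (simp only: power_add power_mult)
      then show ?thesis unfolding c'_eq[OF i] by (simp add: power_mult_distrib)
    qed
    then have "(\<Sum>i<a. c' i y * (of_int v ^ D * z) ^ i) = (\<Sum>i<a. of_int v ^ (D * a) * (c i (y(m := t)) * z ^ i))"
      by (intro sum.cong refl) simp
    moreover have "(of_int v ^ D * z) ^ a = of_int v ^ (D * a) * z ^ a" by (simp add: power_mult_distrib power_mult)
    ultimately show ?thesis unfolding monic_eval_def by (simp only: distrib_left sum_distrib_left)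
  qed
  have v0: "(of_int v :: rat) \<noteq> 0" using uv by simp
  have "\<not> (\<exists>R. mpolyfun UNIV D m R \<and> (\<forall>y. monic_eval a c' y (R y) = 0))"
  proof
    assume "\<exists>R. mpolyfun UNIV D m R \<and> (\<forall>y. monic_eval a c' y (R y) = 0)"
    then obtain R where R: "mpolyfun UNIV D m R" "\<And>y. monic_eval a c' y (R y) = 0" by blast
    have "mpolyfun UNIV D m (\<lambda>y. inverse (of_int v ^ D) * R y)" by (rule mpolyfun_map[OF R(1)]) simp
    moreover have "monic_eval a c (y(m := t)) (inverse (of_int v ^ D) * R y) = 0" for y
    proof -
      define x where "x = inverse (of_int v ^ D) * R y"
      have "of_int v ^ D * x = R y" using v0 by (simp add: x_def)
      then have "of_int v ^ (D * a) * monic_eval a c (y(m := t)) x = 0" using mev'[of y x] R(2)[of y] by simp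
      then show ?thesis using v0 by (simp add: x_def)
    qed
    ultimately show False using nr by blast
  qed
  moreover have "\<exists>z. monic_eval a c' y z = 0" if "monic_eval a c (y(m := t)) z = 0" for y z
    using mev'[of y z] that by auto
  ultimately show ?thesis using pf' by blast
qed

text \<open>Sections are the roots, in the domain of rational polynomials, of a nonzero polynomial
  of degree at most \<open>a\<close>.\<close>

lemma card_sections:
  assumes monic: "\<And>j. g a j = (if j = 0 then 1 else 0)"
  shows "finite {\<sigma> :: rat poly. biv_eval a D g \<sigma> [:0, 1:] = 0} \<and> card {\<sigma> :: rat poly. biv_eval a D g \<sigma> [:0, 1:] = 0} \<le> a"
proof -
  define p :: "rat poly poly" where "p = (\<Sum>i\<le>a. monom (\<Sum>j\<le>D. of_int (g i j) * [:0, 1:] ^ j) i)"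
  have e: "poly p \<sigma> = biv_eval a D g \<sigma> [:0, 1:]" for \<sigma>
    unfolding p_def biv_eval_def poly_sum poly_monom by (simp add: sum_distrib_left sum_distrib_right algebra_simps)
  have "coeff p a = (\<Sum>j\<le>D. of_int (g a j) * [:0, 1:] ^ j)" by (simp add: p_def coeff_sum)
  also have "\<dots> = (\<Sum>j\<le>D. if j = 0 then 1 else 0)" by (intro sum.cong) (auto simp: monic)
  finally have p0: "p \<noteq> 0" by auto
  have "degree p \<le> a" unfolding p_def by (intro degree_sum_le) (auto intro: order_trans[OF degree_monom_le])
  then show ?thesis using poly_roots_finite[OF p0] card_poly_roots_bound[OF p0] by (simp add: e)
qed

lemma bdd_ints_floor: "x \<in> bdd_ints H \<Longrightarrow> of_int \<lfloor>x\<rfloor> = x \<and> \<bar>real_of_int \<lfloor>x\<rfloor>\<bar> \<le> H"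
  by (auto simp: bdd_ints_def)

text \<open>The values on a fixed grid of a root over \<open>t\<close> are rational roots of univariate specializations, hence, outside few \<open>t\<close>, values of one of boundedly many sections. Interpolating such a choice of sections gives a candidate for a root of the whole family; as it is not a root, it is one over boundedly many \<open>t\<close> only.\<close>
lemma count_fibres_with_section:
  assumes a: "a \<ge> 1"
  shows "\<exists>C>0. \<forall>c H B. H \<ge> 3 \<and> B \<ge> 1 \<and> (\<forall>i<a. mpolyfun (bdd_ints H) D (Suc m) (c i)) \<and>
      \<not> (\<exists>R. mpolyfun UNIV D (Suc m) R \<and> (\<forall>y. monic_eval a c y (R y) = 0)) \<longrightarrow>
      real (card {t\<in>ratball B. \<exists>R. mpolyfun UNIV D m R \<and> (\<forall>y. monic_eval a c (y(m := t)) (R y) = 0)}) \<le> C * B * (ln H + ln B) ^ 5"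
proof -
  define M where "M = max 1 (real D)"
  define \<kappa> where "\<kappa> = ((real D + 1) * M ^ D) ^ m"
  have \<kappa>: "\<kappa> \<ge> 1" unfolding \<kappa>_def M_def
    by (intro one_le_power) (use mult_mono[of 1 "real D + 1" 1 "max 1 (real D) ^ D"] in \<open>simp add: one_le_power\<close>)
  obtain C2 where C2: "C2 > 0" "\<And>g H B. H \<ge> 3 \<Longrightarrow> B \<ge> 1 \<Longrightarrow> (\<forall>j. g a j = (if j = 0 then 1 else 0)) \<Longrightarrow> (\<forall>i>a. \<forall>j. g i j = 0) \<Longrightarrow>
     (\<forall>i j. \<bar>real_of_int (g i j)\<bar> \<le> H) \<Longrightarrow>
     real (card {y. real_of_int (rat_height y) \<le> B \<and> (\<exists>z. biv_eval a D g z y = 0 \<and>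
       (\<forall>\<sigma>. degree \<sigma> \<le> D \<and> biv_eval a D g \<sigma> [:0, 1:] = 0 \<longrightarrow> poly \<sigma> y \<noteq> z))}) \<le> C2 * B * (ln H + ln B) ^ 5"
    using count_nonsection_roots[OF a, of D] by blast
  let ?gr = "grid D m"
  define C where "C = real (card ?gr) * (C2 * (ln \<kappa> + 1) ^ 5) + real a ^ card ?gr * real (D * a + D) + 1"
  have lk: "ln \<kappa> \<ge> 0" using \<kappa> by simp
  have "C > 0" unfolding C_def using C2(1) lk by (intro add_nonneg_pos add_nonneg_nonneg mult_nonneg_nonneg) auto
  moreover have "real (card {t\<in>ratball B. \<exists>R. mpolyfun UNIV D m R \<and> (\<forall>y. monic_eval a c (y(m := t)) (R y) = 0)}) \<le> C * B * (ln H + ln B) ^ 5"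
    (is "real (card ?Bad) \<le> _")
    if H: "H \<ge> 3" and B: "B \<ge> 1" and c: "\<And>i. i < a \<Longrightarrow> mpolyfun (bdd_ints H) D (Suc m) (c i)"
      and nr: "\<not> (\<exists>R. mpolyfun UNIV D (Suc m) R \<and> (\<forall>y. monic_eval a c y (R y) = 0))" for c H B
  proof -
    define \<Lambda> where "\<Lambda> = ln H + ln B"
    have lnH: "ln H \<ge> 1" using H exp_le by (subst ln_ge_iff) auto
    have L: "\<Lambda> \<ge> 1" using lnH ln_ge_zero[OF B] by (simp add: \<Lambda>_def)
    have "\<forall>i. \<exists>G. i < a \<longrightarrow> (\<forall>j\<le>D. mpolyfun (bdd_ints H) D m (G j)) \<and> c i = (\<lambda>y. \<Sum>j\<le>D. G j y * y m ^ j)"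
      using c by (auto simp: Bex_def)
    then obtain G where G: "\<And>i j. i < a \<Longrightarrow> j \<le> D \<Longrightarrow> mpolyfun (bdd_ints H) D m (G i j)"
      "\<And>i. i < a \<Longrightarrow> c i = (\<lambda>y. \<Sum>j\<le>D. G i j y * y m ^ j)" by metis
    define r where "r = (\<lambda>(g :: nat \<Rightarrow> int) i. of_int (g i) :: rat)"
    \<comment> \<open>The family specialized at the grid point \<open>g\<close>, the last parameter
      left free, as a coefficient array in \<open>z\<close> and \<open>t\<close>. The values are
      integers and the floor only changes their type; row \<open>a\<close> carries the leading
      coefficient 1.\<close>
    define gg where "gg = (\<lambda>g i j. if i < a \<and> j \<le> D then \<lfloor>G i j (r g)\<rfloor> else if i = a \<and> j = 0 then 1 else 0)"
    have Gr: "G i j (r g) \<in> bdd_ints (\<kappa> * H)" if "i < a" "j \<le> D" "g \<in> ?gr" for i j g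
      unfolding \<kappa>_def
    proof (rule mpolyfun_int_value[OF G(1)[OF that(1,2)]])
      fix i
      have "real_of_int \<bar>g i\<bar> \<le> real_of_int (int D)" using grid_range[OF that(3)] by (intro of_int_le_iff[THEN iffD2]) blast
      then show "r g i = of_int (g i) \<and> \<bar>real_of_int (g i)\<bar> \<le> M" by (simp add: r_def M_def)
    qed (use H in \<open>auto simp: M_def\<close>)
    have gg_monic: "gg g a j = (if j = 0 then 1 else 0)" for g j by (simp add: gg_def)
    have gg_zero: "gg g i j = 0" if "i > a" for g i j using that by (simp add: gg_def)
    have \<kappa>H: "\<kappa> * H \<ge> 3" using \<kappa> H mult_mono[of 1 \<kappa> 3 H] by simp
    have gg_bd: "\<bar>real_of_int (gg g i j)\<bar> \<le> \<kappa> * H" if "g \<in> ?gr" for g i j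
      using bdd_ints_floor[OF Gr[of i j g]] that \<kappa>H by (auto simp: gg_def)
    have biv_eval_gg: "biv_eval a D (gg g) z t = monic_eval a c ((r g)(m := t)) z" if g: "g \<in> ?gr" for g z t
    proof -
      have "(\<Sum>j\<le>D. of_int (gg g i j) * z ^ i * t ^ j) = c i ((r g)(m := t)) * z ^ i" if i: "i < a" for i
      proof -
        have "of_int (gg g i j) * z ^ i * t ^ j = G i j ((r g)(m := t)) * t ^ j * z ^ i" if j: "j \<le> D" for j
        proof -
          have "G i j ((r g)(m := t)) = G i j (r g)" by (rule mpolyfun_cong[OF G(1)[OF i j]]) simp
          moreover have "of_int (gg g i j) = G i j (r g)" using bdd_ints_floor[OF Gr[OF i j g]] i j by (simp add: gg_def)
          ultimately show ?thesis by simp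
        qed
        then have "(\<Sum>j\<le>D. of_int (gg g i j) * z ^ i * t ^ j) = (\<Sum>j\<le>D. G i j ((r g)(m := t)) * t ^ j * z ^ i)"
          by (intro sum.cong refl) simp
        then show ?thesis by (simp add: G(2)[OF i] sum_distrib_right)
      qed
      then show ?thesis unfolding biv_eval_monic[of "gg g" a, OF gg_monic] monic_eval_def by simp
    qed
    define Sec where "Sec = (\<lambda>g. {\<sigma> :: rat poly. degree \<sigma> \<le> D \<and> biv_eval a D (gg g) \<sigma> [:0, 1:] = 0})"
    have Sec: "finite (Sec g) \<and> card (Sec g) \<le> a" for g
    proof -
      have sub: "Sec g \<subseteq> {\<sigma>. biv_eval a D (gg g) \<sigma> [:0, 1:] = 0}" by (auto simp: Sec_def)
      have fin: "finite {\<sigma> :: rat poly. biv_eval a D (gg g) \<sigma> [:0, 1:] = 0}" "card {\<sigma> :: rat poly. biv_eval a D (gg g) \<sigma> [:0, 1:] = 0} \<le> a"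
        using card_sections[of "gg g" a D, OF gg_monic] by auto
      show ?thesis using finite_subset[OF sub fin(1)] card_mono[OF fin(1) sub] fin(2) by linarith
    qed
    \<comment> \<open>The exceptional \<open>t\<close>: over them the family specialized at
      \<open>g\<close> has a root that lies on no section. The one-parameter count bounds their
      number.\<close>
    define Sp where "Sp = (\<lambda>g. {y. real_of_int (rat_height y) \<le> B \<and> (\<exists>z. biv_eval a D (gg g) z y = 0 \<and>
       (\<forall>\<sigma>. degree \<sigma> \<le> D \<and> biv_eval a D (gg g) \<sigma> [:0, 1:] = 0 \<longrightarrow> poly \<sigma> y \<noteq> z))})"
    have Spfin: "finite (Sp g)" for g
      by (rule finite_subset[of _ "ratball B"]) (use ratball_card[OF B] in \<open>auto simp: Sp_def ratball_def\<close>)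
    have Sp: "real (card (Sp g)) \<le> C2 * B * ((ln \<kappa> + 1) * \<Lambda>) ^ 5" if g: "g \<in> ?gr" for g
    proof -
      have "real (card (Sp g)) \<le> C2 * B * (ln (\<kappa> * H) + ln B) ^ 5"
        unfolding Sp_def by (rule C2(2)) (use \<kappa>H B gg_monic gg_zero gg_bd[OF g] in auto)
      also have "\<dots> \<le> C2 * B * ((ln \<kappa> + 1) * \<Lambda>) ^ 5"
      proof (intro mult_left_mono power_mono)
        have "ln (\<kappa> * H) + ln B = ln \<kappa> + \<Lambda>" using \<kappa> H by (simp add: ln_mult \<Lambda>_def)
        moreover have "ln \<kappa> * 1 \<le> ln \<kappa> * \<Lambda>" using lk L by (intro mult_left_mono) auto
        ultimately show "ln (\<kappa> * H) + ln B \<le> (ln \<kappa> + 1) * \<Lambda>" by (simp add: algebra_simps)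
        show "0 \<le> ln (\<kappa> * H) + ln B" using \<kappa>H B by simp
      qed (use C2(1) B in auto)
      finally show ?thesis .
    qed
    obtain Lg where Lg: "\<And>g. g \<in> ?gr \<Longrightarrow> mpolyfun UNIV D m (Lg g)"
      "\<And>F y. mpolyfun UNIV D m F \<Longrightarrow> F y = (\<Sum>g\<in>?gr. F (r g) * Lg g y)"
      using grid_interpolation[of D m] unfolding r_def by metis
    \<comment> \<open>The \<open>t\<close> over which there is a section whose grid values are those
      prescribed by the choice \<open>\<sigma>\<close> of one-parameter sections.\<close>
    define Z where "Z = (\<lambda>\<sigma>. {t. \<exists>R. mpolyfun UNIV D m R \<and> (\<forall>y. monic_eval a c (y(m := t)) (R y) = 0) \<and> (\<forall>g\<in>?gr. R (r g) = poly (\<sigma> g) t)})"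
    have Z: "finite (Z \<sigma>) \<and> card (Z \<sigma>) \<le> D * a + D" if \<sigma>: "\<sigma> \<in> PiE ?gr Sec" for \<sigma>
    proof -
      have d\<sigma>: "degree (\<sigma> g) \<le> D" if "g \<in> ?gr" for g using PiE_mem[OF \<sigma> that] by (simp add: Sec_def)
      \<comment> \<open>The interpolant of the chosen \<open>\<sigma> g\<close>, a function of all
        \<open>Suc m\<close> parameters. It is not a root of the family, so it fails at some
        \<open>y\<close>. With all coordinates of \<open>y\<close> but the last frozen, this gives a
        nonzero polynomial \<open>q\<close> in \<open>t\<close>, which vanishes on
        \<open>Z \<sigma>\<close>.\<close>
      define RR where "RR = (\<lambda>y. \<Sum>g\<in>?gr. 1 * (Lg g y * poly (\<sigma> g) (y m)))"
      have "mpolyfun UNIV D (Suc m) RR" unfolding RR_def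
        using Lg(1) d\<sigma> finite_grid by (intro mpolyfun_sum_UNIV mpolyfun_times_poly) auto
      then obtain y where y: "monic_eval a c y (RR y) \<noteq> 0" using nr by blast
      define \<rho> where "\<rho> = (\<Sum>g\<in>?gr. smult (Lg g y) (\<sigma> g))"
      define q where "q = \<rho> ^ a + (\<Sum>i<a. (\<Sum>j\<le>D. monom (G i j y) j) * \<rho> ^ i)"
      have d\<rho>: "degree \<rho> \<le> D" unfolding \<rho>_def
        using d\<sigma> finite_grid by (intro degree_sum_le) (auto intro: order_trans[OF degree_smult_le])
      have d\<rho>i: "degree (\<rho> ^ i) \<le> D * i" for i
        using degree_power_le[of \<rho> i] mult_le_mono1[OF d\<rho>, of i] by linarith
      have poly\<rho>: "poly \<rho> t = (\<Sum>g\<in>?gr. Lg g y * poly (\<sigma> g) t)" for t by (simp add: \<rho>_def poly_sum)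
      have polyq: "poly q t = monic_eval a c (y(m := t)) (poly \<rho> t)" for t
      proof -
        have "c i (y(m := t)) = (\<Sum>j\<le>D. G i j y * t ^ j)" if i: "i < a" for i
        proof -
          have "G i j (y(m := t)) = G i j y" if "j \<le> D" for j by (rule mpolyfun_cong[OF G(1)[OF i that]]) simp
          then show ?thesis by (simp add: G(2)[OF i])
        qed
        then show ?thesis unfolding q_def monic_eval_def by (simp add: poly_sum poly_monom)
      qed
      have "poly q (y m) \<noteq> 0" unfolding polyq poly\<rho> using y by (simp add: RR_def)
      then have q0: "q \<noteq> 0" by auto
      have "degree q \<le> D * a + D" unfolding q_def
      proof (intro degree_add_le degree_sum_le finite_lessThan)
        show "degree (\<rho> ^ a) \<le> D * a + D" using d\<rho>i[of a] by simp
        fix i assume i: "i \<in> {..<a}"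
        have "degree (\<Sum>j\<le>D. monom (G i j y) j) \<le> D" by (intro degree_sum_le) (auto intro: order_trans[OF degree_monom_le])
        then have "degree ((\<Sum>j\<le>D. monom (G i j y) j) * \<rho> ^ i) \<le> D + D * i"
          using d\<rho>i[of i] degree_mult_le[of "\<Sum>j\<le>D. monom (G i j y) j" "\<rho> ^ i"] by linarith
        also have "\<dots> \<le> D * a + D" using i by simp
        finally show "degree ((\<Sum>j\<le>D. monom (G i j y) j) * \<rho> ^ i) \<le> D * a + D" .
      qed
      then have card: "card {t. poly q t = 0} \<le> D * a + D" using card_poly_roots_bound[OF q0] by simp
      have sub: "Z \<sigma> \<subseteq> {t. poly q t = 0}"
      proof
        fix t assume "t \<in> Z \<sigma>"
        then obtain R where R: "mpolyfun UNIV D m R" "monic_eval a c (y(m := t)) (R y) = 0" "\<And>g. g \<in> ?gr \<Longrightarrow> R (r g) = poly (\<sigma> g) t"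
          by (auto simp: Z_def)
        have "R y = poly \<rho> t" unfolding Lg(2)[OF R(1), of y] poly\<rho> using R(3) by (simp add: mult.commute)
        then show "t \<in> {t. poly q t = 0}" using R(2) by (simp add: polyq)
      qed
      then show ?thesis using card finite_subset[OF sub poly_roots_finite[OF q0]] card_mono[OF poly_roots_finite[OF q0] sub] by linarith
    qed
    have finPi: "finite (PiE ?gr Sec)" using finite_grid Sec by (intro finite_PiE) auto
    have cardPi: "card (PiE ?gr Sec) \<le> a ^ card ?gr"
    proof -
      have "card (PiE ?gr Sec) = (\<Prod>g\<in>?gr. card (Sec g))" by (rule card_PiE[OF finite_grid])
      also have "\<dots> \<le> (\<Prod>g\<in>?gr. a)" using Sec by (intro prod_mono) auto
      finally show ?thesis by simp
    qed
    have sub: "?Bad \<subseteq> (\<Union>g\<in>?gr. Sp g) \<union> (\<Union>\<sigma>\<in>PiE ?gr Sec. Z \<sigma>)"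
    proof
      fix t assume "t \<in> ?Bad"
      then obtain R where t: "real_of_int (rat_height t) \<le> B" and R: "mpolyfun UNIV D m R" "\<And>y. monic_eval a c (y(m := t)) (R y) = 0"
        by (auto simp: ratball_def)
      show "t \<in> (\<Union>g\<in>?gr. Sp g) \<union> (\<Union>\<sigma>\<in>PiE ?gr Sec. Z \<sigma>)"
      proof (cases "t \<in> (\<Union>g\<in>?gr. Sp g)")
        case False
        have "\<exists>\<sigma>. \<sigma> \<in> Sec g \<and> poly \<sigma> t = R (r g)" if g: "g \<in> ?gr" for g
        proof -
          have "biv_eval a D (gg g) (R (r g)) t = 0" unfolding biv_eval_gg[OF g] by (rule R(2))
          then show ?thesis using False g t by (auto simp: Sp_def Sec_def)
        qed
        then obtain s where s: "\<And>g. g \<in> ?gr \<Longrightarrow> s g \<in> Sec g \<and> poly (s g) t = R (r g)" by metis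
        define \<sigma> where "\<sigma> = restrict s ?gr"
        have "\<sigma> \<in> PiE ?gr Sec" using s by (auto simp: \<sigma>_def)
        moreover have "t \<in> Z \<sigma>" unfolding Z_def using R s by (auto simp: \<sigma>_def intro!: exI[of _ R])
        ultimately show ?thesis by blast
      qed simp
    qed
    have fin1: "finite (\<Union>g\<in>?gr. Sp g)" using finite_grid Spfin by auto
    have fin2: "finite (\<Union>\<sigma>\<in>PiE ?gr Sec. Z \<sigma>)" using finPi Z by auto
    have "real (card (\<Union>g\<in>?gr. Sp g)) \<le> real (\<Sum>g\<in>?gr. card (Sp g))" by (intro of_nat_mono card_UN_le finite_grid)
    also have "\<dots> = (\<Sum>g\<in>?gr. real (card (Sp g)))" by simp
    also have "\<dots> \<le> (\<Sum>g\<in>?gr. C2 * B * ((ln \<kappa> + 1) * \<Lambda>) ^ 5)" by (intro sum_mono Sp)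
    also have "\<dots> = real (card ?gr) * (C2 * (ln \<kappa> + 1) ^ 5) * (B * \<Lambda> ^ 5)"
      unfolding power_mult_distrib by simp
    finally have 1: "real (card (\<Union>g\<in>?gr. Sp g)) \<le> real (card ?gr) * (C2 * (ln \<kappa> + 1) ^ 5) * (B * \<Lambda> ^ 5)" .
    have "card (\<Union>\<sigma>\<in>PiE ?gr Sec. Z \<sigma>) \<le> (\<Sum>\<sigma>\<in>PiE ?gr Sec. card (Z \<sigma>))" by (rule card_UN_le[OF finPi])
    also have "\<dots> \<le> (\<Sum>\<sigma>\<in>PiE ?gr Sec. D * a + D)" using Z by (intro sum_mono) blast
    also have "\<dots> \<le> a ^ card ?gr * (D * a + D)" using cardPi by simp
    finally have 2: "real (card (\<Union>\<sigma>\<in>PiE ?gr Sec. Z \<sigma>)) \<le> real a ^ card ?gr * real (D * a + D)"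
      by (metis of_nat_le_iff of_nat_mult of_nat_power)
    have BL: "B * \<Lambda> ^ 5 \<ge> 1" using mult_mono[of 1 B 1 "\<Lambda> ^ 5"] B L by (simp add: one_le_power)
    have 3: "real a ^ card ?gr * real (D * a + D) * 1 \<le> real a ^ card ?gr * real (D * a + D) * (B * \<Lambda> ^ 5)"
      using BL by (intro mult_left_mono) auto
    have "card ?Bad \<le> card ((\<Union>g\<in>?gr. Sp g) \<union> (\<Union>\<sigma>\<in>PiE ?gr Sec. Z \<sigma>))"
      by (rule card_mono[OF _ sub]) (use fin1 fin2 in blast)
    also have "\<dots> \<le> card (\<Union>g\<in>?gr. Sp g) + card (\<Union>\<sigma>\<in>PiE ?gr Sec. Z \<sigma>)" by (rule card_Un_le)
    finally have "real (card ?Bad) \<le> real (card (\<Union>g\<in>?gr. Sp g)) + real (card (\<Union>\<sigma>\<in>PiE ?gr Sec. Z \<sigma>))" by linarith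
    also have "\<dots> \<le> (C - 1) * (B * \<Lambda> ^ 5)" using 1 2 3 unfolding C_def by (simp add: distrib_right)
    also have "\<dots> \<le> C * (B * \<Lambda> ^ 5)" using BL by (intro mult_right_mono) auto
    finally show ?thesis by (simp add: \<Lambda>_def mult.assoc)
  qed
  ultimately show ?thesis by blast
qed

text \<open>Slice by the last parameter. The O(B^2) slices without a section contribute B^(2m-1)
  each by induction; the O(B \<Lambda>^5) slices with a section are bounded trivially by B^(2m)
  each. Both totals are of order B^(2m+1) \<Lambda>^5.\<close>

theorem count_points_with_root:
  "a \<ge> 1 \<Longrightarrow> \<exists>C>0. \<forall>c H B. H \<ge> 3 \<and> B \<ge> 1 \<and> (\<forall>i<a. mpolyfun (bdd_ints H) D m (c i)) \<and>
      \<not> (\<exists>R. mpolyfun UNIV D m R \<and> (\<forall>y. monic_eval a c y (R y) = 0)) \<longrightarrow>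
      real (card {y\<in>ratbox m B. \<exists>z. monic_eval a c y z = 0}) \<le> C * B powr (2 * real m - 1) * (ln H + ln B) ^ 5"
proof (induction m)
  case 0
  show ?case
  proof (intro exI[of _ "1::real"] conjI allI impI)
    fix c :: "nat \<Rightarrow> (nat \<Rightarrow> rat) \<Rightarrow> rat" and H B :: real
    assume h: "H \<ge> 3 \<and> B \<ge> 1 \<and> (\<forall>i<a. mpolyfun (bdd_ints H) D 0 (c i)) \<and> \<not> (\<exists>R. mpolyfun UNIV D 0 R \<and> (\<forall>y. monic_eval a c y (R y) = 0))"
    \<comment> \<open>Without parameters a root is itself a constant section, so the set is empty;
      the exponent of \<open>B\<close> is -1 here, which is why \<open>powr\<close> occurs.\<close>
    have "\<not> (\<exists>z. monic_eval a c y z = 0)" for y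
    proof
      assume "\<exists>z. monic_eval a c y z = 0"
      then obtain z where z: "monic_eval a c y z = 0" by blast
      have "monic_eval a c y' z = 0" for y'
      proof -
        have "c i y' = c i y" if "i < a" for i using h that by (intro mpolyfun_cong[of "bdd_ints H" D 0 "c i"]) auto
        then show ?thesis using z by (simp add: monic_eval_def)
      qed
      moreover have "mpolyfun UNIV D 0 (\<lambda>_. z)" by auto
      ultimately show False using h by blast
    qed
    then have e: "{y\<in>ratbox 0 B. \<exists>z. monic_eval a c y z = 0} = {}" by blast
    have "0 \<le> ln H + ln B" using h by (intro add_nonneg_nonneg) auto
    then show "real (card {y\<in>ratbox 0 B. \<exists>z. monic_eval a c y z = 0}) \<le> 1 * B powr (2 * real 0 - 1) * (ln H + ln B) ^ 5"
      unfolding e by (intro order_trans[OF _ mult_nonneg_nonneg]) auto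
  qed simp
next
  case (Suc m)
  obtain C1 where C1: "C1 > 0" "\<And>c H B. H \<ge> 3 \<Longrightarrow> B \<ge> 1 \<Longrightarrow> (\<forall>i<a. mpolyfun (bdd_ints H) D m (c i)) \<Longrightarrow>
      \<not> (\<exists>R. mpolyfun UNIV D m R \<and> (\<forall>y. monic_eval a c y (R y) = 0)) \<Longrightarrow>
      real (card {y\<in>ratbox m B. \<exists>z. monic_eval a c y z = 0}) \<le> C1 * B powr (2 * real m - 1) * (ln H + ln B) ^ 5"
    using Suc by blast
  obtain C3 where C3: "C3 > 0" "\<And>c H B. H \<ge> 3 \<Longrightarrow> B \<ge> 1 \<Longrightarrow> (\<forall>i<a. mpolyfun (bdd_ints H) D (Suc m) (c i)) \<Longrightarrow>
      \<not> (\<exists>R. mpolyfun UNIV D (Suc m) R \<and> (\<forall>y. monic_eval a c y (R y) = 0)) \<Longrightarrow>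
      real (card {t\<in>ratball B. \<exists>R. mpolyfun UNIV D m R \<and> (\<forall>y. monic_eval a c (y(m := t)) (R y) = 0)}) \<le> C3 * B * (ln H + ln B) ^ 5"
    using count_fibres_with_section[OF Suc.prems, of D m] by blast
  \<comment> \<open>\<open>\<kappa> * \<Lambda>\<close> dominates the logarithms of the data of a
    slice after its denominators have been cleared.\<close>
  define \<kappa> where "\<kappa> = ln (real D + 1) + real (D * a) + 1"
  have \<kappa>: "\<kappa> > 0" by (simp add: \<kappa>_def add_nonneg_pos)
  define C where "C = C3 * 3 ^ m + 3 * C1 * \<kappa> ^ 5"
  have "C > 0" unfolding C_def using C1(1) C3(1) \<kappa> by (intro add_pos_pos mult_pos_pos) auto
  moreover have "real (card {y\<in>ratbox (Suc m) B. \<exists>z. monic_eval a c y z = 0}) \<le> C * B powr (2 * real (Suc m) - 1) * (ln H + ln B) ^ 5"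
    if H: "H \<ge> 3" and B: "B \<ge> 1" and c: "\<forall>i<a. mpolyfun (bdd_ints H) D (Suc m) (c i)"
      and nr: "\<not> (\<exists>R. mpolyfun UNIV D (Suc m) R \<and> (\<forall>y. monic_eval a c y (R y) = 0))" for c H B
  proof -
    define \<Lambda> where "\<Lambda> = ln H + ln B"
    have lnH: "ln H \<ge> 1" using H exp_le by (subst ln_ge_iff) auto
    have L: "\<Lambda> \<ge> 1" "ln B \<ge> 0" "ln B \<le> \<Lambda>" using lnH ln_ge_zero[OF B] by (simp_all add: \<Lambda>_def)
    define Bad where "Bad = {t\<in>ratball B. \<exists>R. mpolyfun UNIV D m R \<and> (\<forall>y. monic_eval a c (y(m := t)) (R y) = 0)}"
    define N where "N = (\<lambda>t. {y\<in>ratbox m B. \<exists>z. monic_eval a c (y(m := t)) z = 0})"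
    define W where "W = C1 * B powr (2 * real m - 1) * (\<kappa> * \<Lambda>) ^ 5"
    have fin: "finite (ratball B)" "finite (ratbox m B)" using ratball_card ratbox_card B by auto
    have good: "real (card (N t)) \<le> W" if t: "t \<in> ratball B - Bad" for t
    proof -
      let ?H = "(real D + 1) * H * B ^ (D * a)"
      have "t \<in> ratball B" "\<not> (\<exists>R. mpolyfun UNIV D m R \<and> (\<forall>y. monic_eval a c (y(m := t)) (R y) = 0))" using t by (auto simp: Bad_def)
      then obtain c' where c': "\<forall>i<a. mpolyfun (bdd_ints ?H) D m (c' i)" "\<not> (\<exists>R. mpolyfun UNIV D m R \<and> (\<forall>y. monic_eval a c' y (R y) = 0))"
          "\<And>y. \<exists>z. monic_eval a c (y(m := t)) z = 0 \<Longrightarrow> \<exists>z. monic_eval a c' y z = 0"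
        using mpolyfun_slice_integral[of a H D m c t B] c B H by auto
      have "1 * 3 * 1 \<le> ?H" using H B by (intro mult_mono one_le_power) auto
      then have H3: "?H \<ge> 3" by simp
      have "card (N t) \<le> card {y\<in>ratbox m B. \<exists>z. monic_eval a c' y z = 0}"
        unfolding N_def using c'(3) fin by (intro card_mono) auto
      then have "real (card (N t)) \<le> C1 * B powr (2 * real m - 1) * (ln ?H + ln B) ^ 5"
        using C1(2)[OF H3 B c'(1,2)] by linarith
      also have "\<dots> \<le> W" unfolding W_def
      proof (intro mult_left_mono power_mono)
        have "ln ?H + ln B = ln (real D + 1) + real (D * a) * ln B + \<Lambda>"
          using H B by (simp add: ln_mult ln_realpow \<Lambda>_def)
        also have "\<dots> \<le> ln (real D + 1) * \<Lambda> + real (D * a) * \<Lambda> + \<Lambda>"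
          using L by (intro add_mono mult_left_mono) (auto simp: mult_le_cancel_left1)
        finally show "ln ?H + ln B \<le> \<kappa> * \<Lambda>" by (simp add: \<kappa>_def algebra_simps)
        show "0 \<le> ln ?H + ln B" using H3 L by (intro add_nonneg_nonneg) auto
      qed (use C1(1) in auto)
      finally show ?thesis .
    qed
    have bad: "real (card (N t)) \<le> (3 * B\<^sup>2) ^ m" for t
    proof -
      have "card (N t) \<le> card (ratbox m B)" unfolding N_def using fin by (intro card_mono) auto
      then show ?thesis using ratbox_card[OF B, of m] by linarith
    qed
    have W0: "W \<ge> 0" unfolding W_def using C1(1) \<kappa> L by (intro mult_nonneg_nonneg) auto
    have "real (card {y\<in>ratbox (Suc m) B. \<exists>z. monic_eval a c y z = 0}) \<le> real (\<Sum>t\<in>ratball B. card (N t))"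
      unfolding N_def by (intro of_nat_mono ratbox_slice_card B)
    also have "\<dots> = (\<Sum>t\<in>Bad. real (card (N t))) + (\<Sum>t\<in>ratball B - Bad. real (card (N t)))"
      using sum.subset_diff[of Bad "ratball B" "\<lambda>t. real (card (N t))"] fin by (simp add: Bad_def add.commute)
    also have "\<dots> \<le> (\<Sum>t\<in>Bad. (3 * B\<^sup>2) ^ m) + (\<Sum>t\<in>ratball B - Bad. W)"
      by (intro add_mono sum_mono good bad)
    also have "\<dots> = real (card Bad) * (3 * B\<^sup>2) ^ m + real (card (ratball B - Bad)) * W" by simp
    also have "\<dots> \<le> (C3 * B * \<Lambda> ^ 5) * (3 * B\<^sup>2) ^ m + (3 * B\<^sup>2) * W"
    proof (intro add_mono mult_right_mono W0)
      show "real (card Bad) \<le> C3 * B * \<Lambda> ^ 5" unfolding Bad_def \<Lambda>_def by (rule C3(2)[OF H B c nr])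
      have "card (ratball B - Bad) \<le> card (ratball B)" using fin by (intro card_mono) auto
      then show "real (card (ratball B - Bad)) \<le> 3 * B\<^sup>2" using ratball_card[OF B] by linarith
    qed simp
    also have "\<dots> = C * B powr (2 * real (Suc m) - 1) * \<Lambda> ^ 5"
    proof -
      have e1: "B * (B\<^sup>2) ^ m = B powr (2 * real (Suc m) - 1)"
      proof -
        have "B * (B\<^sup>2) ^ m = B ^ (2 * m + 1)" by (simp flip: power_mult)
        also have "\<dots> = B powr real (2 * m + 1)" using B by (subst powr_realpow) auto
        also have "real (2 * m + 1) = 2 * real (Suc m) - 1" by simp
        finally show ?thesis .
      qed
      have e2: "B\<^sup>2 * B powr (2 * real m - 1) = B powr (2 * real (Suc m) - 1)"
      proof -
        have "B\<^sup>2 = B powr 2" using B by (simp add: powr_numeral)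
        then have "B\<^sup>2 * B powr (2 * real m - 1) = B powr (2 + (2 * real m - 1))" by (simp only: powr_add)
        also have "2 + (2 * real m - 1) = 2 * real (Suc m) - 1" by simp
        finally show ?thesis .
      qed
      have s1: "(C3 * B * \<Lambda> ^ 5) * (3 * B\<^sup>2) ^ m = C3 * 3 ^ m * (B * (B\<^sup>2) ^ m) * \<Lambda> ^ 5" by (simp add: power_mult_distrib)
      have s2: "(3 * B\<^sup>2) * W = 3 * C1 * \<kappa> ^ 5 * (B\<^sup>2 * B powr (2 * real m - 1)) * \<Lambda> ^ 5"
        by (simp add: W_def power_mult_distrib)
      show ?thesis unfolding s1 s2 e1 e2 C_def by (simp only: distrib_right)
    qed
    finally show ?thesis by (simp add: \<Lambda>_def)
  qed
  ultimately show ?case by blast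
qed

subsection \<open>Multivariate polynomials and evaluation\<close>

definition is_ring_hom :: "('a::comm_ring_1 \<Rightarrow> 'b::comm_ring_1) \<Rightarrow> bool" where
  "is_ring_hom h \<longleftrightarrow> h 0 = 0 \<and> h 1 = 1 \<and> (\<forall>a b. h (a + b) = h a + h b) \<and> (\<forall>a b. h (a * b) = h a * h b)"

lemma is_ring_homD:
  assumes "is_ring_hom h"
  shows "h 0 = 0" "h 1 = 1" "h (a + b) = h a + h b" "h (a * b) = h a * h b"
    "h (a ^ n) = h a ^ n" "h (- a) = - h a" "h (a - b) = h a - h b"
    "h (sum f A) = (\<Sum>i\<in>A. h (f i))" "h (prod f A) = (\<Prod>i\<in>A. h (f i))"
proof -
  note b = assms[unfolded is_ring_hom_def]
  show 1: "h 0 = 0" and 2: "h 1 = 1" and 3: "h (a + b) = h a + h b" and 4: "h (a * b) = h a * h b" for a b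
    using b by auto
  show "h (a ^ n) = h a ^ n" by (induction n) (auto simp: 2 4)
  show u: "h (- a) = - h a" for a using 3[of a "- a"] 1 by (simp add: eq_neg_iff_add_eq_0 add.commute)
  show "h (a - b) = h a - h b" using 3[of a "- b"] u by simp
  show "h (sum f A) = (\<Sum>i\<in>A. h (f i))" by (induction A rule: infinite_finite_induct) (auto simp: 1 3)
  show "h (prod f A) = (\<Prod>i\<in>A. h (f i))" by (induction A rule: infinite_finite_induct) (auto simp: 2 4)
qed

definition monom_eval :: "(nat \<Rightarrow> 'b::comm_ring_1) \<Rightarrow> (nat \<Rightarrow>\<^sub>0 nat) \<Rightarrow> 'b" where
  "monom_eval x m = (\<Prod>i\<in>Poly_Mapping.keys m. x i ^ Poly_Mapping.lookup m i)"

text \<open>The homomorphism given by the universal property of the polynomial ring. Evaluation at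
  rational points, splitting off a variable and setting variables to 0 are instances, so the ring
  laws are proved once.\<close>

definition hom_eval :: "('c::comm_ring_1 \<Rightarrow> 'b::comm_ring_1) \<Rightarrow> (nat \<Rightarrow> 'b) \<Rightarrow> 'c mpoly \<Rightarrow> 'b" where
  "hom_eval \<phi> x p = (\<Sum>m\<in>Poly_Mapping.keys p. \<phi> (Poly_Mapping.lookup p m) * monom_eval x m)"

lemma monom_eval_superset:
  assumes "finite F" "Poly_Mapping.keys m \<subseteq> F"
  shows "monom_eval x m = (\<Prod>i\<in>F. x i ^ Poly_Mapping.lookup m i)"
  unfolding monom_eval_def using assms by (intro prod.mono_neutral_left) (auto simp: in_keys_iff)

lemma monom_eval_add: "monom_eval x (m + m') = monom_eval x m * monom_eval x m'"
proof -
  let ?F = "Poly_Mapping.keys m \<union> Poly_Mapping.keys m'"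
  have "monom_eval x (m + m') = (\<Prod>i\<in>?F. x i ^ Poly_Mapping.lookup (m + m') i)"
    by (rule monom_eval_superset) (auto dest: subsetD[OF Poly_Mapping.keys_add])
  also have "\<dots> = (\<Prod>i\<in>?F. x i ^ Poly_Mapping.lookup m i) * (\<Prod>i\<in>?F. x i ^ Poly_Mapping.lookup m' i)"
    by (simp add: lookup_add power_add prod.distrib)
  also have "\<dots> = monom_eval x m * monom_eval x m'" by (simp add: monom_eval_superset[of ?F])
  finally show ?thesis .
qed

lemma monom_eval_0 [simp]: "monom_eval x 0 = 1" by (simp add: monom_eval_def)

lemma monom_eval_single: "monom_eval x (Poly_Mapping.single i n) = x i ^ n"
  by (cases "n = 0") (auto simp: monom_eval_def)

lemma hom_eval_superset:
  assumes "\<phi> 0 = 0" "finite F" "Poly_Mapping.keys p \<subseteq> F"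
  shows "hom_eval \<phi> x p = (\<Sum>m\<in>F. \<phi> (Poly_Mapping.lookup p m) * monom_eval x m)"
  unfolding hom_eval_def using assms by (intro sum.mono_neutral_left) (auto simp: in_keys_iff)

lemma hom_eval_add:
  assumes "is_ring_hom \<phi>"
  shows "hom_eval \<phi> x (p + q) = hom_eval \<phi> x p + hom_eval \<phi> x q"
proof -
  let ?F = "Poly_Mapping.keys p \<union> Poly_Mapping.keys q"
  have "hom_eval \<phi> x (p + q) = (\<Sum>m\<in>?F. \<phi> (Poly_Mapping.lookup (p + q) m) * monom_eval x m)"
    by (rule hom_eval_superset) (use is_ring_homD(1)[OF assms] in \<open>auto dest: subsetD[OF Poly_Mapping.keys_add]\<close>)
  also have "\<dots> = (\<Sum>m\<in>?F. \<phi> (Poly_Mapping.lookup p m) * monom_eval x m) + (\<Sum>m\<in>?F. \<phi> (Poly_Mapping.lookup q m) * monom_eval x m)"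
    by (simp add: lookup_add is_ring_homD(3)[OF assms] distrib_right sum.distrib)
  also have "\<dots> = hom_eval \<phi> x p + hom_eval \<phi> x q" by (simp add: hom_eval_superset[of \<phi> ?F] is_ring_homD(1)[OF assms])
  finally show ?thesis .
qed

lemma hom_eval_zero [simp]: "hom_eval \<phi> x 0 = 0" by (simp add: hom_eval_def)

lemma hom_eval_sum: "is_ring_hom \<phi> \<Longrightarrow> hom_eval \<phi> x (sum f A) = (\<Sum>i\<in>A. hom_eval \<phi> x (f i))"
  by (induction A rule: infinite_finite_induct) (auto simp: hom_eval_add)

lemma hom_eval_single: "is_ring_hom \<phi> \<Longrightarrow> hom_eval \<phi> x (Poly_Mapping.single m c) = \<phi> c * monom_eval x m"
  by (cases "c = 0") (auto simp: hom_eval_def is_ring_homD(1))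

lemma poly_mapping_sum_singles:
  "p = (\<Sum>m\<in>Poly_Mapping.keys p. Poly_Mapping.single m (Poly_Mapping.lookup p m))"
proof (rule poly_mapping_eqI)
  fix k
  have "(\<Sum>m\<in>Poly_Mapping.keys p. Poly_Mapping.lookup (Poly_Mapping.single m (Poly_Mapping.lookup p m)) k)
      = (\<Sum>m\<in>Poly_Mapping.keys p. if m = k then Poly_Mapping.lookup p k else 0)"
    by (intro sum.cong) (auto simp: lookup_single when_def)
  then show "Poly_Mapping.lookup p k = Poly_Mapping.lookup (\<Sum>m\<in>Poly_Mapping.keys p. Poly_Mapping.single m (Poly_Mapping.lookup p m)) k"
    by (simp add: lookup_sum in_keys_iff)
qed

lemma hom_eval_mult:
  assumes "is_ring_hom \<phi>"
  shows "hom_eval \<phi> x (p * q) = hom_eval \<phi> x p * hom_eval \<phi> x q"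
proof -
  define s where "s = (\<lambda>(p :: 'a mpoly) m. Poly_Mapping.single m (Poly_Mapping.lookup p m))"
  have p: "p = (\<Sum>m\<in>Poly_Mapping.keys p. s p m)" and q: "q = (\<Sum>m\<in>Poly_Mapping.keys q. s q m)"
    unfolding s_def by (rule poly_mapping_sum_singles)+
  have 1: "p * q = (\<Sum>m\<in>Poly_Mapping.keys p. \<Sum>m'\<in>Poly_Mapping.keys q. s p m * s q m')"
    by (subst p, subst q) (simp add: sum_product)
  have "hom_eval \<phi> x (s p m * s q m') = hom_eval \<phi> x (s p m) * hom_eval \<phi> x (s q m')" for m m'
    unfolding s_def by (simp add: mult_single hom_eval_single[OF assms] is_ring_homD(4)[OF assms] monom_eval_add algebra_simps)
  then have "hom_eval \<phi> x (p * q) = (\<Sum>m\<in>Poly_Mapping.keys p. hom_eval \<phi> x (s p m)) * (\<Sum>m\<in>Poly_Mapping.keys q. hom_eval \<phi> x (s q m))"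
    unfolding 1 hom_eval_sum[OF assms] by (simp add: sum_product)
  also have "\<dots> = hom_eval \<phi> x (\<Sum>m\<in>Poly_Mapping.keys p. s p m) * hom_eval \<phi> x (\<Sum>m\<in>Poly_Mapping.keys q. s q m)"
    by (simp add: hom_eval_sum[OF assms])
  finally show ?thesis using p q by simp
qed

lemma is_ring_hom_ev: "is_ring_hom \<phi> \<Longrightarrow> is_ring_hom (hom_eval \<phi> x)"
proof -
  assume h: "is_ring_hom \<phi>"
  have "hom_eval \<phi> x 1 = 1" using hom_eval_single[OF h, of x 0 1] is_ring_homD(2)[OF h] by simp
  then show ?thesis unfolding is_ring_hom_def by (simp add: hom_eval_add[OF h] hom_eval_mult[OF h])
qed

lemma hom_eval_hom:
  assumes "is_ring_hom h"
  shows "h (hom_eval \<phi> x p) = hom_eval (\<lambda>c. h (\<phi> c)) (\<lambda>i. h (x i)) p"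
  unfolding hom_eval_def monom_eval_def by (simp add: is_ring_homD[OF assms])

lemma hom_eval_cong:
  assumes "\<And>m i. m \<in> Poly_Mapping.keys p \<Longrightarrow> i \<in> Poly_Mapping.keys m \<Longrightarrow> x i = x' i"
  shows "hom_eval \<phi> x p = hom_eval \<phi> x' p"
  unfolding hom_eval_def monom_eval_def using assms by (intro sum.cong arg_cong2[of _ _ _ _ "(*)"] prod.cong) auto

definition mconst :: "'a::zero \<Rightarrow> 'a mpoly" where "mconst c = Poly_Mapping.single 0 c"
definition mvar :: "nat \<Rightarrow> 'a::comm_ring_1 mpoly" where "mvar i = Poly_Mapping.single (Poly_Mapping.single i 1) 1"

lemma is_ring_hom_mC: "is_ring_hom (mconst :: 'a::comm_ring_1 \<Rightarrow> _)"
  unfolding is_ring_hom_def mconst_def by (auto simp: single_add mult_single)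

lemma is_ring_hom_id: "is_ring_hom (\<lambda>x. x)" by (simp add: is_ring_hom_def)

lemma is_ring_hom_const_poly: "is_ring_hom (\<lambda>c. [:c:])" by (simp add: is_ring_hom_def)

lemma is_ring_hom_comp: "is_ring_hom g \<Longrightarrow> is_ring_hom h \<Longrightarrow> is_ring_hom (\<lambda>x. h (g x))" by (simp add: is_ring_hom_def)

lemma is_ring_hom_poly: "is_ring_hom (\<lambda>P. poly P a)" by (simp add: is_ring_hom_def)

lemma hom_eval_mC: "is_ring_hom \<phi> \<Longrightarrow> hom_eval \<phi> x (mconst c) = \<phi> c" unfolding mconst_def by (simp add: hom_eval_single)

lemma hom_eval_mV: "is_ring_hom \<phi> \<Longrightarrow> hom_eval \<phi> x (mvar i) = x i" unfolding mvar_def by (simp add: hom_eval_single monom_eval_single is_ring_homD)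

lemma monom_eval_mV: "monom_eval mvar m = (Poly_Mapping.single m 1 :: 'a::comm_ring_1 mpoly)"
proof -
  have pow: "(mvar i :: 'a mpoly) ^ n = Poly_Mapping.single (Poly_Mapping.single i n) 1" for i n
    by (induction n) (auto simp: mvar_def mult_single simp flip: single_add)
  have "(\<Prod>i\<in>F. Poly_Mapping.single (f i) 1) = (Poly_Mapping.single (\<Sum>i\<in>F. f i) 1 :: 'a mpoly)" for F and f :: "nat \<Rightarrow> nat \<Rightarrow>\<^sub>0 nat"
    by (induction F rule: infinite_finite_induct) (auto simp: mult_single)
  then show ?thesis unfolding monom_eval_def pow using poly_mapping_sum_singles[of m] by simp
qed

lemma hom_eval_mC_mV: "hom_eval mconst mvar p = (p :: 'a::comm_ring_1 mpoly)"
  unfolding hom_eval_def monom_eval_mV mconst_def by (simp add: mult_single poly_mapping_sum_singles[symmetric])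

subsection \<open>Subrings of polynomials in a set of variables\<close>

definition subring_on :: "'a::comm_ring_1 set \<Rightarrow> bool" where
  "subring_on R \<longleftrightarrow> 1 \<in> R \<and> (\<forall>a\<in>R. \<forall>b\<in>R. a - b \<in> R \<and> a * b \<in> R)"

lemma subring_onD:
  assumes "subring_on R"
  shows "0 \<in> R" "1 \<in> R" "a \<in> R \<Longrightarrow> b \<in> R \<Longrightarrow> a + b \<in> R" "a \<in> R \<Longrightarrow> b \<in> R \<Longrightarrow> a * b \<in> R"
    "a \<in> R \<Longrightarrow> b \<in> R \<Longrightarrow> a - b \<in> R" "a \<in> R \<Longrightarrow> - a \<in> R" "a \<in> R \<Longrightarrow> a ^ n \<in> R"
    "(\<And>i. i \<in> A \<Longrightarrow> f i \<in> R) \<Longrightarrow> sum f A \<in> R" "(\<And>i. i \<in> A \<Longrightarrow> f i \<in> R) \<Longrightarrow> prod f A \<in> R"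
proof -
  show 1: "1 \<in> R" and m: "a \<in> R \<Longrightarrow> b \<in> R \<Longrightarrow> a * b \<in> R" and d: "a \<in> R \<Longrightarrow> b \<in> R \<Longrightarrow> a - b \<in> R" for a b
    using assms by (auto simp: subring_on_def)
  show z: "0 \<in> R" using d[OF 1 1] by simp
  show u: "a \<in> R \<Longrightarrow> - a \<in> R" for a using d[OF z, of a] by simp
  show p: "a \<in> R \<Longrightarrow> b \<in> R \<Longrightarrow> a + b \<in> R" for a b using d[of a "- b"] u[of b] by simp
  show "a \<in> R \<Longrightarrow> a ^ n \<in> R" by (induction n) (auto simp: 1 m)
  show "(\<And>i. i \<in> A \<Longrightarrow> f i \<in> R) \<Longrightarrow> sum f A \<in> R" by (induction A rule: infinite_finite_induct) (auto simp: z p)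
  show "(\<And>i. i \<in> A \<Longrightarrow> f i \<in> R) \<Longrightarrow> prod f A \<in> R" by (induction A rule: infinite_finite_induct) (auto simp: 1 m)
qed

definition mpoly_on :: "nat set \<Rightarrow> 'a::comm_ring_1 mpoly set" where
  "mpoly_on I = {p. \<forall>m\<in>Poly_Mapping.keys p. Poly_Mapping.keys m \<subseteq> I}"

lemma subring_mpoly_on: "subring_on (mpoly_on I)"
proof -
  have "a * b \<in> mpoly_on I" if "a \<in> mpoly_on I" "b \<in> mpoly_on I" for a b :: "'a mpoly"
    unfolding mpoly_on_def
  proof (intro CollectI ballI)
    fix m assume "m \<in> Poly_Mapping.keys (a * b)"
    then obtain k l where "m = k + l" "k \<in> Poly_Mapping.keys a" "l \<in> Poly_Mapping.keys b"
      using Poly_Mapping.keys_mult[of a b] by blast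
    then show "Poly_Mapping.keys m \<subseteq> I" using that Poly_Mapping.keys_add[of k l] unfolding mpoly_on_def by blast
  qed
  moreover have "a - b \<in> mpoly_on I" if "a \<in> mpoly_on I" "b \<in> mpoly_on I" for a b :: "'a mpoly"
  proof -
    have "Poly_Mapping.keys (a - b) \<subseteq> Poly_Mapping.keys a \<union> Poly_Mapping.keys b"
      by (auto simp: in_keys_iff lookup_minus)
    then show ?thesis using that by (auto simp: mpoly_on_def)
  qed
  moreover have "1 \<in> mpoly_on I" by (simp add: mpoly_on_def)
  ultimately show ?thesis unfolding subring_on_def by blast
qed

lemma mconst_in_mpoly_on: "mconst c \<in> mpoly_on I" by (simp add: mpoly_on_def mconst_def)

lemma mvar_in_mpoly_on: "i \<in> I \<Longrightarrow> mvar i \<in> mpoly_on I" by (simp add: mpoly_on_def mvar_def)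

lemma mpoly_on_mono: "I \<subseteq> J \<Longrightarrow> mpoly_on I \<subseteq> mpoly_on J" by (auto simp: mpoly_on_def)

lemma mpoly_on_empty: "p \<in> mpoly_on {} \<Longrightarrow> \<exists>c. p = mconst c"
proof -
  assume p: "p \<in> mpoly_on {}"
  have "Poly_Mapping.keys p \<subseteq> {0}" using p by (auto simp: mpoly_on_def)
  then have "p = mconst (Poly_Mapping.lookup p 0)"
    by (intro poly_mapping_eqI) (auto simp: mconst_def lookup_single when_def in_keys_iff subset_iff)
  then show ?thesis by blast
qed

lemma hom_eval_cong_on: "p \<in> mpoly_on I \<Longrightarrow> (\<And>i. i \<in> I \<Longrightarrow> x i = x' i) \<Longrightarrow> hom_eval \<phi> x p = hom_eval \<phi> x' p"
  by (rule hom_eval_cong) (auto simp: mpoly_on_def)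

lemma hom_eval_in_subring:
  assumes "subring_on R" "p \<in> mpoly_on I" "\<And>c. \<phi> c \<in> R" "\<And>i. i \<in> I \<Longrightarrow> x i \<in> R"
  shows "hom_eval \<phi> x p \<in> R"
  unfolding hom_eval_def monom_eval_def using assms(2-)
  by (intro subring_onD[OF assms(1)]) (auto simp: mpoly_on_def)

definition polys_on :: "'a::comm_ring_1 set \<Rightarrow> 'a poly set" where
  "polys_on R = {P. \<forall>i. coeff P i \<in> R}"

lemma polys_onI: "(\<And>i. coeff P i \<in> R) \<Longrightarrow> P \<in> polys_on R" by (simp add: polys_on_def)

lemma polys_onD: "P \<in> polys_on R \<Longrightarrow> coeff P i \<in> R" by (simp add: polys_on_def)

lemma subring_polys_on: "subring_on R \<Longrightarrow> subring_on (polys_on R)"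
proof -
  assume R: "subring_on R"
  have "P * Q \<in> polys_on R" if "P \<in> polys_on R" "Q \<in> polys_on R" for P Q
    using that by (intro polys_onI) (auto simp: coeff_mult polys_on_def intro!: subring_onD[OF R])
  moreover have "P - Q \<in> polys_on R" if "P \<in> polys_on R" "Q \<in> polys_on R" for P Q
    using that by (intro polys_onI) (auto simp: polys_on_def intro!: subring_onD[OF R])
  moreover have "1 \<in> polys_on R" by (intro polys_onI) (auto simp: coeff_1 intro: subring_onD[OF R])
  ultimately show ?thesis unfolding subring_on_def by blast
qed

lemma pCons_in_polys_on: "subring_on R \<Longrightarrow> pCons c P \<in> polys_on R \<longleftrightarrow> c \<in> R \<and> P \<in> polys_on R"
  by (auto simp: polys_on_def coeff_pCons split: nat.splits)

lemma const_in_polys_on: "subring_on R \<Longrightarrow> [:c:] \<in> polys_on R \<longleftrightarrow> c \<in> R"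
  by (simp add: pCons_in_polys_on) (simp add: polys_on_def subring_onD)

lemma X_in_polys_on: "subring_on R \<Longrightarrow> [:0, 1:] \<in> polys_on R"
  by (simp add: pCons_in_polys_on subring_onD) (simp add: polys_on_def subring_onD)

lemma smult_in_polys_on: "subring_on R \<Longrightarrow> c \<in> R \<Longrightarrow> P \<in> polys_on R \<Longrightarrow> smult c P \<in> polys_on R"
  by (auto simp: polys_on_def intro!: subring_onD)

lemma monom_in_polys_on: "subring_on R \<Longrightarrow> c \<in> R \<Longrightarrow> monom c k \<in> polys_on R"
  by (auto simp: polys_on_def intro!: subring_onD)

subsection \<open>Splitting off one variable\<close>

text \<open>The coefficients stay in the type of multivariate polynomials and are merely free of
  variable \<open>j\<close>; substituting \<open>mvar j\<close> undoes the splitting.\<close>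

definition split_var :: "nat \<Rightarrow> 'a::comm_ring_1 mpoly \<Rightarrow> 'a mpoly poly" where
  "split_var j p = hom_eval (\<lambda>c. [:mconst c:]) (\<lambda>i. if i = j then [:0, 1:] else [:mvar i:]) p"

lemma is_ring_hom_mC_poly: "is_ring_hom (\<lambda>c. [:mconst c :: 'a::comm_ring_1 mpoly:])"
  by (rule is_ring_hom_comp[OF is_ring_hom_mC is_ring_hom_const_poly])

lemma is_ring_hom_sp: "is_ring_hom (split_var j)"
  unfolding split_var_def[abs_def] by (rule is_ring_hom_ev[OF is_ring_hom_mC_poly])

lemma poly_sp: "poly (split_var j p) (mvar j) = p"
proof -
  have "poly (split_var j p) (mvar j) = hom_eval (\<lambda>c. poly [:mconst c:] (mvar j)) (\<lambda>i. poly (if i = j then [:0, 1:] else [:mvar i:]) (mvar j)) p"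
    unfolding split_var_def by (rule hom_eval_hom[OF is_ring_hom_poly])
  also have "\<dots> = hom_eval mconst mvar p" by (rule arg_cong2[of _ _ _ _ "\<lambda>u v. hom_eval u v p"]) auto
  finally show ?thesis by (simp add: hom_eval_mC_mV)
qed

lemma split_var_const:
  assumes "c \<in> mpoly_on I" "j \<notin> I"
  shows "split_var j c = [:c:]"
proof -
  have "split_var j c = hom_eval (\<lambda>c. [:mconst c:]) (\<lambda>i. [:mvar i:]) c"
    unfolding split_var_def by (rule hom_eval_cong_on[OF assms(1)]) (use assms(2) in auto)
  also have "\<dots> = [:hom_eval mconst mvar c:]" by (rule hom_eval_hom[OF is_ring_hom_const_poly, symmetric])
  finally show ?thesis by (simp add: hom_eval_mC_mV)
qed

lemma split_var_mV: "split_var j (mvar j) = [:0, 1:]"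
  unfolding split_var_def by (simp add: hom_eval_mV[OF is_ring_hom_mC_poly])

lemma split_var_poly:
  assumes "P \<in> polys_on (mpoly_on I)" "j \<notin> I"
  shows "split_var j (poly P (mvar j)) = P"
  using assms(1)
proof (induction P)
  case 0
  then show ?case by (simp add: is_ring_homD[OF is_ring_hom_sp])
next
  case (pCons c P)
  then have "c \<in> mpoly_on I" "P \<in> polys_on (mpoly_on I)"
    by (auto simp: pCons_in_polys_on[OF subring_mpoly_on])
  then show ?case using pCons.IH by (simp add: is_ring_homD[OF is_ring_hom_sp] split_var_const[OF _ assms(2)] split_var_mV)
qed

lemma split_var_in_polys_on: "p \<in> mpoly_on (insert j I) \<Longrightarrow> split_var j p \<in> polys_on (mpoly_on (I - {j}))"
  unfolding split_var_def
  by (rule hom_eval_in_subring[OF subring_polys_on[OF subring_mpoly_on]])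
    (auto simp: const_in_polys_on[OF subring_mpoly_on] mconst_in_mpoly_on X_in_polys_on[OF subring_mpoly_on] intro: mvar_in_mpoly_on)

lemma poly_in_mpoly_on: "P \<in> polys_on (mpoly_on I) \<Longrightarrow> poly P (mvar j) \<in> mpoly_on (insert j I)"
  unfolding poly_altdef using mpoly_on_mono[of I "insert j I"]
  by (intro subring_onD[OF subring_mpoly_on] mvar_in_mpoly_on) (auto simp: polys_on_def)

subsection \<open>Evaluation over the rationals\<close>

definition rat_eval :: "(nat \<Rightarrow> rat) \<Rightarrow> rat mpoly \<Rightarrow> rat" where "rat_eval x p = hom_eval (\<lambda>c. c) x p"

lemma is_ring_hom_evr: "is_ring_hom (rat_eval x)" unfolding rat_eval_def[abs_def] by (rule is_ring_hom_ev[OF is_ring_hom_id])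

lemma rat_eval_mC [simp]: "rat_eval x (mconst c) = c" by (simp add: rat_eval_def hom_eval_mC[OF is_ring_hom_id])

lemma rat_eval_mV [simp]: "rat_eval x (mvar i) = x i" by (simp add: rat_eval_def hom_eval_mV[OF is_ring_hom_id])

lemma rat_eval_poly: "rat_eval x (poly P a) = (\<Sum>i\<le>degree P. rat_eval x (coeff P i) * rat_eval x a ^ i)"
  unfolding poly_altdef by (simp add: is_ring_homD[OF is_ring_hom_evr])

lemma rat_eval_slice:
  assumes "p \<in> mpoly_on (insert j I)"
  shows "rat_eval (x(j := t)) p = (\<Sum>i\<le>degree (split_var j p). rat_eval x (coeff (split_var j p) i) * t ^ i)"
proof -
  have "rat_eval (x(j := t)) p = rat_eval (x(j := t)) (poly (split_var j p) (mvar j))" by (simp add: poly_sp)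
  then have "rat_eval (x(j := t)) p = (\<Sum>i\<le>degree (split_var j p). rat_eval (x(j := t)) (coeff (split_var j p) i) * t ^ i)" by (simp add: rat_eval_poly)
  moreover have "rat_eval (x(j := t)) (coeff (split_var j p) i) = rat_eval x (coeff (split_var j p) i)" for i
    unfolding rat_eval_def by (rule hom_eval_cong_on[OF polys_onD[OF split_var_in_polys_on[OF assms]]]) auto
  ultimately show ?thesis by simp
qed

lemma polynomial_function_zero:
  fixes c :: "nat \<Rightarrow> rat"
  assumes "\<And>t. (\<Sum>i\<le>n. c i * t ^ i) = 0" "i \<le> n"
  shows "c i = 0"
proof -
  define p where "p = (\<Sum>i\<le>n. monom (c i) i)"
  have "poly p t = 0" for t using assms(1)[of t] by (simp add: p_def poly_sum poly_monom)
  then have "p = 0" using poly_all_0_iff_0 by blast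
  then have "coeff p i = 0" by simp
  then show ?thesis using assms(2) by (simp add: p_def coeff_sum)
qed

text \<open>The field is infinite, so the coefficients with respect to the last variable vanish at
  all points, and induction applies to them.\<close>

lemma rat_eval_zero_imp_zero:
  "p \<in> mpoly_on {..<n} \<Longrightarrow> (\<And>x. rat_eval x p = 0) \<Longrightarrow> p = 0"
proof (induction n arbitrary: p)
  case 0
  then obtain c where p: "p = mconst c" using mpoly_on_empty[of p] by auto
  then have "c = 0" using 0(2)[of "\<lambda>_. 0"] by simp
  then show ?case by (simp add: p mconst_def)
next
  case (Suc n)
  have p: "p \<in> mpoly_on (insert n {..<n})" using Suc.prems(1) by (simp add: lessThan_Suc)
  have "coeff (split_var n p) i = 0" if i: "i \<le> degree (split_var n p)" for i
  proof (rule Suc.IH)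
    show "coeff (split_var n p) i \<in> mpoly_on {..<n}" using polys_onD[OF split_var_in_polys_on[OF p], of i] by simp
    show "rat_eval x (coeff (split_var n p) i) = 0" for x
      using polynomial_function_zero[where n = "degree (split_var n p)" and c = "\<lambda>i. rat_eval x (coeff (split_var n p) i)"] i
        rat_eval_slice[OF p, of x] Suc.prems(2) by simp
  qed
  then have "split_var n p = 0" by (intro poly_eqI) (metis coeff_0 coeff_eq_0 not_le)
  then show ?case using poly_sp[of n p] by simp
qed

subsection \<open>Degree bounds\<close>

definition monom_deg :: "(nat \<Rightarrow>\<^sub>0 nat) \<Rightarrow> nat" where
  "monom_deg m = (\<Sum>i\<in>Poly_Mapping.keys m. Poly_Mapping.lookup m i)"

text \<open>A bound rather than a degree: it is stable under cancellation, and zero needs no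
  convention.\<close>

definition total_deg_le :: "'a::zero mpoly \<Rightarrow> nat \<Rightarrow> bool" where
  "total_deg_le p E \<longleftrightarrow> (\<forall>m\<in>Poly_Mapping.keys p. monom_deg m \<le> E)"

lemma monom_deg_add: "monom_deg (m + m') = monom_deg m + monom_deg m'"
proof -
  let ?F = "Poly_Mapping.keys m \<union> Poly_Mapping.keys m'"
  have e: "monom_deg k = (\<Sum>i\<in>?F. Poly_Mapping.lookup k i)" if "Poly_Mapping.keys k \<subseteq> ?F" for k
    unfolding monom_deg_def using that by (intro sum.mono_neutral_left) (auto simp: in_keys_iff)
  show ?thesis using Poly_Mapping.keys_add[of m m'] by (simp add: e lookup_add sum.distrib)
qed

lemma total_deg_le_mult: "total_deg_le p E \<Longrightarrow> total_deg_le q E' \<Longrightarrow> total_deg_le (p * q) (E + E')"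
  unfolding total_deg_le_def using Poly_Mapping.keys_mult[of p q] by (fastforce simp: monom_deg_add intro: add_mono)

lemma total_deg_le_add: "total_deg_le p E \<Longrightarrow> total_deg_le q E \<Longrightarrow> total_deg_le (p + q) E"
  unfolding total_deg_le_def using Poly_Mapping.keys_add[of p q] by blast

lemma total_deg_le_diff: "total_deg_le (p :: 'a::ab_group_add mpoly) E \<Longrightarrow> total_deg_le q E \<Longrightarrow> total_deg_le (p - q) E"
  unfolding total_deg_le_def by (auto simp: in_keys_iff lookup_minus)

lemma total_deg_le_0 [simp]: "total_deg_le 0 E" by (simp add: total_deg_le_def)

lemma total_deg_le_1 [simp]: "total_deg_le 1 E" by (simp add: total_deg_le_def monom_deg_def)

lemma total_deg_le_mono: "total_deg_le p E \<Longrightarrow> E \<le> E' \<Longrightarrow> total_deg_le p E'" by (auto simp: total_deg_le_def)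

lemma total_deg_le_mC: "total_deg_le (mconst c) E" by (auto simp: total_deg_le_def mconst_def monom_deg_def)

lemma total_deg_le_mV: "total_deg_le (mvar i :: 'a::comm_ring_1 mpoly) 1" by (auto simp: total_deg_le_def mvar_def monom_deg_def)

lemma total_deg_le_sum: "(\<And>i. i \<in> A \<Longrightarrow> total_deg_le (f i) E) \<Longrightarrow> total_deg_le (sum f A) E"
  by (induction A rule: infinite_finite_induct) (auto intro: total_deg_le_add)

text \<open>Serves both for splitting off a variable and for restricting a polynomial to a line
  parallel to an axis.\<close>

lemma degree_ev_le:
  fixes x :: "nat \<Rightarrow> 'b::comm_ring_1 poly"
  assumes "total_deg_le p E" "\<And>c. degree (\<phi> c) = 0" "\<And>i. degree (x i) \<le> 1"
  shows "degree (hom_eval \<phi> x p) \<le> E"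
  unfolding hom_eval_def
proof (intro degree_sum_le finite_keys)
  fix m assume m: "m \<in> Poly_Mapping.keys p"
  have "degree (monom_eval x m) \<le> (\<Sum>i\<in>Poly_Mapping.keys m. degree (x i ^ Poly_Mapping.lookup m i))"
    unfolding monom_eval_def by (rule order_trans[OF degree_prod_sum_le]) (auto simp: o_def)
  also have "\<dots> \<le> (\<Sum>i\<in>Poly_Mapping.keys m. Poly_Mapping.lookup m i)"
  proof (intro sum_mono)
    fix i
    show "degree (x i ^ Poly_Mapping.lookup m i) \<le> Poly_Mapping.lookup m i"
      using order_trans[OF degree_power_le mult_le_mono1[OF assms(3)]] by simp
  qed
  also have "\<dots> \<le> E" using assms(1) m by (auto simp: total_deg_le_def monom_deg_def)
  finally show "degree (\<phi> (Poly_Mapping.lookup p m) * monom_eval x m) \<le> E"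
    using degree_mult_le[of "\<phi> (Poly_Mapping.lookup p m)" "monom_eval x m"] assms(2) by simp
qed

lemma degree_sp_le: "total_deg_le p E \<Longrightarrow> degree (split_var j p) \<le> E"
  unfolding split_var_def by (rule degree_ev_le) auto

definition coeffs_total_deg_le :: "'a::comm_ring_1 mpoly poly \<Rightarrow> nat \<Rightarrow> bool" where
  "coeffs_total_deg_le P E \<longleftrightarrow> (\<forall>k. total_deg_le (coeff P k) E)"

lemma coeffs_total_deg_le_mult: "coeffs_total_deg_le P E \<Longrightarrow> coeffs_total_deg_le Q E' \<Longrightarrow> coeffs_total_deg_le (P * Q) (E + E')"
  unfolding coeffs_total_deg_le_def coeff_mult by (auto intro!: total_deg_le_sum total_deg_le_mult)

lemma coeffs_total_deg_le_power: "coeffs_total_deg_le P E \<Longrightarrow> coeffs_total_deg_le (P ^ n) (E * n)"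
proof (induction n)
  case 0
  then show ?case by (auto simp: coeffs_total_deg_le_def coeff_1)
next
  case (Suc n)
  then show ?case using coeffs_total_deg_le_mult[of P E "P ^ n" "E * n"] by simp
qed

lemma coeffs_total_deg_le_prod: "(\<And>i. i \<in> A \<Longrightarrow> coeffs_total_deg_le (f i) (g i)) \<Longrightarrow> coeffs_total_deg_le (prod f A) (sum g A)"
proof (induction A rule: infinite_finite_induct)
  case (insert x F)
  then show ?case by (auto intro: coeffs_total_deg_le_mult)
qed (auto simp: coeffs_total_deg_le_def coeff_1)

lemma coeffs_total_deg_le_sp:
  assumes "total_deg_le p E"
  shows "coeffs_total_deg_le (split_var j p) E"
proof -
  let ?x = "\<lambda>i. if i = j then [:0, 1:] else [:mvar i :: 'a mpoly:]"
  have x: "coeffs_total_deg_le (?x i) 1" for i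
    by (auto simp: coeffs_total_deg_le_def coeff_pCons total_deg_le_mV[unfolded One_nat_def] split: nat.splits)
  have "coeffs_total_deg_le ([:mconst (Poly_Mapping.lookup p m):] * monom_eval ?x m) E" if m: "m \<in> Poly_Mapping.keys p" for m
  proof -
    have "coeffs_total_deg_le (monom_eval ?x m) (\<Sum>i\<in>Poly_Mapping.keys m. 1 * Poly_Mapping.lookup m i)"
      unfolding monom_eval_def by (intro coeffs_total_deg_le_prod coeffs_total_deg_le_power x)
    moreover have "coeffs_total_deg_le [:mconst (Poly_Mapping.lookup p m):] 0"
      by (auto simp: coeffs_total_deg_le_def coeff_pCons total_deg_le_mC split: nat.splits)
    ultimately have "coeffs_total_deg_le ([:mconst (Poly_Mapping.lookup p m):] * monom_eval ?x m) (0 + monom_deg m)"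
      unfolding monom_deg_def by (intro coeffs_total_deg_le_mult) auto
    moreover have "monom_deg m \<le> E" using assms m by (simp add: total_deg_le_def)
    ultimately show ?thesis by (auto simp: coeffs_total_deg_le_def intro: total_deg_le_mono)
  qed
  then show ?thesis unfolding split_var_def hom_eval_def coeffs_total_deg_le_def coeff_sum by (auto intro!: total_deg_le_sum)
qed

subsection \<open>Unique factorization in polynomial rings over a subring\<close>

text \<open>The type of multivariate polynomials has infinitely many variables; factorization in finitely many of them is divisibility relative to a subring.\<close>
definition dvd_in :: "'a::comm_ring_1 set \<Rightarrow> 'a \<Rightarrow> 'a \<Rightarrow> bool" where
  "dvd_in R a b \<longleftrightarrow> (\<exists>w\<in>R. b = a * w)"

definition unit_in :: "'a::comm_ring_1 set \<Rightarrow> 'a \<Rightarrow> bool" where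
  "unit_in R u \<longleftrightarrow> u \<in> R \<and> (\<exists>w\<in>R. u * w = 1)"

definition prime_in :: "'a::comm_ring_1 set \<Rightarrow> 'a \<Rightarrow> bool" where
  "prime_in R p \<longleftrightarrow> p \<in> R \<and> p \<noteq> 0 \<and> \<not> unit_in R p \<and>
     (\<forall>u\<in>R. \<forall>v\<in>R. dvd_in R p (u * v) \<longrightarrow> dvd_in R p u \<or> dvd_in R p v)"

text \<open>The factors are primes rather than irreducibles, so uniqueness of the factorization is
  implied.\<close>

definition ufd_on :: "'a::comm_ring_1 set \<Rightarrow> bool" where
  "ufd_on R \<longleftrightarrow> subring_on R \<and>
     (\<forall>x\<in>R. x \<noteq> 0 \<longrightarrow> (\<exists>c ps. unit_in R c \<and> (\<forall>p\<in>set ps. prime_in R p) \<and> x = c * prod_list ps))"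

lemma prod_list_in_subring: "subring_on R \<Longrightarrow> (\<And>p. p \<in> set ps \<Longrightarrow> p \<in> R) \<Longrightarrow> prod_list ps \<in> R"
  by (induction ps) (auto intro: subring_onD)

lemma prime_in_dvd_prod_list:
  assumes R: "subring_on R" and p: "prime_in R p" and qs: "\<And>q. q \<in> set qs \<Longrightarrow> q \<in> R" and c: "unit_in R c"
    and dvd: "dvd_in R p (c * prod_list qs)"
  shows "\<exists>q\<in>set qs. dvd_in R p q"
  using qs dvd
proof (induction qs)
  case Nil
  then obtain w where w: "w \<in> R" "c = p * w" by (auto simp: dvd_in_def)
  obtain c' where "c' \<in> R" "c * c' = 1" using c by (auto simp: unit_in_def)
  then have "p * (w * c') = 1" "w * c' \<in> R" using w by (auto simp: mult.assoc intro: subring_onD[OF R])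
  then show ?case using p by (auto simp: prime_in_def unit_in_def)
next
  case (Cons q qs)
  have in_R: "q \<in> R" "c * prod_list qs \<in> R" using Cons.prems(1) c
    by (auto simp: unit_in_def intro!: subring_onD[OF R] prod_list_in_subring[OF R])
  have "dvd_in R p (q * (c * prod_list qs))" using Cons.prems(2) by (simp add: mult.left_commute)
  then have "dvd_in R p q \<or> dvd_in R p (c * prod_list qs)" using p in_R by (auto simp: prime_in_def)
  then show ?case using Cons by auto
qed

text \<open>Write \<open>q = p * w\<close>. If the prime \<open>q\<close> divided \<open>w\<close>,
  cancelling it would make \<open>p\<close> a unit; so it divides \<open>p\<close>.\<close>

lemma prime_in_dvd_primeR:
  fixes p q :: "'a::idom"
  assumes R: "subring_on R" and p: "prime_in R p" and q: "prime_in R q" and dvd: "dvd_in R p q"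
  shows "dvd_in R q p"
proof -
  obtain w where w: "w \<in> R" "q = p * w" using dvd by (auto simp: dvd_in_def)
  have pR: "p \<in> R" and q0: "q \<noteq> 0" using p q by (auto simp: prime_in_def)
  have "dvd_in R q (p * w)" using w by (auto simp: dvd_in_def intro!: bexI[of _ 1] subring_onD[OF R])
  then have "dvd_in R q p \<or> dvd_in R q w" using q pR w(1) by (auto simp: prime_in_def)
  moreover have "\<not> dvd_in R q w"
  proof
    assume "dvd_in R q w"
    then obtain v where v: "v \<in> R" "w = q * v" by (auto simp: dvd_in_def)
    then have "q * (p * v) = q * 1" using w(2) by (simp add: algebra_simps)
    then have "p * v = 1" using q0 by (subst (asm) mult_left_cancel) auto
    then show False using p v(1) by (auto simp: prime_in_def unit_in_def)
  qed
  ultimately show ?thesis by blast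
qed

lemma coeff_const_mult: "coeff ([:c:] * P) i = c * coeff P i"
  by simp

lemma dvd_in_const_polys_on:
  assumes "subring_on R"
  shows "dvd_in (polys_on R) [:p:] P \<longleftrightarrow> (\<forall>i. dvd_in R p (coeff P i))"
proof
  assume "dvd_in (polys_on R) [:p:] P"
  then obtain W where W: "W \<in> polys_on R" "P = [:p:] * W" by (auto simp: dvd_in_def)
  have "coeff P i = p * coeff W i" for i unfolding W(2) by simp
  then show "\<forall>i. dvd_in R p (coeff P i)" using polys_onD[OF W(1)] by (auto simp: dvd_in_def)
next
  assume "\<forall>i. dvd_in R p (coeff P i)"
  then obtain w where w: "\<And>i. w i \<in> R" "\<And>i. coeff P i = p * w i" unfolding dvd_in_def by metis
  define W where "W = (\<Sum>i\<le>degree P. monom (w i) i)"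
  have "W \<in> polys_on R" unfolding W_def
    using w(1) by (intro subring_onD[OF subring_polys_on[OF assms]] monom_in_polys_on[OF assms])
  moreover have "P = [:p:] * W"
  proof (rule poly_eqI)
    fix i
    have cW: "coeff W i = (if i \<le> degree P then w i else 0)" by (auto simp: W_def coeff_sum)
    show "coeff P i = coeff ([:p:] * W) i"
      by (cases "i \<le> degree P") (auto simp: cW w(2)[symmetric] coeff_eq_0)
  qed
  ultimately show "dvd_in (polys_on R) [:p:] P" by (auto simp: dvd_in_def)
qed

lemma dvd_in_add: "subring_on R \<Longrightarrow> dvd_in R p a \<Longrightarrow> dvd_in R p b \<Longrightarrow> dvd_in R p (a + b)"
  by (auto simp: dvd_in_def distrib_left[symmetric] intro: subring_onD)

lemma dvd_in_diff: "subring_on R \<Longrightarrow> dvd_in R p a \<Longrightarrow> dvd_in R p b \<Longrightarrow> dvd_in R p (a - b)"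
  by (auto simp: dvd_in_def right_diff_distrib[symmetric] intro: subring_onD)

lemma dvd_in_mult: "subring_on R \<Longrightarrow> dvd_in R p a \<Longrightarrow> b \<in> R \<Longrightarrow> dvd_in R p (a * b)"
  by (auto simp: dvd_in_def mult.assoc intro: subring_onD)

lemma dvd_in_sum: "subring_on R \<Longrightarrow> (\<And>i. i \<in> A \<Longrightarrow> dvd_in R p (f i)) \<Longrightarrow> dvd_in R p (sum f A)"
  by (induction A rule: infinite_finite_induct) (auto intro: dvd_in_add simp: dvd_in_def[of _ _ 0] intro!: bexI[of _ 0] subring_onD)

text \<open>Gauss' lemma: if \<open>p\<close> divides neither factor, take the first coefficients
  not divisible by \<open>p\<close>, at indices i and j. In coefficient i + j of the product, theirs
  is the only term not divisible by \<open>p\<close>.\<close>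

lemma prime_in_const:
  fixes p :: "'a::idom"
  assumes R: "subring_on R" and p: "prime_in R p"
  shows "prime_in (polys_on R) [:p:]"
proof -
  have pR: "p \<in> R" "p \<noteq> 0" using p by (auto simp: prime_in_def)
  have "\<not> unit_in (polys_on R) [:p:]"
  proof
    assume "unit_in (polys_on R) [:p:]"
    then obtain W where "W \<in> polys_on R" "[:p:] * W = 1" by (auto simp: unit_in_def)
    then have "p * coeff W 0 = 1" "coeff W 0 \<in> R" using coeff_const_mult[of p W 0] polys_onD by (auto simp: coeff_1)
    then show False using p by (auto simp: prime_in_def unit_in_def)
  qed
  moreover have "dvd_in (polys_on R) [:p:] U \<or> dvd_in (polys_on R) [:p:] V"
    if U: "U \<in> polys_on R" and V: "V \<in> polys_on R" and dvd: "dvd_in (polys_on R) [:p:] (U * V)" for U V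
  proof (rule ccontr)
    assume "\<not> ?thesis"
    then have ex: "\<exists>i. \<not> dvd_in R p (coeff U i)" "\<exists>i. \<not> dvd_in R p (coeff V i)" by (auto simp: dvd_in_const_polys_on[OF R])
    define i where "i = (LEAST i. \<not> dvd_in R p (coeff U i))"
    define j where "j = (LEAST i. \<not> dvd_in R p (coeff V i))"
    have i: "\<not> dvd_in R p (coeff U i)" "\<And>k. k < i \<Longrightarrow> dvd_in R p (coeff U k)"
      unfolding i_def using LeastI_ex[OF ex(1)] not_less_Least by blast+
    have j: "\<not> dvd_in R p (coeff V j)" "\<And>k. k < j \<Longrightarrow> dvd_in R p (coeff V k)"
      unfolding j_def using LeastI_ex[OF ex(2)] not_less_Least by blast+
    have "coeff (U * V) (i + j) = (\<Sum>k\<le>i + j. coeff U k * coeff V (i + j - k))" by (rule coeff_mult)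
    also have "\<dots> = coeff U i * coeff V j + (\<Sum>k\<in>{..i + j} - {i}. coeff U k * coeff V (i + j - k))"
      by (subst sum.remove[of _ i]) auto
    finally have e: "coeff U i * coeff V j = coeff (U * V) (i + j) - (\<Sum>k\<in>{..i + j} - {i}. coeff U k * coeff V (i + j - k))"
      by simp
    have "dvd_in R p (\<Sum>k\<in>{..i + j} - {i}. coeff U k * coeff V (i + j - k))"
    proof (rule dvd_in_sum[OF R])
      fix k assume k: "k \<in> {..i + j} - {i}"
      show "dvd_in R p (coeff U k * coeff V (i + j - k))"
      proof (cases "k < i")
        case True
        then show ?thesis using i(2) polys_onD[OF V] by (intro dvd_in_mult[OF R]) auto
      next
        case False
        then have "dvd_in R p (coeff V (i + j - k) * coeff U k)" using j(2) k polys_onD[OF U] by (intro dvd_in_mult[OF R]) auto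
        then show ?thesis by (simp add: mult.commute)
      qed
    qed
    moreover have "dvd_in R p (coeff (U * V) (i + j))" using dvd by (auto simp: dvd_in_const_polys_on[OF R])
    ultimately have "dvd_in R p (coeff U i * coeff V j)" unfolding e by (intro dvd_in_diff[OF R])
    then show False using p i(1) j(1) polys_onD[OF U] polys_onD[OF V] by (auto simp: prime_in_def)
  qed
  ultimately show ?thesis using pR by (auto simp: prime_in_def const_in_polys_on[OF R])
qed

text \<open>Primitivity is tested on constant primes, which avoids contents and gcds.\<close>

definition primitive_in :: "'a::comm_ring_1 set \<Rightarrow> 'a poly \<Rightarrow> bool" where
  "primitive_in R P \<longleftrightarrow> P \<in> polys_on R \<and> (\<forall>p. prime_in R p \<longrightarrow> \<not> dvd_in (polys_on R) [:p:] P)"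

text \<open>The primes of \<open>c\<close> are cancelled one at a time: each divides Q W but not the
  primitive Q, hence it divides W.\<close>

lemma primitive_cancel_const:
  fixes Q U :: "'a::idom poly"
  assumes U: "ufd_on R" and Q: "primitive_in R Q" and c: "c \<in> R" "c \<noteq> 0" and U': "U \<in> polys_on R"
    and dvd: "dvd_in (polys_on R) Q ([:c:] * U)"
  shows "dvd_in (polys_on R) Q U"
proof -
  have R: "subring_on R" using U by (auto simp: ufd_on_def)
  note RX = subring_polys_on[OF R]
  obtain e ps where e: "unit_in R e" "\<forall>p\<in>set ps. prime_in R p" "c = e * prod_list ps" using U c by (auto simp: ufd_on_def)
  from e(2) dvd[unfolded e(3)] show ?thesis
  proof (induction ps)
    case Nil
    then obtain W where W: "W \<in> polys_on R" "[:e:] * U = Q * W" by (auto simp: dvd_in_def)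
    obtain e' where e': "e' \<in> R" "e * e' = 1" using e(1) by (auto simp: unit_in_def)
    have "U = [:e' * e:] * U" using e'(2) by (simp add: mult.commute)
    also have "\<dots> = [:e':] * ([:e:] * U)" by (simp add: mult.commute)
    also have "\<dots> = Q * ([:e':] * W)" unfolding W(2) by (simp add: mult.left_commute)
    finally show ?case using W(1) e'(1) by (auto simp: dvd_in_def intro!: bexI[of _ "[:e':] * W"] subring_onD(4)[OF RX] simp: const_in_polys_on[OF R] smult_in_polys_on[OF R])
  next
    case (Cons p ps)
    have p: "prime_in R p" using Cons.prems by simp
    then have p0: "p \<noteq> 0" by (simp add: prime_in_def)
    obtain W where W: "W \<in> polys_on R" "[:e * prod_list (p # ps):] * U = Q * W" using Cons.prems(2) by (auto simp: dvd_in_def)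
    define c' where "c' = e * prod_list ps"
    have c': "c' \<in> R" unfolding c'_def using e(1) Cons.prems(1)
      by (auto simp: unit_in_def prime_in_def intro!: subring_onD[OF R] prod_list_in_subring[OF R])
    have eq: "[:p:] * ([:c':] * U) = Q * W" using W(2) by (simp add: c'_def algebra_simps)
    moreover have "[:c':] * U \<in> polys_on R" using smult_in_polys_on[OF R c' U'] by simp
    ultimately have "dvd_in (polys_on R) [:p:] (Q * W)" unfolding dvd_in_def by (metis (no_types))
    moreover have "\<not> dvd_in (polys_on R) [:p:] Q" "Q \<in> polys_on R" using Q p by (auto simp: primitive_in_def)
    ultimately have "dvd_in (polys_on R) [:p:] W" using prime_in_const[OF R p] W(1) by (auto simp: prime_in_def)
    then obtain W' where W': "W' \<in> polys_on R" "W = [:p:] * W'" by (auto simp: dvd_in_def)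
    have "[:p:] * ([:c':] * U) = [:p:] * (Q * W')" using eq W'(2) by (simp add: mult.left_commute)
    then have "[:c':] * U = Q * W'" using p0 by (subst (asm) mult_left_cancel) auto
    then have "dvd_in (polys_on R) Q ([:c':] * U)" using W'(1) by (auto simp: dvd_in_def)
    then show ?case using Cons by (simp add: c'_def)
  qed
qed

text \<open>Constant primes dividing \<open>P\<close> are split off. Each is an associate of a prime
  factor of the leading coefficient, and the list of those factors shortens with every step.\<close>

lemma primitive_part:
  fixes P :: "'a::idom poly"
  assumes U: "ufd_on R" and P: "P \<in> polys_on R" "P \<noteq> 0"
  shows "\<exists>e P1. e \<in> R \<and> e \<noteq> 0 \<and> primitive_in R P1 \<and> P = [:e:] * P1"
proof -
  have R: "subring_on R" using U by (auto simp: ufd_on_def)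
  have "lead_coeff P \<in> R" "lead_coeff P \<noteq> 0" using P polys_onD by auto
  then obtain c ps where cps: "unit_in R c" "\<forall>p\<in>set ps. prime_in R p" "lead_coeff P = c * prod_list ps"
    using U by (auto simp: ufd_on_def)
  have cR: "c \<in> R" using cps(1) by (simp add: unit_in_def)
  from cps(2,3) P show ?thesis
  proof (induction "length ps" arbitrary: ps P)
    case (0 ps P)
    show ?case
    proof (intro exI conjI)
      show "primitive_in R P" unfolding primitive_in_def
      proof (intro conjI allI impI notI)
        fix p assume p: "prime_in R p" and "dvd_in (polys_on R) [:p:] P"
        then have "dvd_in R p (c * prod_list ps)" unfolding dvd_in_const_polys_on[OF R] 0(3)[symmetric] by blast
        then show False using prime_in_dvd_prod_list[OF R p _ cps(1), of ps] 0(1) by simp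
      qed (use 0 in simp)
    qed (auto intro: subring_onD[OF R])
  next
    case (Suc n ps P)
    show ?case
    proof (cases "primitive_in R P")
      case True
      then show ?thesis by (intro exI[of _ 1] exI[of _ P]) (auto intro: subring_onD[OF R])
    next
      case False
      then obtain p where p: "prime_in R p" "dvd_in (polys_on R) [:p:] P" using Suc.prems by (auto simp: primitive_in_def)
      then have "dvd_in R p (c * prod_list ps)" unfolding dvd_in_const_polys_on[OF R] Suc.prems(2)[symmetric] by blast
      then obtain q where q: "q \<in> set ps" "dvd_in R p q"
        using prime_in_dvd_prod_list[OF R p(1) _ cps(1), of ps] Suc.prems(1) by (auto simp: prime_in_def)
      have qp: "prime_in R q" using q Suc.prems(1) by blast
      then have q0: "q \<noteq> 0" "q \<in> R" by (auto simp: prime_in_def)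
      \<comment> \<open>\<open>p\<close> is traded for its associate \<open>q\<close>, which can be
        removed from the list literally.\<close>
      obtain s where s: "s \<in> R" "p = q * s" using prime_in_dvd_primeR[OF R p(1) qp q(2)] by (auto simp: dvd_in_def)
      obtain P' where P': "P' \<in> polys_on R" "P = [:p:] * P'" using p(2) by (auto simp: dvd_in_def)
      define P2 where "P2 = [:s:] * P'"
      have P2: "P2 \<in> polys_on R" unfolding P2_def using smult_in_polys_on[OF R s(1) P'(1)] by simp
      have PP2: "P = [:q:] * P2" unfolding P2_def P'(2) s(2) by (simp add: mult.commute)
      have split: "prod_list ps = q * prod_list (remove1 q ps)" using q(1)
        by (induction ps) (auto simp: mult.left_commute)
      have "lead_coeff P = q * lead_coeff P2" unfolding PP2 using q0(1) by simp
      then have "q * lead_coeff P2 = q * (c * prod_list (remove1 q ps))"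
        unfolding Suc.prems(2) split by (simp only: mult.left_commute)
      then have lc: "lead_coeff P2 = c * prod_list (remove1 q ps)" by (rule mult_left_cancel[OF q0(1), THEN iffD1])
      have "n = length (remove1 q ps)" using Suc(2) q(1) by (simp add: length_remove1)
      moreover have "\<forall>p\<in>set (remove1 q ps). prime_in R p" using Suc.prems(1) by (meson notin_set_remove1)
      moreover have "P2 \<noteq> 0" using PP2 Suc.prems by auto
      ultimately obtain e P1 where "e \<in> R" "e \<noteq> 0" "primitive_in R P1" "P2 = [:e:] * P1"
        using Suc(1)[of "remove1 q ps" P2] lc P2 by blast
      then show ?thesis using q0 PP2
        by (intro exI[of _ "q * e"] exI[of _ P1]) (auto intro: subring_onD[OF R] simp: mult.commute)
    qed
  qed
qed

lemma pseudo_division_on: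
  fixes W T :: "'a::idom poly"
  assumes R: "subring_on R" and W: "W \<in> polys_on R" "W \<noteq> 0" and T: "T \<in> polys_on R"
  shows "\<exists>c Y Z. c \<in> R \<and> c \<noteq> 0 \<and> Y \<in> polys_on R \<and> Z \<in> polys_on R \<and> [:c:] * T = Y * W + Z \<and> (Z = 0 \<or> degree Z < degree W)"
  using T
proof (induction "degree T" arbitrary: T rule: less_induct)
  case less
  note RX = subring_polys_on[OF R]
  show ?case
  proof (cases "T = 0 \<or> degree T < degree W")
    case True
    then show ?thesis using less.prems
      by (intro exI[of _ 1] exI[of _ 0] exI[of _ T]) (auto intro: subring_onD[OF R] subring_onD[OF RX])
  next
    case False
    define l where "l = lead_coeff W"
    define k where "k = lead_coeff T"
    define d where "d = degree T - degree W"
    define T' where "T' = [:l:] * T - monom k d * W"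
    have lk: "l \<in> R" "k \<in> R" "l \<noteq> 0" "k \<noteq> 0" using polys_onD[OF W(1)] polys_onD[OF less.prems] W False by (auto simp: l_def k_def)
    have T': "T' \<in> polys_on R" unfolding T'_def using lk less.prems W
      by (intro subring_onD[OF RX] monom_in_polys_on[OF R]) (auto simp: const_in_polys_on[OF R])
    have step: "\<exists>c Y Z. c \<in> R \<and> c \<noteq> 0 \<and> Y \<in> polys_on R \<and> Z \<in> polys_on R \<and> [:c:] * T' = Y * W + Z \<and> (Z = 0 \<or> degree Z < degree W)"
    proof (cases "T' = 0")
      case True
      then show ?thesis by (intro exI[of _ 1] exI[of _ 0]) (auto intro: subring_onD[OF R] subring_onD[OF RX])
    next
      case T'0: False
      show ?thesis
      proof (cases "degree T = 0")
        case True
        then have "degree W = 0" "d = 0" using False by (auto simp: d_def)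
        then obtain w t where "W = [:w:]" "T = [:t:]" using True by (metis degree_eq_zeroE)
        then have "T' = 0" using \<open>d = 0\<close> by (simp add: T'_def l_def k_def monom_0 mult.commute)
        then show ?thesis using T'0 by simp
      next
        case dT: False
        have "degree T' < degree T"
        proof (rule degree_lessI)
          show "T' \<noteq> 0 \<or> degree T > 0" using dT by simp
          show "\<forall>i\<ge>degree T. coeff T' i = 0"
          proof (intro allI impI)
            fix i assume i: "i \<ge> degree T"
            have dW: "degree T = d + degree W" using False by (simp add: d_def)
            show "coeff T' i = 0"
            proof (cases "i = degree T")
              case True
              then show ?thesis unfolding T'_def dW using dW
                by (simp add: coeff_monom_mult l_def k_def)
            next
              case False
              then show ?thesis unfolding T'_def using i dW
                by (simp add: coeff_monom_mult coeff_eq_0)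
            qed
          qed
        qed
        then show ?thesis using less.hyps T' by blast
      qed
    qed
    then obtain c Y Z where h: "c \<in> R" "c \<noteq> 0" "Y \<in> polys_on R" "Z \<in> polys_on R" "[:c:] * T' = Y * W + Z" "Z = 0 \<or> degree Z < degree W"
      by blast
    have "[:c * l:] * T = [:c:] * T' + [:c:] * (monom k d * W)" by (simp add: T'_def algebra_simps)
    also have "\<dots> = (Y + [:c:] * monom k d) * W + Z" unfolding h(5) by (simp add: algebra_simps)
    finally have "[:c * l:] * T = (Y + [:c:] * monom k d) * W + Z" .
    moreover have "Y + [:c:] * monom k d \<in> polys_on R" using h lk
      by (intro subring_onD[OF RX] monom_in_polys_on[OF R]) (auto simp: const_in_polys_on[OF R])
    ultimately show ?thesis using h lk by (intro exI[of _ "c * l"] exI conjI) (auto intro: subring_onD[OF R])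
  qed
qed

lemma dvd_in_trans: "subring_on R \<Longrightarrow> dvd_in R a b \<Longrightarrow> dvd_in R b c \<Longrightarrow> dvd_in R a c"
  by (auto simp: dvd_in_def mult.assoc intro: subring_onD)

text \<open>As in Gauss' lemma, but without passing to the field of fractions: if \<open>Q\<close> divides \<open>A0 V\<close> but not \<open>A0\<close>, then an element of least degree of the ideal generated by \<open>A0\<close> and \<open>Q\<close> is a constant.\<close>
lemma prime_of_primitive_irreducible:
  fixes Q :: "'a::idom poly"
  assumes U: "ufd_on R" and Q: "primitive_in R Q" "degree Q > 0"
    and irr: "\<And>Q1 Q2. Q1 \<in> polys_on R \<Longrightarrow> Q2 \<in> polys_on R \<Longrightarrow> Q = Q1 * Q2 \<Longrightarrow> degree Q1 = 0 \<or> degree Q2 = 0"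
  shows "prime_in (polys_on R) Q"
proof -
  have R: "subring_on R" using U by (auto simp: ufd_on_def)
  note RX = subring_polys_on[OF R]
  have QR: "Q \<in> polys_on R" using Q by (simp add: primitive_in_def)
  have Q0: "Q \<noteq> 0" using Q(2) by auto
  have nu: "\<not> unit_in (polys_on R) Q"
  proof
    assume "unit_in (polys_on R) Q"
    then obtain W where "Q * W = 1" by (auto simp: unit_in_def)
    then have "degree Q + degree W = 0" using degree_mult_eq[of Q W] by (metis degree_1 mult_zero_left mult_zero_right zero_neq_one)
    then show False using Q(2) by simp
  qed
  have "dvd_in (polys_on R) Q V" if uv: "A0 \<in> polys_on R" "V \<in> polys_on R" "dvd_in (polys_on R) Q (A0 * V)" and nd: "\<not> dvd_in (polys_on R) Q A0" for A0 V
  proof -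
    define S where "S = {W. W \<noteq> 0 \<and> (\<exists>A\<in>polys_on R. \<exists>B\<in>polys_on R. W = A * A0 + B * Q)}"
    have SI: "W \<in> S" if "W \<noteq> 0" "W = A * A0 + B * Q" "A \<in> polys_on R" "B \<in> polys_on R" for W A B
      unfolding S_def
      by (rule CollectI, rule conjI[OF that(1)], rule bexI[OF _ that(3)], rule bexI[OF _ that(4)], rule that(2))
    have inS: "Q \<in> S" by (rule SI[of _ 0 1]) (use Q0 subring_onD(1,2)[OF RX] in simp_all)
    define n where "n = (LEAST n. \<exists>W\<in>S. degree W = n)"
    have "\<exists>W\<in>S. degree W = n" unfolding n_def by (rule LeastI_ex) (use inS in blast)
    then obtain W where W: "W \<in> S" "degree W = n" by blast
    have minW: "degree W \<le> degree Z" if "Z \<in> S" for Z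
      unfolding W(2) n_def by (rule Least_le) (use that in blast)
    obtain A B where AB: "A \<in> polys_on R" "B \<in> polys_on R" "W = A * A0 + B * Q" and W0: "W \<noteq> 0" using W(1) by (auto simp: S_def)
    have WR: "W \<in> polys_on R" unfolding AB(3) using AB uv QR by (intro subring_onD[OF RX])
    have mult: "\<exists>c Y. c \<in> R \<and> c \<noteq> 0 \<and> Y \<in> polys_on R \<and> [:c:] * T = Y * W"
      if T: "T = A' * A0 + B' * Q" "A' \<in> polys_on R" "B' \<in> polys_on R" for T A' B'
    proof -
      have TR: "T \<in> polys_on R" unfolding T(1) using T uv QR by (intro subring_onD[OF RX])
      obtain c Y Z where h: "c \<in> R" "c \<noteq> 0" "Y \<in> polys_on R" "Z \<in> polys_on R" "[:c:] * T = Y * W + Z" "Z = 0 \<or> degree Z < degree W"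
        using pseudo_division_on[OF R WR W0 TR] by blast
      have "Z = 0"
      proof (rule ccontr)
        assume Z0: "Z \<noteq> 0"
        have "Z = [:c:] * T - Y * W" using h(5) by simp
        also have "\<dots> = ([:c:] * A' - Y * A) * A0 + ([:c:] * B' - Y * B) * Q" unfolding T(1) AB(3) by (simp add: algebra_simps)
        finally have "Z = ([:c:] * A' - Y * A) * A0 + ([:c:] * B' - Y * B) * Q" .
        moreover have "[:c:] * A' - Y * A \<in> polys_on R" "[:c:] * B' - Y * B \<in> polys_on R"
          by (intro subring_onD(4,5)[OF RX] const_in_polys_on[OF R, THEN iffD2] h T AB)+
        ultimately have "Z \<in> S" by (rule SI[OF Z0])
        then show False using minW[of Z] h(6) Z0 by simp
      qed
      then show ?thesis using h by auto
    qed
    have "Q = 0 * A0 + 1 * Q" "A0 = 1 * A0 + 0 * Q" by simp_all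
    note mQ = mult[OF this(1) subring_onD(1,2)[OF RX]] and mA = mult[OF this(2) subring_onD(2,1)[OF RX]]
    obtain c Y where cY: "c \<in> R" "c \<noteq> 0" "Y \<in> polys_on R" "[:c:] * Q = Y * W" using mQ by blast
    obtain c' Y' where cY': "c' \<in> R" "c' \<noteq> 0" "Y' \<in> polys_on R" "[:c':] * A0 = Y' * W" using mA by blast
    show ?thesis
    proof (cases "degree W = 0")
      \<comment> \<open>The constant case: w V = A A0 V + B Q V is a multiple of \<open>Q\<close>,
        and \<open>w\<close> cancels by primitivity.\<close>
      case True
      then obtain w where w: "W = [:w:]" by (metis degree_eq_zeroE)
      have "w \<in> R" "w \<noteq> 0" using WR W0 w by (auto simp: const_in_polys_on[OF R])
      obtain X where X: "X \<in> polys_on R" "A0 * V = Q * X" using uv(3) by (auto simp: dvd_in_def)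
      have "[:w:] * V = A * (A0 * V) + B * Q * V" unfolding w[symmetric] AB(3) by (simp add: algebra_simps)
      also have "\<dots> = Q * (A * X + B * V)" unfolding X(2) by (simp add: algebra_simps)
      finally have "dvd_in (polys_on R) Q ([:w:] * V)"
        using AB X uv by (auto simp: dvd_in_def intro!: bexI[of _ "A * X + B * V"] subring_onD[OF RX])
      then show ?thesis using primitive_cancel_const[OF U Q(1) \<open>w \<in> R\<close> \<open>w \<noteq> 0\<close> uv(2)] by blast
    next
      \<comment> \<open>A nonconstant \<open>W\<close> divides \<open>Q\<close> and
        \<open>A0\<close> up to constants. By irreducibility its primitive part divides
        \<open>Q\<close> with a constant cofactor, which is a unit because \<open>Q\<close> is
        primitive. So \<open>Q\<close> would divide \<open>A0\<close>.\<close>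
      case False
      obtain e W1 where W1: "e \<in> R" "e \<noteq> 0" "primitive_in R W1" "W = [:e:] * W1" using primitive_part[OF U WR W0] by blast
      have W1R: "W1 \<in> polys_on R" using W1 by (simp add: primitive_in_def)
      have dW1: "degree W1 = degree W" using W1 by simp
      have "[:c:] * Q = W1 * ([:e:] * Y)" using cY(4) W1(4) by (simp add: algebra_simps)
      then have "dvd_in (polys_on R) W1 ([:c:] * Q)" using cY W1 by (auto simp: dvd_in_def smult_in_polys_on[OF R] intro!: bexI[of _ "[:e:] * Y"])
      then have "dvd_in (polys_on R) W1 Q" using primitive_cancel_const[OF U W1(3) cY(1,2) QR] by blast
      then obtain Y1 where Y1: "Y1 \<in> polys_on R" "Q = W1 * Y1" by (auto simp: dvd_in_def)
      have "degree Y1 = 0" using irr[OF W1R Y1] dW1 False by simp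
      then obtain y where y: "Y1 = [:y:]" by (metis degree_eq_zeroE)
      have yR: "y \<in> R" "y \<noteq> 0" using Y1 y Q0 by (auto simp: const_in_polys_on[OF R])
      obtain u ps where u: "unit_in R u" "\<forall>p\<in>set ps. prime_in R p" "y = u * prod_list ps" using U yR by (auto simp: ufd_on_def)
      have "ps = []"
      proof (rule ccontr)
        assume "ps \<noteq> []"
        then obtain p ps' where ps: "ps = p # ps'" by (cases ps) auto
        have "Q = [:p:] * ([:u * prod_list ps':] * W1)" using Y1(2) y u(3) ps by (simp add: algebra_simps)
        moreover have "u * prod_list ps' \<in> R" using u ps
          by (auto simp: unit_in_def prime_in_def intro!: subring_onD[OF R] prod_list_in_subring[OF R])
        ultimately have "dvd_in (polys_on R) [:p:] Q" using W1R
          by (auto simp: dvd_in_def mult.commute intro!: bexI[of _ "[:u * prod_list ps':] * W1"] smult_in_polys_on[OF R])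
        then show False using Q(1) u(2) ps by (auto simp: primitive_in_def)
      qed
      then obtain y' where y': "y' \<in> R" "y * y' = 1" using u by (auto simp: unit_in_def)
      have "W1 = [:y * y':] * W1" using y'(2) by simp
      also have "\<dots> = Q * [:y':]" using Y1(2) y by (simp add: algebra_simps)
      finally have W1Q: "W1 = Q * [:y':]" .
      have "[:c':] * A0 = Y' * ([:e:] * (Q * [:y':]))" unfolding cY'(4) W1(4) using W1Q by simp
      also have "\<dots> = Q * (Y' * ([:e:] * [:y':]))" by (simp only: mult_ac)
      finally have eq: "[:c':] * A0 = Q * (Y' * ([:e:] * [:y':]))" .
      have mem: "Y' * ([:e:] * [:y':]) \<in> polys_on R"
        by (intro subring_onD(4)[OF RX] cY' const_in_polys_on[OF R, THEN iffD2] W1 y')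
      have "dvd_in (polys_on R) Q ([:c':] * A0)" unfolding dvd_in_def by (rule bexI, rule eq, rule mem)
      then show ?thesis using primitive_cancel_const[OF U Q(1) cY'(1,2) uv(1)] nd by blast
    qed
  qed
  then show ?thesis unfolding prime_in_def using QR Q0 nu by blast
qed

text \<open>Induction on the degree: a polynomial either splits into factors of smaller positive
  degree, or its primitive part is prime and the remaining constant is factored in
  \<open>R\<close>.\<close>

theorem ufd_on_polys_on:
  fixes R :: "'a::idom set"
  assumes U: "ufd_on R"
  shows "ufd_on (polys_on R)"
proof -
  have R: "subring_on R" using U by (auto simp: ufd_on_def)
  note RX = subring_polys_on[OF R]
  have const: "\<exists>c ps. unit_in (polys_on R) c \<and> (\<forall>p\<in>set ps. prime_in (polys_on R) p) \<and> [:e:] = c * prod_list ps"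
    if e: "e \<in> R" "e \<noteq> 0" for e
  proof -
    obtain c ps where c: "unit_in R c" "\<forall>p\<in>set ps. prime_in R p" "e = c * prod_list ps" using U e by (auto simp: ufd_on_def)
    obtain c' where c': "c' \<in> R" "c \<in> R" "c * c' = 1" using c by (auto simp: unit_in_def)
    have "unit_in (polys_on R) [:c:]" unfolding unit_in_def using c'
      by (auto simp: const_in_polys_on[OF R] one_pCons intro!: bexI[of _ "[:c':]"])
    moreover have "\<forall>p\<in>set (map (\<lambda>p. [:p:]) ps). prime_in (polys_on R) p" using c(2) prime_in_const[OF R] by auto
    moreover have "[:c * prod_list ps:] = [:c:] * prod_list (map (\<lambda>p. [:p:]) ps)" for c
      by (induction ps arbitrary: c) (simp_all add: one_pCons mult.assoc[symmetric], simp add: mult.commute)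
    ultimately show ?thesis using c(3) by blast
  qed
  have "\<exists>c ps. unit_in (polys_on R) c \<and> (\<forall>p\<in>set ps. prime_in (polys_on R) p) \<and> P = c * prod_list ps"
    if "P \<in> polys_on R" "P \<noteq> 0" for P
    using that
  proof (induction "degree P" arbitrary: P rule: less_induct)
    case less
    show ?case
    proof (cases "degree P = 0")
      case True
      then obtain e where "P = [:e:]" by (metis degree_eq_zeroE)
      then show ?thesis using const[of e] less.prems by (auto simp: const_in_polys_on[OF R])
    next
      case dP: False
      show ?thesis
      proof (cases "\<exists>P1\<in>polys_on R. \<exists>P2\<in>polys_on R. P = P1 * P2 \<and> degree P1 \<noteq> 0 \<and> degree P2 \<noteq> 0")
        case True
        then obtain P1 P2 where P12: "P1 \<in> polys_on R" "P2 \<in> polys_on R" "P = P1 * P2" "degree P1 \<noteq> 0" "degree P2 \<noteq> 0" by blast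
        then have nz: "P1 \<noteq> 0" "P2 \<noteq> 0" by auto
        then have "degree P = degree P1 + degree P2" using P12(3) degree_mult_eq by blast
        then have "degree P1 < degree P" "degree P2 < degree P" using P12 by auto
        then obtain c1 ps1 c2 ps2 where h: "unit_in (polys_on R) c1" "\<forall>p\<in>set ps1. prime_in (polys_on R) p" "P1 = c1 * prod_list ps1"
            "unit_in (polys_on R) c2" "\<forall>p\<in>set ps2. prime_in (polys_on R) p" "P2 = c2 * prod_list ps2"
          using less.hyps[of P1] less.hyps[of P2] P12 nz by blast
        have "unit_in (polys_on R) (c1 * c2)"
        proof -
          obtain w1 w2 where "c1 \<in> polys_on R" "c2 \<in> polys_on R" "w1 \<in> polys_on R" "w2 \<in> polys_on R" "c1 * w1 = 1" "c2 * w2 = 1"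
            using h by (auto simp: unit_in_def)
          moreover from this have "(c1 * c2) * (w1 * w2) = 1" by (metis mult.assoc mult.commute mult_1_right)
          ultimately show ?thesis unfolding unit_in_def using subring_onD(4)[OF RX] by blast
        qed
        moreover have "P = (c1 * c2) * prod_list (ps1 @ ps2)" using P12(3) h(3,6) by (simp add: mult_ac)
        ultimately show ?thesis using h(2,5) by (intro exI[of _ "c1 * c2"] exI[of _ "ps1 @ ps2"]) auto
      next
        case irr: False
        obtain e P1 where P1: "e \<in> R" "e \<noteq> 0" "primitive_in R P1" "P = [:e:] * P1" using primitive_part[OF U less.prems] by blast
        have "prime_in (polys_on R) P1"
        proof (rule prime_of_primitive_irreducible[OF U P1(3)])
          show "degree P1 > 0" using dP P1 by simp
          fix Q1 Q2 assume Q: "Q1 \<in> polys_on R" "Q2 \<in> polys_on R" "P1 = Q1 * Q2"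
          have "P = ([:e:] * Q1) * Q2" unfolding P1(4) Q(3) by (simp add: mult.assoc)
          moreover have "[:e:] * Q1 \<in> polys_on R" using Q P1 by (simp add: smult_in_polys_on[OF R])
          ultimately have "degree ([:e:] * Q1) = 0 \<or> degree Q2 = 0" using irr Q(2) by blast
          then show "degree Q1 = 0 \<or> degree Q2 = 0" using P1(2) by simp
        qed
        moreover obtain c ps where "unit_in (polys_on R) c" "\<forall>p\<in>set ps. prime_in (polys_on R) p" "[:e:] = c * prod_list ps"
          using const[OF P1(1,2)] by blast
        ultimately show ?thesis unfolding P1(4) by (intro exI[of _ c] exI[of _ "P1 # ps"]) (auto simp: mult_ac)
      qed
    qed
  qed
  then show ?thesis unfolding ufd_on_def using RX by blast
qed

subsection \<open>Primes among multivariate polynomials\<close>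

text \<open>\<open>h\<close> and \<open>k\<close> need to be inverse to each other only between
  \<open>R\<close> and \<open>R'\<close>, not on the whole types: \<open>split_var\<close> and
  substitution are related in this way.\<close>

lemma dvd_in_transfer:
  assumes h: "is_ring_hom h" and k: "is_ring_hom k" and hR: "\<And>x. x \<in> R \<Longrightarrow> h x \<in> R' \<and> k (h x) = x"
    and kR: "\<And>y. y \<in> R' \<Longrightarrow> k y \<in> R \<and> h (k y) = y" and ab: "a \<in> R" "b \<in> R"
  shows "dvd_in R' (h a) (h b) \<longleftrightarrow> dvd_in R a b"
proof
  assume "dvd_in R' (h a) (h b)"
  then obtain w where w: "w \<in> R'" "h b = h a * w" by (auto simp: dvd_in_def)
  have "k (h b) = k (h a) * k w" unfolding w(2) by (simp add: is_ring_homD[OF k])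
  then have "b = a * k w" using hR ab by simp
  then show "dvd_in R a b" using kR[OF w(1)] by (auto simp: dvd_in_def)
next
  assume "dvd_in R a b"
  then obtain w where w: "w \<in> R" "b = a * w" by (auto simp: dvd_in_def)
  then have "h b = h a * h w" by (simp add: is_ring_homD[OF h])
  then show "dvd_in R' (h a) (h b)" using hR[OF w(1)] by (auto simp: dvd_in_def)
qed

lemma unit_in_iff_dvdR: "unit_in R u \<longleftrightarrow> u \<in> R \<and> dvd_in R u 1"
  by (auto simp: unit_in_def dvd_in_def)

lemma prime_in_transfer:
  assumes h: "is_ring_hom h" and k: "is_ring_hom k" and hR: "\<And>x. x \<in> R \<Longrightarrow> h x \<in> R' \<and> k (h x) = x"
    and kR: "\<And>y. y \<in> R' \<Longrightarrow> k y \<in> R \<and> h (k y) = y" and R: "subring_on R" and p: "prime_in R p"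
  shows "prime_in R' (h p)"
proof -
  have tr: "dvd_in R' (h a) (h b) \<longleftrightarrow> dvd_in R a b" if "a \<in> R" "b \<in> R" for a b
    by (rule dvd_in_transfer[OF h k]) (use hR kR that in auto)
  have pR: "p \<in> R" "p \<noteq> 0" "\<not> dvd_in R p 1" using p by (auto simp: prime_in_def unit_in_iff_dvdR)
  have "h p \<noteq> 0" using hR[OF pR(1)] pR(2) is_ring_homD(1)[OF k] by metis
  moreover have "\<not> dvd_in R' (h p) (h 1)" using tr[OF pR(1) subring_onD(2)[OF R]] pR(3) by simp
  moreover have "dvd_in R' (h p) u \<or> dvd_in R' (h p) v" if uv: "u \<in> R'" "v \<in> R'" "dvd_in R' (h p) (u * v)" for u v
  proof -
    have "u * v = h (k u * k v)" using kR uv by (simp add: is_ring_homD[OF h])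
    moreover have "k u * k v \<in> R" using kR uv by (auto intro: subring_onD[OF R])
    ultimately have "dvd_in R p (k u * k v)" using tr[OF pR(1)] uv(3) by metis
    then have "dvd_in R p (k u) \<or> dvd_in R p (k v)" using p kR uv by (auto simp: prime_in_def)
    then have "dvd_in R' (h p) (h (k u)) \<or> dvd_in R' (h p) (h (k v))" using tr[OF pR(1)] kR uv by metis
    then show ?thesis using kR uv by simp
  qed
  ultimately show ?thesis unfolding prime_in_def unit_in_iff_dvdR using hR[OF pR(1)] is_ring_homD(2)[OF h] by simp
qed

lemma ufd_on_transfer:
  assumes h: "is_ring_hom h" and k: "is_ring_hom k" and hR: "\<And>x. x \<in> R \<Longrightarrow> h x \<in> R' \<and> k (h x) = x"
    and kR: "\<And>y. y \<in> R' \<Longrightarrow> k y \<in> R \<and> h (k y) = y" and R': "subring_on R'" and U: "ufd_on R"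
  shows "ufd_on R'"
  unfolding ufd_on_def
proof (intro conjI ballI impI R')
  fix y assume y: "y \<in> R'" "y \<noteq> 0"
  have R: "subring_on R" using U by (simp add: ufd_on_def)
  have "k y \<in> R" "k y \<noteq> 0" using kR[OF y(1)] y(2) is_ring_homD(1)[OF h] by auto
  then obtain c ps where c: "unit_in R c" "\<forall>p\<in>set ps. prime_in R p" "k y = c * prod_list ps" using U by (auto simp: ufd_on_def)
  have "h (prod_list qs) = prod_list (map h qs)" for qs by (induction qs) (auto simp: is_ring_homD[OF h])
  then have "y = h c * prod_list (map h ps)" using kR[OF y(1)] c(3) by (metis is_ring_homD(4)[OF h])
  moreover have "unit_in R' (h c)"
    using c(1) hR dvd_in_transfer[OF h k hR kR _ subring_onD(2)[OF R], of c] is_ring_homD(2)[OF h] by (auto simp: unit_in_iff_dvdR)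
  moreover have "\<forall>p\<in>set (map h ps). prime_in R' p" using c(2) prime_in_transfer[OF h k hR kR R] by auto
  ultimately show "\<exists>c ps. unit_in R' c \<and> (\<forall>p\<in>set ps. prime_in R' p) \<and> y = c * prod_list ps" by blast
qed

lemma split_iso:
  assumes "j \<notin> I"
  shows "x \<in> mpoly_on (insert j I) \<Longrightarrow> split_var j x \<in> polys_on (mpoly_on I) \<and> poly (split_var j x) (mvar j) = x"
    and "P \<in> polys_on (mpoly_on I) \<Longrightarrow> poly P (mvar j) \<in> mpoly_on (insert j I) \<and> split_var j (poly P (mvar j)) = P"
  using split_var_in_polys_on[of x j I] poly_in_mpoly_on[of P I j] split_var_poly[of P I j] assms by (auto simp: poly_sp)

text \<open>Starts from the field of rationals, where nonzero elements are units, and adjoins one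
  variable at a time.\<close>

theorem ufd_on_mpoly_on: "ufd_on (mpoly_on {..<n} :: rat mpoly set)"
proof (induction n)
  case 0
  have "\<exists>c ps. unit_in (mpoly_on {}) c \<and> (\<forall>p\<in>set ps. prime_in (mpoly_on {}) p) \<and> x = c * prod_list ps"
    if x: "x \<in> mpoly_on {}" "x \<noteq> 0" for x :: "rat mpoly"
  proof -
    obtain c where c: "x = mconst c" using mpoly_on_empty[OF x(1)] by blast
    then have "c \<noteq> 0" using x(2) by (auto simp: mconst_def)
    then have "x * mconst (1 / c) = 1" unfolding c by (simp add: mconst_def mult_single)
    then have "unit_in (mpoly_on {}) x" using x(1) mconst_in_mpoly_on by (auto simp: unit_in_def)
    then show ?thesis by (intro exI[of _ x] exI[of _ "[]"]) auto
  qed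
  then show ?case unfolding ufd_on_def using subring_mpoly_on by (simp add: lessThan_def)
next
  case (Suc n)
  have n: "n \<notin> {..<n}" by simp
  have "ufd_on (mpoly_on (insert n {..<n}) :: rat mpoly set)"
    by (rule ufd_on_transfer[OF is_ring_hom_poly is_ring_hom_sp split_iso(2)[OF n] split_iso(1)[OF n] subring_mpoly_on ufd_on_polys_on[OF Suc]])
  then show ?case by (simp add: lessThan_Suc)
qed

text \<open>An inverse might a priori involve other variables; setting those to 0 produces one that
  does not.\<close>

lemma unit_in_mpoly_on:
  fixes u :: "rat mpoly"
  assumes "u \<in> mpoly_on I" "u dvd 1"
  shows "unit_in (mpoly_on I) u"
proof -
  obtain w where w: "1 = u * w" using assms(2) by blast
  define \<pi> where "\<pi> = hom_eval mconst (\<lambda>i. if i \<in> I then mvar i else 0 :: rat mpoly)"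
  have "\<pi> u = hom_eval mconst mvar u" unfolding \<pi>_def by (rule hom_eval_cong_on[OF assms(1)]) simp
  then have "u * \<pi> w = \<pi> (u * w)" unfolding \<pi>_def by (simp add: hom_eval_mult[OF is_ring_hom_mC] hom_eval_mC_mV)
  also have "\<dots> = 1" unfolding w[symmetric] \<pi>_def by (rule is_ring_homD(2)[OF is_ring_hom_ev[OF is_ring_hom_mC]])
  finally have "u * \<pi> w = 1" .
  moreover have "\<pi> w \<in> mpoly_on I" unfolding \<pi>_def
    by (rule hom_eval_in_subring[OF subring_mpoly_on, of w UNIV])
      (auto simp: mpoly_on_def[of UNIV] mconst_in_mpoly_on subring_onD(1)[OF subring_mpoly_on] intro: mvar_in_mpoly_on)
  ultimately show ?thesis using assms(1) by (auto simp: unit_in_def)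
qed

text \<open>\<open>irreducible\<close> refers to the ring in infinitely many variables, primality to
  finitely many. In a prime factorization of \<open>f\<close> the cofactor of one prime must be a
  unit, so \<open>f\<close> is an associate of that prime.\<close>

lemma irreducible_imp_primeR:
  fixes f :: "rat mpoly"
  assumes f: "f \<in> mpoly_on {..<n}" and irr: "irreducible f"
  shows "prime_in (mpoly_on {..<n}) f"
proof -
  let ?R = "mpoly_on {..<n} :: rat mpoly set"
  note R = subring_mpoly_on[of "{..<n}", where 'a = rat]
  have f0: "f \<noteq> 0" using irr by (auto simp: irreducible_def)
  obtain c ps where c: "unit_in ?R c" "\<forall>p\<in>set ps. prime_in ?R p" "f = c * prod_list ps"
    using ufd_on_mpoly_on[of n] f f0 by (auto simp: ufd_on_def)
  show ?thesis
  proof (cases ps)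
    case Nil
    then have "f dvd 1" using c by (auto simp: unit_in_def dvd_def)
    then show ?thesis using irr by (simp add: irreducible_def)
  next
    case (Cons q qs)
    define e where "e = c * prod_list qs"
    have q: "prime_in ?R q" using c(2) Cons by simp
    have eR: "e \<in> ?R" unfolding e_def using c Cons
      by (auto simp: unit_in_def prime_in_def intro!: subring_onD[OF R] prod_list_in_subring[OF R])
    have feq: "f = q * e" using c(3) Cons by (simp add: e_def mult_ac)
    have "\<not> q dvd 1" using q unit_in_mpoly_on[of q "{..<n}"] by (auto simp: prime_in_def)
    then have "e dvd 1" using irr feq by (auto simp: irreducible_def)
    then obtain e' where e': "e' \<in> ?R" "e * e' = 1" using unit_in_mpoly_on[OF eR] by (auto simp: unit_in_def)
    have qf: "q = f * e'" unfolding feq using e'(2) by (simp add: mult.assoc)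
    have iff: "dvd_in ?R f x \<longleftrightarrow> dvd_in ?R q x" for x
    proof
      assume "dvd_in ?R f x"
      then obtain w where "w \<in> ?R" "x = f * w" by (auto simp: dvd_in_def)
      then show "dvd_in ?R q x" unfolding dvd_in_def feq using eR by (auto simp: mult.assoc intro: subring_onD[OF R])
    next
      assume "dvd_in ?R q x"
      then obtain w where "w \<in> ?R" "x = q * w" by (auto simp: dvd_in_def)
      then show "dvd_in ?R f x" unfolding dvd_in_def qf using e' by (auto simp: mult.assoc intro: subring_onD[OF R])
    qed
    show ?thesis using q f f0 unfolding prime_in_def unit_in_iff_dvdR iff by auto
  qed
qed

lemma prime_in_sp:
  fixes f :: "rat mpoly"
  assumes "prime_in (mpoly_on (insert j I)) f" "j \<notin> I"
  shows "prime_in (polys_on (mpoly_on I)) (split_var j f)"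
  by (rule prime_in_transfer[OF is_ring_hom_sp is_ring_hom_poly split_iso(1)[OF assms(2)] split_iso(2)[OF assms(2)] subring_mpoly_on assms(1)])

text \<open>A root \<open>r\<close> gives \<open>l ^ (a - 1) P = (l X - r) K\<close>, which a prime \<open>P\<close> of degree at least 2 forbids.\<close>
lemma no_root_of_prime:
  fixes P :: "'a::idom poly"
  assumes R: "subring_on R" and P: "prime_in (polys_on R) P" and a: "degree P = a" "a \<ge> 2" and r: "r \<in> R"
  shows "r ^ a + (\<Sum>i<a. lead_coeff P ^ (a - 1 - i) * coeff P i * r ^ i) \<noteq> 0"
proof
  note RX = subring_polys_on[OF R]
  define l where "l = lead_coeff P"
  assume root: "r ^ a + (\<Sum>i<a. lead_coeff P ^ (a - 1 - i) * coeff P i * r ^ i) = 0"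
  have PR: "P \<in> polys_on R" "P \<noteq> 0" using P by (auto simp: prime_in_def)
  have lR: "l \<in> R" "l \<noteq> 0" using polys_onD[OF PR(1)] PR(2) by (auto simp: l_def)
  \<comment> \<open>The monic polynomial with these coefficients, taken at l X, equals
    \<open>l ^ (a - 1)\<close> times \<open>P\<close>.\<close>
  define c where "c = (\<lambda>i. if i = a then 1 else l ^ (a - 1 - i) * coeff P i)"
  have cR: "c i \<in> R" for i unfolding c_def using lR polys_onD[OF PR(1)] by (auto intro!: subring_onD[OF R])
  have cr: "(\<Sum>i\<le>a. c i * r ^ i) = 0"
    using root by (simp add: c_def l_def lessThan_Suc_atMost[symmetric] add.commute)
  define L where "L = [:- r, l:]"
  \<comment> \<open>The telescoping quotient by \<open>L = l X - r\<close> of the difference between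
    the values of the monic polynomial at l X and at r.\<close>
  define K where "K = (\<Sum>i\<le>a. [:c i:] * (\<Sum>k<i. [:r:] ^ (i - Suc k) * [:0, l:] ^ k))"
  have KR: "K \<in> polys_on R" unfolding K_def
    by (intro subring_onD(4,7,8)[OF RX]) (auto simp: pCons_in_polys_on[OF R] const_in_polys_on[OF R] cR r lR subring_onD[OF R] subring_onD(1)[OF RX])
  have LR: "L \<in> polys_on R" unfolding L_def using r lR
    by (auto simp: pCons_in_polys_on[OF R] subring_onD[OF R] subring_onD(1)[OF RX])
  have "[:l ^ (a - 1):] * P = (\<Sum>i\<le>a. [:c i:] * [:0, l:] ^ i)"
  proof (rule poly_eqI)
    fix i
    have pw: "[:0, l:] ^ n = monom (l ^ n) n" for n
    proof -
      have "[:0, l:] = monom l 1" by (simp add: monom_altdef)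
      then show ?thesis by (simp add: monom_power)
    qed
    have "coeff (\<Sum>i\<le>a. [:c i:] * [:0, l:] ^ i) i = (\<Sum>k\<le>a. if k = i then c i * l ^ i else 0)"
      unfolding coeff_sum by (intro sum.cong) (auto simp: pw)
    then have "coeff (\<Sum>i\<le>a. [:c i:] * [:0, l:] ^ i) i = (if i \<le> a then c i * l ^ i else 0)" by simp
    moreover have "l ^ (a - 1) * coeff P i = c i * l ^ i" if i: "i \<le> a"
    proof (cases "i = a")
      case True
      have "l ^ a = l ^ (a - 1) * l" using a by (cases a) auto
      then show ?thesis using True a(1) by (simp add: c_def l_def)
    next
      case False
      then have "l ^ (a - 1) = l ^ (a - 1 - i) * l ^ i" using i by (simp flip: power_add)
      then show ?thesis using False by (simp add: c_def)
    qed
    ultimately show "coeff ([:l ^ (a - 1):] * P) i = coeff (\<Sum>i\<le>a. [:c i:] * [:0, l:] ^ i) i"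
      using a(1) by (auto simp: coeff_eq_0)
  qed
  also have "\<dots> = (\<Sum>i\<le>a. [:c i:] * ([:0, l:] ^ i - [:r:] ^ i))"
  proof -
    have "(\<Sum>i\<le>a. [:c i:] * [:r:] ^ i) = [:\<Sum>i\<le>a. c i * r ^ i:]"
    proof -
      have "[:c i:] * [:r:] ^ i = [:c i * r ^ i:]" for i by (simp add: poly_const_pow)
      moreover have "(\<Sum>i\<in>A. [:c i * r ^ i:]) = [:\<Sum>i\<in>A. c i * r ^ i:]" for A
        by (induction A rule: infinite_finite_induct) auto
      ultimately show ?thesis by simp
    qed
    then show ?thesis using cr by (simp add: right_diff_distrib sum_subtractf)
  qed
  also have "\<dots> = L * K"
  proof -
    have "[:0, l:] - [:r:] = L" by (simp add: L_def)
    then have pd: "[:0, l:] ^ i - [:r:] ^ i = L * (\<Sum>k<i. [:r:] ^ (i - Suc k) * [:0, l:] ^ k)" for i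
      using power_diff_sumr2[of "[:0, l:]" i "[:r:]"] by simp
    have "[:c i:] * ([:0, l:] ^ i - [:r:] ^ i) = L * ([:c i:] * (\<Sum>k<i. [:r:] ^ (i - Suc k) * [:0, l:] ^ k))" for i
      unfolding pd by (rule mult.left_commute)
    then show ?thesis unfolding K_def sum_distrib_left[of L] by (intro sum.cong refl)
  qed
  finally have eq: "[:l ^ (a - 1):] * P = L * K" .
  have cR': "[:l ^ (a - 1):] \<in> polys_on R" using lR by (auto simp: const_in_polys_on[OF R] intro: subring_onD[OF R])
  have "L * K = P * [:l ^ (a - 1):]" using eq by (simp only: mult.commute)
  then have "dvd_in (polys_on R) P (L * K)" unfolding dvd_in_def by (rule bexI) (rule cR')
  \<comment> \<open>\<open>P\<close> cannot divide \<open>L\<close>, whose degree 1 is below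
    \<open>a\<close>. If \<open>P\<close> divides \<open>K\<close>, cancelling it leaves a nonzero
    constant equal to a multiple of \<open>L\<close>, which the degrees exclude as well.\<close>
  then have "dvd_in (polys_on R) P L \<or> dvd_in (polys_on R) P K" using P LR KR by (auto simp: prime_in_def)
  then show False
  proof
    assume "dvd_in (polys_on R) P L"
    then obtain W where W: "L = P * W" by (auto simp: dvd_in_def)
    have "L \<noteq> 0" "degree L = 1" using lR by (auto simp: L_def)
    then show False using W a degree_mult_eq[of P W] PR(2) by (metis One_nat_def Suc_1 le_add1 le_trans mult_zero_right not_less_eq_eq order_refl)
  next
    assume "dvd_in (polys_on R) P K"
    then obtain W where W: "K = P * W" by (auto simp: dvd_in_def)
    have "P * [:l ^ (a - 1):] = P * (L * W)" using eq W by (simp only: mult_ac)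
    then have e: "[:l ^ (a - 1):] = L * W" using PR(2) by (rule mult_left_cancel[THEN iffD1, rotated])
    have "L \<noteq> 0" "degree L = 1" using lR by (auto simp: L_def)
    moreover have "W \<noteq> 0" using e lR by auto
    ultimately have "degree (L * W) = 1 + degree W" by (simp add: degree_mult_eq)
    then show False unfolding e[symmetric] by simp
  qed
qed

text \<open>Coprimality over the field of fractions, stated without fractions: the multipliers
  \<open>c\<close> and \<open>c'\<close> stand for denominators.\<close>

definition coprime_over :: "'a::comm_ring_1 set \<Rightarrow> 'a poly \<Rightarrow> 'a poly \<Rightarrow> bool" where
  "coprime_over R P Q \<longleftrightarrow> (\<forall>W\<in>polys_on R. \<forall>c\<in>R. \<forall>c'\<in>R. c \<noteq> 0 \<longrightarrow> c' \<noteq> 0 \<longrightarrow>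
     dvd_in (polys_on R) W ([:c:] * P) \<longrightarrow> dvd_in (polys_on R) W ([:c':] * Q) \<longrightarrow> degree W = 0)"

lemma coeffs_total_deg_le_diff: "coeffs_total_deg_le P E \<Longrightarrow> coeffs_total_deg_le Q E \<Longrightarrow> coeffs_total_deg_le (P - Q) E" for P Q :: "'a::comm_ring_1 mpoly poly"
  by (auto simp: coeffs_total_deg_le_def intro: total_deg_le_diff)

text \<open>One step of Euclid's algorithm by cross-multiplication with leading coefficients. A
  factor common to the new pair is, up to constants, common to the old one, so coprimality persists;
  multiplying by coefficients doubles the degree bound.\<close>

lemma elimination_step:
  fixes P Q :: "'a::idom mpoly poly"
  assumes R: "subring_on R" and PQ: "P \<in> polys_on R" "Q \<in> polys_on R" "P \<noteq> 0" "Q \<noteq> 0"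
    and cop: "coprime_over R P Q" and E: "coeffs_total_deg_le P E" "coeffs_total_deg_le Q E" and deg: "degree Q > 0" "degree Q \<le> degree P"
  shows "\<exists>l M. [:l:] * P - M * Q \<in> polys_on R \<and> [:l:] * P - M * Q \<noteq> 0 \<and> degree ([:l:] * P - M * Q) < degree P
     \<and> coprime_over R ([:l:] * P - M * Q) Q \<and> coeffs_total_deg_le ([:l:] * P - M * Q) (2 * E)"
proof -
  note RX = subring_polys_on[OF R]
  define l where "l = lead_coeff Q"
  define d where "d = degree P - degree Q"
  define M where "M = monom (lead_coeff P) d"
  define P' where "P' = [:l:] * P - M * Q"
  have l: "l \<in> R" "l \<noteq> 0" using polys_onD[OF PQ(2)] PQ(4) by (auto simp: l_def)
  have MR: "M \<in> polys_on R" unfolding M_def using polys_onD[OF PQ(1)] by (intro monom_in_polys_on[OF R])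
  have P'R: "P' \<in> polys_on R" unfolding P'_def using l PQ MR
    by (intro subring_onD(4,5)[OF RX] const_in_polys_on[OF R, THEN iffD2])
  have dP: "degree P = d + degree Q" using deg by (simp add: d_def)
  have "P' \<noteq> 0"
  proof
    assume "P' = 0"
    then have e: "[:l:] * P = Q * M" by (simp add: P'_def mult.commute)
    have "dvd_in (polys_on R) Q ([:l:] * P)" unfolding dvd_in_def by (rule bexI, rule e, rule MR)
    moreover have "dvd_in (polys_on R) Q ([:1:] * Q)" unfolding dvd_in_def by (rule bexI[of _ 1]) (simp_all add: subring_onD[OF RX])
    ultimately have "degree Q = 0" using cop l PQ subring_onD(2)[OF R] unfolding coprime_over_def by (metis one_neq_zero)
    then show False using deg by simp
  qed
  moreover have "degree P' < degree P"
  proof (rule degree_lessI)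
    show "P' \<noteq> 0 \<or> degree P > 0" using deg by simp
    show "\<forall>i\<ge>degree P. coeff P' i = 0"
    proof (intro allI impI)
      fix i assume i: "i \<ge> degree P"
      show "coeff P' i = 0"
      proof (cases "i = degree P")
        case True
        have "coeff (M * Q) (degree P) = lead_coeff P * lead_coeff Q" unfolding M_def dP by (simp add: coeff_monom_mult)
        then show ?thesis unfolding P'_def True by (simp add: l_def mult.commute)
      next
        case False
        then have "coeff (M * Q) i = 0" unfolding M_def using i dP by (simp add: coeff_monom_mult coeff_eq_0)
        then show ?thesis using False i by (simp add: P'_def coeff_eq_0)
      qed
    qed
  qed
  moreover have "coprime_over R P' Q" unfolding coprime_over_def
  proof (intro ballI impI)
    fix W c c' assume W: "W \<in> polys_on R" and c: "c \<in> R" "c' \<in> R" "c \<noteq> 0" "c' \<noteq> 0"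
      and d1: "dvd_in (polys_on R) W ([:c:] * P')" and d2: "dvd_in (polys_on R) W ([:c':] * Q)"
    have "[:c * c' * l:] * P = ([:c:] * P') * [:c':] + ([:c':] * Q) * ([:c:] * M)"
      by (simp add: P'_def algebra_simps)
    moreover have "dvd_in (polys_on R) W (([:c:] * P') * [:c':] + ([:c':] * Q) * ([:c:] * M))"
    proof (rule dvd_in_add[OF RX])
      show "dvd_in (polys_on R) W (([:c:] * P') * [:c':])"
        by (rule dvd_in_mult[OF RX d1]) (use c const_in_polys_on[OF R] in blast)
      show "dvd_in (polys_on R) W (([:c':] * Q) * ([:c:] * M))"
        by (rule dvd_in_mult[OF RX d2], rule subring_onD(4)[OF RX _ MR]) (use c const_in_polys_on[OF R] in blast)
    qed
    ultimately have "dvd_in (polys_on R) W ([:c * c' * l:] * P)" by simp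
    moreover have "c * c' * l \<in> R" "c * c' * l \<noteq> 0" using c l by (auto intro: subring_onD[OF R])
    ultimately show "degree W = 0" using cop W c d2 unfolding coprime_over_def by blast
  qed
  moreover have "coeffs_total_deg_le P' (2 * E)"
  proof -
    have "coeffs_total_deg_le [:l:] E" "coeffs_total_deg_le M E" using E unfolding coeffs_total_deg_le_def l_def M_def by (auto simp: coeff_pCons split: nat.splits)
    then have "coeffs_total_deg_le P' (E + E)" unfolding P'_def using E by (intro coeffs_total_deg_le_diff coeffs_total_deg_le_mult)
    then show ?thesis by (simp add: mult_2)
  qed
  ultimately show ?thesis using P'R unfolding P'_def by blast
qed

lemma coprime_over_sym: "coprime_over R P Q \<Longrightarrow> coprime_over R Q P"
  unfolding coprime_over_def by blast

text \<open>A substitute for the resultant. Every step of Euclid's algorithm lowers the sum of the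
  degrees and doubles the degree of the coefficients, whence the factor
  \<open>2 ^ (degree P + degree Q)\<close>. The bound involves degrees only, which keeps the final
  constant uniform.\<close>

lemma elimination:
  fixes P Q :: "'a::idom mpoly poly"
  assumes R: "subring_on R"
  shows "P \<in> polys_on R \<Longrightarrow> Q \<in> polys_on R \<Longrightarrow> P \<noteq> 0 \<Longrightarrow> Q \<noteq> 0 \<Longrightarrow> coprime_over R P Q \<Longrightarrow> coeffs_total_deg_le P E \<Longrightarrow> coeffs_total_deg_le Q E \<Longrightarrow>
    \<exists>r\<in>R. r \<noteq> 0 \<and> total_deg_le r (2 ^ (degree P + degree Q) * E) \<and> (\<exists>S T. [:r:] = S * P + T * Q)"
proof (induction "degree P + degree Q" arbitrary: P Q E rule: less_induct)
  case less
  note RX = subring_polys_on[OF R]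
  have const: "\<exists>r\<in>R. r \<noteq> 0 \<and> total_deg_le r (2 ^ n * E) \<and> [:r:] = W"
    if "degree W = 0" "W \<in> polys_on R" "W \<noteq> 0" "coeffs_total_deg_le W E" for W n
  proof -
    obtain w where w: "W = [:w:]" using \<open>degree W = 0\<close> by (metis degree_eq_zeroE)
    have "total_deg_le w E" using \<open>coeffs_total_deg_le W E\<close> unfolding w coeffs_total_deg_le_def by (metis coeff_pCons_0)
    then have "total_deg_le w (2 ^ n * E)" by (rule total_deg_le_mono) simp
    then show ?thesis using that w by (auto simp: const_in_polys_on[OF R])
  qed
  show ?case
  proof (cases "degree Q = 0")
    case True
    obtain r where r: "r \<in> R" "r \<noteq> 0" "total_deg_le r (2 ^ (degree P + degree Q) * E)" "[:r:] = Q"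
      using const[OF True less.prems(2,4,7), of "degree P + degree Q"] by blast
    have "[:r:] = 0 * P + 1 * Q" using r(4) by simp
    then show ?thesis using r by blast
  next
    case dQ: False
    show ?thesis
    proof (cases "degree P = 0")
      case True
      obtain r where r: "r \<in> R" "r \<noteq> 0" "total_deg_le r (2 ^ (degree P + degree Q) * E)" "[:r:] = P"
        using const[OF True less.prems(1,3,6), of "degree P + degree Q"] by blast
      have "[:r:] = 1 * P + 0 * Q" using r(4) by simp
      then show ?thesis using r by blast
    next
      case dP: False
      show ?thesis
      proof (cases "degree Q \<le> degree P")
        case True
        obtain l M where P': "[:l:] * P - M * Q \<in> polys_on R" "[:l:] * P - M * Q \<noteq> 0" "degree ([:l:] * P - M * Q) < degree P"
            "coprime_over R ([:l:] * P - M * Q) Q" "coeffs_total_deg_le ([:l:] * P - M * Q) (2 * E)"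
          using elimination_step[OF R less.prems] dQ True by blast
        let ?P' = "[:l:] * P - M * Q"
        have "coeffs_total_deg_le Q (2 * E)" using less.prems(7) by (auto simp: coeffs_total_deg_le_def intro: total_deg_le_mono)
        then obtain r S T where r: "r \<in> R" "r \<noteq> 0" "total_deg_le r (2 ^ (degree ?P' + degree Q) * (2 * E))" "[:r:] = S * ?P' + T * Q"
          using less.hyps[of ?P' Q "2 * E"] P' less.prems by auto
        have "2 ^ (degree ?P' + degree Q) * (2 * E) = 2 ^ Suc (degree ?P' + degree Q) * E" by simp
        also have "\<dots> \<le> 2 ^ (degree P + degree Q) * E" using P'(3) by (intro mult_le_mono1 power_increasing) auto
        finally have "total_deg_le r (2 ^ (degree P + degree Q) * E)" using r(3) total_deg_le_mono by blast
        moreover have "[:r:] = (S * [:l:]) * P + (T - S * M) * Q" unfolding r(4) by (simp add: algebra_simps)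
        ultimately show ?thesis using r(1,2) by blast
      next
        case False
        obtain l M where P': "[:l:] * Q - M * P \<in> polys_on R" "[:l:] * Q - M * P \<noteq> 0" "degree ([:l:] * Q - M * P) < degree Q"
            "coprime_over R ([:l:] * Q - M * P) P" "coeffs_total_deg_le ([:l:] * Q - M * P) (2 * E)"
          using elimination_step[OF R less.prems(2,1,4,3) coprime_over_sym[OF less.prems(5)] less.prems(7,6)] dP False by auto
        let ?P' = "[:l:] * Q - M * P"
        have "coeffs_total_deg_le P (2 * E)" using less.prems(6) by (auto simp: coeffs_total_deg_le_def intro: total_deg_le_mono)
        then obtain r S T where r: "r \<in> R" "r \<noteq> 0" "total_deg_le r (2 ^ (degree ?P' + degree P) * (2 * E))" "[:r:] = S * ?P' + T * P"
          using less.hyps[of ?P' P "2 * E"] P' less.prems by auto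
        have "2 ^ (degree ?P' + degree P) * (2 * E) = 2 ^ Suc (degree ?P' + degree P) * E" by simp
        also have "\<dots> \<le> 2 ^ (degree P + degree Q) * E" using P'(3) by (intro mult_le_mono1 power_increasing) auto
        finally have "total_deg_le r (2 ^ (degree P + degree Q) * E)" using r(3) total_deg_le_mono by blast
        moreover have "[:r:] = (T - S * M) * P + (S * [:l:]) * Q" unfolding r(4) by (simp add: algebra_simps)
        ultimately show ?thesis using r(1,2) by blast
      qed
    qed
  qed
qed

text \<open>The prime \<open>f\<close> does not divide its leading coefficient in variable 0, so the
  two are coprime with respect to variable \<open>j\<close>. The eliminant vanishes wherever both
  do, in particular wherever \<open>f\<close> vanishes identically in variable 0.\<close>

lemma eliminate_variable:
  fixes f :: "rat mpoly"
  assumes f: "prime_in (mpoly_on {..<n}) f" and td: "total_deg_le f E" and d0: "degree (split_var 0 f) > 0"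
    and j: "0 < j" "j < n" and dj: "degree (split_var j f) > 0"
  shows "\<exists>r\<in>mpoly_on ({..<n} - {j}). r \<noteq> 0 \<and> total_deg_le r (2 ^ (E + E) * E) \<and>
    (\<forall>x. rat_eval x f = 0 \<and> rat_eval x (lead_coeff (split_var 0 f)) = 0 \<longrightarrow> rat_eval x r = 0)"
proof -
  let ?I = "{..<n} - {j}" and ?J = "{..<n} - {0}"
  have I: "insert j ?I = {..<n}" "j \<notin> ?I" and J: "insert 0 ?J = {..<n}" "0 \<notin> ?J" using j by auto
  note R = subring_mpoly_on[of ?I, where 'a = rat]
  note RX = subring_polys_on[OF R]
  define l where "l = lead_coeff (split_var 0 f)"
  have fR: "f \<in> mpoly_on {..<n}" "f \<noteq> 0" using f by (auto simp: prime_in_def)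
  have "split_var 0 f \<in> polys_on (mpoly_on ?J)" using split_iso(1)[OF J(2), of f] fR J(1) by simp
  then have lJ: "l \<in> mpoly_on ?J" unfolding l_def by (rule polys_onD)
  have l0: "l \<noteq> 0" using d0 unfolding l_def by auto
  have ln: "l \<in> mpoly_on {..<n}" using lJ mpoly_on_mono[of ?J "{..<n}"] by blast
  have tdl: "total_deg_le l E" unfolding l_def using coeffs_total_deg_le_sp[OF td, of 0] by (simp add: coeffs_total_deg_le_def)
  define P where "P = split_var j f"
  define Q where "Q = split_var j l"
  have P: "prime_in (polys_on (mpoly_on ?I)) P" unfolding P_def by (rule prime_in_sp) (use f I in simp_all)
  then have PR: "P \<in> polys_on (mpoly_on ?I)" "P \<noteq> 0" by (auto simp: prime_in_def)
  have QR: "Q \<in> polys_on (mpoly_on ?I)" unfolding Q_def using split_iso(1)[OF I(2), of l] ln I(1) by simp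
  have polyQ: "poly Q (mvar j) = l" and polyP: "poly P (mvar j) = f" by (simp_all add: P_def Q_def poly_sp)
  then have Q0: "Q \<noteq> 0" using l0 by auto
  \<comment> \<open>\<open>l\<close> is free of variable 0, while \<open>f\<close> has positive
    degree in it.\<close>
  have PQ: "\<not> dvd_in (polys_on (mpoly_on ?I)) P Q"
  proof
    assume "dvd_in (polys_on (mpoly_on ?I)) P Q"
    then obtain W where "Q = P * W" by (auto simp: dvd_in_def)
    then have "l = f * poly W (mvar j)" using polyQ polyP by (metis poly_mult)
    then have "split_var 0 l = split_var 0 f * split_var 0 (poly W (mvar j))" by (simp add: is_ring_homD[OF is_ring_hom_sp])
    then have e: "[:l:] = split_var 0 f * split_var 0 (poly W (mvar j))" using split_var_const[OF lJ J(2)] by simp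
    then have "split_var 0 f \<noteq> 0" "split_var 0 (poly W (mvar j)) \<noteq> 0" using l0 by auto
    then have "degree [:l:] = degree (split_var 0 f) + degree (split_var 0 (poly W (mvar j)))" unfolding e by (rule degree_mult_eq)
    then show False using d0 by simp
  qed
  have "coprime_over (mpoly_on ?I) P Q" unfolding coprime_over_def
  proof (intro ballI impI)
    fix W c c' assume W: "W \<in> polys_on (mpoly_on ?I)" and c: "c \<in> mpoly_on ?I" "c' \<in> mpoly_on ?I" "c \<noteq> 0" "c' \<noteq> 0"
      and d1: "dvd_in (polys_on (mpoly_on ?I)) W ([:c:] * P)" and d2: "dvd_in (polys_on (mpoly_on ?I)) W ([:c':] * Q)"
    obtain H where H: "H \<in> polys_on (mpoly_on ?I)" "[:c:] * P = W * H" using d1 by (auto simp: dvd_in_def)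
    have "W * H = P * [:c:]" using H(2) by (simp only: mult.commute)
    then have "dvd_in (polys_on (mpoly_on ?I)) P (W * H)" unfolding dvd_in_def
      by (rule bexI) (use c const_in_polys_on[OF R] in blast)
    \<comment> \<open>If \<open>P\<close> divides \<open>H\<close>, then \<open>W\<close> divides
      the constant \<open>c\<close>. If \<open>P\<close> divides \<open>W\<close>, it divides
      \<open>c' Q\<close>, hence \<open>c'\<close>, against its positive degree.\<close>
    then have "dvd_in (polys_on (mpoly_on ?I)) P W \<or> dvd_in (polys_on (mpoly_on ?I)) P H" using P W H(1) by (auto simp: prime_in_def)
    then show "degree W = 0"
    proof
      assume "dvd_in (polys_on (mpoly_on ?I)) P H"
      then obtain H' where H': "H = P * H'" by (auto simp: dvd_in_def)
      have "P * [:c:] = P * (W * H')" using H(2) H' by (simp only: mult_ac)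
      then have e: "[:c:] = W * H'" using PR(2) by (rule mult_left_cancel[THEN iffD1, rotated])
      then have "W \<noteq> 0" "H' \<noteq> 0" using c by auto
      then have "degree [:c:] = degree W + degree H'" unfolding e by (rule degree_mult_eq)
      then show ?thesis by simp
    next
      assume "dvd_in (polys_on (mpoly_on ?I)) P W"
      then have "dvd_in (polys_on (mpoly_on ?I)) P ([:c':] * Q)" using d2 dvd_in_trans[OF RX] by blast
      moreover have "[:c':] \<in> polys_on (mpoly_on ?I)" using c const_in_polys_on[OF R] by blast
      ultimately have "dvd_in (polys_on (mpoly_on ?I)) P [:c':]" using P QR PQ unfolding prime_in_def by blast
      then obtain H' where e: "[:c':] = P * H'" by (auto simp: dvd_in_def)
      then have "H' \<noteq> 0" using c by auto
      then have "degree [:c':] = degree P + degree H'" unfolding e using PR(2) by (intro degree_mult_eq)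
      then show ?thesis using dj by (simp add: P_def)
    qed
  qed
  then obtain r S T where r: "r \<in> mpoly_on ?I" "r \<noteq> 0" "total_deg_le r (2 ^ (degree P + degree Q) * E)" "[:r:] = S * P + T * Q"
    using elimination[OF R PR(1) QR PR(2) Q0, of E] coeffs_total_deg_le_sp[OF td, of j] coeffs_total_deg_le_sp[OF tdl, of j] unfolding P_def Q_def by blast
  have "degree P + degree Q \<le> E + E" unfolding P_def Q_def by (intro add_mono degree_sp_le td tdl)
  then have "2 ^ (degree P + degree Q) * E \<le> 2 ^ (E + E) * E" by (intro mult_le_mono1 power_increasing) auto
  then have "total_deg_le r (2 ^ (E + E) * E)" using r(3) total_deg_le_mono by blast
  moreover have "rat_eval x r = 0" if "rat_eval x f = 0" "rat_eval x l = 0" for x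
  proof -
    have "r = poly [:r:] (mvar j)" by simp
    also have "\<dots> = poly S (mvar j) * f + poly T (mvar j) * l" unfolding r(4) by (simp add: polyP polyQ)
    finally have "rat_eval x r = rat_eval x (poly S (mvar j) * f + poly T (mvar j) * l)" by simp
    then show ?thesis using that by (simp add: is_ring_homD[OF is_ring_hom_evr])
  qed
  ultimately show ?thesis using r(1,2) unfolding l_def by blast
qed

subsection \<open>Counting zeros\<close>

text \<open>Index shift: coordinate \<open>i\<close> of \<open>y\<close> is the variable \<open>Suc i\<close>, because variable 0 is the distinguished one.\<close>
definition forced_zeros :: "nat \<Rightarrow> real \<Rightarrow> rat mpoly \<Rightarrow> (nat \<Rightarrow> rat) set" where
  "forced_zeros k B p = {y\<in>ratbox k B. \<forall>x. (\<forall>i<k. x (Suc i) = y i) \<longrightarrow> rat_eval x p = 0}"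

text \<open>Fibres over the first coordinates; the earlier version fixes the last coordinate
  instead.\<close>

lemma ratbox_slice_card':
  assumes "B \<ge> 1"
  shows "card {y\<in>ratbox (Suc m) B. Q y} \<le> (\<Sum>y\<in>ratbox m B. card {t\<in>ratball B. Q (y(m := t))})"
proof -
  have fin: "finite (ratbox m B)" "finite (ratball B)" using ratbox_card ratball_card assms by auto
  have "{y\<in>ratbox (Suc m) B. Q y} \<subseteq> (\<Union>y\<in>ratbox m B. (\<lambda>t. y(m := t)) ` {t\<in>ratball B. Q (y(m := t))})"
    unfolding ratbox_Suc by auto
  then have "card {y\<in>ratbox (Suc m) B. Q y} \<le> card (\<Union>y\<in>ratbox m B. (\<lambda>t. y(m := t)) ` {t\<in>ratball B. Q (y(m := t))})"
    using fin by (intro card_mono) auto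
  also have "\<dots> \<le> (\<Sum>y\<in>ratbox m B. card ((\<lambda>t. y(m := t)) ` {t\<in>ratball B. Q (y(m := t))}))"
    by (rule card_UN_le[OF fin(1)])
  also have "\<dots> \<le> (\<Sum>y\<in>ratbox m B. card {t\<in>ratball B. Q (y(m := t))})"
    using fin by (intro sum_mono card_image_le) auto
  finally show ?thesis .
qed

text \<open>The restriction to the line through \<open>x\<close> in direction \<open>j\<close> is a
  nonzero polynomial, since it does not vanish at \<open>x\<close> itself.\<close>

lemma card_univariate_zeros:
  assumes td: "total_deg_le p E" and nz: "rat_eval x p \<noteq> 0"
  shows "finite {t. rat_eval (x(j := t)) p = 0} \<and> card {t. rat_eval (x(j := t)) p = 0} \<le> E"
proof -
  define q where "q = hom_eval (\<lambda>c. [:c:]) (\<lambda>i. if i = j then [:0, 1:] else [:x i:]) p"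
  have e: "poly q t = rat_eval (x(j := t)) p" for t
  proof -
    have "poly q t = hom_eval (\<lambda>c. poly [:c:] t) (\<lambda>i. poly (if i = j then [:0, 1:] else [:x i:]) t) p"
      unfolding q_def by (rule hom_eval_hom[OF is_ring_hom_poly])
    also have "\<dots> = rat_eval (x(j := t)) p" unfolding rat_eval_def by (rule arg_cong2[of _ _ _ _ "\<lambda>u v. hom_eval u v p"]) auto
    finally show ?thesis .
  qed
  have "poly q (x j) \<noteq> 0" unfolding e using nz by simp
  then have q0: "q \<noteq> 0" by auto
  have "degree q \<le> E" unfolding q_def by (rule degree_ev_le[OF td]) auto
  then show ?thesis using poly_roots_finite[OF q0] card_poly_roots_bound[OF q0] by (simp add: e)
qed

text \<open>Points already forced extend by every \<open>t\<close>; the others extend only if they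
  lie in \<open>Y\<close>, and then by at most \<open>E\<close> values. The choice of
  \<open>Y\<close> decides the codimension: the whole box gives 1, a set of codimension 1 gives
  2.\<close>

lemma forced_zeros_fibre_bound:
  assumes B: "B \<ge> 1" and E: "\<And>y. y \<in> ratbox k B - forced_zeros k B p \<Longrightarrow> card {t\<in>ratball B. y(k := t) \<in> forced_zeros (Suc k) B p} \<le> (if y \<in> Y then E else 0)"
    and Y: "Y \<subseteq> ratbox k B"
  shows "real (card (forced_zeros (Suc k) B p)) \<le> 3 * B\<^sup>2 * real (card (forced_zeros k B p)) + real E * real (card Y)"
proof -
  have fin: "finite (ratbox k B)" "finite (ratball B)" using ratbox_card ratball_card B by auto
  let ?N = "\<lambda>y. card {t\<in>ratball B. y(k := t) \<in> forced_zeros (Suc k) B p}"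
  have sub: "forced_zeros k B p \<subseteq> ratbox k B" by (auto simp: forced_zeros_def)
  have "{y\<in>ratbox (Suc k) B. y \<in> forced_zeros (Suc k) B p} = forced_zeros (Suc k) B p" by (auto simp: forced_zeros_def)
  then have "card (forced_zeros (Suc k) B p) \<le> (\<Sum>y\<in>ratbox k B. ?N y)" using ratbox_slice_card'[OF B, of k "\<lambda>y. y \<in> forced_zeros (Suc k) B p"] by simp
  also have "\<dots> = (\<Sum>y\<in>ratbox k B - forced_zeros k B p. ?N y) + (\<Sum>y\<in>forced_zeros k B p. ?N y)" by (rule sum.subset_diff[OF sub fin(1)])
  also have "\<dots> \<le> (\<Sum>y\<in>ratbox k B - forced_zeros k B p. if y \<in> Y then E else 0) + (\<Sum>y\<in>forced_zeros k B p. card (ratball B))"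
    using fin by (intro add_mono sum_mono E card_mono) auto
  also have "(\<Sum>y\<in>ratbox k B - forced_zeros k B p. if y \<in> Y then E else 0) \<le> (\<Sum>y\<in>ratbox k B. if y \<in> Y then E else 0)"
    using fin by (intro sum_mono2) auto
  also have "(\<Sum>y\<in>ratbox k B. if y \<in> Y then E else 0) = card Y * E"
    using Y fin by (simp add: sum.If_cases Int_absorb1)
  finally have "card (forced_zeros (Suc k) B p) \<le> card Y * E + card (forced_zeros k B p) * card (ratball B)" by simp
  then have "real (card (forced_zeros (Suc k) B p)) \<le> real (card Y) * real E + real (card (forced_zeros k B p)) * real (card (ratball B))"
    by (metis of_nat_add of_nat_le_iff of_nat_mult)
  also have "real (card (forced_zeros k B p)) * real (card (ratball B)) \<le> real (card (forced_zeros k B p)) * (3 * B\<^sup>2)"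
    using ratball_card[OF B] by (intro mult_left_mono) auto
  finally show ?thesis by (simp add: mult.commute)
qed

lemma forced_zeros_extends:
  assumes "y(k := t) \<in> forced_zeros (Suc k) B p" "\<And>i. i < k \<Longrightarrow> x (Suc i) = y i"
  shows "rat_eval (x(Suc k := t)) p = 0"
  using assms by (auto simp: forced_zeros_def less_Suc_eq)

text \<open>Codimension 1, that is O(M^(k-1)) points with M = 3 B^2. One factor M is kept on the
  left so that k = 0 needs no negative exponent.\<close>

lemma card_Zset:
  assumes td: "total_deg_le p E" and nz: "rat_eval x0 p \<noteq> 0" and B: "B \<ge> 1"
  shows "3 * B\<^sup>2 * real (card (forced_zeros k B p)) \<le> real k * real E * (3 * B\<^sup>2) ^ k"
proof (induction k)
  case 0
  have "forced_zeros 0 B p = {}" using nz by (auto simp: forced_zeros_def)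
  then show ?case by simp
next
  case (Suc k)
  let ?M = "3 * B\<^sup>2"
  have "real (card (forced_zeros (Suc k) B p)) \<le> ?M * real (card (forced_zeros k B p)) + real E * real (card (ratbox k B))"
  proof (rule forced_zeros_fibre_bound[OF B])
    fix y assume y: "y \<in> ratbox k B - forced_zeros k B p"
    then obtain x where x: "\<forall>i<k. x (Suc i) = y i" "rat_eval x p \<noteq> 0" by (auto simp: forced_zeros_def)
    have "card {t\<in>ratball B. y(k := t) \<in> forced_zeros (Suc k) B p} \<le> card {t. rat_eval (x(Suc k := t)) p = 0}"
      using forced_zeros_extends[of y k _ B p x] x card_univariate_zeros[OF td x(2), of "Suc k"] by (intro card_mono) auto
    then show "card {t\<in>ratball B. y(k := t) \<in> forced_zeros (Suc k) B p} \<le> (if y \<in> ratbox k B then E else 0)"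
      using card_univariate_zeros[OF td x(2), of "Suc k"] y by auto
  qed simp
  also have "\<dots> \<le> real k * real E * ?M ^ k + real E * ?M ^ k"
    using Suc ratbox_card[OF B, of k] by (intro add_mono mult_left_mono) auto
  finally have "?M * real (card (forced_zeros (Suc k) B p)) \<le> ?M * (real k * real E * ?M ^ k + real E * ?M ^ k)"
    by (rule mult_left_mono) simp
  also have "\<dots> = real (Suc k) * real E * ?M ^ Suc k" by (simp add: algebra_simps)
  finally show ?case .
qed

text \<open>Codimension 2, that is O(M^(k-2)) points with M = 3 B^2. From \<open>k\<close> to
  \<open>Suc k\<close>, new points arise only over those \<open>y\<close> where the eliminant of
  variable \<open>Suc k\<close> is forced to vanish; as a nonzero polynomial free of that variable,
  it confines these \<open>y\<close> to codimension 1.\<close>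

lemma card_vertical_lines:
  fixes f :: "rat mpoly"
  assumes f: "prime_in (mpoly_on {..<Suc m}) f" and td: "total_deg_le f E" and d0: "degree (split_var 0 f) > 0" and B: "B \<ge> 1"
  shows "k \<le> m \<Longrightarrow> (3 * B\<^sup>2)\<^sup>2 * real (card (forced_zeros k B f)) \<le> real k ^ 2 * real E * real (2 ^ (E + E) * E) * (3 * B\<^sup>2) ^ k"
proof (induction k)
  case 0
  have "f \<in> mpoly_on {..<Suc m}" "f \<noteq> 0" using f by (auto simp: prime_in_def)
  then obtain x where "rat_eval x f \<noteq> 0" using rat_eval_zero_imp_zero by blast
  then have "forced_zeros 0 B f = {}" by (auto simp: forced_zeros_def)
  then show ?case by simp
next
  case (Suc k)
  let ?M = "3 * B\<^sup>2" and ?E' = "2 ^ (E + E) * E" and ?j = "Suc k"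
  have fR: "f \<in> mpoly_on {..<Suc m}" using f by (auto simp: prime_in_def)
  have j: "0 < ?j" "?j < Suc m" using Suc.prems by auto
  have M: "?M \<ge> 0" by simp
  have "\<exists>Y. Y \<subseteq> ratbox k B \<and> ?M * real (card Y) \<le> real k * real ?E' * ?M ^ k \<and>
     (\<forall>y\<in>ratbox k B - forced_zeros k B f. card {t\<in>ratball B. y(k := t) \<in> forced_zeros (Suc k) B f} \<le> (if y \<in> Y then E else 0))"
  proof (cases "degree (split_var ?j f) > 0")
    \<comment> \<open>\<open>f\<close> does not involve variable \<open>Suc k\<close>, so
      prescribing that variable forces nothing new.\<close>
    case False
    then obtain c where c: "split_var ?j f = [:c:]" by (metis degree_eq_zeroE gr0I)
    have ins: "insert ?j ({..<Suc m} - {?j}) = {..<Suc m}" using j by auto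
    have "split_var ?j f \<in> polys_on (mpoly_on ({..<Suc m} - {?j}))" using split_iso(1)[of ?j "{..<Suc m} - {?j}" f] fR ins by simp
    then have cR: "c \<in> mpoly_on ({..<Suc m} - {?j})" unfolding c using const_in_polys_on[OF subring_mpoly_on] by blast
    have fc: "f = c" using poly_sp[of ?j f] c by simp
    have indep: "rat_eval (x(?j := t)) f = rat_eval x f" for x t
      unfolding fc rat_eval_def by (rule hom_eval_cong_on[OF cR]) auto
    have em: "{t\<in>ratball B. y(k := t) \<in> forced_zeros (Suc k) B f} = {}" if y: "y \<in> ratbox k B - forced_zeros k B f" for y
    proof -
      obtain x where x: "\<forall>i<k. x (Suc i) = y i" "rat_eval x f \<noteq> 0" using y by (auto simp: forced_zeros_def)
      then show ?thesis using forced_zeros_extends[of y k _ B f x] indep by auto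
    qed
    show ?thesis
    proof (intro exI[of _ "{}"] conjI ballI)
      fix y assume "y \<in> ratbox k B - forced_zeros k B f"
      then show "card {t\<in>ratball B. y(k := t) \<in> forced_zeros (Suc k) B f} \<le> (if y \<in> {} then E else 0)"
        by (simp only: em card.empty)
    qed auto
  next
    case True
    obtain r where r: "r \<in> mpoly_on ({..<Suc m} - {?j})" "r \<noteq> 0" "total_deg_le r ?E'"
        "\<And>x. rat_eval x f = 0 \<Longrightarrow> rat_eval x (lead_coeff (split_var 0 f)) = 0 \<Longrightarrow> rat_eval x r = 0"
      using eliminate_variable[OF f td d0 j True] by blast
    have rn: "r \<in> mpoly_on {..<Suc m}" using r(1) mpoly_on_mono[of "{..<Suc m} - {?j}" "{..<Suc m}"] by blast
    obtain x0 where x0: "rat_eval x0 r \<noteq> 0" using rat_eval_zero_imp_zero[OF rn] r(2) by blast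
    have cz: "?M * real (card (forced_zeros k B r)) \<le> real k * real ?E' * ?M ^ k" by (rule card_Zset[OF r(3) x0 B])
    have "card {t\<in>ratball B. y(k := t) \<in> forced_zeros (Suc k) B f} \<le> (if y \<in> forced_zeros k B r then E else 0)"
      if y: "y \<in> ratbox k B - forced_zeros k B f" for y
    proof (cases "y \<in> forced_zeros k B r")
      case True
      obtain x where x: "\<forall>i<k. x (Suc i) = y i" "rat_eval x f \<noteq> 0" using y by (auto simp: forced_zeros_def)
      have "card {t\<in>ratball B. y(k := t) \<in> forced_zeros (Suc k) B f} \<le> card {t. rat_eval (x(?j := t)) f = 0}"
        using forced_zeros_extends[of y k _ B f x] x card_univariate_zeros[OF td x(2), of ?j] by (intro card_mono) auto
      then show ?thesis using card_univariate_zeros[OF td x(2), of ?j] True by auto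
    next
      case False
      then obtain x where x: "\<forall>i<k. x (Suc i) = y i" "rat_eval x r \<noteq> 0" using y by (auto simp: forced_zeros_def)
      have "\<not> y(k := t) \<in> forced_zeros (Suc k) B f" for t
      proof
        assume t: "y(k := t) \<in> forced_zeros (Suc k) B f"
        \<comment> \<open>\<open>f\<close> vanishes at x' for all values of variable 0, hence so
          does its leading coefficient, and \<open>r\<close> vanishes at x'. But \<open>r\<close>
          does not see the value \<open>t\<close>, so it vanishes at \<open>x\<close>.\<close>
        define x' where "x' = x(?j := t)"
        have f0: "rat_eval (x'(0 := s)) f = 0" for s
        proof -
          have "(x(0 := s)) (Suc i) = y i" if "i < k" for i using x(1) that by simp
          from forced_zeros_extends[OF t this] have "rat_eval ((x(0 := s))(?j := t)) f = 0" .
          moreover have "(x(0 := s))(?j := t) = x'(0 := s)" by (auto simp: x'_def)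
          ultimately show ?thesis by simp
        qed
        have "f \<in> mpoly_on (insert 0 ({..<Suc m} - {0}))" using fR by (simp add: insert_absorb)
        from rat_eval_slice[OF this, of x'] have "(\<Sum>i\<le>degree (split_var 0 f). rat_eval x' (coeff (split_var 0 f) i) * s ^ i) = 0" for s
          using f0[of s] by simp
        then have "rat_eval x' (lead_coeff (split_var 0 f)) = 0"
          by (rule polynomial_function_zero) simp
        moreover have "rat_eval x' f = 0" using f0[of "x' 0"] by simp
        ultimately have "rat_eval x' r = 0" by (intro r(4))
        moreover have "rat_eval x' r = rat_eval x r" unfolding rat_eval_def x'_def by (rule hom_eval_cong_on[OF r(1)]) auto
        ultimately show False using x(2) by simp
      qed
      then show ?thesis by simp
    qed
    then show ?thesis using cz by (intro exI[of _ "forced_zeros k B r"]) (auto simp: forced_zeros_def)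
  qed
  then obtain Y where Y: "Y \<subseteq> ratbox k B" "?M * real (card Y) \<le> real k * real ?E' * ?M ^ k"
     "\<And>y. y \<in> ratbox k B - forced_zeros k B f \<Longrightarrow> card {t\<in>ratball B. y(k := t) \<in> forced_zeros (Suc k) B f} \<le> (if y \<in> Y then E else 0)" by blast
  have "?M\<^sup>2 * real (card (forced_zeros (Suc k) B f)) \<le> ?M\<^sup>2 * (?M * real (card (forced_zeros k B f)) + real E * real (card Y))"
    by (intro mult_left_mono forced_zeros_fibre_bound[OF B Y(3) Y(1)]) auto
  also have "\<dots> = ?M * (?M\<^sup>2 * real (card (forced_zeros k B f))) + real E * ?M * (?M * real (card Y))"
    by (simp add: power2_eq_square algebra_simps)
  also have "\<dots> \<le> ?M * (real k ^ 2 * real E * real ?E' * ?M ^ k) + real E * ?M * (real k * real ?E' * ?M ^ k)"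
    using Suc Y(2) M by (intro add_mono mult_left_mono) auto
  also have "\<dots> = (real k ^ 2 + real k) * (real E * real ?E' * ?M ^ Suc k)" by (simp add: algebra_simps)
  also have "\<dots> \<le> real (Suc k) ^ 2 * (real E * real ?E' * ?M ^ Suc k)"
  proof (rule mult_right_mono)
    show "0 \<le> real E * real ?E' * ?M ^ Suc k" using B by (intro mult_nonneg_nonneg zero_le_power) auto
  qed (simp add: power2_eq_square algebra_simps)
  finally show ?case by (simp add: mult.assoc)
qed

subsection \<open>The counting theorem\<close>

lemma mpolyfun_deg_mono:
  assumes "D \<le> D'" "0 \<in> S"
  shows "mpolyfun S D m F \<Longrightarrow> mpolyfun S D' m F"
proof (induction m arbitrary: F)
  case (Suc m)
  then obtain G where G: "\<forall>j\<le>D. mpolyfun S D m (G j)" "F = (\<lambda>y. \<Sum>j\<le>D. G j y * y m ^ j)" by auto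
  define G' where "G' = (\<lambda>j. if j \<le> D then G j else (\<lambda>_. 0))"
  have "\<forall>j\<le>D'. mpolyfun S D' m (G' j)" using Suc.IH G(1) mpolyfun_const0[OF assms(2)] by (auto simp: G'_def)
  moreover have "F = (\<lambda>y. \<Sum>j\<le>D'. G' j y * y m ^ j)"
  proof
    fix y
    have "(\<Sum>j\<le>D. G j y * y m ^ j) = (\<Sum>j\<le>D. G' j y * y m ^ j)" by (intro sum.cong) (auto simp: G'_def)
    also have "\<dots> = (\<Sum>j\<le>D'. G' j y * y m ^ j)"
      by (intro sum.mono_neutral_left) (use assms(1) in \<open>auto simp: G'_def\<close>)
    finally show "F y = (\<Sum>j\<le>D'. G' j y * y m ^ j)" by (simp add: G(2))
  qed
  ultimately show ?case unfolding mpolyfun.simps by blast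
qed simp

text \<open>A Cauchy product in the last variable, with at most \<open>D + D' + 1\<close> terms in
  each coefficient.\<close>

lemma mpolyfun_mult:
  assumes H: "H \<ge> 0" "H' \<ge> 0"
  shows "mpolyfun (bdd_ints H) D m F \<Longrightarrow> mpolyfun (bdd_ints H') D' m F' \<Longrightarrow>
    mpolyfun (bdd_ints (real (D + D' + 1) ^ m * (H * H'))) (D + D') m (\<lambda>y. F y * F' y)"
proof (induction m arbitrary: F F')
  case 0
  then obtain c c' where c: "c \<in> bdd_ints H" "F = (\<lambda>_. c)" "c' \<in> bdd_ints H'" "F' = (\<lambda>_. c')" by auto
  then obtain k where k: "c = of_int k" "\<bar>real_of_int k\<bar> \<le> H" by (auto simp: bdd_ints_def)
  have "of_int k * c' \<in> bdd_ints (H * H')" by (rule bdd_ints_mult[OF c(3) k(2)])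
  then show ?case unfolding mpolyfun.simps by (intro bexI[of _ "of_int k * c'"]) (simp_all add: c k)
next
  case (Suc m)
  then obtain G where G: "\<forall>j\<le>D. mpolyfun (bdd_ints H) D m (G j)" "F = (\<lambda>y. \<Sum>j\<le>D. G j y * y m ^ j)" by auto
  from Suc obtain G' where G': "\<forall>j\<le>D'. mpolyfun (bdd_ints H') D' m (G' j)" "F' = (\<lambda>y. \<Sum>j\<le>D'. G' j y * y m ^ j)" by auto
  let ?K = "real (D + D' + 1) ^ m * (H * H')"
  define g where "g = (\<lambda>j. if j \<le> D then G j else (\<lambda>_. 0))"
  define g' where "g' = (\<lambda>j. if j \<le> D' then G' j else (\<lambda>_. 0))"
  have g: "mpolyfun (bdd_ints H) D m (g j)" "mpolyfun (bdd_ints H') D' m (g' j)" for j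
    using G(1) G'(1) mpolyfun_const0[OF zero_in_bdd_ints] H by (auto simp: g_def g'_def)
  define E where "E = (\<lambda>l y. \<Sum>i\<le>l. of_int 1 * (g i y * g' (l - i) y))"
  have "mpolyfun (bdd_ints (real (D + D' + 1) ^ Suc m * (H * H'))) (D + D') m (E l)" if l: "l \<le> D + D'" for l
  proof -
    have "mpolyfun (bdd_ints (real (card {..l}) * (1 * ?K))) (D + D') m (E l)" unfolding E_def
      by (rule mpolyfun_sum_bdd) (use Suc.IH g H in auto)
    moreover have "real (card {..l}) * (1 * ?K) \<le> real (D + D' + 1) * ?K"
      unfolding mult_1 by (rule mult_right_mono) (use l H in auto)
    ultimately have "mpolyfun (bdd_ints (real (D + D' + 1) * ?K)) (D + D') m (E l)" using bdd_ints_mono mpolyfun_subset by blast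
    then show ?thesis by (simp only: power_Suc mult.assoc)
  qed
  moreover have "(\<lambda>y. F y * F' y) = (\<lambda>y. \<Sum>l\<le>D + D'. E l y * y m ^ l)"
  proof
    fix y
    define p where "p = (\<Sum>j\<le>D. monom (G j y) j)"
    define q where "q = (\<Sum>j\<le>D'. monom (G' j y) j)"
    have cp: "coeff p i = g i y" and cq: "coeff q i = g' i y" for i
      by (auto simp: p_def q_def g_def g'_def coeff_sum)
    have "degree p \<le> D" "degree q \<le> D'" unfolding p_def q_def
      by (auto intro!: degree_sum_le intro: order_trans[OF degree_monom_le])
    then have "degree (p * q) \<le> D + D'" using degree_mult_le[of p q] by linarith
    then have "poly (p * q) (y m) = (\<Sum>l\<le>D + D'. coeff (p * q) l * y m ^ l)" by (rule poly_le_sum)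
    moreover have "coeff (p * q) l = E l y" for l by (simp add: coeff_mult cp cq E_def)
    moreover have "F y = poly p (y m)" "F' y = poly q (y m)" by (simp_all add: G(2) G'(2) p_def q_def poly_sum poly_monom)
    ultimately show "F y * F' y = (\<Sum>l\<le>D + D'. E l y * y m ^ l)" by simp
  qed
  ultimately show ?case unfolding mpolyfun.simps by blast
qed

text \<open>The shape of the coefficients of the monic family: a power of the leading coefficient of
  \<open>f\<close> times another coefficient. \<open>K\<close> is chosen before the functions and
  their height.\<close>

lemma mpolyfun_power_mult:
  "\<exists>K\<ge>1. \<forall>F G H. H \<ge> 1 \<longrightarrow> mpolyfun (bdd_ints H) D m F \<longrightarrow> mpolyfun (bdd_ints H) D m G \<longrightarrow>
     mpolyfun (bdd_ints (K * H ^ (e + 1))) (D * (e + 1)) m (\<lambda>y. F y ^ e * G y)"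
proof (induction e)
  case 0
  show ?case by (intro exI[of _ 1]) simp
next
  case (Suc e)
  then obtain K where K: "K \<ge> 1" "\<And>F G H. H \<ge> 1 \<Longrightarrow> mpolyfun (bdd_ints H) D m F \<Longrightarrow> mpolyfun (bdd_ints H) D m G \<Longrightarrow>
     mpolyfun (bdd_ints (K * H ^ (e + 1))) (D * (e + 1)) m (\<lambda>y. F y ^ e * G y)" by blast
  define K' where "K' = real (D + D * (e + 1) + 1) ^ m * K"
  have "1 * 1 \<le> K'" unfolding K'_def using K(1) by (intro mult_mono one_le_power) auto
  moreover have "mpolyfun (bdd_ints (K' * H ^ (Suc e + 1))) (D * (Suc e + 1)) m (\<lambda>y. F y ^ Suc e * G y)"
    if h: "H \<ge> 1" "mpolyfun (bdd_ints H) D m F" "mpolyfun (bdd_ints H) D m G" for F G H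
  proof -
    have "mpolyfun (bdd_ints (real (D + D * (e + 1) + 1) ^ m * (H * (K * H ^ (e + 1))))) (D + D * (e + 1)) m (\<lambda>y. F y * (F y ^ e * G y))"
      by (rule mpolyfun_mult) (use h K in auto)
    moreover have "real (D + D * (e + 1) + 1) ^ m * (H * (K * H ^ (e + 1))) = K' * H ^ (Suc e + 1)"
      by (simp add: K'_def mult_ac)
    moreover have "D + D * (e + 1) = D * (Suc e + 1)" by simp
    moreover have "(\<lambda>y. F y * (F y ^ e * G y)) = (\<lambda>y. F y ^ Suc e * G y)" by (simp add: mult.assoc)
    ultimately show ?thesis by metis
  qed
  ultimately show ?case by (intro exI[of _ K']) auto
qed

lemma mpolyfun_monomial:
  "(\<And>k. k < m \<Longrightarrow> e k \<le> D) \<Longrightarrow> mpolyfun (bdd_ints 1) D m (\<lambda>y. \<Prod>k<m. y k ^ e k)"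
proof (induction m)
  case 0
  then show ?case by (auto simp: bdd_ints_def intro!: bexI[of _ 1] exI[of _ 1])
next
  case (Suc m)
  define G where "G = (\<lambda>j y. if j = e m then (\<Prod>k<m. y k ^ e k) else (0::rat))"
  have "mpolyfun (bdd_ints 1) D m (G j)" for j
    using Suc mpolyfun_const0[OF zero_in_bdd_ints[of 1], of D m] by (cases "j = e m") (auto simp: G_def)
  moreover have "(\<lambda>y. \<Prod>k<Suc m. y k ^ e k) = (\<lambda>y. \<Sum>j\<le>D. G j y * y m ^ j)"
  proof
    fix y :: "nat \<Rightarrow> rat"
    have "(\<Sum>j\<le>D. G j y * y m ^ j) = (\<Sum>j\<le>D. if j = e m then (\<Prod>k<m. y k ^ e k) * y m ^ e m else 0)"
      by (intro sum.cong) (auto simp: G_def)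
    also have "\<dots> = (\<Prod>k<Suc m. y k ^ e k)" using Suc.prems[of m] by simp
    finally show "(\<Prod>k<Suc m. y k ^ e k) = (\<Sum>j\<le>D. G j y * y m ^ j)" by simp
  qed
  ultimately show ?case unfolding mpolyfun.simps by blast
qed

text \<open>Turns a section from a function back into a polynomial, where primality of
  \<open>f\<close> can exclude it.\<close>

lemma mpolyfun_to_mpoly:
  "mpolyfun UNIV D m R \<Longrightarrow> \<exists>r\<in>mpoly_on ({..<Suc m} - {0}). \<forall>x. rat_eval x r = R (\<lambda>i. x (Suc i))"
proof (induction m arbitrary: R)
  case 0
  then obtain c where "R = (\<lambda>_. c)" by auto
  then show ?case by (intro bexI[of _ "mconst c"]) (auto simp: mconst_in_mpoly_on)
next
  case (Suc m)
  then obtain G where G: "\<forall>j\<le>D. mpolyfun UNIV D m (G j)" "R = (\<lambda>y. \<Sum>j\<le>D. G j y * y m ^ j)" by auto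
  have "\<forall>j\<in>{..D}. \<exists>r\<in>mpoly_on ({..<Suc m} - {0}). \<forall>x. rat_eval x r = G j (\<lambda>i. x (Suc i))" using Suc.IH G(1) by auto
  then obtain r where r: "\<And>j. j \<le> D \<Longrightarrow> r j \<in> mpoly_on ({..<Suc m} - {0})" "\<And>j x. j \<le> D \<Longrightarrow> rat_eval x (r j) = G j (\<lambda>i. x (Suc i))"
    by (metis atMost_iff)
  have sub: "mpoly_on ({..<Suc m} - {0}) \<subseteq> mpoly_on ({..<Suc (Suc m)} - {0})" by (rule mpoly_on_mono) auto
  have "(\<Sum>j\<le>D. r j * mvar (Suc m) ^ j) \<in> mpoly_on ({..<Suc (Suc m)} - {0})"
    using r(1) sub by (intro subring_onD(4,7,8)[OF subring_mpoly_on] mvar_in_mpoly_on) auto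
  moreover have "rat_eval x (\<Sum>j\<le>D. r j * mvar (Suc m) ^ j) = R (\<lambda>i. x (Suc i))" for x
    by (simp add: is_ring_homD[OF is_ring_hom_evr] r(2) G(2))
  ultimately show ?case by blast
qed

text \<open>The 0 in the distinguished place is a dummy: it is overwritten, or the polynomial
  evaluated is free of variable 0.\<close>

definition shift :: "(nat \<Rightarrow> rat) \<Rightarrow> nat \<Rightarrow> rat" where
  "shift y = (\<lambda>i. case i of 0 \<Rightarrow> 0 | Suc k \<Rightarrow> y k)"

lemma shift_simps [simp]: "shift y (Suc k) = y k" "shift y 0 = 0"
  by (simp_all add: shift_def)

text \<open>Transfers the hypothesis on \<open>deg_in\<close>, which is stated with exponents, to
  the degree after splitting off the variable.\<close>

lemma lookup_le_degree_sp:
  fixes p :: "rat mpoly"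
  assumes p: "p \<in> mpoly_on (insert j I)" "j \<notin> I" and mon: "mon \<in> Poly_Mapping.keys p"
  shows "Poly_Mapping.lookup mon j \<le> degree (split_var j p)"
proof -
  have "p = (\<Sum>k\<le>degree (split_var j p). coeff (split_var j p) k * mvar j ^ k)"
    using poly_sp[of j p] by (simp add: poly_altdef)
  then have "mon \<in> Poly_Mapping.keys (\<Sum>k\<le>degree (split_var j p). coeff (split_var j p) k * mvar j ^ k)" using mon by simp
  then obtain k where k: "k \<le> degree (split_var j p)" "mon \<in> Poly_Mapping.keys (coeff (split_var j p) k * mvar j ^ k)"
    using Poly_Mapping.keys_sum[of "\<lambda>k. coeff (split_var j p) k * mvar j ^ k" "{..degree (split_var j p)}"] by blast
  then obtain m1 m2 where m12: "mon = m1 + m2" "m1 \<in> Poly_Mapping.keys (coeff (split_var j p) k)" "m2 \<in> Poly_Mapping.keys (mvar j ^ k :: rat mpoly)"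
    using Poly_Mapping.keys_mult by blast
  have "coeff (split_var j p) k \<in> mpoly_on I" using split_iso(1)[OF p(2) p(1)] polys_onD by blast
  then have "j \<notin> Poly_Mapping.keys m1" using m12(2) p(2) by (auto simp: mpoly_on_def)
  then have "Poly_Mapping.lookup m1 j = 0" by (simp add: in_keys_iff)
  moreover have "(mvar j ^ k :: rat mpoly) = Poly_Mapping.single (Poly_Mapping.single j k) 1"
    by (induction k) (auto simp: mvar_def mult_single simp flip: single_add)
  then have "Poly_Mapping.lookup m2 j = k" using m12(3) by simp
  ultimately show ?thesis using m12(1) k(1) by (simp add: lookup_add)
qed

lemma card_bounded_monomials:
  assumes "\<And>mon. mon \<in> J \<Longrightarrow> Poly_Mapping.keys mon \<subseteq> {..<n} \<and> (\<forall>i. Poly_Mapping.lookup mon i \<le> d)"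
  shows "card J \<le> (d + 1) ^ n"
proof -
  let ?h = "\<lambda>mon. \<lambda>i\<in>{..<n}. Poly_Mapping.lookup mon i"
  have "inj_on ?h J"
  proof (rule inj_onI)
    fix a b assume ab: "a \<in> J" "b \<in> J" "?h a = ?h b"
    show "a = b"
    proof (rule poly_mapping_eqI)
      fix i
      show "Poly_Mapping.lookup a i = Poly_Mapping.lookup b i"
      proof (cases "i < n")
        case True
        then show ?thesis using fun_cong[OF ab(3), of i] by simp
      next
        case False
        then have "i \<notin> Poly_Mapping.keys a" "i \<notin> Poly_Mapping.keys b" using assms[OF ab(1)] assms[OF ab(2)] by auto
        then show ?thesis by (simp add: in_keys_iff)
      qed
    qed
  qed
  moreover have "?h ` J \<subseteq> {..<n} \<rightarrow>\<^sub>E {..d}"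
    by (rule image_subsetI, subst restrict_PiE_iff) (use assms in auto)
  moreover have "finite ({..<n} \<rightarrow>\<^sub>E {..d})" by (intro finite_PiE) auto
  ultimately have "card J \<le> card ({..<n} \<rightarrow>\<^sub>E {..d})" by (rule card_inj_on_le)
  then show ?thesis by (simp add: card_PiE)
qed

lemma lookup_le_mdeg: "Poly_Mapping.lookup m i \<le> monom_deg m"
proof (cases "i \<in> Poly_Mapping.keys m")
  case True
  then show ?thesis unfolding monom_deg_def by (intro member_le_sum) auto
qed (simp add: in_keys_iff)

text \<open>Grouping the monomials by their exponent in variable 0 gives integer polynomial
  functions; each group has at most \<open>(d + 1) ^ Suc m\<close> members. They are identified with
  the coefficients by comparing both sides as polynomial functions of the distinguished
  variable.\<close>

lemma coefficient_functions:
  fixes f :: "int mpoly"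
  defines "F \<equiv> Poly_Mapping.map (of_int :: int \<Rightarrow> rat) f"
  assumes F: "F \<in> mpoly_on {..<Suc m}" and td: "total_deg_le F d"
    and b: "\<And>mon. \<bar>real_of_int (Poly_Mapping.lookup f mon)\<bar> \<le> b" and b0: "b \<ge> 0"
  shows "mpolyfun (bdd_ints (real ((d + 1) ^ Suc m) * b)) d m (\<lambda>y. rat_eval (shift y) (coeff (split_var 0 F) i))"
proof (cases "i \<le> d")
  case False
  then have "coeff (split_var 0 F) i = 0" using degree_sp_le[OF td, of 0] by (intro coeff_eq_0) linarith
  then show ?thesis using mpolyfun_const0[OF zero_in_bdd_ints] b0 by (simp add: is_ring_homD[OF is_ring_hom_evr])
next
  case True
  have lk: "Poly_Mapping.lookup F mon = of_int (Poly_Mapping.lookup f mon)" for mon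
    unfolding F_def by (simp add: Poly_Mapping.map.rep_eq when_def)
  have keys: "Poly_Mapping.keys F = Poly_Mapping.keys f" by (auto simp: in_keys_iff lk)
  define J where "J = (\<lambda>i. {mon\<in>Poly_Mapping.keys f. Poly_Mapping.lookup mon 0 = i})"
  define \<mu> where "\<mu> = (\<lambda>mon (y::nat \<Rightarrow> rat). \<Prod>k<m. y k ^ Poly_Mapping.lookup mon (Suc k))"
  define \<beta> where "\<beta> = (\<lambda>i y. \<Sum>mon\<in>J i. of_int (Poly_Mapping.lookup f mon) * \<mu> mon y)"
  have mond: "monom_deg mon \<le> d" "Poly_Mapping.keys mon \<subseteq> {..<Suc m}" if "mon \<in> Poly_Mapping.keys f" for mon
    using td F that by (auto simp: total_deg_le_def mpoly_on_def keys)
  have "mpolyfun (bdd_ints (real (card (J i)) * (b * 1))) d m (\<beta> i)" unfolding \<beta>_def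
  proof (rule mpolyfun_sum_bdd)
    fix mon assume "mon \<in> J i"
    then have "Poly_Mapping.lookup mon k \<le> d" for k using mond(1)[of mon] lookup_le_mdeg[of mon k] by (simp add: J_def)
    then show "mpolyfun (bdd_ints 1) d m (\<mu> mon)" unfolding \<mu>_def by (intro mpolyfun_monomial)
  qed (use b b0 in \<open>auto simp: J_def\<close>)
  moreover have "card (J i) \<le> (d + 1) ^ Suc m"
  proof (rule card_bounded_monomials)
    fix mon assume "mon \<in> J i"
    then have mon: "mon \<in> Poly_Mapping.keys f" by (simp add: J_def)
    show "Poly_Mapping.keys mon \<subseteq> {..<Suc m} \<and> (\<forall>i. Poly_Mapping.lookup mon i \<le> d)"
      using mond(2)[OF mon] order_trans[OF lookup_le_mdeg mond(1)[OF mon]] by blast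
  qed
  then have "real (card (J i)) * (b * 1) \<le> real ((d + 1) ^ Suc m) * b" using b0 by (simp only: mult_1_right) (intro mult_right_mono of_nat_mono)
  ultimately have mpolyfun: "mpolyfun (bdd_ints (real ((d + 1) ^ Suc m) * b)) d m (\<beta> i)" using bdd_ints_mono mpolyfun_subset by blast
  have "rat_eval (shift y) (coeff (split_var 0 F) i) = \<beta> i y" for y
  proof -
    have F0: "F \<in> mpoly_on (insert 0 ({..<Suc m} - {0}))" using F by (simp add: insert_absorb)
    have "(\<Sum>i\<le>d. (rat_eval (shift y) (coeff (split_var 0 F) i) - \<beta> i y) * t ^ i) = 0" for t
    proof -
      have "rat_eval ((shift y)(0 := t)) F = (\<Sum>i\<le>degree (split_var 0 F). rat_eval (shift y) (coeff (split_var 0 F) i) * t ^ i)"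
        by (rule rat_eval_slice[OF F0])
      also have "\<dots> = (\<Sum>i\<le>d. rat_eval (shift y) (coeff (split_var 0 F) i) * t ^ i)"
        using degree_sp_le[OF td, of 0] by (intro sum.mono_neutral_left) (auto simp: coeff_eq_0 is_ring_homD[OF is_ring_hom_evr])
      finally have 1: "rat_eval ((shift y)(0 := t)) F = (\<Sum>i\<le>d. rat_eval (shift y) (coeff (split_var 0 F) i) * t ^ i)" .
      have mv: "monom_eval ((shift y)(0 := t)) mon = \<mu> mon y * t ^ Poly_Mapping.lookup mon 0" if "mon \<in> Poly_Mapping.keys f" for mon
      proof -
        have "monom_eval ((shift y)(0 := t)) mon = (\<Prod>i<Suc m. ((shift y)(0 := t)) i ^ Poly_Mapping.lookup mon i)"
          using mond(2)[OF that] by (intro monom_eval_superset) auto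
        also have "\<dots> = t ^ Poly_Mapping.lookup mon 0 * \<mu> mon y" unfolding \<mu>_def by (subst prod.lessThan_Suc_shift) simp
        finally show ?thesis by simp
      qed
      have "rat_eval ((shift y)(0 := t)) F = (\<Sum>mon\<in>Poly_Mapping.keys f. of_int (Poly_Mapping.lookup f mon) * \<mu> mon y * t ^ Poly_Mapping.lookup mon 0)"
        unfolding rat_eval_def hom_eval_def keys using mv by (intro sum.cong) (simp_all add: lk)
      also have "\<dots> = (\<Sum>i\<le>d. \<Sum>mon\<in>J i. of_int (Poly_Mapping.lookup f mon) * \<mu> mon y * t ^ Poly_Mapping.lookup mon 0)"
        unfolding J_def
      proof (rule sum.group[symmetric])
        show "(\<lambda>mon. Poly_Mapping.lookup mon 0) ` Poly_Mapping.keys f \<subseteq> {..d}"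
          using mond(1) lookup_le_mdeg le_trans by blast
      qed auto
      also have "\<dots> = (\<Sum>i\<le>d. \<beta> i y * t ^ i)" unfolding \<beta>_def sum_distrib_right
        by (intro sum.cong) (auto simp: J_def)
      finally show ?thesis using 1 by (simp add: left_diff_distrib sum_subtractf)
    qed
    then have "rat_eval (shift y) (coeff (split_var 0 F) i) - \<beta> i y = 0"
      by (rule polynomial_function_zero[where c = "\<lambda>i. rat_eval (shift y) (coeff (split_var 0 F) i) - \<beta> i y"]) (rule True)
    then show ?thesis by simp
  qed
  then show ?thesis using mpolyfun by (simp add: ext)
qed

text \<open>Over a parameter where \<open>f\<close> vanishes identically in the distinguished
  variable all O(B^2) values count, elsewhere at most \<open>d\<close> of them.\<close>

lemma card_solutions_le:
  fixes F :: "rat mpoly"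
  assumes F: "F \<in> mpoly_on {..<Suc m}" and td: "total_deg_le F d" and B: "B \<ge> 1"
  shows "real (card {x. (\<forall>i\<ge>Suc m. x i = 0) \<and> (\<forall>i<Suc m. x i \<in> ratball B) \<and> rat_eval x F = 0})
    \<le> 3 * B\<^sup>2 * real (card (forced_zeros m B F)) + real d * real (card {y\<in>ratbox m B. \<exists>s. rat_eval ((shift y)(0 := s)) F = 0})"
proof -
  let ?X = "{x. (\<forall>i\<ge>Suc m. x i = 0) \<and> (\<forall>i<Suc m. x i \<in> ratball B) \<and> rat_eval x F = 0}"
  let ?Y = "{y\<in>ratbox m B. \<exists>s. rat_eval ((shift y)(0 := s)) F = 0}"
  let ?S = "\<lambda>y. {s\<in>ratball B. rat_eval ((shift y)(0 := s)) F = 0}"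
  have fin: "finite (ratbox m B)" "finite (ratball B)" using ratbox_card ratball_card B by auto
  have sub: "?X \<subseteq> (\<lambda>(y, s). (shift y)(0 := s)) ` (SIGMA y:ratbox m B. ?S y)"
  proof
    fix x assume x: "x \<in> ?X"
    define y where "y = (\<lambda>i. x (Suc i))"
    have e: "x = (shift y)(0 := x 0)" by (rule ext) (auto simp: y_def shift_def split: nat.splits)
    have "y \<in> ratbox m B" using x by (auto simp: ratbox_def y_def)
    moreover have "x 0 \<in> ?S y" using x e by simp
    ultimately show "x \<in> (\<lambda>(y, s). (shift y)(0 := s)) ` (SIGMA y:ratbox m B. ?S y)"
      using e by (intro image_eqI[of _ _ "(y, x 0)"]) auto
  qed
  have finS: "finite (SIGMA y:ratbox m B. ?S y)" using fin by (intro finite_SigmaI) auto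
  have Zsub: "forced_zeros m B F \<subseteq> ratbox m B" by (auto simp: forced_zeros_def)
  have d: "card (?S y) \<le> (if y \<in> ?Y then d else 0)" if y: "y \<in> ratbox m B - forced_zeros m B F" for y
  proof (cases "y \<in> ?Y")
    case True
    obtain x where x: "\<forall>i<m. x (Suc i) = y i" "rat_eval x F \<noteq> 0" using y by (auto simp: forced_zeros_def)
    have "rat_eval x F = rat_eval ((shift y)(0 := x 0)) F" unfolding rat_eval_def
      by (rule hom_eval_cong_on[OF F]) (use x(1) in \<open>auto simp: shift_def split: nat.splits\<close>)
    then have nz: "rat_eval ((shift y)(0 := x 0)) F \<noteq> 0" using x(2) by simp
    have cu: "finite {t. rat_eval ((shift y)(0 := t)) F = 0}" "card {t. rat_eval ((shift y)(0 := t)) F = 0} \<le> d"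
      using card_univariate_zeros[OF td nz, of 0] by simp_all
    have "card (?S y) \<le> card {t. rat_eval ((shift y)(0 := t)) F = 0}" using cu(1) by (intro card_mono) auto
    then show ?thesis using cu(2) True by simp
  next
    case False
    then have em: "?S y = {}" using y by auto
    show ?thesis by (simp only: em card.empty)
  qed
  have "card ?X \<le> card (SIGMA y:ratbox m B. ?S y)" by (rule surj_card_le[OF finS sub])
  also have "\<dots> = (\<Sum>y\<in>ratbox m B. card (?S y))" using fin by (intro card_SigmaI) auto
  also have "\<dots> = (\<Sum>y\<in>ratbox m B - forced_zeros m B F. card (?S y)) + (\<Sum>y\<in>forced_zeros m B F. card (?S y))" by (rule sum.subset_diff[OF Zsub fin(1)])
  also have "\<dots> \<le> (\<Sum>y\<in>ratbox m B - forced_zeros m B F. if y \<in> ?Y then d else 0) + (\<Sum>y\<in>forced_zeros m B F. card (ratball B))"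
    using fin by (intro add_mono sum_mono d card_mono) auto
  also have "(\<Sum>y\<in>ratbox m B - forced_zeros m B F. if y \<in> ?Y then d else 0) \<le> (\<Sum>y\<in>ratbox m B. if y \<in> ?Y then d else 0)"
    using fin by (intro sum_mono2) auto
  also have "(\<Sum>y\<in>ratbox m B. if y \<in> ?Y then d else 0) = card ?Y * d"
  proof -
    have "ratbox m B \<inter> {y. y \<in> ?Y} = ?Y" by auto
    then show ?thesis using fin by (simp only: sum.If_cases[OF fin(1)]) simp
  qed
  finally have "card ?X \<le> card ?Y * d + card (forced_zeros m B F) * card (ratball B)" by simp
  then have "real (card ?X) \<le> real (card ?Y * d + card (forced_zeros m B F) * card (ratball B))" by (rule of_nat_mono)
  also have "\<dots> = real (card ?Y) * real d + real (card (forced_zeros m B F)) * real (card (ratball B))"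
    by (simp only: of_nat_add of_nat_mult)
  also have "\<dots> \<le> real d * real (card ?Y) + 3 * B\<^sup>2 * real (card (forced_zeros m B F))"
    using ratball_card[OF B] by (intro add_mono) (auto simp: mult.commute[of _ "real (card (ratball B))"] intro!: mult_right_mono)
  finally show ?thesis by linarith
qed

theorem theorem1p2:
  fixes d n :: nat
  assumes "n \<ge> 1"
  shows "\<exists>c>0. \<forall>(f :: int mpoly) (B :: real).
           vars_in n f \<and>
           irreducible (Poly_Mapping.map (of_int :: int \<Rightarrow> rat) f) \<and>
           total_deg f = d \<and> deg_in 0 f \<ge> 2 \<and> B \<ge> 1 \<longrightarrow>
           real (N_rat n f B) \<le>
             c * B powr (2 * real n - 3) * (ln (real_of_int (coeff_norm f)) + ln B) ^ 5"
proof -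
  obtain m where n: "n = Suc m" using assms by (cases n) auto
  \<comment> \<open>The coefficient of z^i is a product of \<open>a - i\<close> coefficients of
    \<open>f\<close>: at most \<open>d\<close> factors, each of degree at most
    \<open>d\<close>.\<close>
  define D where "D = d * d"
  have "\<forall>a. \<exists>C. a \<ge> 1 \<longrightarrow> C > 0 \<and> (\<forall>c H B. H \<ge> 3 \<and> B \<ge> 1 \<and> (\<forall>i<a. mpolyfun (bdd_ints H) D m (c i)) \<and>
      \<not> (\<exists>R. mpolyfun UNIV D m R \<and> (\<forall>y. monic_eval a c y (R y) = 0)) \<longrightarrow>
      real (card {y\<in>ratbox m B. \<exists>z. monic_eval a c y z = 0}) \<le> C * B powr (2 * real m - 1) * (ln H + ln B) ^ 5)"
    using count_points_with_root[of _ D m] by blast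
  from choice[OF this] obtain C where C: "\<And>a. a \<ge> 1 \<Longrightarrow> C a > 0" "\<And>a c H B. a \<ge> 1 \<Longrightarrow> H \<ge> 3 \<Longrightarrow> B \<ge> 1 \<Longrightarrow> (\<forall>i<a. mpolyfun (bdd_ints H) D m (c i)) \<Longrightarrow>
      \<not> (\<exists>R. mpolyfun UNIV D m R \<and> (\<forall>y. monic_eval a c y (R y) = 0)) \<Longrightarrow>
      real (card {y\<in>ratbox m B. \<exists>z. monic_eval a c y z = 0}) \<le> C a * B powr (2 * real m - 1) * (ln H + ln B) ^ 5"
    by blast
  have "\<forall>e. \<exists>K\<ge>1. \<forall>F G H. H \<ge> 1 \<longrightarrow> mpolyfun (bdd_ints H) d m F \<longrightarrow> mpolyfun (bdd_ints H) d m G \<longrightarrow>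
     mpolyfun (bdd_ints (K * H ^ (e + 1))) (d * (e + 1)) m (\<lambda>y. F y ^ e * G y)"
    using mpolyfun_power_mult[of d m] by blast
  from choice[OF this] obtain K where K: "\<And>e. K e \<ge> 1" "\<And>e F G H. H \<ge> 1 \<Longrightarrow> mpolyfun (bdd_ints H) d m F \<Longrightarrow> mpolyfun (bdd_ints H) d m G \<Longrightarrow>
     mpolyfun (bdd_ints (K e * H ^ (e + 1))) (d * (e + 1)) m (\<lambda>y. F y ^ e * G y)"
    by blast
  \<comment> \<open>\<open>C\<close> depends on the degree \<open>a\<close> and \<open>K\<close> on
    an exponent \<open>e\<close>. Both indices are at most \<open>d\<close>, so the sums
    \<open>Cs\<close> and \<open>Ks\<close> serve as uniform bounds.\<close>
  define Ks where "Ks = (\<Sum>e\<le>d. K e)"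
  have Ks: "K e \<le> Ks" if "e \<le> d" for e unfolding Ks_def using K(1) that by (intro member_le_sum) (auto intro: order_trans[OF zero_le_one])
  have Ks1: "Ks \<ge> 1" using Ks[of 0] K(1)[of 0] by simp
  define q where "q = real ((d + 1) ^ Suc m)"
  have "1 \<le> (d + 1) ^ Suc m" by (rule one_le_power) simp
  then have q1: "q \<ge> 1" unfolding q_def by (rule real_of_nat_ge_one_iff[THEN iffD2])
  \<comment> \<open>Chosen so that the height \<open>H\<close> below equals
    \<open>h * b ^ d\<close>; the 3 ensures \<open>H >= 3\<close>.\<close>
  define h where "h = 3 * Ks * q ^ d"
  have h3: "h \<ge> 3"
  proof -
    have "3 * 1 * 1 \<le> h" unfolding h_def using Ks1 q1 by (intro mult_mono one_le_power) auto
    then show ?thesis by simp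
  qed
  \<comment> \<open>The norm is at least 2 and \<open>ln 2 >= 2 / 3\<close>, so 3 / 2 times
    \<Lambda> is at least 1. This factor lets constants be absorbed into \<Lambda>.\<close>
  define \<kappa> where "\<kappa> = ln h * (3 / 2) + real d + 1"
  have \<kappa>0: "\<kappa> \<ge> 0" using h3 by (simp add: \<kappa>_def add_nonneg_nonneg)
  define Cs where "Cs = (\<Sum>a\<in>{1..d}. C a)"
  have Cs: "C a \<le> Cs" if "1 \<le> a" "a \<le> d" for a unfolding Cs_def using C(1) that
    by (intro member_le_sum) (auto intro: less_imp_le)
  define V where "V = real m ^ 2 * real d * real (2 ^ (d + d) * d) * 3 ^ m"
  define c0 where "c0 = V * (3 / 2) ^ 5 + real d * Cs * \<kappa> ^ 5 + 1"
  have Cs0: "Cs \<ge> 0" unfolding Cs_def using C(1) by (intro sum_nonneg) (auto intro: less_imp_le)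
  have "c0 > 0" unfolding c0_def V_def using Cs0 \<kappa>0 by (intro add_nonneg_pos add_nonneg_nonneg mult_nonneg_nonneg) auto
  moreover have "real (N_rat n f B) \<le> c0 * B powr (2 * real n - 3) * (ln (real_of_int (coeff_norm f)) + ln B) ^ 5"
    if vars: "vars_in n f" and irr: "irreducible (Poly_Mapping.map (of_int :: int \<Rightarrow> rat) f)"
      and deg: "total_deg f = d" "deg_in 0 f \<ge> 2" and B: "B \<ge> 1" for f :: "int mpoly" and B :: real
  proof -
    define F where "F = Poly_Mapping.map (of_int :: int \<Rightarrow> rat) f"
    have lk: "Poly_Mapping.lookup F mon = of_int (Poly_Mapping.lookup f mon)" for mon
      unfolding F_def by (simp add: Poly_Mapping.map.rep_eq when_def)
    have keys: "Poly_Mapping.keys F = Poly_Mapping.keys f" by (auto simp: in_keys_iff lk)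
    have FR: "F \<in> mpoly_on {..<Suc m}" using vars by (simp add: mpoly_on_def vars_in_def keys n)
    have td: "total_deg_le F d"
    proof -
      have "monom_deg mon \<le> d" if "mon \<in> Poly_Mapping.keys f" for mon
        unfolding deg(1)[symmetric] total_deg_def monom_deg_def using that by (intro Max_ge) auto
      then show ?thesis by (simp add: total_deg_le_def keys)
    qed
    define P where "P = split_var 0 F"
    define a where "a = degree P"
    have ins: "insert 0 ({..<Suc m} - {0}) = {..<Suc m}" by auto
    have F0: "F \<in> mpoly_on (insert 0 ({..<Suc m} - {0}))" using FR ins by simp
    have a2: "a \<ge> 2"
    proof -
      have "Max (insert 0 ((\<lambda>m. Poly_Mapping.lookup m 0) ` Poly_Mapping.keys f)) \<in> insert 0 ((\<lambda>m. Poly_Mapping.lookup m 0) ` Poly_Mapping.keys f)"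
        by (rule Max_in) auto
      then obtain mon where mon: "mon \<in> Poly_Mapping.keys f" "Poly_Mapping.lookup mon 0 = deg_in 0 f"
        using deg(2) unfolding deg_in_def by auto
      then show ?thesis using lookup_le_degree_sp[OF F0, of mon] deg(2) by (simp add: keys a_def P_def)
    qed
    have ad: "a \<le> d" unfolding a_def P_def by (rule degree_sp_le[OF td])
    have prime: "prime_in (mpoly_on {..<Suc m}) F" by (rule irreducible_imp_primeR[OF FR]) (use irr in \<open>simp add: F_def\<close>)
    have primeP: "prime_in (polys_on (mpoly_on ({..<Suc m} - {0}))) P" unfolding P_def
      by (rule prime_in_sp) (use prime ins in simp_all)
    have PR: "P \<in> polys_on (mpoly_on ({..<Suc m} - {0}))" using primeP by (simp add: prime_in_def)
    define b where "b = real_of_int (coeff_norm f)"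
    have b2: "b \<ge> 2" unfolding b_def coeff_norm_def by simp
    have bb: "\<bar>real_of_int (Poly_Mapping.lookup f mon)\<bar> \<le> b" for mon
    proof (cases "mon \<in> Poly_Mapping.keys f")
      case True
      then have "\<bar>Poly_Mapping.lookup f mon\<bar> \<le> Max (insert 0 ((\<lambda>m. \<bar>Poly_Mapping.lookup f m\<bar>) ` Poly_Mapping.keys f))" by (intro Max_ge) auto
      then have "\<bar>Poly_Mapping.lookup f mon\<bar> \<le> coeff_norm f" by (simp add: coeff_norm_def)
      then show ?thesis unfolding b_def by linarith
    next
      case False
      then show ?thesis using b2 by (simp add: in_keys_iff)
    qed
    define \<alpha> where "\<alpha> = (\<lambda>i y. rat_eval (shift y) (coeff P i))"
    have \<alpha>: "mpolyfun (bdd_ints (q * b)) d m (\<alpha> i)" for i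
      unfolding \<alpha>_def P_def F_def q_def by (rule coefficient_functions) (use FR td bb b2 in \<open>auto simp: F_def\<close>)
    \<comment> \<open>The coefficients of the monic equation for z = l X, where l is
      \<open>\<alpha> a\<close>.\<close>
    define c where "c = (\<lambda>i y. \<alpha> a y ^ (a - 1 - i) * \<alpha> i y)"
    define H where "H = 3 * Ks * (q * b) ^ d"
    have qb: "q * b \<ge> 1" using mult_mono[of 1 q 1 b] q1 b2 by simp
    have H3: "H \<ge> 3"
    proof -
      have "3 * 1 * 1 \<le> H" unfolding H_def using Ks1 qb by (intro mult_mono one_le_power) auto
      then show ?thesis by simp
    qed
    have c: "mpolyfun (bdd_ints H) D m (c i)" if i: "i < a" for i
    proof -
      let ?e = "a - 1 - i"
      have e: "?e + 1 \<le> d" using i ad by linarith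
      have "mpolyfun (bdd_ints (K ?e * (q * b) ^ (?e + 1))) (d * (?e + 1)) m (c i)"
        unfolding c_def by (rule K(2)[OF qb \<alpha> \<alpha>])
      moreover have "d * (?e + 1) \<le> D" unfolding D_def using e by (intro mult_le_mono2)
      moreover have "0 \<in> bdd_ints (K ?e * (q * b) ^ (?e + 1))"
      proof (rule zero_in_bdd_ints, rule mult_nonneg_nonneg)
        show "0 \<le> K ?e" using K(1)[of ?e] by linarith
        show "0 \<le> (q * b) ^ (?e + 1)" by (rule zero_le_power) (use qb in linarith)
      qed
      ultimately have 1: "mpolyfun (bdd_ints (K ?e * (q * b) ^ (?e + 1))) D m (c i)" using mpolyfun_deg_mono by blast
      have "K ?e * (q * b) ^ (?e + 1) \<le> (3 * Ks) * (q * b) ^ d"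
      proof (rule mult_mono)
        show "K ?e \<le> 3 * Ks" using Ks[of ?e] e Ks1 by simp
        show "(q * b) ^ (?e + 1) \<le> (q * b) ^ d" using e qb by (intro power_increasing)
      qed (use Ks1 qb in auto)
      then show ?thesis using mpolyfun_subset[OF 1 bdd_ints_mono] by (simp add: H_def)
    qed
    have coefR: "rat_eval x (coeff P i) = \<alpha> i (\<lambda>i. x (Suc i))" for x i
      unfolding \<alpha>_def rat_eval_def by (rule hom_eval_cong_on[OF polys_onD[OF PR]]) (auto simp: shift_def split: nat.splits)
    \<comment> \<open>A section would give a polynomial \<open>r\<close> for which \<open>T\<close>
      vanishes at all rational points, hence is zero; a prime of degree at least 2 forbids
      this.\<close>
    have nr: "\<not> (\<exists>R. mpolyfun UNIV D m R \<and> (\<forall>y. monic_eval a c y (R y) = 0))"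
    proof
      assume "\<exists>R. mpolyfun UNIV D m R \<and> (\<forall>y. monic_eval a c y (R y) = 0)"
      then obtain R where R: "mpolyfun UNIV D m R" "\<And>y. monic_eval a c y (R y) = 0" by blast
      obtain r where r: "r \<in> mpoly_on ({..<Suc m} - {0})" "\<And>x. rat_eval x r = R (\<lambda>i. x (Suc i))" using mpolyfun_to_mpoly[OF R(1)] by blast
      define T where "T = r ^ a + (\<Sum>i<a. lead_coeff P ^ (a - 1 - i) * coeff P i * r ^ i)"
      have "rat_eval x T = monic_eval a c (\<lambda>i. x (Suc i)) (R (\<lambda>i. x (Suc i)))" for x
        unfolding T_def monic_eval_def c_def a_def[symmetric] by (simp add: is_ring_homD[OF is_ring_hom_evr] r(2) coefR)
      then have "rat_eval x T = 0" for x using R(2) by simp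
      moreover have "T \<in> mpoly_on ({..<Suc m} - {0})" unfolding T_def
        using r(1) polys_onD[OF PR] by (intro subring_onD(3,4,7,8)[OF subring_mpoly_on])
      then have "T \<in> mpoly_on {..<Suc m}" using mpoly_on_mono[of "{..<Suc m} - {0}" "{..<Suc m}"] by blast
      ultimately have "T = 0" using rat_eval_zero_imp_zero by blast
      then show False using no_root_of_prime[OF subring_mpoly_on primeP a_def[symmetric] a2 r(1)] by (simp add: T_def)
    qed
    define \<Lambda> where "\<Lambda> = ln b + ln B"
    have lnB: "ln B \<ge> 0" using B by simp
    have lnb: "ln b \<ge> 2 / 3"
    proof -
      have "ln 2 \<le> ln b" using b2 by (subst ln_le_cancel_iff) auto
      then show ?thesis using ln2_ge_two_thirds by linarith
    qed
    have L: "\<Lambda> * (3 / 2) \<ge> 1" using lnb lnB by (simp add: \<Lambda>_def)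
    have HB0: "0 \<le> ln H + ln B" using H3 lnB by (intro add_nonneg_nonneg) auto
    let ?Y = "{y\<in>ratbox m B. \<exists>s. rat_eval ((shift y)(0 := s)) F = 0}"
    let ?Z = "{y\<in>ratbox m B. \<exists>z. monic_eval a c y z = 0}"
    have "?Y \<subseteq> ?Z"
    proof
      fix y assume "y \<in> ?Y"
      then obtain s where s: "y \<in> ratbox m B" "rat_eval ((shift y)(0 := s)) F = 0" by blast
      have sum0: "(\<Sum>i\<le>a. \<alpha> i y * s ^ i) = 0" using s(2) rat_eval_slice[OF F0, of "shift y" s] by (simp add: \<alpha>_def P_def a_def)
      \<comment> \<open>An identity that holds also where the leading coefficient vanishes, so no
        parameter has to be excluded.\<close>
      have "monic_eval a c y (\<alpha> a y * s) = \<alpha> a y ^ (a - 1) * (\<Sum>i\<le>a. \<alpha> i y * s ^ i)"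
      proof -
        have "c i y * (\<alpha> a y * s) ^ i = \<alpha> a y ^ (a - 1) * (\<alpha> i y * s ^ i)" if "i < a" for i
        proof -
          have "\<alpha> a y ^ (a - 1) = \<alpha> a y ^ (a - 1 - i) * \<alpha> a y ^ i" using that by (simp flip: power_add)
          then show ?thesis by (simp add: c_def power_mult_distrib)
        qed
        then have "(\<Sum>i<a. c i y * (\<alpha> a y * s) ^ i) = (\<Sum>i<a. \<alpha> a y ^ (a - 1) * (\<alpha> i y * s ^ i))" by (intro sum.cong) auto
        moreover have "(\<alpha> a y * s) ^ a = \<alpha> a y ^ (a - 1) * (\<alpha> a y * s ^ a)"
        proof -
          have "\<alpha> a y ^ a = \<alpha> a y ^ (a - 1) * \<alpha> a y" using a2 by (cases a) auto
          then show ?thesis by (simp add: power_mult_distrib)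
        qed
        ultimately show ?thesis unfolding monic_eval_def by (simp add: lessThan_Suc_atMost[symmetric] sum_distrib_left algebra_simps)
      qed
      then have "monic_eval a c y (\<alpha> a y * s) = 0" using sum0 by simp
      then show "y \<in> ?Z" using s(1) by blast
    qed
    then have "card ?Y \<le> card ?Z" using ratbox_card[OF B, of m] by (intro card_mono) auto
    moreover have "real (card ?Z) \<le> C a * B powr (2 * real m - 1) * (ln H + ln B) ^ 5"
      using C(2)[OF _ H3 B _ nr] a2 c by simp
    ultimately have "real (card ?Y) \<le> C a * B powr (2 * real m - 1) * (ln H + ln B) ^ 5" by linarith
    also have "\<dots> \<le> Cs * B powr (2 * real m - 1) * (\<kappa> * \<Lambda>) ^ 5"
    proof (intro mult_mono power_mono)
      show "C a \<le> Cs" using Cs a2 ad by simp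
      have "ln H = ln h + real d * ln b" unfolding H_def h_def using Ks1 q1 b2
        by (simp add: ln_mult ln_realpow power_mult_distrib)
      moreover have "ln h * 1 \<le> ln h * (\<Lambda> * (3 / 2))" using L h3 by (intro mult_left_mono) auto
      moreover have "real d * ln b \<le> real d * \<Lambda>" using lnB by (intro mult_left_mono) (auto simp: \<Lambda>_def)
      moreover have "ln B \<le> \<Lambda>" using lnb by (simp add: \<Lambda>_def)
      ultimately show "ln H + ln B \<le> \<kappa> * \<Lambda>" by (simp add: \<kappa>_def algebra_simps)
    qed (use Cs0 HB0 in auto)
    finally have Ybd: "real (card ?Y) \<le> Cs * B powr (2 * real m - 1) * (\<kappa> * \<Lambda>) ^ 5" .
    \<comment> \<open>Codimension 2 gives O(B^(2m-4)) parameters with O(B^2) values each; a whole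
      factor B can be given away to reach the common exponent 2m - 1.\<close>
    have Zbd: "3 * B\<^sup>2 * real (card (forced_zeros m B F)) \<le> V * B powr (2 * real m - 1)"
    proof -
      let ?M = "3 * B\<^sup>2"
      let ?W = "real m ^ 2 * real d * real (2 ^ (d + d) * d)"
      have d0: "degree (split_var 0 F) > 0" using a2 by (simp add: a_def P_def)
      have 1: "?M\<^sup>2 * real (card (forced_zeros m B F)) \<le> ?W * ?M ^ m"
        by (rule card_vertical_lines[OF prime td d0 B]) simp
      have M0: "?M > 0" using B by simp
      have "B ^ (2 * m) = B powr real (2 * m)" using B by (subst powr_realpow) auto
      also have "real (2 * m) = (2 * real m - 1) + 1" by simp
      also have "B powr \<dots> = B powr (2 * real m - 1) * B powr 1" by (rule powr_add)
      also have "\<dots> \<le> B powr (2 * real m - 1) * ?M"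
        using B by (intro mult_left_mono) (auto simp: power2_eq_square mult_le_cancel_left1 intro: order_trans[of B "B * B"])
      finally have "?M ^ m \<le> 3 ^ m * (B powr (2 * real m - 1) * ?M)" by (simp add: power_mult_distrib power_mult)
      then have "?W * ?M ^ m \<le> ?W * (3 ^ m * (B powr (2 * real m - 1) * ?M))" by (intro mult_left_mono) auto
      then have "?M * (?M * real (card (forced_zeros m B F))) \<le> ?M * (V * B powr (2 * real m - 1))"
        using 1 unfolding V_def by (simp add: power2_eq_square algebra_simps)
      then show ?thesis using M0 by (rule mult_left_le_imp_le)
    qed
    have "N_rat n f B = card {x. (\<forall>i\<ge>Suc m. x i = 0) \<and> (\<forall>i<Suc m. x i \<in> ratball B) \<and> rat_eval x F = 0}"
    proof -
      have "mpoly_eval f x = rat_eval x F" for x :: "nat \<Rightarrow> rat"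
        unfolding mpoly_eval_def rat_eval_def hom_eval_def monom_eval_def keys lk ..
      then show ?thesis unfolding N_rat_def n ratball_def by simp
    qed
    then have "real (N_rat n f B) \<le> 3 * B\<^sup>2 * real (card (forced_zeros m B F)) + real d * real (card ?Y)"
      using card_solutions_le[OF FR td B] by simp
    also have "\<dots> \<le> V * B powr (2 * real m - 1) * ((\<Lambda> * (3 / 2)) ^ 5) + real d * (Cs * B powr (2 * real m - 1) * (\<kappa> * \<Lambda>) ^ 5)"
    proof (intro add_mono mult_left_mono Ybd)
      \<comment> \<open>This contribution has no logarithm; it is multiplied by a quantity that is
        at least 1 to fit the common shape.\<close>
      have "V * B powr (2 * real m - 1) * 1 \<le> V * B powr (2 * real m - 1) * ((\<Lambda> * (3 / 2)) ^ 5)"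
        using L by (intro mult_left_mono one_le_power) (auto simp: V_def)
      then show "3 * B\<^sup>2 * real (card (forced_zeros m B F)) \<le> V * B powr (2 * real m - 1) * ((\<Lambda> * (3 / 2)) ^ 5)" using Zbd by linarith
    qed simp
    also have "\<dots> = (c0 - 1) * (B powr (2 * real m - 1) * \<Lambda> ^ 5)"
      unfolding c0_def power_mult_distrib by (simp add: algebra_simps)
    also have "\<dots> \<le> c0 * (B powr (2 * real m - 1) * \<Lambda> ^ 5)"
    proof (rule mult_right_mono)
      show "0 \<le> B powr (2 * real m - 1) * \<Lambda> ^ 5" using L by (intro mult_nonneg_nonneg zero_le_power) auto
    qed simp
    also have "2 * real m - 1 = 2 * real n - 3" by (simp add: n)
    finally show ?thesis by (simp add: \<Lambda>_def b_def mult.assoc)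
  qed
  ultimately show ?thesis by blast
qed

end
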